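(* Let $G$ be a simply-connected simple algebraic group with root system $\Phi$ of type $D_4$ over an algebraically closed field $k$ of characteristic zero or odd good characteristic. Let $\theta$ be the automorphism of order $3$ of the Dynkin diagram mapping $\alpha_1$ to $\alpha_3$. Then there exist no involutive $\theta$-twisted conjugacy classes in $G$.
   Context: The characteristic is good if it does not divide any coefficient in the expression of the highest root in terms of simple roots. $T$ is a maximal torus of $G$, $B\supset T$ a Borel subgroup, $\Delta=\{\alpha_1,\alpha_2,\alpha_3,\alpha_4\}$ the corresponding simple roots, numbered as in Bourbaki (so $\alpha_2$ is the central node), and $W=N(T)/T$ the Weyl group. $\theta$ also denotes the induced automorphism of $W$ and the induced automorphism of $G$, which stabilizes $T$ and $B$ and satisfies $\theta(x_{\pm\alpha}(\xi))=x_{\pm\theta\alpha}(\xi)$ for $\alpha\in\Delta$, $\xi\in k$, where the $x_{\pm\alpha}$ are fixed parametrisations of the root subgroups such that $x_\alpha(1)x_{-\alpha}(-1)x_\alpha(1)\in N(T)$. A $\theta$-twisted conjugacy class is an orbit of the action of $G$ on itself given by $g*x=gx\theta(g)^{-1}$. An element $w\in W$ is a $\theta$-twisted involution if $w\theta(w)=1$. A $\theta$-twisted conjugacy class $C$ is involutive if $C\cap BwB\neq\emptyset$ only when $w$ is a $\theta$-twisted involution. *)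

theory Defs
  imports
    "HOL-Analysis.Determinants"
    "HOL-Computational_Algebra.Polynomial"
    "HOL-Algebra.Group_Action"
    "HOL-Algebra.Solvable_Groups"
    "HOL-Library.FuncSet"
begin

section \<open>Linear algebraic groups over an algebraically closed field\<close>

text \<open>
  A linear algebraic group is identified with its group of rational points: a Zariski closed
  subgroup of some general linear group over the algebraically closed field. Polynomials are
  represented by polynomial functions, which loses nothing because the field is infinite.
\<close>

inductive_set func_alg :: "('a \<Rightarrow> 'k::field) set \<Rightarrow> ('a \<Rightarrow> 'k) set" for S where
  const: "(\<lambda>_. c) \<in> func_alg S"
| gen: "f \<in> S \<Longrightarrow> f \<in> func_alg S"
| add: "f \<in> func_alg S \<Longrightarrow> g \<in> func_alg S \<Longrightarrow> (\<lambda>x. f x + g x) \<in> func_alg S"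
| mult: "f \<in> func_alg S \<Longrightarrow> g \<in> func_alg S \<Longrightarrow> (\<lambda>x. f x * g x) \<in> func_alg S"

definition entry_funs :: "('k::field^'n^'n \<Rightarrow> 'k) set" where
  "entry_funs = {\<lambda>A. A $ i $ j | i j. True}"

definition matrix_polys :: "('k::field^'n^'n \<Rightarrow> 'k) set" where
  "matrix_polys = func_alg entry_funs"

definition GL_regular :: "('k::field^'n^'n \<Rightarrow> 'k) set" where
  "GL_regular = func_alg (insert (\<lambda>A. inverse (det A)) entry_funs)"

definition zariski_closed :: "('k::field^'n^'n) set \<Rightarrow> bool" where
  "zariski_closed Z \<longleftrightarrow>
     (\<exists>F \<subseteq> matrix_polys. Z = {A. invertible A \<and> (\<forall>f\<in>F. f A = 0)})"

definition zariski_connected :: "('k::field^'n^'n) set \<Rightarrow> bool" where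
  "zariski_connected S \<longleftrightarrow>
     \<not> (\<exists>Y Z. zariski_closed Y \<and> zariski_closed Z \<and> S \<subseteq> Y \<union> Z \<and> S \<inter> Y \<inter> Z = {} \<and>
            S \<inter> Y \<noteq> {} \<and> S \<inter> Z \<noteq> {})"

text \<open>A regular function on a closed subset of the general linear group is the restriction of
  a regular function on the whole of it.\<close>

definition regular_on :: "('k::field^'n^'n) set \<Rightarrow> ('k^'n^'n \<Rightarrow> 'k) \<Rightarrow> bool" where
  "regular_on S f \<longleftrightarrow> (\<exists>h\<in>GL_regular. \<forall>A\<in>S. f A = h A)"

definition matrix_group :: "('k::field^'n^'n) set \<Rightarrow> ('k^'n^'n) monoid" where
  "matrix_group S = \<lparr>carrier = S, mult = (**), one = mat 1\<rparr>"

definition algebraic_group :: "('k::field^'n^'n) set \<Rightarrow> bool" where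
  "algebraic_group G \<longleftrightarrow> zariski_closed G \<and> subgroup G (matrix_group {A. invertible A})"

definition simple_algebraic_group :: "('k::field^'n^'n) set \<Rightarrow> bool" where
  "simple_algebraic_group G \<longleftrightarrow>
     algebraic_group G \<and> zariski_connected G \<and> \<not> comm_group (matrix_group G) \<and>
     (\<forall>H. algebraic_group H \<and> zariski_connected H \<and> H \<lhd> matrix_group G
          \<longrightarrow> H = {mat 1} \<or> H = G)"

definition algebraic_automorphism ::
    "('k::field^'n^'n) set \<Rightarrow> ('k^'n^'n \<Rightarrow> 'k^'n^'n) \<Rightarrow> bool" where
  "algebraic_automorphism G \<phi> \<longleftrightarrow>
     \<phi> \<in> iso (matrix_group G) (matrix_group G) \<and>
     (\<forall>i j. regular_on G (\<lambda>A. \<phi> A $ i $ j)) \<and>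
     (\<forall>i j. regular_on G (\<lambda>A. the_inv_into G \<phi> A $ i $ j))"

section \<open>Tori and Borel subgroups\<close>

text \<open>The group \<open>G\<^sub>m\<^sup>r\<close> consists of the \<open>r\<close>-tuples of nonzero scalars.\<close>

definition Gm_power :: "nat \<Rightarrow> (nat \<Rightarrow> 'k::field) set" where
  "Gm_power r = {..<r} \<rightarrow>\<^sub>E (- {0})"

definition Gm_power_regular :: "nat \<Rightarrow> ((nat \<Rightarrow> 'k::field) \<Rightarrow> 'k) set" where
  "Gm_power_regular r =
     func_alg ((\<lambda>i s. s i) ` {..<r} \<union> (\<lambda>i s. inverse (s i)) ` {..<r})"

definition torus :: "('k::field^'n^'n) set \<Rightarrow> bool" where
  "torus T \<longleftrightarrow> algebraic_group T \<and>
     (\<exists>r \<phi>. bij_betw \<phi> (Gm_power r) T \<and>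
        (\<forall>s\<in>Gm_power r. \<forall>t\<in>Gm_power r. \<phi> (\<lambda>i\<in>{..<r}. s i * t i) = \<phi> s ** \<phi> t) \<and>
        (\<forall>i j. \<exists>f\<in>Gm_power_regular r. \<forall>s\<in>Gm_power r. \<phi> s $ i $ j = f s) \<and>
        (\<forall>i<r. regular_on T (\<lambda>A. the_inv_into (Gm_power r) \<phi> A i)))"

definition maximal_torus :: "('k::field^'n^'n) set \<Rightarrow> ('k^'n^'n) set \<Rightarrow> bool" where
  "maximal_torus G T \<longleftrightarrow>
     torus T \<and> T \<subseteq> G \<and> (\<forall>S. torus S \<and> T \<subseteq> S \<and> S \<subseteq> G \<longrightarrow> S = T)"

definition connected_solvable_subgroup ::
    "('k::field^'n^'n) set \<Rightarrow> ('k^'n^'n) set \<Rightarrow> bool" where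
  "connected_solvable_subgroup G B \<longleftrightarrow>
     algebraic_group B \<and> B \<subseteq> G \<and> zariski_connected B \<and> solvable (matrix_group B)"

definition borel_subgroup :: "('k::field^'n^'n) set \<Rightarrow> ('k^'n^'n) set \<Rightarrow> bool" where
  "borel_subgroup G B \<longleftrightarrow> connected_solvable_subgroup G B \<and>
     (\<forall>H. connected_solvable_subgroup G H \<and> B \<subseteq> H \<longrightarrow> H = B)"

definition characters :: "('k::field^'n^'n) set \<Rightarrow> ('k^'n^'n \<Rightarrow> 'k) set" where
  "characters T = {a \<in> extensional T. regular_on T a \<and>
     (\<forall>t\<in>T. a t \<noteq> 0) \<and> (\<forall>s\<in>T. \<forall>t\<in>T. a (s ** t) = a s * a t)}"

definition cocharacters :: "('k::field^'n^'n) set \<Rightarrow> ('k \<Rightarrow> 'k^'n^'n) set" where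
  "cocharacters T = {l \<in> (- {0}) \<rightarrow>\<^sub>E T.
     (\<forall>s t. s \<noteq> 0 \<longrightarrow> t \<noteq> 0 \<longrightarrow> l (s * t) = l s ** l t) \<and>
     (\<forall>i j. \<exists>f \<in> func_alg {\<lambda>s. s, inverse}. \<forall>s. s \<noteq> 0 \<longrightarrow> l s $ i $ j = f s)}"

definition cocharacter_group :: "('k::field^'n^'n) set \<Rightarrow> ('k \<Rightarrow> 'k^'n^'n) monoid" where
  "cocharacter_group T = \<lparr>carrier = cocharacters T,
     mult = (\<lambda>l m. \<lambda>s\<in>- {0}. l s ** m s), one = (\<lambda>s\<in>- {0}. mat 1)\<rparr>"

definition char_inverse ::
    "('k::field^'n^'n) set \<Rightarrow> ('k^'n^'n \<Rightarrow> 'k) \<Rightarrow> ('k^'n^'n \<Rightarrow> 'k)" where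
  "char_inverse T a = (\<lambda>t\<in>T. inverse (a t))"

section \<open>Roots, root subgroups and coroots\<close>

text \<open>The Lie algebra is the tangent space at the identity: all differentials at the identity
  of polynomials vanishing on the group are zero on it. The differential in direction \<open>X\<close> is the
  linear coefficient of the polynomial \<open>s \<mapsto> f (1 + s X)\<close>; note that \<open>mat s ** X\<close> is the
  scalar multiple of \<open>X\<close> by \<open>s\<close>.\<close>

definition lie_algebra :: "('k::field^'n^'n) set \<Rightarrow> ('k^'n^'n) set" where
  "lie_algebra G = {X. \<forall>f\<in>matrix_polys. (\<forall>A\<in>G. f A = 0) \<longrightarrow>
     (\<exists>p. (\<forall>s. f (mat 1 + mat s ** X) = poly p s) \<and> coeff p 1 = 0)}"

definition weight_space ::
    "('k::field^'n^'n) set \<Rightarrow> ('k^'n^'n) set \<Rightarrow> ('k^'n^'n \<Rightarrow> 'k) \<Rightarrow> ('k^'n^'n) set" where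
  "weight_space G T a =
     {X \<in> lie_algebra G. \<forall>t\<in>T. t ** X ** matrix_inv t = mat (a t) ** X}"

definition roots :: "('k::field^'n^'n) set \<Rightarrow> ('k^'n^'n) set \<Rightarrow> ('k^'n^'n \<Rightarrow> 'k) set" where
  "roots G T = {a \<in> characters T. (\<exists>t\<in>T. a t \<noteq> 1) \<and> weight_space G T a \<noteq> {0}}"

text \<open>The root space decomposition \<open>Lie G = Lie T \<oplus> (\<Oplus>\<alpha>. g\<^sub>\<alpha>)\<close> with one-dimensional root
  spaces, which is what makes the roots of \<open>(G, T)\<close> a (reduced) root system of \<open>G\<close>
  (cf. the notion of splitting, SGA 3, XXII, 1.13). It holds for every reductive group and
  every maximal torus. Directness of the sum is automatic, as the weights are distinct.\<close>

definition root_space_decomposition :: "('k::field^'n^'n) set \<Rightarrow> ('k^'n^'n) set \<Rightarrow> bool" where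
  "root_space_decomposition G T \<longleftrightarrow>
     finite (roots G T) \<and>
     lie_algebra G = {Y + (\<Sum>a\<in>roots G T. Z a) | Y Z.
        Y \<in> lie_algebra T \<and> (\<forall>a\<in>roots G T. Z a \<in> weight_space G T a)} \<and>
     (\<forall>a\<in>roots G T. \<exists>X. X \<noteq> 0 \<and> weight_space G T a = {mat c ** X | c. True})"

text \<open>Isomorphisms of algebraic groups from the additive group onto the root subgroup of the
  root \<open>a\<close>.\<close>

definition root_parametrisation ::
    "('k::field^'n^'n) set \<Rightarrow> ('k^'n^'n) set \<Rightarrow> ('k^'n^'n \<Rightarrow> 'k) \<Rightarrow> ('k \<Rightarrow> 'k^'n^'n) \<Rightarrow> bool" where
  "root_parametrisation G T a x \<longleftrightarrow>
     a \<in> roots G T \<and> range x \<subseteq> G \<and> zariski_closed (range x) \<and>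
     (\<forall>\<xi> \<eta>. x (\<xi> + \<eta>) = x \<xi> ** x \<eta>) \<and>
     (\<forall>i j. \<exists>p. \<forall>\<xi>. x \<xi> $ i $ j = poly p \<xi>) \<and>
     (\<exists>h\<in>GL_regular. \<forall>\<xi>. h (x \<xi>) = \<xi>) \<and>
     (\<forall>t\<in>T. \<forall>\<xi>. t ** x \<xi> ** matrix_inv t = x (a t * \<xi>))"

definition positive_roots ::
    "('k::field^'n^'n) set \<Rightarrow> ('k^'n^'n) set \<Rightarrow> ('k^'n^'n) set \<Rightarrow> ('k^'n^'n \<Rightarrow> 'k) set" where
  "positive_roots G T B = {a. \<exists>x. root_parametrisation G T a x \<and> range x \<subseteq> B}"

definition simple_roots ::
    "('k::field^'n^'n) set \<Rightarrow> ('k^'n^'n) set \<Rightarrow> ('k^'n^'n) set \<Rightarrow> ('k^'n^'n \<Rightarrow> 'k) set" where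
  "simple_roots G T B = {a \<in> positive_roots G T B.
     \<not> (\<exists>b\<in>positive_roots G T B. \<exists>c\<in>positive_roots G T B. \<forall>t\<in>T. a t = b t * c t)}"

text \<open>The coroot of \<open>a\<close> is the unique cocharacter with \<open>\<langle>a, l\<rangle> = 2\<close> whose image lies in the
  group generated by the root subgroups of \<open>a\<close> and of its negative.\<close>

definition coroots :: "('k::field^'n^'n) set \<Rightarrow> ('k^'n^'n) set \<Rightarrow> ('k \<Rightarrow> 'k^'n^'n) set" where
  "coroots G T = {l \<in> cocharacters T. \<exists>a x y.
     root_parametrisation G T a x \<and> root_parametrisation G T (char_inverse T a) y \<and>
     (\<forall>s. s \<noteq> 0 \<longrightarrow> a (l s) = s ^ 2 \<and> l s \<in> generate (matrix_group G) (range x \<union> range y))}"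

definition simply_connected :: "('k::field^'n^'n) set \<Rightarrow> ('k^'n^'n) set \<Rightarrow> bool" where
  "simply_connected G T \<longleftrightarrow> generate (cocharacter_group T) (coroots G T) = cocharacters T"

section \<open>The root system of type D4\<close>

text \<open>Bourbaki's numbering: \<open>N2\<close> is the central node. Root lattice elements are given by their
  coordinates with respect to the simple roots.\<close>

datatype d4_node = N1 | N2 | N3 | N4

definition d4_cartan :: "d4_node \<Rightarrow> d4_node \<Rightarrow> int" where
  "d4_cartan i j = (if i = j then 2 else if (i = N2) \<noteq> (j = N2) then - 1 else 0)"

lemma UNIV_d4_node: "(UNIV :: d4_node set) = {N1, N2, N3, N4}"
  using d4_node.exhaust by auto

inductive_set d4_roots :: "(d4_node \<Rightarrow> int) set" where
  simple: "(\<lambda>j. if j = i then 1 else 0) \<in> d4_roots"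
| reflection: "c \<in> d4_roots \<Longrightarrow> c(j := c j - (\<Sum>i\<in>UNIV. c i * d4_cartan i j)) \<in> d4_roots"

definition d4_highest_root :: "(d4_node \<Rightarrow> int) \<Rightarrow> bool" where
  "d4_highest_root c \<longleftrightarrow> c \<in> d4_roots \<and> (\<forall>c'\<in>d4_roots. \<forall>i. c' i \<le> c i)"

definition d4_good_characteristic :: "nat \<Rightarrow> bool" where
  "d4_good_characteristic p \<longleftrightarrow> (\<forall>c. d4_highest_root c \<longrightarrow> (\<forall>i. \<not> int p dvd c i))"

definition lattice_char ::
    "('k::field^'n^'n) set \<Rightarrow> (d4_node \<Rightarrow> 'k^'n^'n \<Rightarrow> 'k) \<Rightarrow> (d4_node \<Rightarrow> int) \<Rightarrow> 'k^'n^'n \<Rightarrow> 'k"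
  where "lattice_char T \<alpha> c = (\<lambda>t\<in>T. \<Prod>i\<in>UNIV. \<alpha> i t powi c i)"

text \<open>The root system of \<open>(G, T)\<close> is of type D4, with \<open>\<alpha>\<close> the numbered simple roots
  determined by \<open>B\<close>.\<close>

definition root_system_D4 ::
    "('k::field^'n^'n) set \<Rightarrow> ('k^'n^'n) set \<Rightarrow> ('k^'n^'n) set \<Rightarrow>
     (d4_node \<Rightarrow> 'k^'n^'n \<Rightarrow> 'k) \<Rightarrow> bool" where
  "root_system_D4 G T B \<alpha> \<longleftrightarrow>
     root_space_decomposition G T \<and>
     range \<alpha> = simple_roots G T B \<and>
     inj (lattice_char T \<alpha>) \<and>
     roots G T = lattice_char T \<alpha> ` d4_roots"

definition d4_diagram_automorphism :: "(d4_node \<Rightarrow> d4_node) \<Rightarrow> bool" where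
  "d4_diagram_automorphism \<theta> \<longleftrightarrow>
     bij \<theta> \<and> (\<forall>i j. d4_cartan (\<theta> i) (\<theta> j) = d4_cartan i j)"

section \<open>Twisted conjugacy classes and twisted involutions\<close>

text \<open>Elements of the Weyl group are cosets \<open>nT\<close>, so that an automorphism of \<open>G\<close> stabilizing
  \<open>T\<close> acts on the Weyl group by taking images, and the double coset \<open>BwB\<close> is a product of sets.\<close>

definition weyl_group :: "('k::field^'n^'n) set \<Rightarrow> ('k^'n^'n) set \<Rightarrow> ('k^'n^'n) set monoid" where
  "weyl_group G T = (matrix_group G)\<lparr>carrier := normalizer (matrix_group G) T\<rparr> Mod T"

definition twisted_involution ::
    "('k::field^'n^'n) set \<Rightarrow> ('k^'n^'n) set \<Rightarrow> ('k^'n^'n \<Rightarrow> 'k^'n^'n) \<Rightarrow> ('k^'n^'n) set \<Rightarrow> bool"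
  where "twisted_involution G T \<tau> w \<longleftrightarrow>
     w \<in> carrier (weyl_group G T) \<and>
     w \<otimes>\<^bsub>weyl_group G T\<^esub> (\<tau> ` w) = \<one>\<^bsub>weyl_group G T\<^esub>"

definition bruhat_cell ::
    "('k::field^'n^'n) set \<Rightarrow> ('k^'n^'n) set \<Rightarrow> ('k^'n^'n) set \<Rightarrow> ('k^'n^'n) set" where
  "bruhat_cell G B w = B <#>\<^bsub>matrix_group G\<^esub> w <#>\<^bsub>matrix_group G\<^esub> B"

definition twisted_conjugacy_classes ::
    "('k::field^'n^'n) set \<Rightarrow> ('k^'n^'n \<Rightarrow> 'k^'n^'n) \<Rightarrow> ('k^'n^'n) set set" where
  "twisted_conjugacy_classes G \<tau> = {{g ** x ** matrix_inv (\<tau> g) | g. g \<in> G} | x. x \<in> G}"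

definition involutive ::
    "('k::field^'n^'n) set \<Rightarrow> ('k^'n^'n) set \<Rightarrow> ('k^'n^'n) set \<Rightarrow> ('k^'n^'n \<Rightarrow> 'k^'n^'n) \<Rightarrow>
     ('k^'n^'n) set \<Rightarrow> bool" where
  "involutive G T B \<tau> C \<longleftrightarrow>
     (\<forall>w\<in>carrier (weyl_group G T). C \<inter> bruhat_cell G B w \<noteq> {} \<longrightarrow> twisted_involution G T \<tau> w)"

end

theory Submission
  imports Defs "HOL-Library.Function_Algebras" "HOL-Computational_Algebra.Polynomial_FPS"
begin

text \<open>
  Let \<open>x\<close> lie in an involutive class. By the Bruhat decomposition (lemma \<open>bruhat\<close>) \<open>x = b m b'\<close>
  with \<open>m\<close> normalizing \<open>T\<close>, and after twisted conjugation by \<open>b\<^sup>-\<^sup>1\<close> one may take \<open>x = m b\<close>.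
  Twisted conjugation by the representative \<open>n\<^sub>1\<close> of the simple reflection \<open>s\<^sub>1\<close> gives
  \<open>n\<^sub>1 m b n\<^sub>3\<^sup>-\<^sup>1\<close>, which by the exchange property of double cosets (lemma \<open>double_coset_step\<close>)
  lies in \<open>B n\<^sub>1 m B\<close> or in \<open>B n\<^sub>1 m n\<^sub>3\<^sup>-\<^sup>1 B\<close>. So if \<open>w\<close> is the Weyl group element of \<open>m\<close>,
  then \<open>w\<close> and one of \<open>s\<^sub>1 w\<close>, \<open>s\<^sub>1 w s\<^sub>3\<close> are twisted involutions. This is impossible: as \<open>\<theta>\<close>
  has order three, \<open>w \<theta>(w) = 1\<close> forces \<open>w\<close> to be an involution commuting with \<open>\<theta>\<close> (lemma
  \<open>twisted_commutes\<close>), and a short computation in the root lattice excludes both possibilities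
  (lemma \<open>no_involutive_element\<close>).

  The structure theory behind this is developed from the definition of the Lie algebra, in four
  steps.

  (1) A closed connected group is generated by any subgroup containing rational curves through 1
  whose tangent vectors span the Lie algebra (theorem \<open>generated_by_curves\<close>). A regular function
  vanishing on all products of points of the curves lies in every power of the maximal ideal of
  1, because its leading form vanishes; by Krull's theorem it vanishes near 1. Extending
  homomorphisms from the coordinate ring of the group to that of the parameter space then shows
  that the products contain a nonempty open set, so that the subgroup is open and closed.

  (2) If \<open>u\<close> is a polynomial curve in \<open>G\<close> with \<open>u(0) = 1\<close>, its lowest nonconstant coefficient
  lies in the Lie algebra. If moreover \<open>T\<close> acts on the parameter through a root \<open>c\<close>, that
  coefficient has a weight that is a multiple of \<open>c\<close>, hence \<open>c\<close> itself, and the curve is trivial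
  as soon as its tangent vector vanishes (lemma \<open>equivariant_curve\<close>; lemma \<open>equivariant_surface\<close>
  for two parameters). This gives the uniqueness of root groups and the commutator formula
  (\<open>root_group_unique\<close>, \<open>root_group_commutator\<close>).

  (3) The elements \<open>n\<^sub>i = x\<^sub>i(1) y\<^sub>i(-1) x\<^sub>i(1)\<close> act on the root lattice as the simple
  reflections (lemma \<open>acts_reflection\<close>).

  (4) With these facts the classical argument for groups with a BN-pair applies: the group
  generated by \<open>T\<close> and the positive root groups factors through each simple root group
  (\<open>borel_factor\<close>), which yields the exchange property, and by (1) the group \<open>G\<close> is generated by
  \<open>T\<close> and the simple root groups and their opposites (\<open>gen_all\<close>), which yields the Bruhat
  decomposition.

  Roots are handled as vectors of integers through the quadratic form of \<open>D\<^sub>4\<close>: it takes the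
  value 2 on every root and is at least 2 on every nonzero vector, and this gives all the
  combinatorics of the root system that is used.
\<close>

section \<open>Finitely generated extensions of rings\<close>

definition unital_subring :: "'r::comm_ring_1 set \<Rightarrow> bool" where
  "unital_subring A \<longleftrightarrow> 1 \<in> A \<and> (\<forall>a\<in>A. \<forall>b\<in>A. a + b \<in> A \<and> a * b \<in> A) \<and> (\<forall>a\<in>A. - a \<in> A)"

lemma unital_subringD:
  assumes "unital_subring A"
  shows "1 \<in> A" "0 \<in> A" "a \<in> A \<Longrightarrow> b \<in> A \<Longrightarrow> a + b \<in> A" "a \<in> A \<Longrightarrow> b \<in> A \<Longrightarrow> a * b \<in> A"
    "a \<in> A \<Longrightarrow> - a \<in> A" "a \<in> A \<Longrightarrow> b \<in> A \<Longrightarrow> a - b \<in> A" "a \<in> A \<Longrightarrow> a ^ n \<in> A"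
proof -
  show 1: "1 \<in> A" and 2: "a \<in> A \<Longrightarrow> b \<in> A \<Longrightarrow> a + b \<in> A" and 3: "a \<in> A \<Longrightarrow> b \<in> A \<Longrightarrow> a * b \<in> A"
    and 4: "a \<in> A \<Longrightarrow> - a \<in> A" for a b
    using assms by (auto simp: unital_subring_def)
  show "0 \<in> A" using 2[OF 1 4[OF 1]] by simp
  show "a \<in> A \<Longrightarrow> b \<in> A \<Longrightarrow> a - b \<in> A" using 2[of a "- b"] 4[of b] by simp
  show "a \<in> A \<Longrightarrow> a ^ n \<in> A" by (induction n) (auto intro: 1 3)
qed

lemma unital_subring_sum:
  assumes "unital_subring A" "\<And>i. i \<in> S \<Longrightarrow> f i \<in> A"
  shows "sum f S \<in> A"
  using assms(2)
  by (induction S rule: infinite_finite_induct) (auto intro: unital_subringD[OF assms(1)])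

definition coeffs_in :: "'r::comm_ring_1 set \<Rightarrow> 'r poly set" where
  "coeffs_in A = {p. \<forall>i. coeff p i \<in> A}"

definition adjoin :: "'r::comm_ring_1 set \<Rightarrow> 'r \<Rightarrow> 'r set" where
  "adjoin A x = (\<lambda>p. poly p x) ` coeffs_in A"

text \<open>The list of generators makes induction over one new generator at a time possible, which is
  how finite generation is used.\<close>

fun adjoins :: "'r::comm_ring_1 set \<Rightarrow> 'r list \<Rightarrow> 'r set" where
  "adjoins A [] = A"
| "adjoins A (x # xs) = adjoins (adjoin A x) xs"

lemma coeffs_in_closed:
  assumes A: "unital_subring A"
  shows "0 \<in> coeffs_in A" "1 \<in> coeffs_in A"
    "p \<in> coeffs_in A \<Longrightarrow> q \<in> coeffs_in A \<Longrightarrow> p + q \<in> coeffs_in A"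
    "p \<in> coeffs_in A \<Longrightarrow> q \<in> coeffs_in A \<Longrightarrow> p - q \<in> coeffs_in A"
    "p \<in> coeffs_in A \<Longrightarrow> q \<in> coeffs_in A \<Longrightarrow> p * q \<in> coeffs_in A"
    "p \<in> coeffs_in A \<Longrightarrow> - p \<in> coeffs_in A"
    "p \<in> coeffs_in A \<Longrightarrow> r \<in> A \<Longrightarrow> smult r p \<in> coeffs_in A"
    "r \<in> A \<Longrightarrow> monom r n \<in> coeffs_in A"
    "r \<in> A \<Longrightarrow> [:r:] \<in> coeffs_in A"
    "p \<in> coeffs_in A \<Longrightarrow> coeff p n \<in> A"
  by (auto simp: coeffs_in_def coeff_mult coeff_1 coeff_pCons split: nat.split
      intro!: unital_subring_sum[OF A] unital_subringD[OF A])

lemma unital_subring_adjoin: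
  assumes A: "unital_subring A"
  shows "unital_subring (adjoin A x)"
proof -
  have "poly p x + poly q x \<in> adjoin A x \<and> poly p x * poly q x \<in> adjoin A x \<and> - poly p x \<in> adjoin A x"
    if "p \<in> coeffs_in A" "q \<in> coeffs_in A" for p q
    using coeffs_in_closed(3,5)[OF A that] coeffs_in_closed(6)[OF A that(1)]
    unfolding adjoin_def image_iff by (metis poly_add poly_mult poly_minus)
  moreover have "1 \<in> adjoin A x"
    unfolding adjoin_def image_iff using coeffs_in_closed(2)[OF A] by (metis poly_1)
  ultimately show ?thesis
    unfolding unital_subring_def by (auto simp: adjoin_def)
qed

lemma adjoin_base:
  assumes A: "unital_subring A" and "a \<in> A"
  shows "a \<in> adjoin A x"
proof -
  have "[:a:] \<in> coeffs_in A" "poly [:a:] x = a"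
    using coeffs_in_closed(9)[OF assms] by auto
  thus ?thesis unfolding adjoin_def by (metis image_eqI)
qed

lemma adjoin_gen: "unital_subring A \<Longrightarrow> x \<in> adjoin A x"
proof -
  assume A: "unital_subring A"
  have "monom 1 1 \<in> coeffs_in A" "poly (monom 1 1) x = x"
    using coeffs_in_closed(8)[OF A unital_subringD(1)[OF A]] by (auto simp: poly_monom)
  thus ?thesis unfolding adjoin_def by (metis image_eqI)
qed

lemma poly_in_subring:
  assumes B: "unital_subring B" "x \<in> B" and p: "p \<in> coeffs_in B"
  shows "poly p x \<in> B"
proof -
  have "poly p x = (\<Sum>i\<le>degree p. coeff p i * x ^ i)" by (simp add: poly_altdef)
  also have "\<dots> \<in> B" using coeffs_in_closed(10)[OF B(1) p]
    by (intro unital_subring_sum[OF B(1)] unital_subringD[OF B(1)] B(2))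
  finally show ?thesis .
qed

lemma adjoin_least:
  assumes "unital_subring B" "A \<subseteq> B" "x \<in> B"
  shows "adjoin A x \<subseteq> B"
  using poly_in_subring[OF assms(1,3)] assms(2) by (auto simp: adjoin_def coeffs_in_def)

lemma adjoins_subring: "unital_subring A \<Longrightarrow> unital_subring (adjoins A xs)"
  by (induction xs arbitrary: A) (auto intro: unital_subring_adjoin)

lemma adjoins_base: "unital_subring A \<Longrightarrow> a \<in> A \<Longrightarrow> a \<in> adjoins A xs"
  by (induction xs arbitrary: A) (auto intro: unital_subring_adjoin adjoin_base)

lemma adjoins_gen: "unital_subring A \<Longrightarrow> x \<in> set xs \<Longrightarrow> x \<in> adjoins A xs"
  by (induction xs arbitrary: A) (auto intro: unital_subring_adjoin adjoin_gen adjoins_base)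

lemma adjoins_least: "unital_subring B \<Longrightarrow> A \<subseteq> B \<Longrightarrow> set xs \<subseteq> B \<Longrightarrow> adjoins A xs \<subseteq> B"
  by (induction xs arbitrary: A) (auto dest: adjoin_least)

section \<open>Noetherian rings\<close>

text \<open>The ideal generated by \<open>F\<close> in the ring \<open>A\<close>, which need not be the whole type.\<close>

inductive_set ideal_gen :: "'r::comm_ring_1 set \<Rightarrow> 'r set \<Rightarrow> 'r set" for A F where
  zero: "0 \<in> ideal_gen A F"
| step: "r \<in> A \<Longrightarrow> f \<in> F \<Longrightarrow> g \<in> ideal_gen A F \<Longrightarrow> r * f + g \<in> ideal_gen A F"

definition is_ideal :: "'r::comm_ring_1 set \<Rightarrow> 'r set \<Rightarrow> bool" where
  "is_ideal A I \<longleftrightarrow> I \<subseteq> A \<and> 0 \<in> I \<and> (\<forall>a\<in>I. \<forall>b\<in>I. a + b \<in> I) \<and> (\<forall>r\<in>A. \<forall>a\<in>I. r * a \<in> I)"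

definition noetherian :: "'r::comm_ring_1 set \<Rightarrow> bool" where
  "noetherian A \<longleftrightarrow> (\<forall>I. is_ideal A I \<longrightarrow> (\<exists>F. finite F \<and> F \<subseteq> I \<and> I \<subseteq> ideal_gen A F))"

lemma ideal_gen_least: "is_ideal A I \<Longrightarrow> F \<subseteq> I \<Longrightarrow> ideal_gen A F \<subseteq> I"
proof
  fix x assume I: "is_ideal A I" "F \<subseteq> I" and "x \<in> ideal_gen A F"
  from this(3) show "x \<in> I" by induction (use I in \<open>auto simp: is_ideal_def\<close>)
qed

lemma ideal_gen_is_ideal:
  assumes A: "unital_subring A" and F: "F \<subseteq> A"
  shows "is_ideal A (ideal_gen A F)"
proof -
  have 1: "x \<in> A" if "x \<in> ideal_gen A F" for x
    using that by induction (use F in \<open>auto intro: unital_subringD[OF A]\<close>)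
  have 2: "x + y \<in> ideal_gen A F" if "x \<in> ideal_gen A F" "y \<in> ideal_gen A F" for x y
    using that by induction (auto simp: add.assoc intro: ideal_gen.intros)
  have 3: "r * x \<in> ideal_gen A F" if "x \<in> ideal_gen A F" "r \<in> A" for r x
    using that by induction
      (auto simp: distrib_left mult.assoc[symmetric] intro: ideal_gen.intros unital_subringD[OF A])
  show ?thesis unfolding is_ideal_def using 1 2 3 by (auto intro: ideal_gen.zero)
qed

lemma ideal_gen_gen: "unital_subring A \<Longrightarrow> f \<in> F \<Longrightarrow> f \<in> ideal_gen A F"
  using ideal_gen.step[of 1 A f F 0] by (auto intro: unital_subringD ideal_gen.zero)

lemma ideal_gen_mono: "F \<subseteq> F' \<Longrightarrow> ideal_gen A F \<subseteq> ideal_gen A F'"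
proof
  fix x assume F: "F \<subseteq> F'" and "x \<in> ideal_gen A F"
  from this(2) show "x \<in> ideal_gen A F'" by induction (use F in \<open>auto intro: ideal_gen.intros\<close>)
qed

lemma ideal_gen_range:
  assumes "x \<in> ideal_gen A (range f)"
  shows "\<exists>n::nat. x \<in> ideal_gen A (f ` {..<n})"
  using assms
proof induction
  case (step r h g)
  then obtain n m where n: "g \<in> ideal_gen A (f ` {..<n})" and m: "h = f m" by auto
  have "g \<in> ideal_gen A (f ` {..<max n (Suc m)})"
    using n ideal_gen_mono[of "f ` {..<n}" "f ` {..<max n (Suc m)}" A] by (auto simp: image_mono)
  thus ?case using step.hyps(1) m by (intro exI[of _ "max n (Suc m)"] ideal_gen.step) auto
qed (auto intro: ideal_gen.zero)

text \<open>The form in which the Noetherian property is applied: in every sequence some term is a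
  combination of earlier ones.\<close>

lemma noetherian_sequence:
  fixes f :: "nat \<Rightarrow> 'r::comm_ring_1"
  assumes A: "unital_subring A" "noetherian A" and f: "\<And>n. f n \<in> A"
  shows "\<exists>n. f n \<in> ideal_gen A (f ` {..<n})"
proof -
  let ?I = "ideal_gen A (range f)"
  have "is_ideal A ?I" using f by (intro ideal_gen_is_ideal A) auto
  then obtain F where F: "finite F" "F \<subseteq> ?I" "?I \<subseteq> ideal_gen A F"
    using A(2) unfolding noetherian_def by blast
  have "\<exists>N. F \<subseteq> ideal_gen A (f ` {..<N})"
    using F(1,2)
  proof (induction F)
    case (insert x F)
    then obtain N n where N: "F \<subseteq> ideal_gen A (f ` {..<N})" and n: "x \<in> ideal_gen A (f ` {..<n})"
      using ideal_gen_range[of x A f] by auto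
    have "ideal_gen A (f ` {..<N}) \<subseteq> ideal_gen A (f ` {..<max N n})"
      "ideal_gen A (f ` {..<n}) \<subseteq> ideal_gen A (f ` {..<max N n})"
      by (intro ideal_gen_mono; auto)+
    with N n show ?case by (intro exI[of _ "max N n"]) auto
  qed auto
  then obtain N where N: "F \<subseteq> ideal_gen A (f ` {..<N})" by blast
  have "f N \<in> ideal_gen A F" using F(3) ideal_gen_gen[OF A(1), of "f N" "range f"] by auto
  also have "ideal_gen A F \<subseteq> ideal_gen A (f ` {..<N})"
    using f by (intro ideal_gen_least[OF _ N] ideal_gen_is_ideal A(1)) auto
  finally show ?thesis by blast
qed

text \<open>Hilbert's argument: in an ideal that is not finitely generated choose elements of least
  degree outside the ideal of the previous ones. Some leading coefficient is a combination of
  the earlier ones, and subtracting the corresponding combination of elements lowers the degree.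
  Degrees refer to polynomials representing the elements of the extension, which need not be
  unique.\<close>

lemma hilbert_basis_step:
  fixes x :: "'r::comm_ring_1"
  assumes A: "unital_subring A" "noetherian A"
  shows "noetherian (adjoin A x)"
proof (rule ccontr)
  let ?B = "adjoin A x"
  have B: "unital_subring ?B" by (rule unital_subring_adjoin[OF A(1)])
  assume "\<not> noetherian ?B"
  then obtain I where I: "is_ideal ?B I" and nfg: "\<And>F. finite F \<Longrightarrow> F \<subseteq> I \<Longrightarrow> \<not> I \<subseteq> ideal_gen ?B F"
    unfolding noetherian_def by blast
  define cand where "cand F p \<longleftrightarrow> p \<in> coeffs_in A \<and> poly p x \<in> I \<and> poly p x \<notin> ideal_gen ?B F" for F p
  define pick where "pick F = arg_min degree (cand F)" for F
  have pick: "cand F (pick F)" "cand F p \<Longrightarrow> degree (pick F) \<le> degree p"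
    if F: "finite F" "F \<subseteq> I" for F p
  proof -
    obtain y where "y \<in> I" "y \<notin> ideal_gen ?B F" using nfg[OF F] by blast
    moreover have "y \<in> ?B" using \<open>y \<in> I\<close> I by (auto simp: is_ideal_def)
    ultimately obtain q where q: "cand F q" unfolding cand_def adjoin_def by blast
    show "cand F (pick F)" unfolding pick_def using arg_min_natI[of "cand F" q degree] q by simp
    show "cand F p \<Longrightarrow> degree (pick F) \<le> degree p" unfolding pick_def using arg_min_nat_le[of "cand F" p degree] by simp
  qed
  define FF where "FF = rec_nat {} (\<lambda>_ F. insert (poly (pick F) x) F)"
  have FF_simps: "FF 0 = {}" "FF (Suc n) = insert (poly (pick (FF n)) x) (FF n)" for n
    by (simp_all add: FF_def)
  have FF: "finite (FF n) \<and> FF n \<subseteq> I" for n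
  proof (induction n)
    case (Suc n)
    thus ?case using pick(1)[of "FF n"] by (auto simp: FF_simps cand_def)
  qed (auto simp: FF_simps)
  define g where "g n = pick (FF n)" for n
  have g: "cand (FF n) (g n)" for n using pick(1) FF by (simp add: g_def)
  have FF_eq: "FF n = (\<lambda>i. poly (g i) x) ` {..<n}" for n
    by (induction n) (auto simp: FF_simps g_def lessThan_Suc)
  have deg: "degree (g i) \<le> degree (g n)" if "i \<le> n" for i n
  proof -
    have "FF i \<subseteq> FF n" using that by (auto simp: FF_eq)
    hence "cand (FF i) (g n)" using g[of n] ideal_gen_mono[of "FF i" "FF n"]
      by (auto simp: cand_def)
    thus ?thesis using pick(2) FF by (simp add: g_def)
  qed
  have gA: "g n \<in> coeffs_in A" for n using g by (simp add: cand_def)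
  have "lead_coeff (g n) \<in> A" for n using coeffs_in_closed(10)[OF A(1) gA] .
  from noetherian_sequence[OF A, of "\<lambda>n. lead_coeff (g n)", OF this]
  obtain n where n: "lead_coeff (g n) \<in> ideal_gen A ((\<lambda>n. lead_coeff (g n)) ` {..<n})" by blast
  have ideal: "is_ideal ?B (ideal_gen ?B (FF n))"
    using FF[of n] I by (intro ideal_gen_is_ideal B) (auto simp: is_ideal_def)
  \<comment> \<open>every combination of the leading coefficients is realised in top degree by an element of
      the ideal generated so far\<close>
  have lift: "\<exists>p\<in>coeffs_in A. degree p \<le> degree (g n) \<and> coeff p (degree (g n)) = a \<and>
        poly p x \<in> ideal_gen ?B (FF n)"
    if "a \<in> ideal_gen A ((\<lambda>n. lead_coeff (g n)) ` {..<n})" for a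
    using that
  proof induction
    case zero
    show ?case by (rule bexI[of _ 0]) (auto intro: ideal_gen.zero coeffs_in_closed A)
  next
    case (step r f b)
    then obtain i p where i: "i < n" "f = lead_coeff (g i)"
      and p: "p \<in> coeffs_in A" "degree p \<le> degree (g n)" "coeff p (degree (g n)) = b"
        "poly p x \<in> ideal_gen ?B (FF n)" by auto
    define e where "e = degree (g n) - degree (g i)"
    have e: "degree (g n) = e + degree (g i)" using deg[of i n] i by (simp add: e_def)
    have q: "monom r e * g i \<in> coeffs_in A"
      by (intro coeffs_in_closed A gA step)
    have "degree (monom r e * g i) \<le> degree (g n)"
      unfolding e by (rule order.trans[OF degree_mult_le]) (auto intro: degree_monom_le)
    moreover have "coeff (monom r e * g i) (degree (g n)) = r * f"
      by (simp add: coeff_monom_mult e i)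
    moreover have "poly (monom r e * g i) x = (r * x ^ e) * poly (g i) x"
      by (simp add: poly_monom)
    moreover have "r * x ^ e \<in> ?B"
      by (intro unital_subringD[OF B] adjoin_base adjoin_gen A step)
    ultimately show ?case
      using p q i by (intro bexI[of _ "monom r e * g i + p"])
        (auto intro!: degree_add_le coeffs_in_closed(3)[OF A(1)] ideal_gen.step simp: FF_eq)
  qed
  obtain p where p: "p \<in> coeffs_in A" "degree p \<le> degree (g n)"
    "coeff p (degree (g n)) = lead_coeff (g n)" "poly p x \<in> ideal_gen ?B (FF n)"
    using lift[OF n] by blast
  have pI: "poly p x \<in> I" using p(4) ideal_gen_least[OF I] FF by blast
  have neg: "- y \<in> J" if "is_ideal ?B J" "y \<in> J" for y J
    using that unital_subringD(5)[OF B unital_subringD(1)[OF B]]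
    unfolding is_ideal_def by (metis mult_minus1)
  have c: "cand (FF n) (g n - p)"
  proof -
    have "poly (g n) x + - poly p x \<in> I"
      using g[of n] neg[OF I pI] I unfolding cand_def is_ideal_def by blast
    moreover have "poly (g n) x - poly p x \<notin> ideal_gen ?B (FF n)"
    proof
      assume "poly (g n) x - poly p x \<in> ideal_gen ?B (FF n)"
      hence "(poly (g n) x - poly p x) + poly p x \<in> ideal_gen ?B (FF n)"
        using ideal p(4) unfolding is_ideal_def by blast
      thus False using g[of n] by (simp add: cand_def)
    qed
    ultimately show ?thesis
      using coeffs_in_closed(4)[OF A(1) gA p(1), of n] by (simp add: cand_def)
  qed
  hence le: "degree (g n) \<le> degree (g n - p)" using pick(2) FF by (simp add: g_def)
  moreover have "degree (g n - p) \<le> degree (g n)" using p(2) by (simp add: degree_diff_le)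
  ultimately have "degree (g n - p) = degree (g n)" by simp
  hence "lead_coeff (g n - p) = 0" using p(3) by simp
  hence "g n - p = 0" by (simp only: leading_coeff_0_iff)
  thus False using c ideal by (simp add: cand_def ideal_gen.zero)
qed

lemma noetherian_adjoins:
  "unital_subring A \<Longrightarrow> noetherian A \<Longrightarrow> noetherian (adjoins A xs)"
  by (induction xs arbitrary: A) (auto intro: hilbert_basis_step unital_subring_adjoin)

lemma noetherian_field:
  assumes A: "unital_subring A" and inv: "\<And>a. a \<in> A \<Longrightarrow> a \<noteq> 0 \<Longrightarrow> \<exists>b\<in>A. b * a = 1"
  shows "noetherian A"
  unfolding noetherian_def
proof (intro allI impI)
  fix I assume I: "is_ideal A I"
  show "\<exists>F. finite F \<and> F \<subseteq> I \<and> I \<subseteq> ideal_gen A F"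
  proof (cases "I = {0}")
    case True
    thus ?thesis by (intro exI[of _ "{}"]) (auto intro: ideal_gen.zero)
  next
    case False
    then obtain a where a: "a \<in> I" "a \<noteq> 0" using I by (auto simp: is_ideal_def)
    moreover from this have "a \<in> A" using I by (auto simp: is_ideal_def)
    ultimately obtain b where b: "b \<in> A" "b * a = 1" using inv by blast
    have "y \<in> ideal_gen A {a}" if "y \<in> I" for y
    proof -
      have "y * b \<in> A" using that I b unital_subringD(4)[OF A] by (auto simp: is_ideal_def)
      hence "(y * b) * a + 0 \<in> ideal_gen A {a}" by (intro ideal_gen.intros) auto
      thus ?thesis using b by (simp add: mult.assoc)
    qed
    thus ?thesis using a by (intro exI[of _ "{a}"]) auto
  qed
qed

lemma noetherian_image:
  fixes h :: "'r::comm_ring_1 \<Rightarrow> 's::comm_ring_1"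
  assumes A: "noetherian A"
    and h: "h 0 = 0" "\<And>a b. a \<in> A \<Longrightarrow> b \<in> A \<Longrightarrow> h (a + b) = h a + h b"
      "\<And>a b. a \<in> A \<Longrightarrow> b \<in> A \<Longrightarrow> h (a * b) = h a * h b"
    and A': "unital_subring A"
  shows "noetherian (h ` A)"
  unfolding noetherian_def
proof (intro allI impI)
  fix J assume J: "is_ideal (h ` A) J"
  let ?I = "{a \<in> A. h a \<in> J}"
  have "is_ideal A ?I"
    using J h A' by (auto simp: is_ideal_def intro: unital_subringD)
  then obtain F where F: "finite F" "F \<subseteq> ?I" "?I \<subseteq> ideal_gen A F"
    using A[unfolded noetherian_def, rule_format, of ?I] by blast
  have "h a \<in> ideal_gen (h ` A) (h ` F) \<and> a \<in> A" if "a \<in> ideal_gen A F" for a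
    using that
  proof induction
    case (step r f g)
    hence "f \<in> A" using F by auto
    hence "h (r * f + g) = h r * h f + h g" "r * f \<in> A"
      using step h unital_subringD(4)[OF A', of r f] by auto
    thus ?case using step unital_subringD(3)[OF A', of "r * f" g] by (auto intro: ideal_gen.step)
  qed (auto simp: h(1) intro: ideal_gen.zero unital_subringD[OF A'])
  thus "\<exists>F. finite F \<and> F \<subseteq> J \<and> J \<subseteq> ideal_gen (h ` A) F"
  proof (intro exI conjI)
    show "J \<subseteq> ideal_gen (h ` A) (h ` F)"
    proof
      fix y assume y: "y \<in> J"
      then obtain a where a: "a \<in> A" "y = h a" using J by (auto simp: is_ideal_def)
      hence "a \<in> ideal_gen A F" using y F by auto
      thus "y \<in> ideal_gen (h ` A) (h ` F)"
        using \<open>\<And>a. a \<in> ideal_gen A F \<Longrightarrow> h a \<in> ideal_gen (h ` A) (h ` F) \<and> a \<in> A\<close> a by auto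
    qed
  qed (use F in auto)
qed

section \<open>The intersection of the powers of an ideal\<close>

text \<open>The Rees algebra of the ideal generated by \<open>xs\<close>: a monomial of degree \<open>n\<close> lies in it
  exactly when its coefficient lies in the \<open>n\<close>-th power of that ideal. Powers of ideals are
  expressed through it throughout, so that the finite generation of one ring replaces the
  Artin-Rees lemma.\<close>

definition rees :: "'r::comm_ring_1 set \<Rightarrow> 'r list \<Rightarrow> 'r poly set" where
  "rees A xs = adjoins ((\<lambda>a. [:a:]) ` A) (map (\<lambda>x. monom x 1) xs)"

lemma unital_subring_consts: "unital_subring A \<Longrightarrow> unital_subring ((\<lambda>a. [:a:]) ` A)"
  unfolding unital_subring_def[of "_ ` _"]
  by (auto simp: image_iff one_pCons intro!: unital_subringD)

lemma unital_subring_rees: "unital_subring A \<Longrightarrow> unital_subring (rees A xs)"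
  unfolding rees_def by (intro adjoins_subring unital_subring_consts)

lemma noetherian_rees: "unital_subring A \<Longrightarrow> noetherian A \<Longrightarrow> noetherian (rees A xs)"
  unfolding rees_def
  by (intro noetherian_adjoins unital_subring_consts noetherian_image) auto

lemma rees_induct:
  assumes A: "unital_subring A" and P: "unital_subring P"
    and "\<And>a. a \<in> A \<Longrightarrow> [:a:] \<in> P" "\<And>x. x \<in> set xs \<Longrightarrow> monom x 1 \<in> P"
  shows "rees A xs \<subseteq> P"
  unfolding rees_def using assms by (intro adjoins_least) auto

text \<open>Krull's intersection theorem. The monomials of all degrees with coefficient \<open>f\<close> lie in the
  Noetherian Rees algebra, so one of them is a combination of those of lower degree. Comparing
  coefficients in that degree gives \<open>f = a f\<close>, where \<open>a\<close> is a sum of coefficients of positive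
  degree of the Rees algebra and therefore lies in \<open>m\<close>.\<close>

lemma krull_intersection:
  fixes f :: "'r::comm_ring_1"
  assumes A: "unital_subring A" "noetherian A"
    and m: "is_ideal A m" "set xs \<subseteq> m"
    and f: "\<And>n. monom f n \<in> rees A xs"
  shows "\<exists>a\<in>m. f = a * f"
proof -
  let ?S = "rees A xs"
  let ?P = "{s. \<forall>n. coeff s n \<in> A \<and> (n \<ge> 1 \<longrightarrow> coeff s n \<in> m)}"
  have mA: "m \<subseteq> A" and m0: "0 \<in> m" and m_add: "\<And>a b. a \<in> m \<Longrightarrow> b \<in> m \<Longrightarrow> a + b \<in> m"
    and m_mult: "\<And>r a. r \<in> A \<Longrightarrow> a \<in> m \<Longrightarrow> r * a \<in> m"
    using m(1) by (auto simp: is_ideal_def)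
  have m_sum: "sum h T \<in> m" if "\<And>i. i \<in> T \<Longrightarrow> h i \<in> m" for h :: "nat \<Rightarrow> 'r" and T
    using that by (induction T rule: infinite_finite_induct) (auto simp: m0 m_add)
  have m_neg: "- a \<in> m" if "a \<in> m" for a
    using m_mult[of "- 1" a] that unital_subringD(1,5)[OF A(1)] by auto
  have "unital_subring ?P"
    unfolding unital_subring_def
  proof (intro conjI ballI)
    fix s t assume s: "s \<in> ?P" and t: "t \<in> ?P"
    show "s + t \<in> ?P" using s t by (auto intro: m_add unital_subringD[OF A(1)])
    have "coeff s i * coeff t (n - i) \<in> m" if "n \<ge> 1" "i \<le> n" for n i
    proof (cases "i \<ge> 1")
      case True
      thus ?thesis using m_mult[of "coeff t (n - i)" "coeff s i"] s t by (simp add: mult.commute)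
    next
      case False
      thus ?thesis using m_mult[of "coeff s i" "coeff t (n - i)"] s t that by simp
    qed
    thus "s * t \<in> ?P" using s t
      by (auto simp: coeff_mult intro!: m_sum unital_subring_sum[OF A(1)] unital_subringD[OF A(1)])
  qed (auto simp: coeff_1 m0 m_neg intro: unital_subringD[OF A(1)])
  moreover have "[:a:] \<in> ?P" if "a \<in> A" for a
    using that by (auto simp: coeff_pCons m0 unital_subringD[OF A(1)] split: nat.split)
  moreover have "monom x 1 \<in> ?P" if "x \<in> set xs" for x
    using that m(2) mA m0 by auto
  ultimately have SP: "?S \<subseteq> ?P" by (intro rees_induct A) auto
  obtain n where n: "monom f n \<in> ideal_gen ?S ((\<lambda>n. monom f n) ` {..<n})"
    using noetherian_sequence[of ?S "\<lambda>n. monom f n"] f unital_subring_rees noetherian_rees A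
    by blast
  have "\<exists>a\<in>m. coeff h n = a * f" if "h \<in> ideal_gen ?S ((\<lambda>n. monom f n) ` {..<n})" for h
    using that
  proof induction
    case (step s q h)
    then obtain i a where i: "i < n" "q = monom f i" and a: "a \<in> m" "coeff h n = a * f" by auto
    have "coeff s (n - i) \<in> m" using step SP i by auto
    hence "coeff s (n - i) + a \<in> m" using a m_add by auto
    moreover have "coeff (s * q + h) n = (coeff s (n - i) + a) * f"
    proof -
      have "coeff (s * monom f i) n = coeff (monom f i * s) n" by (simp only: mult.commute)
      also have "\<dots> = f * coeff s (n - i)" using i by (simp add: coeff_monom_mult)
      finally show ?thesis using i a by (simp add: distrib_left mult.commute[of _ f])
    qed
    ultimately show ?case by blast
  qed (auto intro!: bexI[of _ 0] m0)
  from this[OF n] show ?thesis by simp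
qed

section \<open>Extension of homomorphisms\<close>

definition is_hom :: "'r::comm_ring_1 set \<Rightarrow> ('r \<Rightarrow> 'k::comm_ring_1) \<Rightarrow> bool" where
  "is_hom A \<phi> \<longleftrightarrow> \<phi> 1 = 1 \<and> (\<forall>a\<in>A. \<forall>b\<in>A. \<phi> (a + b) = \<phi> a + \<phi> b \<and> \<phi> (a * b) = \<phi> a * \<phi> b)"

lemma is_homD:
  assumes A: "unital_subring A" and h: "is_hom A \<phi>"
  shows "\<phi> 0 = 0" "\<phi> 1 = 1" "a \<in> A \<Longrightarrow> b \<in> A \<Longrightarrow> \<phi> (a + b) = \<phi> a + \<phi> b"
    "a \<in> A \<Longrightarrow> b \<in> A \<Longrightarrow> \<phi> (a * b) = \<phi> a * \<phi> b"
    "a \<in> A \<Longrightarrow> \<phi> (a ^ n) = \<phi> a ^ n"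
    "(\<And>i. i \<in> S \<Longrightarrow> f i \<in> A) \<Longrightarrow> \<phi> (sum f S) = (\<Sum>i\<in>S. \<phi> (f i))"
proof -
  show 0: "\<phi> 0 = 0"
    using h unital_subringD(2)[OF A] unfolding is_hom_def by (metis add_cancel_right_right)
  show 1: "\<phi> 1 = 1" using h by (simp add: is_hom_def)
  show 2: "a \<in> A \<Longrightarrow> b \<in> A \<Longrightarrow> \<phi> (a + b) = \<phi> a + \<phi> b" for a b using h by (simp add: is_hom_def)
  show 3: "a \<in> A \<Longrightarrow> b \<in> A \<Longrightarrow> \<phi> (a * b) = \<phi> a * \<phi> b" for a b using h by (simp add: is_hom_def)
  show "a \<in> A \<Longrightarrow> \<phi> (a ^ n) = \<phi> a ^ n"
    by (induction n) (auto simp: 1 3 unital_subringD[OF A])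
  show "(\<And>i. i \<in> S \<Longrightarrow> f i \<in> A) \<Longrightarrow> \<phi> (sum f S) = (\<Sum>i\<in>S. \<phi> (f i))"
    by (induction S rule: infinite_finite_induct) (auto simp: 0 2 unital_subring_sum[OF A])
qed

lemma map_poly_hom:
  assumes A: "unital_subring A" and h: "is_hom A \<phi>" and p: "p \<in> coeffs_in A" and q: "q \<in> coeffs_in A"
  shows "map_poly \<phi> (p + q) = map_poly \<phi> p + map_poly \<phi> q"
    "map_poly \<phi> (p * q) = map_poly \<phi> p * map_poly \<phi> q"
proof -
  note pc = coeffs_in_closed(10)[OF A p] and qc = coeffs_in_closed(10)[OF A q]
  note hD = is_homD[OF A h]
  show "map_poly \<phi> (p + q) = map_poly \<phi> p + map_poly \<phi> q"
    by (intro poly_eqI) (simp add: coeff_map_poly hD pc qc)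
  show "map_poly \<phi> (p * q) = map_poly \<phi> p * map_poly \<phi> q"
    by (intro poly_eqI)
      (simp add: coeff_map_poly hD(1,4) coeff_mult pc qc hD(6) unital_subringD(4)[OF A])
qed

text \<open>Evaluation at \<open>\<xi>\<close> is well defined because \<open>\<xi>\<close> is a root of the image of every relation of
  \<open>x\<close> over \<open>A\<close>.\<close>

lemma hom_extension_root:
  fixes \<phi> :: "'r::comm_ring_1 \<Rightarrow> 'k::comm_ring_1"
  assumes A: "unital_subring A" and h: "is_hom A \<phi>"
    and root: "\<And>p. p \<in> coeffs_in A \<Longrightarrow> poly p x = 0 \<Longrightarrow> poly (map_poly \<phi> p) \<xi> = 0"
  shows "\<exists>\<psi>. is_hom (adjoin A x) \<psi> \<and> (\<forall>a\<in>A. \<psi> a = \<phi> a) \<and>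
    (\<forall>p\<in>coeffs_in A. \<psi> (poly p x) = poly (map_poly \<phi> p) \<xi>)"
proof -
  define \<psi> where "\<psi> c = poly (map_poly \<phi> (SOME p. p \<in> coeffs_in A \<and> poly p x = c)) \<xi>" for c
  have \<psi>: "\<psi> (poly p x) = poly (map_poly \<phi> p) \<xi>" if p: "p \<in> coeffs_in A" for p
  proof -
    define q where "q = (SOME q. q \<in> coeffs_in A \<and> poly q x = poly p x)"
    have q: "q \<in> coeffs_in A" "poly q x = poly p x"
      using someI[of "\<lambda>q. q \<in> coeffs_in A \<and> poly q x = poly p x" p] p by (auto simp: q_def)
    have d: "p - q \<in> coeffs_in A" by (intro coeffs_in_closed A p q)
    have "map_poly \<phi> p = map_poly \<phi> (q + (p - q))" by simp
    also have "\<dots> = map_poly \<phi> q + map_poly \<phi> (p - q)" by (rule map_poly_hom[OF A h q(1) d])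
    finally have "poly (map_poly \<phi> p) \<xi> = poly (map_poly \<phi> q) \<xi>"
      using root[OF d] q by simp
    thus ?thesis by (simp add: \<psi>_def q_def)
  qed
  have const: "\<psi> a = \<phi> a" if "a \<in> A" for a
    using \<psi>[OF coeffs_in_closed(9)[OF A that]] is_homD(1)[OF A h] by (simp add: map_poly_pCons)
  have "is_hom (adjoin A x) \<psi>"
    unfolding is_hom_def
  proof (intro conjI ballI)
    show "\<psi> 1 = 1" using const[OF unital_subringD(1)[OF A]] is_homD(2)[OF A h] by simp
    fix a b assume "a \<in> adjoin A x" "b \<in> adjoin A x"
    then obtain p q where p: "p \<in> coeffs_in A" "a = poly p x" and q: "q \<in> coeffs_in A" "b = poly q x"
      by (auto simp: adjoin_def)
    show "\<psi> (a + b) = \<psi> a + \<psi> b"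
      using \<psi>[OF coeffs_in_closed(3)[OF A p(1) q(1)]] \<psi>[OF p(1)] \<psi>[OF q(1)] p(2) q(2)
        map_poly_hom[OF A h p(1) q(1)] by simp
    show "\<psi> (a * b) = \<psi> a * \<psi> b"
      using \<psi>[OF coeffs_in_closed(5)[OF A p(1) q(1)]] \<psi>[OF p(1)] \<psi>[OF q(1)] p(2) q(2)
        map_poly_hom[OF A h p(1) q(1)] by simp
  qed
  thus ?thesis using const \<psi> by blast
qed

lemma pseudo_division:
  assumes A: "unital_subring A" and p: "p \<in> coeffs_in A" and q: "q \<in> coeffs_in A"
  shows "\<exists>k. \<exists>s\<in>coeffs_in A. \<exists>r\<in>coeffs_in A.
    smult (lead_coeff p ^ k) q = p * s + r \<and> (r = 0 \<or> degree r < degree p)"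
  using q
proof (induction "degree q" arbitrary: q rule: less_induct)
  case less
  note cl = coeffs_in_closed[OF A]
  let ?c = "lead_coeff p"
  show ?case
  proof (cases "q = 0 \<or> degree q < degree p")
    case True
    thus ?thesis using less.prems cl by (intro exI[of _ 0] bexI[of _ 0] bexI[of _ q]) auto
  next
    case False
    define e where "e = degree q - degree p"
    define m where "m = monom (lead_coeff q) e"
    have dq: "degree q = e + degree p" using False by (simp add: e_def)
    define q' where "q' = smult ?c q - m * p"
    have m: "m \<in> coeffs_in A" unfolding m_def by (intro cl less.prems)
    have q': "q' \<in> coeffs_in A" unfolding q'_def by (intro cl less.prems p m)
    have "degree (m * p) \<le> degree q"
      unfolding m_def dq by (rule order.trans[OF degree_mult_le]) (auto intro: degree_monom_le)
    hence "degree q' \<le> degree q" unfolding q'_def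
      by (intro degree_diff_le order.trans[OF degree_smult_le]) auto
    moreover have "coeff q' (degree q) = 0"
      by (simp add: q'_def m_def coeff_monom_mult dq[symmetric]) (simp add: dq)
    ultimately have "q' = 0 \<or> degree q' < degree q"
      by (metis leading_coeff_0_iff le_neq_implies_less)
    then obtain k s r where s: "s \<in> coeffs_in A" and r: "r \<in> coeffs_in A" "r = 0 \<or> degree r < degree p"
      and eq: "smult (?c ^ k) q' = p * s + r"
    proof
      assume "q' = 0"
      thus ?thesis using that[of 0 0 0] cl by auto
    next
      assume "degree q' < degree q"
      from less.hyps[OF this q'] show ?thesis using that by blast
    qed
    have "smult (?c ^ Suc k) q = p * (s + smult (?c ^ k) m) + r"
    proof -
      have "smult ?c q = q' + m * p" by (simp add: q'_def)
      hence "smult (?c ^ k) (smult ?c q) = smult (?c ^ k) (q' + m * p)" by simp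
      thus ?thesis using eq by (simp add: smult_add_right algebra_simps)
    qed
    moreover have "s + smult (?c ^ k) m \<in> coeffs_in A"
      by (intro cl s m unital_subringD[OF A] p)
    ultimately show ?thesis using r by blast
  qed
qed

lemma infinite_alg_closed: "infinite (UNIV :: 'k::alg_closed_field set)"
proof
  assume fin: "finite (UNIV :: 'k set)"
  define p :: "'k poly" where "p = (\<Prod>a\<in>UNIV. [:- a, 1:]) + 1"
  have d: "degree (\<Prod>a\<in>(UNIV::'k set). [:- a, 1:]) = card (UNIV::'k set)"
    by (subst degree_prod_eq_sum_degree) auto
  have "card (UNIV::'k set) > 0" using fin by (simp add: card_gt_0_iff)
  hence "degree p > 0" unfolding p_def using d by (simp add: degree_add_eq_left)
  then obtain z where "poly p z = 0" using alg_closed_imp_poly_has_root by blast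
  moreover have "poly (\<Prod>a\<in>(UNIV::'k set). [:- a, 1:]) z = 0"
    using fin by (simp add: poly_prod)
  ultimately show False by (simp add: p_def)
qed

text \<open>If \<open>x\<close> is transcendental, \<open>b\<close> is a polynomial in \<open>x\<close> and any point outside the finitely
  many roots of its image can serve as the image of \<open>x\<close>; the leading coefficient keeps that
  image nonzero. If \<open>x\<close> is algebraic with minimal polynomial \<open>p\<close>, any root of the image of \<open>p\<close>
  can serve, provided the leading coefficient of \<open>p\<close> survives; and \<open>b\<close> divides a nonzero element
  of \<open>A\<close>, which is required to survive as well.\<close>

lemma hom_extension_step:
  fixes x :: "'r::comm_ring_1"
  assumes A: "unital_subring A"
    and dom: "\<And>b c. b \<in> adjoin A x \<Longrightarrow> c \<in> adjoin A x \<Longrightarrow> b * c = 0 \<Longrightarrow> b = 0 \<or> c = 0"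
    and b: "b \<in> adjoin A x" "b \<noteq> 0"
  shows "\<exists>a\<in>A. a \<noteq> 0 \<and> (\<forall>\<phi>::'r \<Rightarrow> 'k::alg_closed_field. is_hom A \<phi> \<and> \<phi> a \<noteq> 0 \<longrightarrow>
     (\<exists>\<psi>. is_hom (adjoin A x) \<psi> \<and> (\<forall>c\<in>A. \<psi> c = \<phi> c) \<and> \<psi> b \<noteq> 0))"
proof -
  note cl = coeffs_in_closed[OF A] and rg = unital_subringD[OF A]
  have B: "unital_subring (adjoin A x)" by (rule unital_subring_adjoin[OF A])
  have inB: "poly p x \<in> adjoin A x" if "p \<in> coeffs_in A" for p using that by (auto simp: adjoin_def)
  have AB: "a \<in> adjoin A x" if "a \<in> A" for a using adjoin_base[OF A that] .
  obtain pb where pb: "pb \<in> coeffs_in A" "b = poly pb x" using b by (auto simp: adjoin_def)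
  show ?thesis
  proof (cases "\<forall>p\<in>coeffs_in A. poly p x = 0 \<longrightarrow> p = 0")
    case True
    have pb0: "pb \<noteq> 0" using b pb by auto
    have "\<exists>\<psi>. is_hom (adjoin A x) \<psi> \<and> (\<forall>c\<in>A. \<psi> c = \<phi> c) \<and> \<psi> b \<noteq> 0"
      if \<phi>: "is_hom A \<phi>" "\<phi> (lead_coeff pb) \<noteq> 0" for \<phi> :: "'r \<Rightarrow> 'k"
    proof -
      have "coeff (map_poly \<phi> pb) (degree pb) \<noteq> 0"
        using \<phi> is_homD(1)[OF A \<phi>(1)] by (simp add: coeff_map_poly)
      hence "map_poly \<phi> pb \<noteq> 0" by (metis coeff_0)
      hence "finite {\<xi>. poly (map_poly \<phi> pb) \<xi> = 0}" by (rule poly_roots_finite)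
      moreover have "infinite (UNIV :: 'k set)" by (rule infinite_alg_closed)
      ultimately have "{\<xi>. poly (map_poly \<phi> pb) \<xi> = 0} \<noteq> UNIV" by metis
      then obtain \<xi> where \<xi>: "poly (map_poly \<phi> pb) \<xi> \<noteq> 0" by auto
      have "poly (map_poly \<phi> p) \<xi> = 0" if "p \<in> coeffs_in A" "poly p x = 0" for p
        using True that by auto
      from hom_extension_root[OF A \<phi>(1) this] show ?thesis using \<xi> pb by metis
    qed
    thus ?thesis using pb0 coeffs_in_closed(10)[OF A pb(1)]
      by (intro bexI[of _ "lead_coeff pb"]) auto
  next
    case False
    define P where "P p \<longleftrightarrow> p \<in> coeffs_in A \<and> poly p x = 0 \<and> p \<noteq> 0" for p
    define p where "p = arg_min degree P"
    from False obtain p0 where "P p0" by (auto simp: P_def)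
    hence "P p" unfolding p_def by (rule arg_min_natI)
    hence p: "p \<in> coeffs_in A" "poly p x = 0" "p \<noteq> 0" by (auto simp: P_def)
    have min: "r = 0" if "r \<in> coeffs_in A" "poly r x = 0" "r = 0 \<or> degree r < degree p" for r
      proof (rule ccontr)
      assume "r \<noteq> 0"
      hence "degree p \<le> degree r" using that arg_min_nat_le[of P r degree] by (simp add: P_def p_def)
      thus False using that \<open>r \<noteq> 0\<close> by simp
    qed
    let ?c = "lead_coeff p"
    have c: "?c \<in> A" "?c \<noteq> 0" using cl(10)[OF p(1)] p(3) by auto
    have nz: "a * y \<noteq> 0" if "a \<in> adjoin A x" "a \<noteq> 0" "y \<in> adjoin A x" "y \<noteq> 0" for a y
      using dom that by blast
    have pow_nz: "a ^ k \<noteq> 0" if "a \<in> A" "a \<noteq> 0" for a k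
    proof (induction k)
      case 0
      have "(1::'r) \<noteq> 0" by simp
      thus ?case by simp
    next
      case (Suc k)
      thus ?case using nz[of a "a ^ k"] that AB rg by auto
    qed
    have dp: "degree p > 0"
    proof (rule ccontr)
      assume "\<not> degree p > 0"
      then obtain a where "p = [:a:]" by (auto elim: degree_eq_zeroE)
      thus False using p by auto
    qed
    \<comment> \<open>the element \<open>x\<close> is algebraic, so every nonzero element of the extension divides a
        nonzero element of the base: this is the Euclidean algorithm with the minimal polynomial\<close>
    have bez: "\<exists>u\<in>coeffs_in A. \<exists>d\<in>A. d \<noteq> 0 \<and> poly u x * poly q x = d"
      if "q \<in> coeffs_in A" "poly q x \<noteq> 0" for q
      using that
    proof (induction "degree q" arbitrary: q rule: less_induct)
      case less
      have main: "\<exists>u\<in>coeffs_in A. \<exists>d\<in>A. d \<noteq> 0 \<and> poly u x * poly r x = d"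
        if r: "r \<in> coeffs_in A" "poly r x \<noteq> 0" "degree r < degree p" "degree r \<le> degree q" for r
      proof (cases "degree r = 0")
        case True
        then obtain d where "r = [:d:]" by (auto elim: degree_eq_zeroE)
        hence "poly r x = d" "d \<in> A" using cl(10)[OF r(1), of 0] by auto
        thus ?thesis using r by (intro bexI[of _ 1] bexI[of _ d] cl) auto
      next
        case False
        obtain k s r' where s: "s \<in> coeffs_in A" and r': "r' \<in> coeffs_in A" "r' = 0 \<or> degree r' < degree r"
          and eq: "smult (lead_coeff r ^ k) p = r * s + r'"
          using pseudo_division[OF A r(1) p(1)] by blast
        have r0: "lead_coeff r \<in> A" "lead_coeff r \<noteq> 0" using cl(10)[OF r(1)] r(2) by auto
        have "poly (smult (lead_coeff r ^ k) p) x = poly (r * s + r') x" by (simp only: eq)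
        hence ev: "poly r x * poly s x + poly r' x = 0" using p(2) by simp
        have lk: "coeff (smult (lead_coeff r ^ k) p) (degree p) \<noteq> 0"
          using nz[of "lead_coeff r ^ k" ?c] pow_nz[OF r0] AB r0 c rg by auto
        have "poly r' x \<noteq> 0"
        proof
          assume z: "poly r' x = 0"
          hence r'0: "r' = 0" using min r' r(3) by auto
          hence "poly s x = 0" using ev dom[of "poly r x" "poly s x"] r inB s by auto
          moreover have "s \<noteq> 0" using eq lk r'0 by auto
          moreover have "degree s < degree p"
          proof -
            have ls: "lead_coeff r * lead_coeff s \<noteq> 0"
              using nz[of "lead_coeff r" "lead_coeff s"] AB r0 cl(10)[OF s] \<open>s \<noteq> 0\<close> by auto
            have "coeff (r * s) (degree r + degree s) = lead_coeff r * lead_coeff s"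
              by (rule coeff_mult_degree_sum)
            hence "degree r + degree s \<le> degree (r * s)" using ls by (intro le_degree) simp
            also have "\<dots> \<le> degree p" using eq r'0 degree_smult_le[of "lead_coeff r ^ k" p] by simp
            finally show ?thesis using False by simp
          qed
          ultimately show False using min[of s] s by auto
        qed
        moreover have "degree r' < degree q" using r' r(4) calculation by auto
        ultimately obtain u d where u: "u \<in> coeffs_in A" "d \<in> A" "d \<noteq> 0" "poly u x * poly r' x = d"
          using less.hyps r'(1) by blast
        have "poly (- (u * s)) x * poly r x = d"
        proof -
          have "poly r' x = - (poly r x * poly s x)" using ev by (simp add: eq_neg_iff_add_eq_0 add.commute)
          thus ?thesis using u(4) by (simp add: mult_ac)
        qed
        moreover have "- (u * s) \<in> coeffs_in A" by (intro cl u s)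
        ultimately show ?thesis using u by blast
      qed
      show ?case
      proof (cases "degree q < degree p")
        case True
        thus ?thesis using main less.prems by auto
      next
        case False
        obtain k s r where s: "s \<in> coeffs_in A" and r: "r \<in> coeffs_in A" "r = 0 \<or> degree r < degree p"
          and eq: "smult (?c ^ k) q = p * s + r"
          using pseudo_division[OF A p(1) less.prems(1)] by blast
        have "poly (smult (?c ^ k) q) x = poly (p * s + r) x" by (simp only: eq)
        hence ev: "poly r x = ?c ^ k * poly q x" using p(2) by simp
        hence "poly r x \<noteq> 0"
          using nz[of "?c ^ k" "poly q x"] pow_nz[OF c] AB c rg inB less.prems by auto
        hence "degree r < degree p" using r by auto
        then obtain u d where "u \<in> coeffs_in A" "d \<in> A" "d \<noteq> 0" "poly u x * poly r x = d"
          using main[OF r(1) \<open>poly r x \<noteq> 0\<close>] False by auto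
        thus ?thesis using ev c rg cl
          by (intro bexI[of _ "smult (?c ^ k) u"] bexI[of _ d]) (auto simp: mult_ac)
      qed
    qed
    obtain u d where u: "u \<in> coeffs_in A" "d \<in> A" "d \<noteq> 0" "poly u x * b = d"
      using bez[OF pb(1)] b pb by auto
    have "\<exists>\<psi>. is_hom (adjoin A x) \<psi> \<and> (\<forall>c\<in>A. \<psi> c = \<phi> c) \<and> \<psi> b \<noteq> 0"
      if \<phi>: "is_hom A \<phi>" "\<phi> (?c * d) \<noteq> 0" for \<phi> :: "'r \<Rightarrow> 'k"
    proof -
      note hD = is_homD[OF A \<phi>(1)]
      have nzc: "\<phi> ?c \<noteq> 0" and nzd: "\<phi> d \<noteq> 0" using \<phi>(2) hD(4)[OF c(1) u(2)] by auto
      have "coeff (map_poly \<phi> p) (degree p) \<noteq> 0" using nzc hD(1) by (simp add: coeff_map_poly)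
      hence "degree (map_poly \<phi> p) > 0" using dp le_degree[of "map_poly \<phi> p" "degree p"] by simp
      then obtain \<xi> where \<xi>: "poly (map_poly \<phi> p) \<xi> = 0" using alg_closed_imp_poly_has_root by blast
      have root: "poly (map_poly \<phi> q) \<xi> = 0" if q: "q \<in> coeffs_in A" "poly q x = 0" for q
      proof -
        obtain k s r where s: "s \<in> coeffs_in A" and r: "r \<in> coeffs_in A" "r = 0 \<or> degree r < degree p"
          and eq: "smult (?c ^ k) q = p * s + r"
          using pseudo_division[OF A p(1) q(1)] by blast
        have "poly (smult (?c ^ k) q) x = poly (p * s + r) x" by (simp only: eq)
        hence "poly r x = 0" using p(2) q(2) by simp
        hence "r = 0" using min r by blast
        have ck: "?c ^ k \<in> A" using c rg by auto
        have "[:?c ^ k:] * q = p * s" using eq \<open>r = 0\<close> by simp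
        hence "map_poly \<phi> ([:?c ^ k:] * q) = map_poly \<phi> (p * s)" by simp
        hence "map_poly \<phi> [:?c ^ k:] * map_poly \<phi> q = map_poly \<phi> p * map_poly \<phi> s"
          by (simp only: map_poly_hom(2)[OF A \<phi>(1) cl(9)[OF ck] q(1)] map_poly_hom(2)[OF A \<phi>(1) p(1) s])
        hence "poly (map_poly \<phi> [:?c ^ k:]) \<xi> * poly (map_poly \<phi> q) \<xi> = 0"
          using \<xi> by (metis poly_mult mult_zero_left)
        thus ?thesis using nzc hD(1,5) c(1) by (simp add: map_poly_pCons)
      qed
      obtain \<psi> where \<psi>: "is_hom (adjoin A x) \<psi>" "\<forall>a\<in>A. \<psi> a = \<phi> a"
        using hom_extension_root[OF A \<phi>(1) root] by blast
      have "\<psi> (poly u x) * \<psi> b = \<phi> d"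
        using is_homD(4)[OF B \<psi>(1) inB[OF u(1)] b(1)] u \<psi>(2) by simp
      thus ?thesis using nzd \<psi> by auto
    qed
    moreover have "?c * d \<noteq> 0" using nz AB c u by auto
    ultimately show ?thesis using c u rg by (intro bexI[of _ "?c * d"]) auto
  qed
qed

text \<open>Chevalley's extension theorem for a finitely generated extension of domains. It is what
  turns the dominance of a morphism into the existence of points in its image.\<close>

lemma hom_extension:
  fixes xs :: "'r::comm_ring_1 list"
  assumes "unital_subring A"
    and "\<And>b c. b \<in> adjoins A xs \<Longrightarrow> c \<in> adjoins A xs \<Longrightarrow> b * c = 0 \<Longrightarrow> b = 0 \<or> c = 0"
    and "b \<in> adjoins A xs" "b \<noteq> 0"
  shows "\<exists>a\<in>A. a \<noteq> 0 \<and> (\<forall>\<phi>::'r \<Rightarrow> 'k::alg_closed_field. is_hom A \<phi> \<and> \<phi> a \<noteq> 0 \<longrightarrow>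
     (\<exists>\<psi>. is_hom (adjoins A xs) \<psi> \<and> (\<forall>c\<in>A. \<psi> c = \<phi> c) \<and> \<psi> b \<noteq> 0))"
  using assms
proof (induction xs arbitrary: A b)
  case Nil
  thus ?case by auto
next
  case (Cons x xs)
  let ?B = "adjoin A x"
  have B: "unital_subring ?B" by (rule unital_subring_adjoin[OF Cons.prems(1)])
  obtain c where c: "c \<in> ?B" "c \<noteq> 0" and c': "\<forall>\<phi>::'r \<Rightarrow> 'k. is_hom ?B \<phi> \<and> \<phi> c \<noteq> 0 \<longrightarrow>
     (\<exists>\<psi>. is_hom (adjoins ?B xs) \<psi> \<and> (\<forall>d\<in>?B. \<psi> d = \<phi> d) \<and> \<psi> b \<noteq> 0)"
    using Cons.IH[OF B, of b] Cons.prems unfolding adjoins.simps by blast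
  obtain a where a: "a \<in> A" "a \<noteq> 0" and a': "\<forall>\<phi>::'r \<Rightarrow> 'k. is_hom A \<phi> \<and> \<phi> a \<noteq> 0 \<longrightarrow>
     (\<exists>\<psi>. is_hom ?B \<psi> \<and> (\<forall>d\<in>A. \<psi> d = \<phi> d) \<and> \<psi> c \<noteq> 0)"
    using hom_extension_step[OF Cons.prems(1) _ c] Cons.prems(2) adjoins_base[OF B, of _ xs] by auto
  have "\<exists>\<psi>. is_hom (adjoins A (x # xs)) \<psi> \<and> (\<forall>d\<in>A. \<psi> d = \<phi> d) \<and> \<psi> b \<noteq> 0"
    if \<phi>: "is_hom A \<phi> \<and> \<phi> a \<noteq> 0" for \<phi> :: "'r \<Rightarrow> 'k"
  proof -
    obtain \<psi> where \<psi>: "is_hom ?B \<psi>" "\<forall>d\<in>A. \<psi> d = \<phi> d" "\<psi> c \<noteq> 0" using a' \<phi> by blast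
    then obtain \<rho> where "is_hom (adjoins ?B xs) \<rho>" "\<forall>d\<in>?B. \<rho> d = \<psi> d" "\<rho> b \<noteq> 0" using c' by blast
    thus ?thesis using \<psi>(2) adjoin_base[OF Cons.prems(1)] by (intro exI[of _ \<rho>]) auto
  qed
  thus ?case using a by blast
qed

section \<open>Germs and jets of curves\<close>

text \<open>The function \<open>c\<close> is a quotient of polynomials regular at 0, up to its values at the zeros
  of the denominator, and \<open>F\<close> is its Taylor series. The exceptional points are needed because
  functions such as \<open>inverse\<close> are total.\<close>

definition germ :: "('k::field \<Rightarrow> 'k) \<Rightarrow> 'k fps \<Rightarrow> bool" where
  "germ c F \<longleftrightarrow> (\<exists>p q. poly q 0 \<noteq> 0 \<and> (\<forall>s. poly q s \<noteq> 0 \<longrightarrow> c s * poly q s = poly p s) \<and>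
     F * fps_of_poly q = fps_of_poly p)"

lemma germ_poly: "germ (\<lambda>s. poly p s) (fps_of_poly p)"
  unfolding germ_def by (rule exI[of _ p], rule exI[of _ 1]) auto

lemma germ_const: "germ (\<lambda>_. a) (fps_const a)"
  using germ_poly[of "[:a:]"] by (simp add: fps_of_poly_const)

lemma germ_add:
  assumes "germ c F" "germ d G"
  shows "germ (\<lambda>s. c s + d s) (F + G)"
proof -
  obtain p q p' q' where h: "poly q 0 \<noteq> 0" "\<And>s. poly q s \<noteq> 0 \<Longrightarrow> c s * poly q s = poly p s"
    "F * fps_of_poly q = fps_of_poly p" "poly q' 0 \<noteq> 0"
    "\<And>s. poly q' s \<noteq> 0 \<Longrightarrow> d s * poly q' s = poly p' s" "G * fps_of_poly q' = fps_of_poly p'"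
    using assms unfolding germ_def by blast
  have "(c s + d s) * poly (q * q') s = poly (p * q' + p' * q) s" if "poly (q * q') s \<noteq> 0" for s
    using h(2)[of s] h(5)[of s] that by (simp add: algebra_simps)
  moreover have "(F + G) * fps_of_poly (q * q') = fps_of_poly (p * q' + p' * q)"
    unfolding fps_of_poly_mult fps_of_poly_add h(3)[symmetric] h(6)[symmetric]
    by (simp add: algebra_simps)
  ultimately show ?thesis unfolding germ_def using h(1,4)
    by (intro exI[of _ "p * q' + p' * q"] exI[of _ "q * q'"]) auto
qed

lemma germ_mult:
  assumes "germ c F" "germ d G"
  shows "germ (\<lambda>s. c s * d s) (F * G)"
proof -
  obtain p q p' q' where h: "poly q 0 \<noteq> 0" "\<And>s. poly q s \<noteq> 0 \<Longrightarrow> c s * poly q s = poly p s"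
    "F * fps_of_poly q = fps_of_poly p" "poly q' 0 \<noteq> 0"
    "\<And>s. poly q' s \<noteq> 0 \<Longrightarrow> d s * poly q' s = poly p' s" "G * fps_of_poly q' = fps_of_poly p'"
    using assms unfolding germ_def by blast
  have "c s * d s * poly (q * q') s = poly (p * p') s" if "poly (q * q') s \<noteq> 0" for s
    using h(2)[of s, symmetric] h(5)[of s, symmetric] that by (simp add: mult_ac)
  moreover have "F * G * fps_of_poly (q * q') = fps_of_poly (p * p')"
    unfolding fps_of_poly_mult h(3)[symmetric] h(6)[symmetric] by (simp add: mult_ac)
  ultimately show ?thesis unfolding germ_def using h(1,4)
    by (intro exI[of _ "p * p'"] exI[of _ "q * q'"]) auto
qed

lemma germ_nonzero_at_0:
  assumes "poly q 0 \<noteq> 0" "F * fps_of_poly q = fps_of_poly p"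
  shows "poly p 0 = fps_nth F 0 * poly q 0"
  using arg_cong[OF assms(2), of "\<lambda>f. fps_nth f 0"] by (simp add: poly_0_coeff_0)

lemma germ_inverse:
  assumes "germ c F" "fps_nth F 0 \<noteq> 0"
  shows "germ (\<lambda>s. inverse (c s)) (inverse F)"
proof -
  obtain p q where h: "poly q 0 \<noteq> 0" "\<And>s. poly q s \<noteq> 0 \<Longrightarrow> c s * poly q s = poly p s"
    "F * fps_of_poly q = fps_of_poly p" using assms unfolding germ_def by blast
  have p0: "poly p 0 \<noteq> 0" using germ_nonzero_at_0[OF h(1,3)] h(1) assms(2) by simp
  have "inverse (c s) * poly (p * q) s = poly (q * q) s" if "poly (p * q) s \<noteq> 0" for s
    using h(2)[of s, symmetric] that by (auto simp: field_simps)
  moreover have "inverse F * fps_of_poly (p * q) = fps_of_poly (q * q)"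
  proof -
    have "inverse F * fps_of_poly (p * q) = inverse F * F * (fps_of_poly q * fps_of_poly q)"
      unfolding fps_of_poly_mult h(3)[symmetric] by (simp add: mult_ac)
    thus ?thesis using assms(2) by (simp add: inverse_mult_eq_1 fps_of_poly_mult)
  qed
  ultimately show ?thesis unfolding germ_def using h(1) p0
    by (intro exI[of _ "q * q"] exI[of _ "p * q"]) auto
qed

text \<open>A germ is unaffected by changing the function at finitely many nonzero points.\<close>

lemma germ_cong:
  assumes "germ c F" "poly Q 0 \<noteq> 0" "\<And>s. poly Q s \<noteq> 0 \<Longrightarrow> c s = d s"
  shows "germ d F"
proof -
  obtain p q where h: "poly q 0 \<noteq> 0" "\<And>s. poly q s \<noteq> 0 \<Longrightarrow> c s * poly q s = poly p s"
    "F * fps_of_poly q = fps_of_poly p" using assms unfolding germ_def by blast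
  have "d s * poly (q * Q) s = poly (p * Q) s" if "poly (q * Q) s \<noteq> 0" for s
    using h(2)[of s, symmetric] that assms(3)[of s] by simp
  moreover have "F * fps_of_poly (q * Q) = fps_of_poly (p * Q)"
    unfolding fps_of_poly_mult h(3)[symmetric] by (simp add: mult_ac)
  ultimately show ?thesis unfolding germ_def using h(1) assms(2)
    by (intro exI[of _ "p * Q"] exI[of _ "q * Q"]) auto
qed

lemma poly_zero_cofinite:
  fixes p Q :: "'k::alg_closed_field poly"
  assumes "Q \<noteq> 0" "\<And>s. poly Q s \<noteq> 0 \<Longrightarrow> poly p s = 0"
  shows "p = 0"
proof (rule ccontr)
  assume "p \<noteq> 0"
  hence "p * Q \<noteq> 0" using assms(1) by simp
  hence "finite {s. poly (p * Q) s = 0}" by (rule poly_roots_finite)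
  moreover have "{s. poly (p * Q) s = 0} = UNIV" using assms(2) by auto
  ultimately show False using infinite_alg_closed by metis
qed

lemma poly_eq_cofinite:
  fixes p q Q :: "'k::alg_closed_field poly"
  assumes "Q \<noteq> 0" "\<And>s. poly Q s \<noteq> 0 \<Longrightarrow> poly p s = poly q s"
  shows "p = q"
  using poly_zero_cofinite[of Q "p - q"] assms by simp

text \<open>A rational function with infinitely many zeros is zero.\<close>

lemma germ_zero:
  fixes c :: "'k::alg_closed_field \<Rightarrow> 'k"
  assumes "germ c F" "Q \<noteq> 0" "\<And>s. poly Q s \<noteq> 0 \<Longrightarrow> c s = 0"
  shows "F = 0"
proof -
  obtain p q where h: "poly q 0 \<noteq> 0" "\<And>s. poly q s \<noteq> 0 \<Longrightarrow> c s * poly q s = poly p s"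
    "F * fps_of_poly q = fps_of_poly p" using assms unfolding germ_def by blast
  have "q \<noteq> 0" using h(1) by auto
  have "p = 0"
  proof (rule poly_zero_cofinite[of "q * Q"])
    show "poly p s = 0" if "poly (q * Q) s \<noteq> 0" for s using h(2)[of s] assms(3)[of s] that by auto
  qed (use \<open>q \<noteq> 0\<close> assms(2) in auto)
  thus ?thesis using h(3) \<open>q \<noteq> 0\<close> fps_of_poly_eq_iff[of q 0] by auto
qed

lemma germ_uminus: "germ c F \<Longrightarrow> germ (\<lambda>s. - c s) (- F)"
  using germ_mult[OF germ_const[of "-1"], of c F] unfolding fps_const_neg[symmetric] by simp

lemma germ_unique:
  fixes c :: "'k::alg_closed_field \<Rightarrow> 'k"
  assumes "germ c F" "germ c G"
  shows "F = G"
  using germ_zero[OF germ_add[OF assms(1) germ_uminus[OF assms(2)]], of 1] by simp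

text \<open>The curve is \<open>a + d s\<^sup>m\<close> up to higher order. Orders \<open>m > 1\<close> occur because in positive
  characteristic the first nonconstant coefficient of a curve may be of high degree.\<close>

definition scalar_jet :: "('k::field \<Rightarrow> 'k) \<Rightarrow> nat \<Rightarrow> 'k \<Rightarrow> 'k \<Rightarrow> bool" where
  "scalar_jet c m a d \<longleftrightarrow> (\<exists>F. germ c F \<and> fps_nth F 0 = a \<and>
     (\<forall>l. 0 < l \<and> l < m \<longrightarrow> fps_nth F l = 0) \<and> fps_nth F m = d)"

text \<open>The curve \<open>\<gamma>\<close> is \<open>1 + D s\<^sup>m\<close> up to higher order.\<close>

definition matrix_jet :: "('k::field \<Rightarrow> 'k^'n^'n) \<Rightarrow> nat \<Rightarrow> 'k^'n^'n \<Rightarrow> bool" where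
  "matrix_jet \<gamma> m D \<longleftrightarrow> (\<forall>i j. scalar_jet (\<lambda>s. \<gamma> s $ i $ j) m ((mat 1 :: 'k^'n^'n) $ i $ j) (D $ i $ j))"

lemma scalar_jet_const: "m \<ge> 1 \<Longrightarrow> scalar_jet (\<lambda>_. a) m a 0"
  unfolding scalar_jet_def by (intro exI[of _ "fps_const a"]) (auto intro: germ_const)

lemma scalar_jet_add:
  assumes "scalar_jet c m a d" "scalar_jet c' m a' d'"
  shows "scalar_jet (\<lambda>s. c s + c' s) m (a + a') (d + d')"
proof -
  obtain F F' where "germ c F" "germ c' F'" "fps_nth F 0 = a" "fps_nth F' 0 = a'"
    "\<forall>l. 0 < l \<and> l < m \<longrightarrow> fps_nth F l = 0" "\<forall>l. 0 < l \<and> l < m \<longrightarrow> fps_nth F' l = 0"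
    "fps_nth F m = d" "fps_nth F' m = d'"
    using assms unfolding scalar_jet_def by blast
  thus ?thesis unfolding scalar_jet_def by (intro exI[of _ "F + F'"]) (auto intro: germ_add)
qed

lemma fps_mult_low:
  fixes F G :: "'a::comm_ring_1 fps"
  assumes F: "\<forall>l. 0 < l \<and> l < m \<longrightarrow> fps_nth F l = 0" and G: "\<forall>l. 0 < l \<and> l < m \<longrightarrow> fps_nth G l = 0"
  shows "0 < l \<Longrightarrow> l < m \<Longrightarrow> fps_nth (F * G) l = 0"
    "m \<ge> 1 \<Longrightarrow> fps_nth (F * G) m = fps_nth F 0 * fps_nth G m + fps_nth F m * fps_nth G 0"
proof -
  show "fps_nth (F * G) l = 0" if l: "0 < l" "l < m"
    unfolding fps_mult_nth
  proof (intro sum.neutral ballI)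
    fix i assume "i \<in> {0..l}"
    thus "fps_nth F i * fps_nth G (l - i) = 0" using F G l by (cases "i = 0") auto
  qed
  show "fps_nth (F * G) m = fps_nth F 0 * fps_nth G m + fps_nth F m * fps_nth G 0" if m: "m \<ge> 1"
  proof -
    have "fps_nth (F * G) m = (\<Sum>i\<in>{0, m}. fps_nth F i * fps_nth G (m - i))"
      unfolding fps_mult_nth using F by (intro sum.mono_neutral_right) auto
    thus ?thesis using m by auto
  qed
qed

lemma scalar_jet_mult:
  assumes "m \<ge> 1" "scalar_jet c m a d" "scalar_jet c' m a' d'"
  shows "scalar_jet (\<lambda>s. c s * c' s) m (a * a') (a * d' + d * a')"
proof -
  obtain F F' where F: "germ c F" "germ c' F'" "fps_nth F 0 = a" "fps_nth F' 0 = a'"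
    "\<forall>l. 0 < l \<and> l < m \<longrightarrow> fps_nth F l = 0" "\<forall>l. 0 < l \<and> l < m \<longrightarrow> fps_nth F' l = 0"
    "fps_nth F m = d" "fps_nth F' m = d'"
    using assms unfolding scalar_jet_def by blast
  thus ?thesis unfolding scalar_jet_def
    using fps_mult_low[OF F(5,6)] assms(1)
    by (intro exI[of _ "F * F'"]) (auto intro: germ_mult)
qed

lemma scalar_jet_sum:
  assumes "m \<ge> 1" "\<And>i. i \<in> I \<Longrightarrow> scalar_jet (c i) m (a i) (d i)"
  shows "scalar_jet (\<lambda>s. \<Sum>i\<in>I. c i s) m (\<Sum>i\<in>I. a i) (\<Sum>i\<in>I. d i)"
  using assms(2)
  by (induction I rule: infinite_finite_induct)
    (auto intro: scalar_jet_const[OF assms(1)] scalar_jet_add)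

lemma scalar_jet_inverse:
  assumes "scalar_jet c 1 a d" "a \<noteq> 0"
  shows "scalar_jet (\<lambda>s. inverse (c s)) 1 (inverse a) (- d / a\<^sup>2)"
proof -
  obtain F where F: "germ c F" "fps_nth F 0 = a" "fps_nth F 1 = d"
    using assms unfolding scalar_jet_def by blast
  have "F * inverse F = 1" using F assms(2) by (simp add: inverse_mult_eq_1')
  hence "fps_nth (F * inverse F) 0 = 1" "fps_nth (F * inverse F) 1 = 0" by simp_all
  hence 1: "fps_nth (inverse F) 0 = inverse a"
    and 2: "a * fps_nth (inverse F) 1 + d * fps_nth (inverse F) 0 = 0"
    using F fps_mult_low(2)[of 1 F "inverse F"] assms(2) by (auto simp: field_simps)
  have "fps_nth (inverse F) 1 = - d / a\<^sup>2"
    using 1 2 assms(2) by (simp add: field_simps power2_eq_square add_eq_0_iff)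
  thus ?thesis unfolding scalar_jet_def using germ_inverse[OF F(1)] F(2) assms(2) 1
    by (intro exI[of _ "inverse F"]) auto
qed

lemma scalar_jet_unique:
  fixes c :: "'k::alg_closed_field \<Rightarrow> 'k"
  assumes "scalar_jet c m a d" "scalar_jet c m a' d'"
  shows "a = a'" "d = d'"
  using assms germ_unique unfolding scalar_jet_def by blast+

lemma scalar_jet_cong:
  assumes "scalar_jet c m a d" "poly Q 0 \<noteq> 0" "\<And>s. poly Q s \<noteq> 0 \<Longrightarrow> c s = c' s"
  shows "scalar_jet c' m a d"
proof -
  obtain F where F: "germ c F" "fps_nth F 0 = a" "\<forall>l. 0 < l \<and> l < m \<longrightarrow> fps_nth F l = 0" "fps_nth F m = d"
    using assms(1) unfolding scalar_jet_def by blast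
  show ?thesis unfolding scalar_jet_def using germ_cong[OF F(1) assms(2,3)] F(2-) by blast
qed

lemma scalar_jet_poly: "scalar_jet (\<lambda>s. poly p s) 1 (coeff p 0) (coeff p 1)"
  unfolding scalar_jet_def by (intro exI[of _ "fps_of_poly p"]) (auto intro: germ_poly)

text \<open>At the identity the product rule becomes additivity.\<close>

lemma matrix_jet_mult:
  fixes \<gamma> \<delta> :: "'k::field \<Rightarrow> 'k^'n^'n"
  assumes "m \<ge> 1" "matrix_jet \<gamma> m D" "matrix_jet \<delta> m E"
  shows "matrix_jet (\<lambda>s. \<gamma> s ** \<delta> s) m (D + E)"
  unfolding matrix_jet_def
proof (intro allI)
  fix i j
  let ?I = "mat 1 :: 'k^'n^'n"
  have "scalar_jet (\<lambda>s. \<Sum>k\<in>UNIV. \<gamma> s $ i $ k * \<delta> s $ k $ j) m (\<Sum>k\<in>UNIV. ?I $ i $ k * ?I $ k $ j)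
      (\<Sum>k\<in>UNIV. ?I $ i $ k * E $ k $ j + D $ i $ k * ?I $ k $ j)"
    using assms by (intro scalar_jet_sum scalar_jet_mult) (auto simp: matrix_jet_def)
  moreover have "(\<Sum>k\<in>UNIV. ?I $ i $ k * ?I $ k $ j) = (?I ** ?I) $ i $ j"
    by (simp only: matrix_matrix_mult_def vec_lambda_beta)
  hence "(\<Sum>k\<in>UNIV. ?I $ i $ k * ?I $ k $ j) = ?I $ i $ j" by (simp only: matrix_mul_lid)
  moreover have "(\<Sum>k\<in>UNIV. ?I $ i $ k * E $ k $ j + D $ i $ k * ?I $ k $ j) = (?I ** E + D ** ?I) $ i $ j"
    by (simp only: matrix_matrix_mult_def sum.distrib vec_lambda_beta vector_add_component)
  hence "(\<Sum>k\<in>UNIV. ?I $ i $ k * E $ k $ j + D $ i $ k * ?I $ k $ j) = (D + E) $ i $ j"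
    by (simp add: add.commute)
  moreover have "(\<lambda>s. (\<gamma> s ** \<delta> s) $ i $ j) = (\<lambda>s. \<Sum>k\<in>UNIV. \<gamma> s $ i $ k * \<delta> s $ k $ j)"
    by (simp add: matrix_matrix_mult_def)
  ultimately show "scalar_jet (\<lambda>s. (\<gamma> s ** \<delta> s) $ i $ j) m (?I $ i $ j) ((D + E) $ i $ j)"
    using \<open>(\<Sum>k\<in>UNIV. ?I $ i $ k * ?I $ k $ j) = ?I $ i $ j\<close> by simp
qed

lemma matrix_jet_one: "m \<ge> 1 \<Longrightarrow> matrix_jet (\<lambda>_. mat 1) m 0"
  by (auto simp: matrix_jet_def intro: scalar_jet_const)

lemma scale_nth: "(mat s ** X) $ i $ j = s * X $ i $ j"
  by (simp add: matrix_matrix_mult_def mat_def if_distrib[of "\<lambda>x. x * _"] cong: if_cong)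

lemma matrix_jet_line:
  fixes X :: "'k::field^'n^'n"
  shows "matrix_jet (\<lambda>s. mat 1 + mat s ** X) 1 X"
  unfolding matrix_jet_def
proof (intro allI)
  fix i j
  show "scalar_jet (\<lambda>s. (mat 1 + mat s ** X) $ i $ j) 1 ((mat 1 :: 'k^'n^'n) $ i $ j) (X $ i $ j)"
    using scalar_jet_poly[of "[:(mat 1 :: 'k^'n^'n) $ i $ j, X $ i $ j:]"]
    by (simp add: scale_nth mult.commute)
qed

section \<open>Gradients and the Lie algebra\<close>

definition pairing :: "'k::field^'n^'n \<Rightarrow> 'k^'n^'n \<Rightarrow> 'k" where
  "pairing c X = (\<Sum>i\<in>UNIV. \<Sum>j\<in>UNIV. c $ i $ j * X $ i $ j)"

lemma pairing_add: "pairing (c + d) X = pairing c X + pairing d X"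
  "pairing c (X + Y) = pairing c X + pairing c Y"
  by (simp_all add: pairing_def sum.distrib distrib_left distrib_right)

lemma pairing_scale: "pairing (mat a ** c) X = a * pairing c X"
  "pairing c (mat a ** X) = a * pairing c X"
  by (simp_all add: pairing_def scale_nth sum_distrib_left mult_ac)

lemma pairing_0 [simp]: "pairing 0 X = 0" "pairing c 0 = 0"
  by (simp_all add: pairing_def)

lemma pairing_sum: "pairing c (sum X I) = (\<Sum>i\<in>I. pairing c (X i))"
  by (induction I rule: infinite_finite_induct) (auto simp: pairing_add)

lemma pairing_sum_left: "pairing (sum c I) X = (\<Sum>i\<in>I. pairing (c i) X)"
  by (induction I rule: infinite_finite_induct) (auto simp: pairing_add)

definition unit_matrix :: "'n \<Rightarrow> 'n \<Rightarrow> 'k::field^'n^'n" where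
  "unit_matrix a b = (\<chi> i j. if i = a \<and> j = b then 1 else 0)"

lemma pairing_unit: "pairing (unit_matrix a b) X = X $ a $ b" "pairing c (unit_matrix a b) = c $ a $ b"
proof -
  have "pairing (unit_matrix a b) X = (\<Sum>i\<in>UNIV. if i = a then (\<Sum>j\<in>UNIV. if j = b then X $ i $ j else 0) else 0)"
    unfolding pairing_def unit_matrix_def by (intro sum.cong refl) (auto simp: if_distrib[of "\<lambda>x. x * _"] cong: if_cong)
  thus "pairing (unit_matrix a b) X = X $ a $ b" by (simp add: if_distrib[of "\<lambda>x. x * _"] cong: if_cong)
  have "pairing c (unit_matrix a b) = (\<Sum>i\<in>UNIV. if i = a then (\<Sum>j\<in>UNIV. if j = b then c $ i $ j else 0) else 0)"
    unfolding pairing_def unit_matrix_def by (intro sum.cong refl) (auto simp: if_distrib[of "\<lambda>x. _ * x"] cong: if_cong)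
  thus "pairing c (unit_matrix a b) = c $ a $ b" by (simp add: if_distrib[of "\<lambda>x. _ * x"] cong: if_cong)
qed

text \<open>Differentiation is expressed by its effect on curves, of any order of contact, since
  curves are the only objects along which functions are expanded.\<close>

definition has_gradient :: "('k::field^'n^'n \<Rightarrow> 'k) \<Rightarrow> 'k^'n^'n \<Rightarrow> bool" where
  "has_gradient f c \<longleftrightarrow> (\<forall>\<gamma> m D. m \<ge> 1 \<longrightarrow> matrix_jet \<gamma> m D \<longrightarrow>
     scalar_jet (\<lambda>s. f (\<gamma> s)) m (f (mat 1)) (pairing c D))"

lemma has_gradientD:
  "has_gradient f c \<Longrightarrow> m \<ge> 1 \<Longrightarrow> matrix_jet \<gamma> m D \<Longrightarrow>
    scalar_jet (\<lambda>s. f (\<gamma> s)) m (f (mat 1)) (pairing c D)"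
  by (simp add: has_gradient_def)

lemma has_gradient_const: "has_gradient (\<lambda>_. a) 0"
  by (auto simp: has_gradient_def intro: scalar_jet_const)

lemma has_gradient_entry: "has_gradient (\<lambda>A. A $ i $ j) (unit_matrix i j)"
  by (auto simp: has_gradient_def matrix_jet_def pairing_unit)

lemma has_gradient_add:
  "has_gradient f c \<Longrightarrow> has_gradient g d \<Longrightarrow> has_gradient (\<lambda>A. f A + g A) (c + d)"
  by (auto simp: has_gradient_def pairing_add intro: scalar_jet_add)

lemma has_gradient_mult:
  assumes "has_gradient f c" "has_gradient g d"
  shows "has_gradient (\<lambda>A. f A * g A) (mat (f (mat 1)) ** d + mat (g (mat 1)) ** c)"
  unfolding has_gradient_def pairing_add pairing_scale
proof (intro allI impI)
  fix \<gamma> :: "'a \<Rightarrow> 'a^'b^'b" and m :: nat and D assume "m \<ge> 1" "matrix_jet \<gamma> m D"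
  with assms show "scalar_jet (\<lambda>s. f (\<gamma> s) * g (\<gamma> s)) m (f (mat 1) * g (mat 1))
      (f (mat 1) * pairing d D + g (mat 1) * pairing c D)"
    using scalar_jet_mult[of m "\<lambda>s. f (\<gamma> s)" "f (mat 1)" "pairing c D" "\<lambda>s. g (\<gamma> s)" "g (mat 1)" "pairing d D"]
    by (simp add: has_gradient_def mult.commute)
qed

lemma has_gradient_exists: "f \<in> matrix_polys \<Longrightarrow> \<exists>c. has_gradient f c"
  unfolding matrix_polys_def
proof (induction rule: func_alg.induct)
  case (gen f)
  thus ?case unfolding entry_funs_def using has_gradient_entry by blast
qed (blast intro: has_gradient_const has_gradient_add has_gradient_mult)+

lemma has_gradient_unique:
  fixes f :: "'k::alg_closed_field^'n^'n \<Rightarrow> 'k"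
  assumes "has_gradient f c" "has_gradient f d"
  shows "c = d"
proof -
  have "pairing c X = pairing d X" for X
    using scalar_jet_unique(2)[OF has_gradientD[OF assms(1) _ matrix_jet_line[of X]]
      has_gradientD[OF assms(2) _ matrix_jet_line[of X]]] by simp
  from this[of "unit_matrix _ _"] show ?thesis unfolding pairing_unit by (simp add: vec_eq_iff)
qed

lemma matrix_polys_closed:
  fixes f g :: "'a::field^'b^'b \<Rightarrow> 'a" and h :: "'i \<Rightarrow> 'a^'b^'b \<Rightarrow> 'a"
  shows "(\<lambda>_::'a^'b^'b. c) \<in> matrix_polys" "(\<lambda>A::'a^'b^'b. A $ i $ j) \<in> matrix_polys"
  "f \<in> matrix_polys \<Longrightarrow> g \<in> matrix_polys \<Longrightarrow> (\<lambda>A. f A + g A) \<in> matrix_polys"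
  "f \<in> matrix_polys \<Longrightarrow> g \<in> matrix_polys \<Longrightarrow> (\<lambda>A. f A * g A) \<in> matrix_polys"
  "(\<And>k. k \<in> I \<Longrightarrow> h k \<in> matrix_polys) \<Longrightarrow> (\<lambda>A. \<Sum>k\<in>I. h k A) \<in> matrix_polys"
proof -
  show 1: "(\<lambda>_::'a^'b^'b. c) \<in> matrix_polys" for c :: 'a unfolding matrix_polys_def by (rule func_alg.const)
  show "(\<lambda>A::'a^'b^'b. A $ i $ j) \<in> matrix_polys" unfolding matrix_polys_def
    by (rule func_alg.gen) (auto simp: entry_funs_def)
  show 3: "(\<lambda>A. f A + g A) \<in> matrix_polys" if "f \<in> matrix_polys" "g \<in> matrix_polys" for f g :: "'a^'b^'b \<Rightarrow> 'a"
    using that unfolding matrix_polys_def by (rule func_alg.add)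
  show "f \<in> matrix_polys \<Longrightarrow> g \<in> matrix_polys \<Longrightarrow> (\<lambda>A. f A * g A) \<in> matrix_polys"
    unfolding matrix_polys_def by (rule func_alg.mult)
  show "(\<And>k. k \<in> I \<Longrightarrow> h k \<in> matrix_polys) \<Longrightarrow> (\<lambda>A. \<Sum>k\<in>I. h k A) \<in> matrix_polys"
    by (induction I rule: infinite_finite_induct) (auto intro: 1 3)
qed

lemma matrix_polys_substitute:
  assumes f: "f \<in> matrix_polys" and \<phi>: "\<And>i j. (\<lambda>A. \<phi> A $ i $ j) \<in> matrix_polys"
  shows "(\<lambda>A. f (\<phi> A)) \<in> matrix_polys"
  using f[unfolded matrix_polys_def]
proof (induction rule: func_alg.induct)
  case (gen f)
  thus ?case using \<phi> by (auto simp: entry_funs_def)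
qed (auto intro: matrix_polys_closed)

lemma matrix_polys_mult_arg:
  "f \<in> matrix_polys \<Longrightarrow> (\<lambda>A. f (M ** A ** N)) \<in> matrix_polys"
  by (rule matrix_polys_substitute)
    (auto simp: matrix_matrix_mult_def sum_distrib_right intro!: matrix_polys_closed)

lemma matrix_polys_line:
  assumes "f \<in> matrix_polys"
  shows "\<exists>p. \<forall>s. f (mat 1 + mat s ** X) = poly p s"
  using assms[unfolded matrix_polys_def]
proof (induction rule: func_alg.induct)
  case (const c)
  show ?case by (rule exI[of _ "[:c:]"]) simp
next
  case (gen f)
  then obtain i j where f: "f = (\<lambda>A. A $ i $ j)" by (auto simp: entry_funs_def)
  show ?case by (rule exI[of _ "[:(mat 1 :: 'a^'b^'b) $ i $ j, X $ i $ j:]"]) (simp add: f scale_nth)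
next
  case (add f g)
  then obtain p q where "\<forall>s. f (mat 1 + mat s ** X) = poly p s" "\<forall>s. g (mat 1 + mat s ** X) = poly q s"
    by blast
  thus ?case by (intro exI[of _ "p + q"]) simp
next
  case (mult f g)
  then obtain p q where "\<forall>s. f (mat 1 + mat s ** X) = poly p s" "\<forall>s. g (mat 1 + mat s ** X) = poly q s"
    by blast
  thus ?case by (intro exI[of _ "p * q"]) simp
qed

definition conormal :: "('k::field^'n^'n) set \<Rightarrow> ('k^'n^'n) set" where
  "conormal G = {c. \<exists>f\<in>matrix_polys. (\<forall>A\<in>G. f A = 0) \<and> has_gradient f c}"

text \<open>The linear coefficient of \<open>f (1 + s X)\<close> is the derivative of \<open>f\<close> along the line through 1
  in the direction \<open>X\<close>, hence the pairing of the gradient with \<open>X\<close>.\<close>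

lemma lie_algebra_eq:
  fixes G :: "('k::alg_closed_field^'n^'n) set"
  shows "lie_algebra G = {X. \<forall>c\<in>conormal G. pairing c X = 0}"
proof -
  have key: "(\<exists>p. (\<forall>s. f (mat 1 + mat s ** X) = poly p s) \<and> coeff p 1 = 0) \<longleftrightarrow> pairing c X = 0"
    if f: "f \<in> matrix_polys" "has_gradient f c" for f c and X :: "'k^'n^'n"
  proof -
    have jet: "scalar_jet (\<lambda>s. f (mat 1 + mat s ** X)) 1 (f (mat 1)) (pairing c X)"
      by (rule has_gradientD[OF f(2) _ matrix_jet_line]) simp
    have "coeff p 1 = pairing c X" if "\<forall>s. f (mat 1 + mat s ** X) = poly p s" for p
      using scalar_jet_unique(2)[OF jet] scalar_jet_poly[of p] that by simp
    thus ?thesis using matrix_polys_line[OF f(1), of X] by metis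
  qed
  show ?thesis
    unfolding lie_algebra_def conormal_def using key has_gradient_exists by blast
qed

lemma conormal_closed:
  shows "c \<in> conormal G \<Longrightarrow> d \<in> conormal G \<Longrightarrow> c + d \<in> conormal G"
    "c \<in> conormal G \<Longrightarrow> mat a ** c \<in> conormal G" "0 \<in> conormal G"
proof -
  assume "c \<in> conormal G" "d \<in> conormal G"
  then obtain f g where "f \<in> matrix_polys" "\<forall>A\<in>G. f A = 0" "has_gradient f c"
    "g \<in> matrix_polys" "\<forall>A\<in>G. g A = 0" "has_gradient g d" by (auto simp: conormal_def)
  thus "c + d \<in> conormal G" unfolding conormal_def
    using matrix_polys_closed(3)[of f g] has_gradient_add[of f c g d]
    by (auto intro!: bexI[of _ "\<lambda>A. f A + g A"])
next
  assume "c \<in> conormal G"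
  then obtain f where "f \<in> matrix_polys" "\<forall>A\<in>G. f A = 0" "has_gradient f c" by (auto simp: conormal_def)
  thus "mat a ** c \<in> conormal G" unfolding conormal_def
    using matrix_polys_closed(4)[of "\<lambda>_. a" f] has_gradient_mult[of "\<lambda>_. a" 0 f c] has_gradient_const[of a]
    by (auto intro!: bexI[of _ "\<lambda>A. a * f A"] matrix_polys_closed)
next
  show "0 \<in> conormal G" unfolding conormal_def
    using has_gradient_const[of 0] by (auto intro!: bexI[of _ "\<lambda>_. 0"] matrix_polys_closed)
qed

text \<open>Every linear form on matrices is a pairing. Matrices are flattened to vectors because the
  bases and extensions of linear maps used here are those of the vector space of columns.\<close>

lemma separating_functional:
  fixes S :: "('k::field^'n^'n) set"
  assumes add: "\<And>x y. x \<in> S \<Longrightarrow> y \<in> S \<Longrightarrow> x + y \<in> S" and scale: "\<And>a x. x \<in> S \<Longrightarrow> mat a ** x \<in> S"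
    and zero: "0 \<in> S" and c: "c \<notin> S"
  shows "\<exists>X. (\<forall>s\<in>S. pairing s X = 0) \<and> pairing c X = 1"
proof -
  define fl :: "'k^'n^'n \<Rightarrow> 'k^('n \<times> 'n)" where "fl M = (\<chi> p. M $ fst p $ snd p)" for M
  have fl_inj: "fl M = fl N \<longleftrightarrow> M = N" for M N by (auto simp: fl_def vec_eq_iff)
  have fl_add: "fl (M + N) = fl M + fl N" and fl_scale: "fl (mat a ** M) = a *s fl M"
    and fl_0: "fl 0 = 0" for M N a
    by (auto simp: fl_def vec_eq_iff scale_nth)
  have sub: "vec.subspace (fl ` S)"
    unfolding vec.subspace_def using add scale zero
    by (auto simp: fl_0[symmetric] fl_add[symmetric] fl_scale[symmetric])
  have c': "fl c \<notin> fl ` S" using c by (auto simp: fl_inj)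
  obtain B where B: "B \<subseteq> fl ` S" "vec.independent B" "fl ` S \<subseteq> vec.span B"
    using vec.maximal_independent_subset by blast
  have sp: "vec.span B = fl ` S"
    using B sub by (metis subset_antisym vec.span_minimal)
  hence ind: "vec.independent (insert (fl c) B)"
    using B c' by (simp add: vec.independent_insert)
  define v :: "'k^1" where "v = (\<chi> _. 1)"
  obtain g :: "'k^('n \<times> 'n) \<Rightarrow> 'k^1" where g: "Vector_Spaces.linear (*s) (*s) g"
    "\<forall>x\<in>insert (fl c) B. g x = (if x = fl c then v else 0)"
    using vec.linear_independent_extend[OF ind, of "\<lambda>x. if x = fl c then v else 0"] by blast
  interpret g: Vector_Spaces.linear "(*s)" "(*s)" g by (rule g(1))
  have gB: "g x = 0" if "x \<in> vec.span B" for x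
    using that
  proof (induction rule: vec.span_induct_alt)
    case (step a x y)
    have "x \<noteq> fl c" using step B c' by auto
    thus ?case using step g(2) by (simp add: g.add g.scale)
  qed (simp add: g.zero)
  define X :: "'k^'n^'n" where "X = (\<chi> i j. g (axis (i, j) 1) $ 1)"
  have pair: "pairing M X = g (fl M) $ 1" for M
  proof -
    have "fl M = (\<Sum>p\<in>UNIV. (M $ fst p $ snd p) *s axis p 1)"
      by (simp add: fl_def vec_eq_iff axis_def if_distrib[of "\<lambda>x. _ * x"] cong: if_cong)
    hence "g (fl M) $ 1 = (\<Sum>p\<in>UNIV. (M $ fst p $ snd p) * g (axis p 1) $ 1)"
      by (simp add: g.sum g.scale)
    also have "\<dots> = (\<Sum>(i, j)\<in>UNIV \<times> UNIV. M $ i $ j * g (axis (i, j) 1) $ 1)"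
      by (simp add: case_prod_beta)
    also have "\<dots> = pairing M X"
      unfolding pairing_def X_def by (simp add: sum.cartesian_product)
    finally show ?thesis by simp
  qed
  show ?thesis
  proof (intro exI[of _ X] conjI ballI)
    fix s assume "s \<in> S"
    thus "pairing s X = 0" using gB sp pair by simp
  next
    show "pairing c X = 1" using pair g(2) by (simp add: v_def)
  qed
qed

text \<open>The double annihilator of a subspace is the subspace: linear forms vanishing on the Lie
  algebra are differentials of functions vanishing on the group.\<close>

lemma conormal_of_lie_algebra:
  fixes G :: "('k::alg_closed_field^'n^'n) set"
  assumes "\<And>X. X \<in> lie_algebra G \<Longrightarrow> pairing c X = 0"
  shows "c \<in> conormal G"
proof (rule ccontr)
  assume "c \<notin> conormal G"
  then obtain X where "\<forall>s\<in>conormal G. pairing s X = 0" "pairing c X = 1"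
    using separating_functional[of "conormal G" c] conormal_closed by metis
  thus False using assms[of X] by (auto simp: lie_algebra_eq)
qed

lemma combination_functional:
  fixes E :: "'i \<Rightarrow> 'k::field^'n^'n"
  assumes K: "finite K" and X: "\<nexists>a. X = (\<Sum>k\<in>K. mat (a k) ** E k)"
  shows "\<exists>d. (\<forall>k\<in>K. pairing d (E k) = 0) \<and> pairing d X = 1"
proof -
  define S where "S = range (\<lambda>a. \<Sum>k\<in>K. mat (a k) ** E k)"
  have "\<exists>d. (\<forall>s\<in>S. pairing s d = 0) \<and> pairing X d = 1"
  proof (rule separating_functional)
    show "X \<notin> S" using X by (auto simp: S_def)
    show "0 \<in> S" unfolding S_def by (intro image_eqI[of _ _ "\<lambda>_. 0"]) auto
    fix x assume "x \<in> S"
    then obtain a where a: "x = (\<Sum>k\<in>K. mat (a k) ** E k)" by (auto simp: S_def)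
    have "mat t ** x = (\<Sum>k\<in>K. mat (t * a k) ** E k)" for t
      by (simp add: a vec_eq_iff scale_nth sum_distrib_left mult.assoc)
    thus "mat t ** x \<in> S" for t unfolding S_def by (intro image_eqI[of _ _ "\<lambda>k. t * a k"]) auto
    fix y assume "y \<in> S"
    then obtain b where b: "y = (\<Sum>k\<in>K. mat (b k) ** E k)" by (auto simp: S_def)
    have "x + y = (\<Sum>k\<in>K. mat (a k + b k) ** E k)"
      by (simp add: a b vec_eq_iff scale_nth sum.distrib distrib_right)
    thus "x + y \<in> S" unfolding S_def by (intro image_eqI[of _ _ "\<lambda>k. a k + b k"]) auto
  qed
  then obtain d where d: "\<forall>s\<in>S. pairing s d = 0" "pairing X d = 1" by blast
  have "E k \<in> S" if "k \<in> K" for k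
  proof -
    have "E k = (\<Sum>l\<in>K. mat (if l = k then 1 else 0) ** E l)"
      using that K by (simp add: vec_eq_iff scale_nth if_distrib[of "\<lambda>x. x * _"] cong: if_cong)
    thus ?thesis unfolding S_def by (intro image_eqI[of _ _ "\<lambda>l. if l = k then 1 else 0"]) auto
  qed
  moreover have "pairing d Y = pairing Y d" for Y by (simp add: pairing_def mult.commute)
  ultimately show ?thesis using d by metis
qed

section \<open>Matrix groups\<close>

text \<open>Groups that need not be closed, such as the group generated by root groups before it is
  known to be everything, also occur.\<close>

definition matrix_subgroup :: "('k::field^'n^'n) set \<Rightarrow> bool" where
  "matrix_subgroup G \<longleftrightarrow> mat 1 \<in> G \<and> (\<forall>A\<in>G. \<forall>B\<in>G. A ** B \<in> G) \<and>
     (\<forall>A\<in>G. invertible A \<and> matrix_inv A \<in> G)"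

lemma matrix_inv_props:
  assumes "invertible (A :: 'k::field^'n^'n)"
  shows "A ** matrix_inv A = mat 1" "matrix_inv A ** A = mat 1"
  using assms unfolding invertible_def matrix_inv_def by (metis (mono_tags, lifting) someI_ex)+

lemma matrix_inv_unique:
  fixes A B :: "'k::field^'n^'n"
  assumes "A ** B = mat 1"
  shows "matrix_inv A = B" "matrix_inv B = A" "invertible A" "B ** A = mat 1"
proof -
  show BA: "B ** A = mat 1" using assms matrix_left_right_inverse by blast
  show inv: "invertible A" using assms BA unfolding invertible_def by blast
  have inv': "invertible B" using assms BA unfolding invertible_def by blast
  show "matrix_inv A = B"
    by (metis assms inv matrix_inv_props(2) matrix_mul_assoc matrix_mul_lid matrix_mul_rid)
  show "matrix_inv B = A"
    by (metis BA inv' matrix_inv_props(2) matrix_mul_assoc matrix_mul_lid matrix_mul_rid)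
qed

lemma matrix_subgroupD:
  assumes "matrix_subgroup G"
  shows "mat 1 \<in> G" "A \<in> G \<Longrightarrow> B \<in> G \<Longrightarrow> A ** B \<in> G" "A \<in> G \<Longrightarrow> matrix_inv A \<in> G"
    "A \<in> G \<Longrightarrow> A ** matrix_inv A = mat 1" "A \<in> G \<Longrightarrow> matrix_inv A ** A = mat 1"
    "A \<in> G \<Longrightarrow> invertible A"
  using assms matrix_inv_props unfolding matrix_subgroup_def by blast+

lemma m_inv_matrix_group:
  fixes A :: "'k::field^'n^'n"
  assumes "A \<in> S" "matrix_inv A \<in> S" "invertible A"
  shows "inv\<^bsub>matrix_group S\<^esub> A = matrix_inv A"
  unfolding m_inv_def
proof (rule the_equality)
  show "matrix_inv A \<in> carrier (matrix_group S) \<and> A \<otimes>\<^bsub>matrix_group S\<^esub> matrix_inv A = \<one>\<^bsub>matrix_group S\<^esub> \<and>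
    matrix_inv A \<otimes>\<^bsub>matrix_group S\<^esub> A = \<one>\<^bsub>matrix_group S\<^esub>"
    using assms matrix_inv_props[OF assms(3)] by (simp add: matrix_group_def)
  fix y assume "y \<in> carrier (matrix_group S) \<and> A \<otimes>\<^bsub>matrix_group S\<^esub> y = \<one>\<^bsub>matrix_group S\<^esub> \<and>
    y \<otimes>\<^bsub>matrix_group S\<^esub> A = \<one>\<^bsub>matrix_group S\<^esub>"
  hence "A ** y = mat 1" by (simp add: matrix_group_def)
  thus "y = matrix_inv A" using matrix_inv_unique(1) by metis
qed

lemma algebraic_group_matrix_subgroup:
  fixes G :: "('k::field^'n^'n) set"
  assumes "algebraic_group G"
  shows "matrix_subgroup G" "zariski_closed G"
proof -
  let ?GL = "{A :: 'k^'n^'n. invertible A}"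
  show "zariski_closed G" using assms by (simp add: algebraic_group_def)
  have sub: "subgroup G (matrix_group ?GL)" using assms by (simp add: algebraic_group_def)
  have inv: "invertible A" if "A \<in> G" for A using subgroup.subset[OF sub] that
    by (auto simp: matrix_group_def)
  have "matrix_inv A \<in> G" if A: "A \<in> G" for A
  proof -
    have "invertible (matrix_inv A)"
      using matrix_inv_unique(3)[OF matrix_inv_props(2)[OF inv[OF A]]] .
    hence "inv\<^bsub>matrix_group ?GL\<^esub> A = matrix_inv A"
      using inv[OF A] by (intro m_inv_matrix_group) auto
    thus ?thesis using subgroup.m_inv_closed[OF sub A] by simp
  qed
  thus "matrix_subgroup G" unfolding matrix_subgroup_def
    using subgroup.one_closed[OF sub] subgroup.m_closed[OF sub] inv
    by (auto simp: matrix_group_def)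
qed

section \<open>The coordinate ring and the powers of a maximal ideal\<close>

text \<open>The factor \<open>v\<close> in the derivative is the chain rule for the substitution of \<open>s v\<close> for \<open>s\<close>.
  The same \<open>d\<close> serves all \<open>v\<close>, so the product of the curves can be expanded along every line
  through the origin of the parameter space.\<close>

lemma scalar_jet_of_reparametrised:
  fixes f :: "'k::field \<Rightarrow> 'k"
  assumes "f \<in> func_alg {\<lambda>s. s, \<lambda>s. inverse (1 + s)}"
  shows "\<exists>d. \<forall>v. scalar_jet (\<lambda>s. f (s * v)) 1 (f 0) (v * d)"
  using assms
proof (induction rule: func_alg.induct)
  case (const c)
  show ?case by (rule exI[of _ 0]) (auto intro: scalar_jet_const)
next
  case (gen f)
  have 1: "scalar_jet (\<lambda>s. s * v) 1 0 v" for v :: 'k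
    using scalar_jet_poly[of "[:0, v:]"] by simp
  have "scalar_jet (\<lambda>s. 1 + s * v) 1 1 v" for v :: 'k
    using scalar_jet_poly[of "[:1, v:]"] by simp
  hence 2: "scalar_jet (\<lambda>s. inverse (1 + s * v)) 1 1 (- v)" for v :: 'k
    using scalar_jet_inverse[of "\<lambda>s. 1 + s * v" 1 v] by simp
  from gen consider "f = (\<lambda>s. s)" | "f = (\<lambda>s. inverse (1 + s))" by auto
  thus ?case
  proof cases
    case 1
    thus ?thesis using \<open>\<And>v. scalar_jet (\<lambda>s. s * v) 1 0 v\<close> by (intro exI[of _ 1]) simp
  next
    case 2
    thus ?thesis using \<open>\<And>v. scalar_jet (\<lambda>s. inverse (1 + s * v)) 1 1 (- v)\<close>
      by (intro exI[of _ "- 1"]) simp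
  qed
next
  case (add f g)
  then obtain d e where "\<forall>v. scalar_jet (\<lambda>s. f (s * v)) 1 (f 0) (v * d)"
    "\<forall>v. scalar_jet (\<lambda>s. g (s * v)) 1 (g 0) (v * e)" by blast
  thus ?case using scalar_jet_add[of "\<lambda>s. f (s * _)" 1 _ _ "\<lambda>s. g (s * _)"]
    by (intro exI[of _ "d + e"]) (simp add: distrib_left)
next
  case (mult f g)
  then obtain d e where de: "\<forall>v. scalar_jet (\<lambda>s. f (s * v)) 1 (f 0) (v * d)"
    "\<forall>v. scalar_jet (\<lambda>s. g (s * v)) 1 (g 0) (v * e)" by blast
  have "scalar_jet (\<lambda>s. f (s * v) * g (s * v)) 1 (f 0 * g 0) (v * (f 0 * e + d * g 0))" for v
    using scalar_jet_mult[of 1 "\<lambda>s. f (s * v)" "f 0" "v * d" "\<lambda>s. g (s * v)" "g 0" "v * e",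
        OF _ de(1)[rule_format] de(2)[rule_format]]
    by (simp add: algebra_simps)
  thus ?case by blast
qed

primrec curve_prod :: "(nat \<Rightarrow> 'k \<Rightarrow> 'k::field^'n^'n) \<Rightarrow> nat list \<Rightarrow> (nat \<Rightarrow> 'k) \<Rightarrow> 'k^'n^'n" where
  "curve_prod z [] p = mat 1"
| "curve_prod z (k # ks) p = z k (p k) ** curve_prod z ks p"

definition const_funs :: "('x \<Rightarrow> 'k::field) set" where
  "const_funs = range (\<lambda>a _. a)"

lemma const_funs_subring: "unital_subring (const_funs :: ('x \<Rightarrow> 'k::field) set)"
proof -
  have c: "(\<lambda>_. a) \<in> const_funs" for a :: 'k by (auto simp: const_funs_def)
  have "(\<lambda>_. a) + (\<lambda>_. b) = (\<lambda>_::'x. a + b)" "(\<lambda>_. a) * (\<lambda>_. b) = (\<lambda>_::'x. a * b)"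
    "- (\<lambda>_. a) = (\<lambda>_::'x. - a)" "1 = (\<lambda>_::'x. 1::'k)" for a b :: 'k
    by (auto simp: fun_eq_iff)
  hence "(\<lambda>_::'x. a) + (\<lambda>_. b) \<in> const_funs" "(\<lambda>_::'x. a) * (\<lambda>_. b) \<in> const_funs"
    "- (\<lambda>_::'x. a) \<in> const_funs" "(1 :: 'x \<Rightarrow> 'k) \<in> const_funs" for a b :: 'k
    using c by metis+
  thus ?thesis unfolding unital_subring_def by (auto simp: const_funs_def image_iff)
qed

lemma const_funs_noetherian: "noetherian (const_funs :: ('x \<Rightarrow> 'k::field) set)"
proof (rule noetherian_field[OF const_funs_subring])
  fix a :: "'x \<Rightarrow> 'k" assume "a \<in> const_funs" "a \<noteq> 0"
  then obtain c where c: "a = (\<lambda>_. c)" "c \<noteq> 0" by (auto simp: const_funs_def fun_eq_iff)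
  hence "(\<lambda>_. inverse c) * a = 1" by (simp add: fun_eq_iff)
  thus "\<exists>b\<in>const_funs. b * a = 1" by (auto simp: const_funs_def)
qed

text \<open>The tangent vectors \<open>E k\<close> form a basis of the Lie algebra, with dual system \<open>c k\<close>. The
  poles at \<open>s = - 1\<close> are those of the curve \<open>s \<mapsto> 1 + s\<close> in a one-dimensional torus and its
  inverse.\<close>

locale curve_family =
  fixes G H :: "('k::alg_closed_field^'n^'n) set" and ks :: "nat list"
    and z :: "nat \<Rightarrow> 'k \<Rightarrow> 'k^'n^'n" and E c :: "nat \<Rightarrow> 'k^'n^'n"
  assumes G_closed: "zariski_closed G" and G_connected: "zariski_connected G"
    and G_group: "matrix_subgroup G" and H_group: "matrix_subgroup H" and H_sub: "H \<subseteq> G"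
    and ks_distinct: "distinct ks"
    and z_in: "\<And>k s. k \<in> set ks \<Longrightarrow> 1 + s \<noteq> 0 \<Longrightarrow> z k s \<in> H"
    and z_regular: "\<And>k i j. k \<in> set ks \<Longrightarrow> (\<lambda>s. z k s $ i $ j) \<in> func_alg {\<lambda>s. s, \<lambda>s. inverse (1 + s)}"
    and z_jet: "\<And>k. k \<in> set ks \<Longrightarrow> matrix_jet (z k) 1 (E k)"
    and dual: "\<And>k l. k \<in> set ks \<Longrightarrow> l \<in> set ks \<Longrightarrow> pairing (c k) (E l) = (if k = l then 1 else 0)"
    and spanning: "\<And>X. X \<in> lie_algebra G \<Longrightarrow> \<exists>a. X = (\<Sum>k\<in>set ks. mat (a k) ** E k)"
begin

text \<open>Composition with this map identifies functions on \<open>G\<close> with certain functions on all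
  matrices, so that the coordinate ring is a subring of a function type.\<close>

definition retr :: "'k^'n^'n \<Rightarrow> 'k^'n^'n" where
  "retr A = (if A \<in> G then A else mat 1)"

lemma retr_in: "retr A \<in> G" and retr_id: "A \<in> G \<Longrightarrow> retr A = A" and retr_one: "retr (mat 1) = mat 1"
  using matrix_subgroupD(1)[OF G_group] by (auto simp: retr_def)

definition gens :: "('k^'n^'n \<Rightarrow> 'k) list" where
  "gens = (SOME xs. set xs = (\<lambda>(i, j) A. retr A $ i $ j) ` UNIV)"

lemma set_gens: "set gens = (\<lambda>(i, j) A. retr A $ i $ j) ` UNIV"
proof -
  have "\<exists>xs. set xs = (\<lambda>(i, j) A. retr A $ i $ j) ` UNIV" by (rule finite_list) simp
  thus ?thesis unfolding gens_def by (rule someI_ex)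
qed

definition coord_ring :: "('k^'n^'n \<Rightarrow> 'k) set" where
  "coord_ring = adjoins const_funs gens"

lemma coord_ring_subring: "unital_subring coord_ring" unfolding coord_ring_def by (intro adjoins_subring const_funs_subring)

lemma coord_ring_noetherian: "noetherian coord_ring"
  unfolding coord_ring_def by (intro noetherian_adjoins const_funs_subring const_funs_noetherian)

lemma coord_ring_const: "(\<lambda>_. a) \<in> coord_ring"
  unfolding coord_ring_def by (intro adjoins_base const_funs_subring) (simp add: const_funs_def)

lemma coord_ring_eq: "coord_ring = (\<lambda>f A. f (retr A)) ` matrix_polys"
proof
  let ?S = "(\<lambda>f A. f (retr A)) ` matrix_polys"
  have I: "(\<lambda>A. f (retr A)) \<in> ?S" if "f \<in> matrix_polys" for f using that by blast
  have "unital_subring ?S"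
    unfolding unital_subring_def
  proof (intro conjI ballI)
    show "1 \<in> ?S" unfolding one_fun_def by (rule I) (rule matrix_polys_closed)
    fix a assume "a \<in> ?S"
    then obtain f where f: "f \<in> matrix_polys" "a = (\<lambda>A. f (retr A))" by auto
    show "- a \<in> ?S"
      using I[OF matrix_polys_closed(4)[OF matrix_polys_closed(1)[of "- 1"] f(1)]] f(2)
      by (simp add: fun_Compl_def)
    fix b assume "b \<in> ?S"
    then obtain g where g: "g \<in> matrix_polys" "b = (\<lambda>A. g (retr A))" by auto
    show "a + b \<in> ?S"
      using I[OF matrix_polys_closed(3)[OF f(1) g(1)]] f(2) g(2) by (simp add: plus_fun_def)
    show "a * b \<in> ?S"
      using I[OF matrix_polys_closed(4)[OF f(1) g(1)]] f(2) g(2) by (simp add: times_fun_def)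
  qed
  moreover have "const_funs \<subseteq> ?S"
  proof
    fix f :: "'k^'n^'n \<Rightarrow> 'k" assume "f \<in> const_funs"
    then obtain a where "f = (\<lambda>_. a)" by (auto simp: const_funs_def)
    thus "f \<in> ?S" using I[OF matrix_polys_closed(1)[of a]] by simp
  qed
  moreover have "set gens \<subseteq> ?S" unfolding set_gens using I matrix_polys_closed(2) by force
  ultimately show "coord_ring \<subseteq> ?S" unfolding coord_ring_def by (rule adjoins_least)
  have "(\<lambda>A. f (retr A)) \<in> coord_ring" if "f \<in> matrix_polys" for f
    using that[unfolded matrix_polys_def]
  proof (induction rule: func_alg.induct)
    case (const a)
    show ?case by (rule coord_ring_const)
  next
    case (gen f)
    then obtain i j where "f = (\<lambda>A. A $ i $ j)" by (auto simp: entry_funs_def)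
    hence "(\<lambda>A. f (retr A)) \<in> set gens" by (auto simp: set_gens image_iff)
    thus ?case unfolding coord_ring_def by (intro adjoins_gen const_funs_subring)
  next
    case (add f g)
    thus ?case using unital_subringD(3)[OF coord_ring_subring add.IH] by (simp add: plus_fun_def)
  next
    case (mult f g)
    thus ?case using unital_subringD(4)[OF coord_ring_subring mult.IH] by (simp add: times_fun_def)
  qed
  thus "?S \<subseteq> coord_ring" by auto
qed

lemma coord_ring_poly: "f \<in> matrix_polys \<Longrightarrow> (\<lambda>A. f (retr A)) \<in> coord_ring"
  by (auto simp: coord_ring_eq)

text \<open>Generators of the maximal ideal of the identity.\<close>

definition aug_gens :: "('k^'n^'n \<Rightarrow> 'k) list" where
  "aug_gens = map (\<lambda>g A. g A - g (mat 1)) gens"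

definition max_ideal :: "('k^'n^'n \<Rightarrow> 'k) set" where
  "max_ideal = {g \<in> coord_ring. g (mat 1) = 0}"

lemma max_ideal_ideal: "is_ideal coord_ring max_ideal"
  unfolding is_ideal_def max_ideal_def by (auto intro: unital_subringD[OF coord_ring_subring])

lemma aug_gens_sub: "set aug_gens \<subseteq> max_ideal"
proof
  fix x assume "x \<in> set aug_gens"
  then obtain g where g: "g \<in> set gens" "x = (\<lambda>A. g A - g (mat 1))" by (auto simp: aug_gens_def)
  have "g \<in> coord_ring" unfolding coord_ring_def by (intro adjoins_gen const_funs_subring g)
  hence "g - (\<lambda>_. g (mat 1)) \<in> coord_ring" by (intro unital_subringD(6)[OF coord_ring_subring] coord_ring_const)
  thus "x \<in> max_ideal" by (simp add: max_ideal_def g fun_diff_def)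
qed

abbreviation "Rees \<equiv> rees coord_ring aug_gens"

lemmas Rees_subring = unital_subring_rees[OF coord_ring_subring, of aug_gens]

lemma Rees_const: "a \<in> coord_ring \<Longrightarrow> [:a:] \<in> Rees"
  unfolding rees_def by (intro adjoins_base unital_subring_consts coord_ring_subring) auto

text \<open>Membership in the \<open>n\<close>-th power of the maximal ideal of the identity.\<close>

definition in_pow :: "nat \<Rightarrow> ('k^'n^'n \<Rightarrow> 'k) \<Rightarrow> bool" where
  "in_pow n g \<longleftrightarrow> monom g n \<in> Rees"

lemma in_pow_0: "g \<in> coord_ring \<Longrightarrow> in_pow 0 g"
  using Rees_const by (simp add: in_pow_def monom_0)

lemma in_pow_add: "in_pow n g \<Longrightarrow> in_pow n h \<Longrightarrow> in_pow n (g + h)"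
  using unital_subringD(3)[OF Rees_subring] unfolding in_pow_def by (metis add_monom)

lemma in_pow_mult: "in_pow n g \<Longrightarrow> in_pow m h \<Longrightarrow> in_pow (n + m) (g * h)"
  using unital_subringD(4)[OF Rees_subring] unfolding in_pow_def by (metis mult_monom)

lemma in_pow_smult: "in_pow n g \<Longrightarrow> in_pow n (\<lambda>A. a * g A)"
  using in_pow_mult[OF in_pow_0[OF coord_ring_const[of a]], of n g] by (simp add: times_fun_def)

lemma in_pow_zero: "in_pow n 0"
  using unital_subringD(2)[OF Rees_subring] by (simp add: in_pow_def)

lemma in_pow_uminus: "in_pow n g \<Longrightarrow> in_pow n (- g)"
  using in_pow_smult[of n g "- 1"] by (simp add: fun_Compl_def)

lemma in_pow_gen: "x \<in> set aug_gens \<Longrightarrow> in_pow 1 x"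
  unfolding in_pow_def rees_def
  by (intro adjoins_gen unital_subring_consts coord_ring_subring) auto

definition linear_part :: "'k^'n^'n \<Rightarrow> 'k^'n^'n \<Rightarrow> 'k" where
  "linear_part d A = pairing d (retr A - mat 1)"

text \<open>By induction on \<open>f\<close>; for a product, the error is the product of two elements of the
  maximal ideal.\<close>

lemma taylor:
  assumes "f \<in> matrix_polys"
  shows "\<exists>d. has_gradient f d \<and> in_pow 1 (\<lambda>A. f (retr A) - f (mat 1)) \<and>
    in_pow 2 (\<lambda>A. f (retr A) - f (mat 1) - linear_part d A)"
  using assms[unfolded matrix_polys_def]
proof (induction rule: func_alg.induct)
  case (const a)
  have "(\<lambda>A. 0) = (0 :: 'k^'n^'n \<Rightarrow> 'k)" by (simp add: fun_eq_iff)
  thus ?case using has_gradient_const[of a] in_pow_zero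
    by (intro exI[of _ 0]) (simp add: linear_part_def)
next
  case (gen f)
  then obtain i j where f: "f = (\<lambda>A. A $ i $ j)" by (auto simp: entry_funs_def)
  have "(\<lambda>A. retr A $ i $ j) \<in> set gens" by (auto simp: set_gens image_iff)
  hence "(\<lambda>A. retr A $ i $ j - retr (mat 1) $ i $ j) \<in> set aug_gens"
    by (auto simp: aug_gens_def image_iff)
  hence 1: "in_pow 1 (\<lambda>A. f (retr A) - f (mat 1))" using in_pow_gen by (simp add: f retr_one)
  have "(\<lambda>A. f (retr A) - f (mat 1) - linear_part (unit_matrix i j) A) = 0"
    by (auto simp: f linear_part_def pairing_unit fun_eq_iff)
  thus ?case using 1 has_gradient_entry[of i j] in_pow_zero
    by (intro exI[of _ "unit_matrix i j"]) (simp add: f)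
next
  case (add f g)
  then obtain d e where d: "has_gradient f d" "in_pow 1 (\<lambda>A. f (retr A) - f (mat 1))"
      "in_pow 2 (\<lambda>A. f (retr A) - f (mat 1) - linear_part d A)"
    and e: "has_gradient g e" "in_pow 1 (\<lambda>A. g (retr A) - g (mat 1))"
      "in_pow 2 (\<lambda>A. g (retr A) - g (mat 1) - linear_part e A)" by blast
  show ?case
  proof (intro exI[of _ "d + e"] conjI)
    show "has_gradient (\<lambda>x. f x + g x) (d + e)" by (rule has_gradient_add[OF d(1) e(1)])
    show "in_pow 1 (\<lambda>A. f (retr A) + g (retr A) - (f (mat 1) + g (mat 1)))"
      using in_pow_add[OF d(2) e(2)] by (simp add: plus_fun_def algebra_simps)
    show "in_pow 2 (\<lambda>A. f (retr A) + g (retr A) - (f (mat 1) + g (mat 1)) - linear_part (d + e) A)"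
      using in_pow_add[OF d(3) e(3)]
      by (simp add: plus_fun_def linear_part_def pairing_add algebra_simps)
  qed
next
  case (mult f g)
  then obtain d e where d: "has_gradient f d" "in_pow 1 (\<lambda>A. f (retr A) - f (mat 1))"
      "in_pow 2 (\<lambda>A. f (retr A) - f (mat 1) - linear_part d A)"
    and e: "has_gradient g e" "in_pow 1 (\<lambda>A. g (retr A) - g (mat 1))"
      "in_pow 2 (\<lambda>A. g (retr A) - g (mat 1) - linear_part e A)" by blast
  let ?f = "f (mat 1)" and ?g = "g (mat 1)"
  have prod: "in_pow 2 (\<lambda>A. (f (retr A) - ?f) * (g (retr A) - ?g))"
    using in_pow_mult[OF d(2) e(2)] by (simp add: times_fun_def numeral_2_eq_2)
  show ?case
  proof (intro exI[of _ "mat ?f ** e + mat ?g ** d"] conjI)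
    show "has_gradient (\<lambda>x. f x * g x) (mat ?f ** e + mat ?g ** d)"
      by (rule has_gradient_mult[OF d(1) e(1)])
    have "in_pow 1 ((\<lambda>A. f (retr A) - ?f) * (\<lambda>A. g (retr A)) + (\<lambda>A. ?f * (g (retr A) - ?g)))"
      using in_pow_mult[OF d(2) in_pow_0[OF coord_ring_poly[of g]]] in_pow_smult[OF e(2)] mult.hyps
      by (intro in_pow_add) (auto simp: matrix_polys_def)
    thus "in_pow 1 (\<lambda>A. f (retr A) * g (retr A) - ?f * ?g)"
      by (simp add: plus_fun_def times_fun_def algebra_simps)
    have "in_pow 2 ((\<lambda>A. (f (retr A) - ?f) * (g (retr A) - ?g)) +
        ((\<lambda>A. ?f * (g (retr A) - ?g - linear_part e A)) + (\<lambda>A. ?g * (f (retr A) - ?f - linear_part d A))))"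
      by (intro in_pow_add prod in_pow_smult d e)
    thus "in_pow 2 (\<lambda>A. f (retr A) * g (retr A) - ?f * ?g - linear_part (mat ?f ** e + mat ?g ** d) A)"
      by (simp add: plus_fun_def linear_part_def pairing_add pairing_scale algebra_simps)
  qed
qed

lemma taylor_gradient:
  assumes "f \<in> matrix_polys" "has_gradient f d"
  shows "in_pow 2 (\<lambda>A. f (retr A) - f (mat 1) - linear_part d A)"
  using taylor[OF assms(1)] has_gradient_unique[OF assms(2)] by blast

section \<open>Leading forms\<close>

definition coord :: "nat \<Rightarrow> 'k^'n^'n \<Rightarrow> 'k" where
  "coord k = linear_part (c k)"

lemma linear_part_poly: "(\<lambda>A. pairing d (A - mat 1)) \<in> matrix_polys"
  unfolding pairing_def vector_minus_component
  unfolding diff_conv_add_uminus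
  by (intro matrix_polys_closed)

lemma linear_part_gradient: "has_gradient (\<lambda>A. pairing d (A - mat 1)) (d :: 'k^'n^'n)"
proof -
  obtain e where e: "has_gradient (\<lambda>A. pairing d (A - mat 1)) e"
    using has_gradient_exists[OF linear_part_poly] by blast
  have "pairing e X = pairing d X" for X
  proof -
    have 1: "scalar_jet (\<lambda>s. pairing d (mat 1 + mat s ** X - mat 1)) 1 (pairing d (mat 1 - mat 1)) (pairing e X)"
      using has_gradientD[OF e _ matrix_jet_line[of X]] by simp
    have 2: "scalar_jet (\<lambda>s. pairing d (mat 1 + mat s ** X - mat 1)) 1 0 (pairing d X)"
      using scalar_jet_poly[of "[:0, pairing d X:]"] by (simp add: pairing_scale)
    show ?thesis by (rule scalar_jet_unique(2)[OF 1 2])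
  qed
  from this[of "unit_matrix _ _"] have "e = d" unfolding pairing_unit by (simp add: vec_eq_iff)
  thus ?thesis using e by simp
qed

lemma coord_in_pow: "in_pow 1 (coord k)"
  using taylor[OF linear_part_poly[of "c k"]]
  by (auto simp: coord_def[abs_def] linear_part_def[abs_def])

text \<open>Modulo the square of the maximal ideal, every element of it is a combination of the
  coordinates: the differential of the difference vanishes on the Lie algebra, so it is the
  differential of a function vanishing on \<open>G\<close>. Only the functions dual to the basis \<open>E\<close> remain,
  and this is where the curves are required to span the Lie algebra.\<close>

lemma aug_coord:
  assumes "x \<in> set aug_gens"
  shows "\<exists>a. in_pow 2 (x - (\<lambda>A. \<Sum>k\<in>set ks. a k * coord k A))"
proof -
  obtain i j where x: "x = (\<lambda>A. retr A $ i $ j - (mat 1 :: 'k^'n^'n) $ i $ j)"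
    using assms by (auto simp: aug_gens_def set_gens retr_one)
  define a where "a k = E k $ i $ j" for k
  define d where "d = unit_matrix i j + (\<Sum>k\<in>set ks. mat (- a k) ** c k)"
  have dE: "pairing d (E l) = 0" if "l \<in> set ks" for l
    using that by (simp add: d_def pairing_add pairing_unit pairing_sum_left pairing_scale dual a_def
        if_distrib[of "\<lambda>x. _ * x"] sum.delta cong: if_cong)
  have "d \<in> conormal G"
  proof (rule conormal_of_lie_algebra)
    fix X assume "X \<in> lie_algebra G"
    then obtain b where "X = (\<Sum>k\<in>set ks. mat (b k) ** E k)" using spanning by blast
    thus "pairing d X = 0" using dE by (simp add: pairing_sum pairing_scale)
  qed
  then obtain h where h: "h \<in> matrix_polys" "\<forall>A\<in>G. h A = 0" "has_gradient h d"
    by (auto simp: conormal_def)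
  have "in_pow 2 (\<lambda>A. - linear_part d A)"
    using taylor_gradient[OF h(1,3)] h(2) retr_in matrix_subgroupD(1)[OF G_group] by simp
  hence "in_pow 2 (linear_part d)"
    using in_pow_uminus[of 2 "\<lambda>A. - linear_part d A"] by (simp add: fun_Compl_def)
  moreover have "linear_part d = x - (\<lambda>A. \<Sum>k\<in>set ks. a k * coord k A)"
    by (auto simp: fun_eq_iff x linear_part_def coord_def d_def pairing_add pairing_unit
        pairing_sum_left pairing_scale sum_negf)
  ultimately show ?thesis by auto
qed

text \<open>Forms of degree \<open>n\<close> in the variables indexed by \<open>ks\<close>, as functions; the zero form has
  every degree.\<close>

inductive hom_poly :: "nat \<Rightarrow> ((nat \<Rightarrow> 'k) \<Rightarrow> 'k) \<Rightarrow> bool" where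
  const: "hom_poly 0 (\<lambda>_. a)"
| zero: "hom_poly n (\<lambda>_. 0)"
| var: "k \<in> set ks \<Longrightarrow> hom_poly 1 (\<lambda>v. v k)"
| add: "hom_poly n P \<Longrightarrow> hom_poly n Q \<Longrightarrow> hom_poly n (\<lambda>v. P v + Q v)"
| mult: "hom_poly n P \<Longrightarrow> hom_poly m Q \<Longrightarrow> hom_poly (n + m) (\<lambda>v. P v * Q v)"

definition coords :: "'k^'n^'n \<Rightarrow> nat \<Rightarrow> 'k" where
  "coords A k = coord k A"

lemma hom_poly_in_pow: "hom_poly n P \<Longrightarrow> in_pow n (\<lambda>A. P (coords A))"
proof (induction rule: hom_poly.induct)
  case (const a)
  show ?case by (rule in_pow_0[OF coord_ring_const])
next
  case (zero n)
  show ?case using in_pow_zero by (simp add: zero_fun_def)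
next
  case (var k)
  show ?case using coord_in_pow by (simp add: coords_def)
next
  case (add n P Q)
  thus ?case using in_pow_add[OF add.IH] by (simp add: plus_fun_def)
next
  case (mult n P m Q)
  thus ?case using in_pow_mult[OF mult.IH] by (simp add: times_fun_def)
qed

lemma hom_poly_sum: "(\<And>i. i \<in> I \<Longrightarrow> hom_poly n (P i)) \<Longrightarrow> hom_poly n (\<lambda>v. \<Sum>i\<in>I. P i v)"
  by (induction I rule: infinite_finite_induct) (auto intro: hom_poly.intros)

text \<open>The function \<open>g\<close> has a leading form of degree \<open>n\<close> in the coordinates, possibly zero.\<close>

definition leading :: "nat \<Rightarrow> ('k^'n^'n \<Rightarrow> 'k) \<Rightarrow> bool" where
  "leading n g \<longleftrightarrow> in_pow n g \<and> (\<exists>P. hom_poly n P \<and> in_pow (Suc n) (g - (\<lambda>A. P (coords A))))"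

lemma leading_zero: "leading n 0"
  unfolding leading_def using in_pow_zero
  by (auto intro!: exI[of _ "\<lambda>_. 0"] hom_poly.zero simp: zero_fun_def[symmetric])

lemma leading_add: "leading n g \<Longrightarrow> leading n h \<Longrightarrow> leading n (g + h)"
proof -
  assume "leading n g" "leading n h"
  then obtain P Q where h: "in_pow n g" "in_pow n h" "hom_poly n P" "hom_poly n Q"
    "in_pow (Suc n) (g - (\<lambda>A. P (coords A)))" "in_pow (Suc n) (h - (\<lambda>A. Q (coords A)))"
    unfolding leading_def by blast
  have "(g - (\<lambda>A. P (coords A))) + (h - (\<lambda>A. Q (coords A))) = g + h - (\<lambda>A. P (coords A) + Q (coords A))"
    by (simp add: fun_eq_iff)
  with in_pow_add[OF h(5,6)] have "in_pow (Suc n) (g + h - (\<lambda>A. P (coords A) + Q (coords A)))" by simp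
  thus ?thesis unfolding leading_def using in_pow_add[OF h(1,2)] hom_poly.add[OF h(3,4)] by blast
qed

lemma leading_mult: "leading n g \<Longrightarrow> leading m h \<Longrightarrow> leading (n + m) (g * h)"
proof -
  assume "leading n g" "leading m h"
  then obtain P Q where h: "in_pow n g" "in_pow m h" "hom_poly n P" "hom_poly m Q"
    "in_pow (Suc n) (g - (\<lambda>A. P (coords A)))" "in_pow (Suc m) (h - (\<lambda>A. Q (coords A)))"
    unfolding leading_def by blast
  have t1: "in_pow (Suc (n + m)) ((g - (\<lambda>A. P (coords A))) * h)"
    using in_pow_mult[OF h(5,2)] by simp
  have t2: "in_pow (Suc (n + m)) ((\<lambda>A. P (coords A)) * (h - (\<lambda>A. Q (coords A))))"
    using in_pow_mult[OF hom_poly_in_pow[OF h(3)] h(6)] by simp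
  have t3: "(g - (\<lambda>A. P (coords A))) * h + (\<lambda>A. P (coords A)) * (h - (\<lambda>A. Q (coords A)))
      = g * h - (\<lambda>A. P (coords A) * Q (coords A))"
    by (simp add: fun_eq_iff algebra_simps)
  have "in_pow (Suc (n + m)) (g * h - (\<lambda>A. P (coords A) * Q (coords A)))"
    using in_pow_add[OF t1 t2] unfolding t3 .
  thus ?thesis unfolding leading_def using in_pow_mult[OF h(1,2)] hom_poly.mult[OF h(3,4)] by blast
qed

lemma leading_const: "leading 0 (\<lambda>_. a)"
  unfolding leading_def
proof (intro conjI exI[of _ "\<lambda>_. a"])
  have "(\<lambda>_. a) - (\<lambda>_. a) = (0 :: 'k^'n^'n \<Rightarrow> 'k)" by simp
  thus "in_pow (Suc 0) ((\<lambda>_. a) - (\<lambda>A. a))" using in_pow_zero by simp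
qed (rule in_pow_0[OF coord_ring_const] hom_poly.const)+

lemma leading_sum: "(\<And>i. i \<in> I \<Longrightarrow> leading n (g i)) \<Longrightarrow> leading n (sum g I)"
  by (induction I rule: infinite_finite_induct) (auto intro: leading_zero leading_add)

text \<open>The polynomials all of whose coefficients have leading forms of the corresponding degrees
  form a ring, and it contains the generators of the Rees algebra.\<close>

lemma leading_in_pow:
  assumes "in_pow n g"
  shows "leading n g"
proof -
  let ?P = "{s. \<forall>n. leading n (coeff s n)}"
  have "unital_subring ?P"
    unfolding unital_subring_def
  proof (intro conjI ballI)
    have "leading 0 1" using leading_const[of 1] by (simp add: one_fun_def)
    thus "1 \<in> ?P" by (auto simp: coeff_1 leading_zero)
    fix s assume s: "s \<in> ?P"
    have "leading n (- coeff s n)" for n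
      using leading_mult[OF leading_const[of "- 1"], of n "coeff s n"] s by (simp add: times_fun_def fun_Compl_def)
    thus "- s \<in> ?P" by simp
    fix t assume t: "t \<in> ?P"
    show "s + t \<in> ?P" using s t by (auto intro: leading_add)
    have "leading n (coeff s i * coeff t (n - i))" if "i \<le> n" for i n
      using leading_mult[of i "coeff s i" "n - i" "coeff t (n - i)"] s t that by simp
    thus "s * t \<in> ?P" by (auto simp: coeff_mult intro!: leading_sum)
  qed
  moreover have "[:a:] \<in> ?P" if a: "a \<in> coord_ring" for a
  proof -
    obtain f where f: "f \<in> matrix_polys" "a = (\<lambda>A. f (retr A))" using a by (auto simp: coord_ring_eq)
    have "in_pow (Suc 0) (a - (\<lambda>A. f (mat 1)))"
      using taylor[OF f(1)] f(2) by (auto simp: fun_diff_def)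
    hence "leading 0 a" unfolding leading_def using in_pow_0[OF a] hom_poly.const[of "f (mat 1)"] by blast
    thus ?thesis by (auto simp: coeff_pCons leading_zero split: nat.split)
  qed
  moreover have "monom x 1 \<in> ?P" if x: "x \<in> set aug_gens" for x
  proof -
    obtain a where a: "in_pow 2 (x - (\<lambda>A. \<Sum>k\<in>set ks. a k * coord k A))" using aug_coord[OF x] by blast
    have "hom_poly 1 (\<lambda>v. a k * v k)" if "k \<in> set ks" for k
      using hom_poly.mult[OF hom_poly.const[of "a k"] hom_poly.var[OF that]] by simp
    hence "hom_poly 1 (\<lambda>v. \<Sum>k\<in>set ks. a k * v k)" by (intro hom_poly_sum) auto
    hence "leading 1 x" unfolding leading_def using in_pow_gen[OF x] a
      by (auto intro!: exI[of _ "\<lambda>v. \<Sum>k\<in>set ks. a k * v k"] simp: coords_def numeral_2_eq_2)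
    thus ?thesis by (auto simp: leading_zero)
  qed
  ultimately have "Rees \<subseteq> ?P" by (intro rees_induct coord_ring_subring) auto
  hence "monom g n \<in> ?P" using assms unfolding in_pow_def by (rule subsetD)
  hence "leading n (coeff (monom g n) n)" unfolding mem_Collect_eq by (rule spec)
  thus ?thesis by simp
qed

section \<open>Expansion along the product map\<close>

text \<open>The parameters at which all the curves are defined.\<close>

definition admissible :: "(nat \<Rightarrow> 'k) \<Rightarrow> bool" where
  "admissible p \<longleftrightarrow> (\<forall>k\<in>set ks. 1 + p k \<noteq> 0)"

abbreviation "\<Phi> \<equiv> curve_prod z ks"

lemma curve_prod_in: "admissible p \<Longrightarrow> \<Phi> p \<in> H"
proof -
  have "curve_prod z ls p \<in> H" if "admissible p" "set ls \<subseteq> set ks" for ls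
    using that(2) by (induction ls)
      (use that(1) z_in matrix_subgroupD[OF H_group] in \<open>auto simp: admissible_def\<close>)
  thus "admissible p \<Longrightarrow> \<Phi> p \<in> H" by blast
qed

lemma z_jet_scaled:
  assumes "k \<in> set ks"
  shows "matrix_jet (\<lambda>s. z k (s * v)) 1 (mat v ** E k)"
  unfolding matrix_jet_def
proof (intro allI)
  fix i j
  obtain d where d: "\<And>v. scalar_jet (\<lambda>s. z k (s * v) $ i $ j) 1 (z k 0 $ i $ j) (v * d)"
    using scalar_jet_of_reparametrised[OF z_regular[OF assms]] by blast
  have "scalar_jet (\<lambda>s. z k s $ i $ j) 1 ((mat 1 :: 'k^'n^'n) $ i $ j) (E k $ i $ j)"
    using z_jet[OF assms] by (simp add: matrix_jet_def)
  with d[of 1] have "z k 0 $ i $ j = (mat 1 :: 'k^'n^'n) $ i $ j" "d = E k $ i $ j"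
    using scalar_jet_unique by fastforce+
  thus "scalar_jet (\<lambda>s. z k (s * v) $ i $ j) 1 ((mat 1 :: 'k^'n^'n) $ i $ j) ((mat v ** E k) $ i $ j)"
    using d[of v] by (simp add: scale_nth)
qed

lemma curve_jet: "matrix_jet (\<lambda>s. \<Phi> (\<lambda>k. s * v k)) 1 (\<Sum>k\<in>set ks. mat (v k) ** E k)"
proof -
  have "matrix_jet (\<lambda>s. curve_prod z ls (\<lambda>k. s * v k)) 1 (\<Sum>k\<in>set ls. mat (v k) ** E k)"
    if "set ls \<subseteq> set ks" "distinct ls" for ls
    using that
  proof (induction ls)
    case Nil
    show ?case using matrix_jet_one[of 1] by simp
  next
    case (Cons l ls)
    have "matrix_jet (\<lambda>s. z l (s * v l) ** curve_prod z ls (\<lambda>k. s * v k)) 1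
        (mat (v l) ** E l + (\<Sum>k\<in>set ls. mat (v k) ** E k))"
      using Cons by (intro matrix_jet_mult z_jet_scaled) auto
    thus ?case using Cons.prems by simp
  qed
  thus ?thesis using ks_distinct by blast
qed

text \<open>Its zeros are the points of the line through the origin in the direction \<open>v\<close> at which some
  curve is undefined.\<close>

definition line_denom :: "(nat \<Rightarrow> 'k) \<Rightarrow> 'k poly" where
  "line_denom v = (\<Prod>k\<in>set ks. [:1, v k:])"

lemma line_denom: "poly (line_denom v) 0 \<noteq> 0" "poly (line_denom v) s \<noteq> 0 \<Longrightarrow> admissible (\<lambda>k. s * v k)"
  by (auto simp: line_denom_def poly_prod admissible_def)

text \<open>The pullback of \<open>g\<close> under the product map vanishes to order \<open>n\<close> along the line in the
  direction \<open>v\<close>.\<close>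

definition vanishing :: "(nat \<Rightarrow> 'k) \<Rightarrow> nat \<Rightarrow> ('k^'n^'n \<Rightarrow> 'k) \<Rightarrow> bool" where
  "vanishing v n g \<longleftrightarrow> (\<exists>F. germ (\<lambda>s. g (\<Phi> (\<lambda>k. s * v k))) F \<and> (\<forall>l<n. fps_nth F l = 0))"

lemma fps_mult_vanishing:
  fixes F K :: "'k fps"
  assumes "\<forall>l<n. fps_nth F l = 0" "\<forall>l<m. fps_nth K l = 0"
  shows "\<forall>l<n + m. fps_nth (F * K) l = 0" "fps_nth (F * K) (n + m) = fps_nth F n * fps_nth K m"
proof -
  have z: "fps_nth F i * fps_nth K (l - i) = 0" if "l \<le> n + m" "i \<le> l" "i \<noteq> n \<or> l \<noteq> n + m" for i l
  proof (cases "i < n")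
    case False
    hence "l - i < m" using that by auto
    thus ?thesis using assms by simp
  qed (use assms in simp)
  show "\<forall>l<n + m. fps_nth (F * K) l = 0"
    unfolding fps_mult_nth by (intro allI impI sum.neutral ballI z) auto
  have "fps_nth (F * K) (n + m) = (\<Sum>i\<in>{n}. fps_nth F i * fps_nth K (n + m - i))"
    unfolding fps_mult_nth by (intro sum.mono_neutral_right) (use z in auto)
  thus "fps_nth (F * K) (n + m) = fps_nth F n * fps_nth K m" by simp
qed

lemma vanishing_zero: "vanishing v n 0"
  unfolding vanishing_def using germ_const[of 0] by (intro exI[of _ 0]) simp

lemma vanishing_add: "vanishing v n g \<Longrightarrow> vanishing v n h \<Longrightarrow> vanishing v n (g + h)"
proof -
  assume "vanishing v n g" "vanishing v n h"
  then obtain F K where "germ (\<lambda>s. g (\<Phi> (\<lambda>k. s * v k))) F" "germ (\<lambda>s. h (\<Phi> (\<lambda>k. s * v k))) K"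
    "\<forall>l<n. fps_nth F l = 0" "\<forall>l<n. fps_nth K l = 0" unfolding vanishing_def by blast
  thus ?thesis unfolding vanishing_def by (intro exI[of _ "F + K"]) (auto dest: germ_add)
qed

lemma vanishing_mult: "vanishing v n g \<Longrightarrow> vanishing v m h \<Longrightarrow> vanishing v (n + m) (g * h)"
proof -
  assume "vanishing v n g" "vanishing v m h"
  then obtain F K where h: "germ (\<lambda>s. g (\<Phi> (\<lambda>k. s * v k))) F" "germ (\<lambda>s. h (\<Phi> (\<lambda>k. s * v k))) K"
    "\<forall>l<n. fps_nth F l = 0" "\<forall>l<m. fps_nth K l = 0" unfolding vanishing_def by blast
  thus ?thesis unfolding vanishing_def
    using germ_mult[OF h(1,2)] fps_mult_vanishing(1)[OF h(3,4)] by (intro exI[of _ "F * K"]) auto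
qed

lemma vanishing_sum: "(\<And>i. i \<in> I \<Longrightarrow> vanishing v n (g i)) \<Longrightarrow> vanishing v n (sum g I)"
  by (induction I rule: infinite_finite_induct) (auto intro: vanishing_zero vanishing_add)

lemma jet_retr:
  assumes "f \<in> matrix_polys" "has_gradient f d"
  shows "scalar_jet (\<lambda>s. f (retr (\<Phi> (\<lambda>k. s * v k)))) 1 (f (mat 1)) (pairing d (\<Sum>k\<in>set ks. mat (v k) ** E k))"
proof (rule scalar_jet_cong[OF has_gradientD[OF assms(2) _ curve_jet[of v]] line_denom(1)[of v]])
  fix s assume "poly (line_denom v) s \<noteq> 0"
  hence "\<Phi> (\<lambda>k. s * v k) \<in> G" using line_denom(2) curve_prod_in H_sub by blast
  thus "f (\<Phi> (\<lambda>k. s * v k)) = f (retr (\<Phi> (\<lambda>k. s * v k)))" by (simp add: retr_id)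
qed simp

lemma vanishing_in_pow:
  assumes "in_pow n g"
  shows "vanishing v n g"
proof -
  let ?P = "{s. \<forall>n. vanishing v n (coeff s n)}"
  have v0: "vanishing v 0 a" if a: "a \<in> coord_ring" for a
  proof -
    obtain f where f: "f \<in> matrix_polys" "a = (\<lambda>A. f (retr A))" using a by (auto simp: coord_ring_eq)
    obtain d where "has_gradient f d" using has_gradient_exists[OF f(1)] by blast
    from jet_retr[OF f(1) this] show ?thesis unfolding vanishing_def scalar_jet_def f(2) by blast
  qed
  have "unital_subring ?P"
    unfolding unital_subring_def
  proof (intro conjI ballI)
    have "vanishing v 0 1" using v0[OF coord_ring_const[of 1]] by (simp add: one_fun_def)
    thus "1 \<in> ?P" by (auto simp: coeff_1 vanishing_zero)
    fix s assume s: "s \<in> ?P"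
    have "vanishing v n (- coeff s n)" for n
      using vanishing_mult[OF v0[OF coord_ring_const[of "- 1"]], of n "coeff s n"] s
      by (simp add: times_fun_def fun_Compl_def)
    thus "- s \<in> ?P" by simp
    fix t assume t: "t \<in> ?P"
    show "s + t \<in> ?P" using s t by (auto intro: vanishing_add)
    have "vanishing v n (coeff s i * coeff t (n - i))" if "i \<le> n" for i n
      using vanishing_mult[of v i "coeff s i" "n - i" "coeff t (n - i)"] s t that by simp
    thus "s * t \<in> ?P" by (auto simp: coeff_mult intro!: vanishing_sum)
  qed
  moreover have "[:a:] \<in> ?P" if a: "a \<in> coord_ring" for a
    using v0[OF a] by (auto simp: coeff_pCons vanishing_zero split: nat.split)
  moreover have "monom x 1 \<in> ?P" if x: "x \<in> set aug_gens" for x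
  proof -
    obtain i j where x: "x = (\<lambda>A. retr A $ i $ j - (mat 1 :: 'k^'n^'n) $ i $ j)"
      using x by (auto simp: aug_gens_def set_gens retr_one)
    define f where "f A = A $ i $ j + - (mat 1 :: 'k^'n^'n) $ i $ j" for A :: "'k^'n^'n"
    have f: "f \<in> matrix_polys" unfolding f_def by (intro matrix_polys_closed)
    obtain d where "has_gradient f d" using has_gradient_exists[OF f(1)] by blast
    from jet_retr[OF f(1) this] have "vanishing v 1 x"
      unfolding vanishing_def scalar_jet_def x by (auto simp: f_def)
    thus ?thesis by (auto simp: vanishing_zero)
  qed
  ultimately have "Rees \<subseteq> ?P" by (intro rees_induct coord_ring_subring) auto
  hence "monom g n \<in> ?P" using assms unfolding in_pow_def by (rule subsetD)
  hence "vanishing v n (coeff (monom g n) n)" unfolding mem_Collect_eq by (rule spec)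
  thus ?thesis by simp
qed

text \<open>The \<open>k\<close>-th coordinate along the line in the direction \<open>v\<close> is \<open>s v\<^sub>k\<close> up to higher order,
  since \<open>c\<close> is dual to \<open>E\<close>; so a form of degree \<open>n\<close> becomes \<open>s\<^sup>n P(v)\<close> up to higher order.\<close>

lemma hom_poly_germ:
  assumes "hom_poly n P"
  shows "\<exists>F. germ (\<lambda>s. P (coords (\<Phi> (\<lambda>k. s * v k)))) F \<and> (\<forall>l<n. fps_nth F l = 0) \<and> fps_nth F n = P v"
  using assms
proof (induction rule: hom_poly.induct)
  case (const a)
  show ?case using germ_const[of a] by (intro exI[of _ "fps_const a"]) simp
next
  case (zero n)
  show ?case using germ_const[of 0] by (intro exI[of _ 0]) simp
next
  case (var k)
  have "pairing (c k) (\<Sum>l\<in>set ks. mat (v l) ** E l) = v k"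
    using var by (simp add: pairing_sum pairing_scale dual if_distrib[of "\<lambda>x. _ * x"] cong: if_cong)
  with jet_retr[OF linear_part_poly linear_part_gradient, of "c k" v]
  show ?case unfolding scalar_jet_def coords_def coord_def linear_part_def by auto
next
  case (add n P Q)
  then obtain F K where "germ (\<lambda>s. P (coords (\<Phi> (\<lambda>k. s * v k)))) F" "\<forall>l<n. fps_nth F l = 0" "fps_nth F n = P v"
    "germ (\<lambda>s. Q (coords (\<Phi> (\<lambda>k. s * v k)))) K" "\<forall>l<n. fps_nth K l = 0" "fps_nth K n = Q v" by blast
  thus ?case by (intro exI[of _ "F + K"]) (auto intro: germ_add)
next
  case (mult n P m Q)
  then obtain F K where h: "germ (\<lambda>s. P (coords (\<Phi> (\<lambda>k. s * v k)))) F" "\<forall>l<n. fps_nth F l = 0" "fps_nth F n = P v"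
    "germ (\<lambda>s. Q (coords (\<Phi> (\<lambda>k. s * v k)))) K" "\<forall>l<m. fps_nth K l = 0" "fps_nth K m = Q v" by blast
  thus ?case using fps_mult_vanishing[OF h(2,5)] germ_mult[OF h(1,4)] by (intro exI[of _ "F * K"]) auto
qed

text \<open>If \<open>g\<close> lies in the \<open>n\<close>-th power with leading form \<open>P\<close>, then its pullback along the line in
  the direction \<open>v\<close> is \<open>s\<^sup>n P(v)\<close> up to higher order. As the pullback is zero, so is \<open>P\<close>, and
  \<open>g\<close> lies in the next power.\<close>

lemma in_all_pow:
  assumes g: "g \<in> coord_ring" and van: "\<And>p. admissible p \<Longrightarrow> g (\<Phi> p) = 0"
  shows "in_pow n g"
proof (induction n)
  case 0
  show ?case by (rule in_pow_0[OF g])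
next
  case (Suc n)
  obtain P where P: "hom_poly n P" "in_pow (Suc n) (g - (\<lambda>A. P (coords A)))"
    using leading_in_pow[OF Suc] unfolding leading_def by blast
  have "P v = 0" for v
  proof -
    obtain F where F: "germ (\<lambda>s. P (coords (\<Phi> (\<lambda>k. s * v k)))) F" "fps_nth F n = P v"
      using hom_poly_germ[OF P(1)] by blast
    obtain K where K: "germ (\<lambda>s. (g - (\<lambda>A. P (coords A))) (\<Phi> (\<lambda>k. s * v k))) K" "\<forall>l<Suc n. fps_nth K l = 0"
      using vanishing_in_pow[OF P(2)] unfolding vanishing_def by blast
    have "germ (\<lambda>s. g (\<Phi> (\<lambda>k. s * v k))) (K + F)"
      using germ_add[OF K(1) F(1)] by simp
    moreover have "line_denom v \<noteq> 0" using line_denom(1)[of v] by (metis poly_0)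
    ultimately have "K + F = 0" by (rule germ_zero) (rule van[OF line_denom(2)])
    hence "fps_nth (K + F) n = 0" by simp
    thus "P v = 0" using F K by simp
  qed
  hence "g - (\<lambda>A. P (coords A)) = g" by (simp add: fun_eq_iff)
  thus ?case using P(2) by simp
qed

lemma vanishing_krull:
  assumes "g \<in> coord_ring" "\<And>p. admissible p \<Longrightarrow> g (\<Phi> p) = 0"
  shows "\<exists>a\<in>coord_ring. a (mat 1) = 0 \<and> g = a * g"
  using krull_intersection[OF coord_ring_subring coord_ring_noetherian max_ideal_ideal aug_gens_sub, of g] in_all_pow[OF assms]
  by (auto simp: in_pow_def max_ideal_def)

text \<open>The ideal of functions vanishing on the image is finitely generated, so finitely many
  instances of Krull's theorem provide a single \<open>h\<close>. On the open set where \<open>h\<close> is nonzero, the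
  image is dense in \<open>G\<close>.\<close>

lemma vanishing_denominator:
  "\<exists>h\<in>coord_ring. h (mat 1) = 1 \<and> (\<forall>g\<in>coord_ring. (\<forall>p. admissible p \<longrightarrow> g (\<Phi> p) = 0) \<longrightarrow> h * g = 0)"
proof -
  let ?I = "{g\<in>coord_ring. \<forall>p. admissible p \<longrightarrow> g (\<Phi> p) = 0}"
  have "is_ideal coord_ring ?I" unfolding is_ideal_def by (auto intro: unital_subringD[OF coord_ring_subring])
  then obtain F where F: "finite F" "F \<subseteq> ?I" "?I \<subseteq> ideal_gen coord_ring F"
    using coord_ring_noetherian[unfolded noetherian_def, rule_format, of ?I] by blast
  have "\<exists>h\<in>coord_ring. h (mat 1) = 1 \<and> (\<forall>g\<in>F. h * g = 0)"
    using F(1,2)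
  proof (induction F)
    case empty
    show ?case by (rule bexI[of _ 1]) (auto intro: unital_subringD[OF coord_ring_subring])
  next
    case (insert g F)
    then obtain h where h: "h \<in> coord_ring" "h (mat 1) = 1" "\<forall>g\<in>F. h * g = 0"
      using insert.IH insert.prems by blast
    obtain a where a: "a \<in> coord_ring" "a (mat 1) = 0" "g = a * g" using vanishing_krull[of g] insert.prems by blast
    have "(1 - a) * g = 0" using a(3) by (simp add: left_diff_distrib)
    hence "h * (1 - a) * g = 0" by (simp only: mult.assoc mult_zero_right)
    moreover have "h * (1 - a) * f = 0" if "f \<in> F" for f
    proof -
      have "h * (1 - a) * f = (1 - a) * (h * f)" by (simp only: mult_ac)
      thus ?thesis using h that by (simp only: mult_zero_right)
    qed
    moreover have "h * (1 - a) \<in> coord_ring" by (intro unital_subringD[OF coord_ring_subring] h a)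
    moreover have "(h * (1 - a)) (mat 1) = 1" using h a by simp
    ultimately show ?case by blast
  qed
  then obtain h where h: "h \<in> coord_ring" "h (mat 1) = 1" "\<forall>g\<in>F. h * g = 0" by blast
  have "h * g = 0" if "g \<in> ideal_gen coord_ring F" for g
    using that
  proof induction
    case (step r f g)
    have "h * (r * f) = r * (h * f)" by (simp add: mult_ac)
    also have "\<dots> = 0" using step(2) h(3) by (simp only: mult_zero_right)
    finally have "h * (r * f) = 0" .
    thus ?case using step.IH by (simp only: distrib_left add_0)
  qed simp
  thus ?thesis using h F(3) by blast
qed

end

section \<open>The image of the product map\<close>

context curve_family
begin

text \<open>As with \<open>retr\<close>, composition with this map turns functions on the admissible parameters
  into functions on a whole type.\<close>

definition reparam :: "(nat \<Rightarrow> 'k) \<Rightarrow> nat \<Rightarrow> 'k" where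
  "reparam p = (if admissible p then p else (\<lambda>_. 0))"

lemma admissible_reparam: "admissible (reparam p)" and reparam_admissible: "admissible p \<Longrightarrow> reparam p = p"
  by (auto simp: reparam_def admissible_def)

definition param_gens :: "((nat \<Rightarrow> 'k) \<Rightarrow> 'k) list" where
  "param_gens = map (\<lambda>k p. reparam p k) ks @ map (\<lambda>k p. inverse (1 + reparam p k)) ks"

text \<open>The coordinate ring of the space of admissible parameters, a product of affine lines
  without a point.\<close>

definition Params :: "((nat \<Rightarrow> 'k) \<Rightarrow> 'k) set" where
  "Params = adjoins const_funs param_gens"

definition pullback :: "('k^'n^'n \<Rightarrow> 'k) \<Rightarrow> (nat \<Rightarrow> 'k) \<Rightarrow> 'k" where
  "pullback g p = g (\<Phi> (reparam p))"

lemma Params_subring: "unital_subring Params"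
  unfolding Params_def by (intro adjoins_subring const_funs_subring)

lemma Params_const: "(\<lambda>_. a) \<in> Params"
  unfolding Params_def by (intro adjoins_base const_funs_subring) (simp add: const_funs_def)

lemma Params_gen: "x \<in> set param_gens \<Longrightarrow> x \<in> Params"
  unfolding Params_def by (intro adjoins_gen const_funs_subring)

lemma Params_reparam:
  assumes "F \<in> Params"
  shows "F (reparam p) = F p"
proof -
  let ?S = "{F. \<forall>p. F (reparam p) = F p}"
  have "unital_subring ?S" by (auto simp: unital_subring_def)
  moreover have "set param_gens \<subseteq> ?S" by (auto simp: param_gens_def reparam_admissible admissible_reparam)
  moreover have "const_funs \<subseteq> ?S" by (auto simp: const_funs_def)
  ultimately have "Params \<subseteq> ?S" unfolding Params_def by (intro adjoins_least)
  thus ?thesis using assms by auto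
qed

text \<open>The line joining two admissible points meets the complement of the admissible set in
  finitely many points, so functions restrict to rational functions of one variable that are
  regular at both ends.\<close>

lemma Params_line:
  assumes "F \<in> Params" and p: "admissible p" and q: "admissible q"
  shows "\<exists>N D. poly D 0 \<noteq> 0 \<and> poly D 1 \<noteq> 0 \<and>
    (\<forall>s. poly D s \<noteq> 0 \<longrightarrow> F (\<lambda>k. p k + s * (q k - p k)) * poly D s = poly N s)"
proof -
  let ?l = "\<lambda>s k. p k + s * (q k - p k)"
  let ?Q = "\<lambda>F N D. poly D 0 \<noteq> 0 \<and> poly D 1 \<noteq> 0 \<and> (\<forall>s. poly D s \<noteq> 0 \<longrightarrow> F (?l s) * poly D s = poly N s)"
  let ?S = "{F. \<exists>N D. ?Q F N D}"
  have "unital_subring ?S"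
    unfolding unital_subring_def
  proof (intro conjI ballI)
    have "?Q 1 1 1" by simp
    thus "1 \<in> ?S" by blast
    fix F assume "F \<in> ?S"
    then obtain N D where N: "?Q F N D" by blast
    have "?Q (- F) (- N) D" using N by simp
    thus "- F \<in> ?S" by blast
    fix K assume "K \<in> ?S"
    then obtain M C where M: "?Q K M C" by blast
    have e: "F (?l s) * (poly D s * poly C s) = poly N s * poly C s"
      "K (?l s) * (poly D s * poly C s) = poly M s * poly D s"
      "F (?l s) * K (?l s) * (poly D s * poly C s) = poly N s * poly M s"
      if "poly D s \<noteq> 0" "poly C s \<noteq> 0" for s
    proof -
      have 1: "poly N s = F (?l s) * poly D s" "poly M s = K (?l s) * poly C s" using N M that by auto
      show "F (?l s) * (poly D s * poly C s) = poly N s * poly C s"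
        "K (?l s) * (poly D s * poly C s) = poly M s * poly D s"
        "F (?l s) * K (?l s) * (poly D s * poly C s) = poly N s * poly M s"
        unfolding 1 by (simp_all add: mult_ac)
    qed
    have "?Q (F + K) (N * C + M * D) (D * C)"
    proof (intro conjI allI impI)
      fix s assume "poly (D * C) s \<noteq> 0"
      hence "poly D s \<noteq> 0" "poly C s \<noteq> 0" by auto
      from e(1,2)[OF this] show "(F + K) (?l s) * poly (D * C) s = poly (N * C + M * D) s"
        by (simp only: poly_mult poly_add plus_fun_apply distrib_right)
    qed (use N M in auto)
    moreover have "?Q (F * K) (N * M) (D * C)"
    proof (intro conjI allI impI)
      fix s assume "poly (D * C) s \<noteq> 0"
      hence "poly D s \<noteq> 0" "poly C s \<noteq> 0" by auto
      from e(3)[OF this] show "(F * K) (?l s) * poly (D * C) s = poly (N * M) s"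
        by (simp only: poly_mult times_fun_apply)
    qed (use N M in auto)
    ultimately show "F + K \<in> ?S" "F * K \<in> ?S" by blast+
  qed
  moreover have "const_funs \<subseteq> ?S"
  proof
    fix F :: "(nat \<Rightarrow> 'k) \<Rightarrow> 'k" assume "F \<in> const_funs"
    then obtain a where "F = (\<lambda>_. a)" by (auto simp: const_funs_def)
    hence "?Q F [:a:] 1" by simp
    thus "F \<in> ?S" by blast
  qed
  moreover have "set param_gens \<subseteq> ?S"
  proof
    fix F assume F: "F \<in> set param_gens"
    define L where "L = (\<Prod>k\<in>set ks. [:1 + p k, q k - p k:])"
    have L: "poly L 0 \<noteq> 0" "poly L 1 \<noteq> 0" "poly L s \<noteq> 0 \<Longrightarrow> admissible (?l s)" for s
      using p q by (auto simp: L_def poly_prod admissible_def algebra_simps)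
    from F consider k where "k \<in> set ks" "F = (\<lambda>p. reparam p k)"
      | k where "k \<in> set ks" "F = (\<lambda>p. inverse (1 + reparam p k))"
      by (auto simp: param_gens_def)
    thus "F \<in> ?S"
    proof cases
      case 1
      hence "?Q F (L * [:p k, q k - p k:]) L" using L by (simp add: reparam_admissible algebra_simps)
      thus ?thesis by blast
    next
      case 2
      have lin: "poly [:1 + p k, q k - p k:] s = 1 + ?l s k" for s by (simp add: algebra_simps)
      have "?Q F L (L * [:1 + p k, q k - p k:])"
      proof (intro conjI allI impI)
        show "poly (L * [:1 + p k, q k - p k:]) 0 \<noteq> 0" "poly (L * [:1 + p k, q k - p k:]) 1 \<noteq> 0"
          unfolding poly_mult lin using L p q 2 by (auto simp: admissible_def)
        fix s assume "poly (L * [:1 + p k, q k - p k:]) s \<noteq> 0"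
        hence s: "poly L s \<noteq> 0" "1 + ?l s k \<noteq> 0" unfolding poly_mult lin by auto
        show "F (?l s) * poly (L * [:1 + p k, q k - p k:]) s = poly L s"
          unfolding poly_mult lin 2(2) reparam_admissible[OF L(3)[OF s(1)]] using s(2) by (simp add: mult_ac)
      qed
      thus ?thesis by blast
    qed
  qed
  ultimately have "Params \<subseteq> ?S" unfolding Params_def by (rule adjoins_least)
  thus ?thesis using assms(1) by blast
qed

text \<open>If \<open>F\<close> is nonzero at one point and \<open>K\<close> at another, both restrict to nonzero rational
  functions on the line joining them, and these have a nonzero product.\<close>

lemma Params_domain:
  assumes F: "F \<in> Params" and K: "K \<in> Params" and FK: "F * K = 0"
  shows "F = 0 \<or> K = 0"
proof (rule ccontr)
  assume "\<not> (F = 0 \<or> K = 0)"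
  then obtain p q where "F p \<noteq> 0" "K q \<noteq> 0" by (auto simp: fun_eq_iff)
  hence pq: "F (reparam p) \<noteq> 0" "K (reparam q) \<noteq> 0" using Params_reparam[OF F, of p] Params_reparam[OF K, of q] by auto
  let ?l = "\<lambda>s k. reparam p k + s * (reparam q k - reparam p k)"
  obtain N D where D: "poly D 0 \<noteq> 0" "poly D 1 \<noteq> 0" "\<And>s. poly D s \<noteq> 0 \<Longrightarrow> F (?l s) * poly D s = poly N s"
    using Params_line[OF F admissible_reparam[of p] admissible_reparam[of q]] by blast
  obtain M C where C: "poly C 0 \<noteq> 0" "poly C 1 \<noteq> 0" "\<And>s. poly C s \<noteq> 0 \<Longrightarrow> K (?l s) * poly C s = poly M s"
    using Params_line[OF K admissible_reparam[of p] admissible_reparam[of q]] by blast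
  have "poly N 0 \<noteq> 0" using D(3)[of 0] D(1) pq(1) by auto
  moreover have "poly M 1 \<noteq> 0" using C(3)[of 1] C(2) pq(2) by auto
  ultimately have nz: "N * M \<noteq> 0" "D * C \<noteq> 0" using D(1) C(1) by auto
  have "poly (N * M) s = 0" if "poly (D * C) s \<noteq> 0" for s
  proof -
    have "(F * K) (?l s) = 0" unfolding FK by simp
    thus ?thesis using D(3)[of s, symmetric] C(3)[of s, symmetric] that by auto
  qed
  thus False using poly_zero_cofinite[OF nz(2)] nz(1) by blast
qed

lemma Params_curve_entry:
  assumes "k \<in> set ks"
  shows "(\<lambda>p. z k (reparam p k) $ i $ j) \<in> Params"
proof -
  have "(\<lambda>p. f (reparam p k)) \<in> Params" if "f \<in> func_alg {\<lambda>s. s, \<lambda>s. inverse (1 + s)}" for f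
    using that
  proof (induction rule: func_alg.induct)
    case (const a)
    show ?case by (rule Params_const)
  next
    case (gen f)
    thus ?case using assms by (intro Params_gen) (auto simp: param_gens_def image_iff)
  next
    case (add f g)
    thus ?case using unital_subringD(3)[OF Params_subring add.IH] by (simp add: plus_fun_def)
  next
    case (mult f g)
    thus ?case using unital_subringD(4)[OF Params_subring mult.IH] by (simp add: times_fun_def)
  qed
  from this[OF z_regular[OF assms]] show ?thesis .
qed

lemma sum_fun_apply: "(\<Sum>i\<in>I. f i) x = (\<Sum>i\<in>I. f i x)"
  by (induction I rule: infinite_finite_induct) auto

lemma Params_prod_entry: "(\<lambda>p. \<Phi> (reparam p) $ i $ j) \<in> Params"
proof -
  have "(\<lambda>p. curve_prod z ls (reparam p) $ i $ j) \<in> Params" if "set ls \<subseteq> set ks" for ls i j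
    using that
  proof (induction ls arbitrary: i j)
    case Nil
    show ?case using Params_const by simp
  next
    case (Cons l ls)
    have "(\<Sum>k\<in>UNIV. (\<lambda>p. z l (reparam p l) $ i $ k) * (\<lambda>p. curve_prod z ls (reparam p) $ k $ j)) \<in> Params"
      using Cons by (intro unital_subring_sum[OF Params_subring] unital_subringD(4)[OF Params_subring]
          Params_curve_entry) auto
    moreover have "(\<Sum>k\<in>UNIV. (\<lambda>p. z l (reparam p l) $ i $ k) * (\<lambda>p. curve_prod z ls (reparam p) $ k $ j))
       = (\<lambda>p. curve_prod z (l # ls) (reparam p) $ i $ j)"
      by (simp add: fun_eq_iff sum_fun_apply matrix_matrix_mult_def)
    ultimately show ?case by simp
  qed
  thus ?thesis by blast
qed

lemma prod_in_G: "\<Phi> (reparam p) \<in> G"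
  using curve_prod_in[OF admissible_reparam] H_sub by blast

lemma pullback_in_Params:
  assumes "g \<in> coord_ring"
  shows "pullback g \<in> Params"
proof -
  obtain f where f: "f \<in> matrix_polys" "g = (\<lambda>A. f (retr A))" using assms by (auto simp: coord_ring_eq)
  have "(\<lambda>p. f (\<Phi> (reparam p))) \<in> Params"
    using f(1)[unfolded matrix_polys_def]
  proof (induction rule: func_alg.induct)
    case (const a)
    show ?case by (rule Params_const)
  next
    case (gen f)
    thus ?case using Params_prod_entry by (auto simp: entry_funs_def)
  next
    case (add f g)
    thus ?case using unital_subringD(3)[OF Params_subring add.IH] by (simp add: plus_fun_def)
  next
    case (mult f g)
    thus ?case using unital_subringD(4)[OF Params_subring mult.IH] by (simp add: times_fun_def)
  qed
  moreover have "pullback g = (\<lambda>p. f (\<Phi> (reparam p)))"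
    using prod_in_G by (simp add: fun_eq_iff pullback_def f(2) retr_id)
  ultimately show ?thesis by simp
qed

lemma pullback_ring: "pullback (g + h) = pullback g + pullback h" "pullback (g * h) = pullback g * pullback h"
  "pullback (- g) = - pullback g" "pullback 1 = 1" "pullback (\<lambda>_. a) = (\<lambda>_. a)"
  by (simp_all add: fun_eq_iff pullback_def)

lemma pullback_subring: "unital_subring (pullback ` coord_ring)"
proof -
  have I: "pullback g \<in> pullback ` coord_ring" if "g \<in> coord_ring" for g using that by blast
  show ?thesis unfolding unital_subring_def
  proof (intro conjI ballI)
    show "1 \<in> pullback ` coord_ring" using I[OF unital_subringD(1)[OF coord_ring_subring]] by (simp only: pullback_ring)
    fix a assume "a \<in> pullback ` coord_ring"
    then obtain g where g: "g \<in> coord_ring" "a = pullback g" by blast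
    show "- a \<in> pullback ` coord_ring"
      using I[OF unital_subringD(5)[OF coord_ring_subring g(1)]] by (simp only: pullback_ring g(2))
    fix b assume "b \<in> pullback ` coord_ring"
    then obtain h where h: "h \<in> coord_ring" "b = pullback h" by blast
    show "a + b \<in> pullback ` coord_ring"
      using I[OF unital_subringD(3)[OF coord_ring_subring g(1) h(1)]] by (simp only: pullback_ring g(2) h(2))
    show "a * b \<in> pullback ` coord_ring"
      using I[OF unital_subringD(4)[OF coord_ring_subring g(1) h(1)]] by (simp only: pullback_ring g(2) h(2))
  qed
qed

lemma adjoins_pullback: "adjoins (pullback ` coord_ring) param_gens = Params"
proof
  show "adjoins (pullback ` coord_ring) param_gens \<subseteq> Params"
    using pullback_in_Params Params_gen by (intro adjoins_least Params_subring) auto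
  have "const_funs \<subseteq> pullback ` coord_ring"
  proof
    fix F :: "(nat \<Rightarrow> 'k) \<Rightarrow> 'k" assume "F \<in> const_funs"
    then obtain a where "F = pullback (\<lambda>_. a)" by (auto simp: const_funs_def pullback_ring)
    thus "F \<in> pullback ` coord_ring" using coord_ring_const by blast
  qed
  thus "Params \<subseteq> adjoins (pullback ` coord_ring) param_gens"
    unfolding Params_def using adjoins_base[OF pullback_subring] adjoins_gen[OF pullback_subring]
    by (intro adjoins_least adjoins_subring pullback_subring) blast+
qed

text \<open>Evaluation at \<open>A\<close> descends to the ring of pullbacks, because \<open>h\<close> kills the functions whose
  pullback is zero and \<open>h\<close> is nonzero at \<open>A\<close>. Its extension to the coordinate ring of the
  parameter space is evaluation at an admissible point \<open>q\<close>, with coordinates the images of the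
  coordinate functions, and this point is mapped to \<open>A\<close>.\<close>

lemma point_in_image:
  assumes h: "h \<in> coord_ring" "\<And>g. g \<in> coord_ring \<Longrightarrow> (\<And>p. admissible p \<Longrightarrow> g (\<Phi> p) = 0) \<Longrightarrow> h * g = 0"
    and a: "\<And>\<phi> :: ((nat \<Rightarrow> 'k) \<Rightarrow> 'k) \<Rightarrow> 'k. is_hom (pullback ` coord_ring) \<phi> \<Longrightarrow> \<phi> (pullback f) \<noteq> 0 \<Longrightarrow>
      \<exists>\<psi>. is_hom Params \<psi> \<and> (\<forall>c\<in>pullback ` coord_ring. \<psi> c = \<phi> c)"
    and f: "f \<in> coord_ring" and A: "A \<in> G" "f A \<noteq> 0" "h A \<noteq> 0"
  shows "\<exists>q. admissible q \<and> \<Phi> q = A"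
proof -
  define \<phi> where "\<phi> F = (SOME g. g \<in> coord_ring \<and> F = pullback g) A" for F
  have \<phi>: "\<phi> (pullback g) = g A" if g: "g \<in> coord_ring" for g
  proof -
    define g' where "g' = (SOME g'. g' \<in> coord_ring \<and> pullback g = pullback g')"
    have g': "g' \<in> coord_ring" "pullback g = pullback g'"
      using someI[of "\<lambda>g'. g' \<in> coord_ring \<and> pullback g = pullback g'" g] g by (auto simp: g'_def)
    have "h * (g - g') = 0"
    proof (rule h(2))
      show "g - g' \<in> coord_ring" by (intro unital_subringD[OF coord_ring_subring] g g')
      fix p assume "admissible p"
      thus "(g - g') (\<Phi> p) = 0" using fun_cong[OF g'(2), of p] by (simp add: pullback_def reparam_admissible)
    qed
    from fun_cong[OF this, of A] have "g' A = g A" using A(3) by simp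
    thus ?thesis by (simp add: \<phi>_def g'_def)
  qed
  have "is_hom (pullback ` coord_ring) \<phi>"
    unfolding is_hom_def
  proof (intro conjI ballI)
    show "\<phi> 1 = 1" using \<phi>[OF unital_subringD(1)[OF coord_ring_subring]] by (simp add: pullback_ring)
    fix a b assume "a \<in> pullback ` coord_ring" "b \<in> pullback ` coord_ring"
    then obtain g h where g: "g \<in> coord_ring" "a = pullback g" "h \<in> coord_ring" "b = pullback h" by blast
    show "\<phi> (a + b) = \<phi> a + \<phi> b"
      using \<phi>[OF unital_subringD(3)[OF coord_ring_subring g(1,3)]] \<phi>[OF g(1)] \<phi>[OF g(3)] g(2,4)
      by (simp add: pullback_ring)
    show "\<phi> (a * b) = \<phi> a * \<phi> b"
      using \<phi>[OF unital_subringD(4)[OF coord_ring_subring g(1,3)]] \<phi>[OF g(1)] \<phi>[OF g(3)] g(2,4)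
      by (simp add: pullback_ring)
  qed
  moreover have "\<phi> (pullback f) \<noteq> 0" using \<phi>[OF f] A(2) by simp
  ultimately obtain \<psi> where \<psi>: "is_hom Params \<psi>" "\<And>c. c \<in> pullback ` coord_ring \<Longrightarrow> \<psi> c = \<phi> c" using a by blast
  note hD = is_homD[OF Params_subring \<psi>(1)]
  have const: "\<psi> (\<lambda>_. a) = a" for a
    using \<psi>(2)[of "\<lambda>_. a"] \<phi>[OF coord_ring_const[of a]] coord_ring_const[of a] pullback_ring(5)[of a]
    by (metis image_eqI)
  define q where "q k = \<psi> (\<lambda>p. reparam p k)" for k
  have inv: "\<psi> (\<lambda>p. inverse (1 + reparam p k)) * (1 + q k) = 1" if k: "k \<in> set ks" for k
  proof -
    have v: "(\<lambda>p. reparam p k) \<in> Params" "(\<lambda>p. inverse (1 + reparam p k)) \<in> Params"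
      using k by (auto intro!: Params_gen simp: param_gens_def image_iff)
    have v1: "1 + (\<lambda>p. reparam p k) \<in> Params" by (intro unital_subringD[OF Params_subring] v)
    have "(\<lambda>p. inverse (1 + reparam p k)) * (1 + (\<lambda>p. reparam p k)) = 1"
      using admissible_reparam k by (auto simp: fun_eq_iff admissible_def)
    hence "\<psi> (\<lambda>p. inverse (1 + reparam p k)) * \<psi> (1 + (\<lambda>p. reparam p k)) = 1"
      using hD(4)[OF v(2) v1] hD(2) by simp
    moreover have "\<psi> (1 + (\<lambda>p. reparam p k)) = 1 + q k"
      using hD(3)[OF unital_subringD(1)[OF Params_subring] v(1)] hD(2) by (simp add: q_def)
    ultimately show ?thesis by simp
  qed
  hence q: "admissible q" unfolding admissible_def by force
  have ev: "\<psi> F = F q" if "F \<in> Params" for F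
  proof -
    let ?S = "{F \<in> Params. \<psi> F = F q}"
    have "unital_subring ?S"
      unfolding unital_subring_def
    proof (intro conjI ballI)
      show "1 \<in> ?S" using hD(2) unital_subringD(1)[OF Params_subring] by simp
      fix F assume F: "F \<in> ?S"
      have "\<psi> ((\<lambda>_. - 1) * F) = - \<psi> F" using hD(4)[OF Params_const[of "- 1"], of F] F const by simp
      moreover have "(\<lambda>_. - 1) * F = - F" by (simp add: fun_eq_iff)
      ultimately show "- F \<in> ?S" using F unital_subringD(5)[OF Params_subring] by simp
      fix K assume K: "K \<in> ?S"
      show "F + K \<in> ?S" "F * K \<in> ?S"
        using F K hD(3,4)[of F K] unital_subringD(3,4)[OF Params_subring, of F K] by auto
    qed
    moreover have "const_funs \<subseteq> ?S" using const Params_const by (auto simp: const_funs_def)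
    moreover have "set param_gens \<subseteq> ?S"
    proof
      fix F assume F: "F \<in> set param_gens"
      hence "F \<in> Params" by (rule Params_gen)
      moreover have "\<psi> F = F q"
      proof -
        from F consider k where "k \<in> set ks" "F = (\<lambda>p. reparam p k)"
          | k where "k \<in> set ks" "F = (\<lambda>p. inverse (1 + reparam p k))"
          by (auto simp: param_gens_def)
        thus ?thesis
        proof cases
          case 1
          thus ?thesis using q by (simp add: q_def reparam_admissible)
        next
          case 2
          from inv[OF this(1)] show ?thesis
            using 2(2) q by (simp add: reparam_admissible) (metis inverse_unique mult.commute)
        qed
      qed
      ultimately show "F \<in> ?S" by simp
    qed
    ultimately have "Params \<subseteq> ?S" unfolding Params_def by (rule adjoins_least)
    thus ?thesis using that by blast
  qed
  have "\<Phi> q $ i $ j = A $ i $ j" for i j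
  proof -
    let ?g = "\<lambda>A. retr A $ i $ j"
    have g: "?g \<in> coord_ring" by (rule coord_ring_poly[OF matrix_polys_closed(2)])
    have "pullback ?g q = \<psi> (pullback ?g)" using ev[OF pullback_in_Params[OF g]] by simp
    also have "\<dots> = A $ i $ j" using \<psi>(2)[of "pullback ?g"] \<phi>[OF g] g A(1) by (simp add: retr_id)
    finally show ?thesis using prod_in_G[of q] q by (simp add: pullback_def retr_id reparam_admissible)
  qed
  thus ?thesis using q by (auto simp: vec_eq_iff)
qed

lemma open_subset: "\<exists>f\<in>matrix_polys. (\<exists>A\<in>G. f A \<noteq> 0) \<and> (\<forall>A\<in>G. f A \<noteq> 0 \<longrightarrow> A \<in> H)"
proof -
  obtain h where h: "h \<in> coord_ring" "h (mat 1) = 1"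
    "\<And>g. g \<in> coord_ring \<Longrightarrow> (\<And>p. admissible p \<Longrightarrow> g (\<Phi> p) = 0) \<Longrightarrow> h * g = 0"
    using vanishing_denominator by blast
  have "\<exists>a\<in>pullback ` coord_ring. a \<noteq> 0 \<and> (\<forall>\<phi>::((nat \<Rightarrow> 'k) \<Rightarrow> 'k) \<Rightarrow> 'k. is_hom (pullback ` coord_ring) \<phi> \<and> \<phi> a \<noteq> 0 \<longrightarrow>
     (\<exists>\<psi>. is_hom (adjoins (pullback ` coord_ring) param_gens) \<psi> \<and> (\<forall>c\<in>pullback ` coord_ring. \<psi> c = \<phi> c) \<and> \<psi> 1 \<noteq> 0))"
  proof (rule hom_extension[OF pullback_subring])
    show "1 \<in> adjoins (pullback ` coord_ring) param_gens"
      unfolding adjoins_pullback by (rule unital_subringD(1)[OF Params_subring])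
    show "(1 :: (nat \<Rightarrow> 'k) \<Rightarrow> 'k) \<noteq> 0" by simp
  qed (use Params_domain adjoins_pullback in auto)
  then obtain f where f: "f \<in> coord_ring" "pullback f \<noteq> 0"
    and ext: "\<And>\<phi> :: ((nat \<Rightarrow> 'k) \<Rightarrow> 'k) \<Rightarrow> 'k. is_hom (pullback ` coord_ring) \<phi> \<Longrightarrow> \<phi> (pullback f) \<noteq> 0 \<Longrightarrow>
      \<exists>\<psi>. is_hom Params \<psi> \<and> (\<forall>c\<in>pullback ` coord_ring. \<psi> c = \<phi> c)"
    unfolding adjoins_pullback by blast
  have "f * h \<in> coord_ring" by (intro unital_subringD[OF coord_ring_subring] f h)
  then obtain g where g: "g \<in> matrix_polys" "f * h = (\<lambda>A. g (retr A))" by (auto simp: coord_ring_eq)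
  have gG: "g A = f A * h A" if "A \<in> G" for A using fun_cong[OF g(2), of A] that by (simp add: retr_id)
  have "pullback h (\<lambda>_. 0) \<noteq> 0"
  proof -
    have "admissible (\<lambda>_. 0)" by (simp add: admissible_def)
    moreover have "z k 0 = mat 1" if k: "k \<in> set ks" for k
    proof -
      have "z k 0 $ i $ j = (mat 1 :: 'k^'n^'n) $ i $ j" for i j
      proof -
        obtain d where d: "\<forall>v. scalar_jet (\<lambda>s. z k (s * v) $ i $ j) 1 (z k 0 $ i $ j) (v * d)"
          using scalar_jet_of_reparametrised[OF z_regular[OF k]] by blast
        have 1: "scalar_jet (\<lambda>s. z k s $ i $ j) 1 (z k 0 $ i $ j) d"
          using d[rule_format, of 1] unfolding mult_1 mult_1_right .
        have 2: "scalar_jet (\<lambda>s. z k s $ i $ j) 1 ((mat 1 :: 'k^'n^'n) $ i $ j) (E k $ i $ j)"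
          using z_jet[OF k] by (simp add: matrix_jet_def)
        show ?thesis by (rule scalar_jet_unique(1)[OF 1 2])
      qed
      thus ?thesis by (simp add: vec_eq_iff)
    qed
    hence "curve_prod z ls (\<lambda>_. 0) = mat 1" if "set ls \<subseteq> set ks" for ls
      using that by (induction ls) auto
    ultimately show ?thesis by (simp add: pullback_def reparam_admissible h(2))
  qed
  hence "pullback h \<noteq> 0" by (auto simp: fun_eq_iff)
  hence "pullback f * pullback h \<noteq> 0" using Params_domain pullback_in_Params f h(1) by blast
  then obtain p where "(pullback f * pullback h) p \<noteq> 0" by (auto simp: fun_eq_iff)
  hence "g (\<Phi> (reparam p)) \<noteq> 0" using gG[OF prod_in_G[of p]] by (simp add: pullback_def)
  moreover have "A \<in> H" if A: "A \<in> G" "g A \<noteq> 0" for A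
  proof -
    have "f A \<noteq> 0" "h A \<noteq> 0" using gG[OF A(1)] A(2) by auto
    then obtain q where "admissible q" "\<Phi> q = A" using point_in_image[OF h(1,3) ext f(1) A(1)] by blast
    thus ?thesis using curve_prod_in by blast
  qed
  ultimately show ?thesis using g(1) prod_in_G by blast
qed

text \<open>Let \<open>U\<close> be the open subset of \<open>H\<close>. Both \<open>H\<close> and its complement are unions of translates of
  \<open>U\<close>, by the elements of \<open>H\<close> and by those of the complement; so both are open, hence both are
  closed.\<close>

theorem H_eq_G: "H = G"
proof (rule ccontr)
  assume "H \<noteq> G"
  hence ne: "G - H \<noteq> {}" using H_sub by blast
  obtain f B where f: "f \<in> matrix_polys" "B \<in> G" "f B \<noteq> 0" and open_H: "\<And>A. A \<in> G \<Longrightarrow> f A \<noteq> 0 \<Longrightarrow> A \<in> H"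
    using open_subset by blast
  have BH: "B \<in> H" using open_H f by blast
  note Gr = matrix_subgroupD[OF G_group] and Hr = matrix_subgroupD[OF H_group]
  obtain F0 where F0: "F0 \<subseteq> matrix_polys" "G = {A. invertible A \<and> (\<forall>f\<in>F0. f A = 0)}"
    using G_closed unfolding zariski_closed_def by blast
  have closedI: "zariski_closed S" if S: "S \<subseteq> G"
    and disj: "\<And>g A. g \<in> G - S \<Longrightarrow> A \<in> S \<Longrightarrow> f (B ** matrix_inv g ** A) = 0" for S
    unfolding zariski_closed_def
  proof (intro exI conjI)
    let ?F = "F0 \<union> (\<lambda>g A. f (B ** matrix_inv g ** A)) ` (G - S)"
    have "(\<lambda>A. f (M ** A)) \<in> matrix_polys" for M
      using matrix_polys_mult_arg[OF f(1), of M "mat 1"] by simp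
    thus "?F \<subseteq> matrix_polys" using F0 by auto
    have sub: "A \<in> S" if A: "A \<in> G" "\<And>g. g \<in> G - S \<Longrightarrow> f (B ** matrix_inv g ** A) = 0" for A
    proof (rule ccontr)
      assume "A \<notin> S"
      hence "f (B ** matrix_inv A ** A) = 0" using A by blast
      thus False using f(3) Gr(5)[OF A(1)] by (simp add: matrix_mul_assoc[symmetric])
    qed
    show "S = {A. invertible A \<and> (\<forall>f\<in>?F. f A = 0)}"
    proof (intro subset_antisym subsetI)
      fix A assume A: "A \<in> S"
      have F0A: "f A = 0" if "f \<in> F0" for f using A S F0(2) that by blast
      have "invertible A" using A S F0(2) by blast
      moreover have "f' A = 0" if f': "f' \<in> ?F" for f'
      proof (cases "f' \<in> F0")
        case False
        then obtain g where g: "g \<in> G - S" "f' = (\<lambda>A. f (B ** matrix_inv g ** A))" using f' by auto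
        show ?thesis unfolding g(2) by (rule disj[OF g(1) A])
      qed (rule F0A)
      ultimately show "A \<in> {A. invertible A \<and> (\<forall>f\<in>?F. f A = 0)}" by simp
    next
      fix A assume "A \<in> {A. invertible A \<and> (\<forall>f\<in>?F. f A = 0)}"
      hence A: "invertible A" "\<forall>f\<in>?F. f A = 0" by simp_all
      have "\<forall>f\<in>F0. f A = 0" using A(2) unfolding ball_Un by (rule conjunct1)
      hence "A \<in> G" unfolding F0(2) using A(1) by simp
      moreover have "f (B ** matrix_inv g ** A) = 0" if "g \<in> G - S" for g
        using A(2) that unfolding ball_Un ball_simps by (rule bspec[OF conjunct2])
      ultimately show "A \<in> S" by (rule sub)
    qed
  qed
  have "zariski_closed H"
  proof (rule closedI[OF H_sub])
    fix g A assume g: "g \<in> G - H" and A: "A \<in> H"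
    show "f (B ** matrix_inv g ** A) = 0"
    proof (rule ccontr)
      assume nz: "f (B ** matrix_inv g ** A) \<noteq> 0"
      have "B ** matrix_inv g ** A \<in> G" using Gr(2,3) f(2) g A H_sub by blast
      hence BgA: "B ** matrix_inv g ** A \<in> H" using open_H nz by blast
      have "matrix_inv B ** (B ** matrix_inv g ** A) ** matrix_inv A \<in> H"
        by (rule Hr(2)[OF Hr(2)[OF Hr(3)[OF BH] BgA] Hr(3)[OF A]])
      moreover have "matrix_inv B ** (B ** matrix_inv g ** A) ** matrix_inv A = matrix_inv g"
      proof -
        have "matrix_inv B ** (B ** matrix_inv g ** A) ** matrix_inv A
            = (matrix_inv B ** B) ** matrix_inv g ** (A ** matrix_inv A)" by (simp only: matrix_mul_assoc)
        thus ?thesis using Hr(4)[OF A] Hr(5)[OF BH] by simp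
      qed
      ultimately have "matrix_inv g \<in> H" by simp
      hence "matrix_inv (matrix_inv g) \<in> H" by (rule Hr(3))
      moreover have "matrix_inv (matrix_inv g) = g" using matrix_inv_unique(2)[OF Gr(4)] g by blast
      ultimately show False using g by simp
    qed
  qed
  moreover have "zariski_closed (G - H)"
  proof (rule closedI)
    fix g A assume "g \<in> G - (G - H)" and A: "A \<in> G - H"
    hence g: "g \<in> H" by blast
    show "f (B ** matrix_inv g ** A) = 0"
    proof (rule ccontr)
      assume nz: "f (B ** matrix_inv g ** A) \<noteq> 0"
      have "B ** matrix_inv g ** A \<in> G" using Gr(2,3) f(2) g A H_sub by blast
      hence BgA: "B ** matrix_inv g ** A \<in> H" using open_H nz by blast
      have "(g ** matrix_inv B) ** (B ** matrix_inv g ** A) \<in> H"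
        by (rule Hr(2)[OF Hr(2)[OF g Hr(3)[OF BH]] BgA])
      moreover have "(g ** matrix_inv B) ** (B ** matrix_inv g ** A) = A"
      proof -
        have "(g ** matrix_inv B) ** (B ** matrix_inv g ** A)
            = g ** (matrix_inv B ** B) ** matrix_inv g ** A" by (simp only: matrix_mul_assoc)
        thus ?thesis using Hr(4)[OF g] Hr(5)[OF BH] by simp
      qed
      ultimately show False using A by simp
    qed
  qed auto
  moreover have "G \<inter> H \<noteq> {}" using Hr(1) Gr(1) by blast
  moreover have "G \<subseteq> H \<union> (G - H)" "G \<inter> H \<inter> (G - H) = {}" "G \<inter> (G - H) \<noteq> {}" using ne by auto
  ultimately show False using G_connected unfolding zariski_connected_def by blast
qed

end

text \<open>The tangent vectors of a minimal subfamily that still spans are independent, so they have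
  a dual system.\<close>

theorem generated_by_curves:
  fixes G H :: "('k::alg_closed_field^'n^'n) set" and z :: "nat \<Rightarrow> 'k \<Rightarrow> 'k^'n^'n"
  assumes G: "zariski_closed G" "zariski_connected G" "matrix_subgroup G"
    and H: "matrix_subgroup H" "H \<subseteq> G"
    and z: "\<And>k s. k < N \<Longrightarrow> 1 + s \<noteq> 0 \<Longrightarrow> z k s \<in> H"
      "\<And>k i j. k < N \<Longrightarrow> (\<lambda>s. z k s $ i $ j) \<in> func_alg {\<lambda>s. s, \<lambda>s. inverse (1 + s)}"
      "\<And>k. k < N \<Longrightarrow> matrix_jet (z k) 1 (E k)"
    and span: "\<And>X. X \<in> lie_algebra G \<Longrightarrow> \<exists>a. X = (\<Sum>k<N. mat (a k) ** E k)"
  shows "H = G"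
proof -
  define spans where "spans K \<longleftrightarrow> K \<subseteq> {..<N} \<and> (\<forall>X\<in>lie_algebra G. \<exists>a. X = (\<Sum>k\<in>K. mat (a k) ** E k))" for K
  define K where "K = arg_min card spans"
  have "spans {..<N}" using span by (auto simp: spans_def)
  hence K: "spans K" and min: "\<And>L. spans L \<Longrightarrow> card K \<le> card L"
    unfolding K_def using arg_min_natI[of spans "{..<N}" card] arg_min_nat_le[of spans _ card] by auto
  have KN: "K \<subseteq> {..<N}" and spanK: "\<And>X. X \<in> lie_algebra G \<Longrightarrow> \<exists>a. X = (\<Sum>k\<in>K. mat (a k) ** E k)"
    using K by (auto simp: spans_def)
  have finK: "finite K" using KN finite_subset by blast
  have indep: "\<nexists>a. E k = (\<Sum>l\<in>K - {k}. mat (a l) ** E l)" if k: "k \<in> K" for k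
  proof
    assume "\<exists>a. E k = (\<Sum>l\<in>K - {k}. mat (a l) ** E l)"
    then obtain a where a: "E k = (\<Sum>l\<in>K - {k}. mat (a l) ** E l)" by blast
    have "\<exists>b. X = (\<Sum>l\<in>K - {k}. mat (b l) ** E l)" if X: "X \<in> lie_algebra G" for X
    proof -
      obtain b where "X = (\<Sum>l\<in>K. mat (b l) ** E l)" using spanK[OF X] by blast
      hence "X = mat (b k) ** E k + (\<Sum>l\<in>K - {k}. mat (b l) ** E l)"
        by (simp add: sum.remove[OF finK k])
      hence "X = (\<Sum>l\<in>K - {k}. mat (b k * a l + b l) ** E l)"
        unfolding a by (simp add: vec_eq_iff scale_nth sum.distrib sum_distrib_left distrib_right mult.assoc)
      thus ?thesis by (rule exI[of _ "\<lambda>l. b k * a l + b l"])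
    qed
    hence "spans (K - {k})" using KN by (auto simp: spans_def)
    from min[OF this] show False using k finK by (metis card_Diff1_less not_le)
  qed
  have "\<exists>d. (\<forall>l\<in>K - {k}. pairing d (E l) = 0) \<and> pairing d (E k) = 1" if "k \<in> K" for k
    by (rule combination_functional[OF _ indep[OF that]]) (use finK in simp)
  then obtain c where c: "\<And>k. k \<in> K \<Longrightarrow> (\<forall>l\<in>K - {k}. pairing (c k) (E l) = 0) \<and> pairing (c k) (E k) = 1"
    by metis
  have dual: "pairing (c k) (E l) = (if k = l then 1 else 0)" if "k \<in> K" "l \<in> K" for k l
    using c[OF that(1)] that(2) by auto
  define ks where "ks = sorted_list_of_set K"
  have ks: "set ks = K" "distinct ks" using finK by (auto simp: ks_def)
  have "curve_family G H ks z E c"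
    by unfold_locales (use G H z dual spanK KN ks in auto)
  thus ?thesis by (rule curve_family.H_eq_G)
qed

section \<open>Rational functions on a group\<close>

text \<open>A function vanishing on the group vanishes along the curve, and the first nonconstant
  coefficient of its expansion is the pairing of its gradient with \<open>D\<close>.\<close>

lemma curve_in_lie_algebra:
  fixes G :: "('k::alg_closed_field^'n^'n) set"
  assumes m: "m \<ge> 1" and jet: "matrix_jet \<gamma> m D"
    and Q: "poly Q 0 \<noteq> 0" "\<And>s. poly Q s \<noteq> 0 \<Longrightarrow> \<gamma> s \<in> G"
  shows "D \<in> lie_algebra G"
  unfolding lie_algebra_eq
proof (intro CollectI ballI)
  fix c assume "c \<in> conormal G"
  then obtain f where f: "\<forall>A\<in>G. f A = 0" "has_gradient f c" by (auto simp: conormal_def)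
  have "scalar_jet (\<lambda>_. 0) m (f (mat 1)) (pairing c D)"
    by (rule scalar_jet_cong[OF has_gradientD[OF f(2) m jet] Q(1)]) (use f(1) Q(2) in auto)
  thus "pairing c D = 0" using scalar_jet_unique(2) scalar_jet_const[OF m, of 0] by blast
qed

lemma matrix_polys_prod:
  "(\<And>k. k \<in> I \<Longrightarrow> h k \<in> matrix_polys) \<Longrightarrow> (\<lambda>A. \<Prod>k\<in>I. h k A) \<in> matrix_polys"
  by (induction I rule: infinite_finite_induct) (auto intro: matrix_polys_closed)

lemma det_matrix_polys: "det \<in> matrix_polys"
proof -
  have "(\<lambda>A::'a::field^'b^'b. \<Sum>p\<in>{p. p permutes UNIV}. of_int (sign p) * (\<Prod>i\<in>UNIV. A $ i $ p i)) \<in> matrix_polys"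
    by (intro matrix_polys_closed matrix_polys_prod)
  thus ?thesis by (simp add: det_def[abs_def])
qed

text \<open>Quotients of polynomials with a denominator that has no zero on \<open>T\<close>. Unlike functions on
  \<open>T\<close>, these are defined along the lines \<open>1 + s X\<close>, which leave \<open>T\<close>.\<close>

definition locally_regular :: "('k::field^'n^'n) set \<Rightarrow> ('k^'n^'n \<Rightarrow> 'k) \<Rightarrow> bool" where
  "locally_regular T F \<longleftrightarrow> (\<exists>N\<in>matrix_polys. \<exists>D\<in>matrix_polys. (\<forall>A\<in>T. D A \<noteq> 0) \<and>
     (\<forall>A. D A \<noteq> 0 \<longrightarrow> F A * D A = N A))"

lemma locally_regular_poly: "f \<in> matrix_polys \<Longrightarrow> locally_regular T f"
  unfolding locally_regular_def by (intro bexI[of _ f] bexI[of _ "\<lambda>_. 1"] matrix_polys_closed) auto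

lemma locally_regular_add:
  assumes "locally_regular T f" "locally_regular T g"
  shows "locally_regular T (\<lambda>A. f A + g A)"
proof -
  obtain N D where N: "N \<in> matrix_polys" "D \<in> matrix_polys" "\<forall>A\<in>T. D A \<noteq> 0" "\<And>A. D A \<noteq> 0 \<Longrightarrow> N A = f A * D A"
    using assms(1) unfolding locally_regular_def by metis
  obtain M C where M: "M \<in> matrix_polys" "C \<in> matrix_polys" "\<forall>A\<in>T. C A \<noteq> 0" "\<And>A. C A \<noteq> 0 \<Longrightarrow> M A = g A * C A"
    using assms(2) unfolding locally_regular_def by metis
  show ?thesis unfolding locally_regular_def
    by (rule bexI[of _ "\<lambda>A. N A * C A + M A * D A"], rule bexI[of _ "\<lambda>A. D A * C A"])
      (use N M in \<open>auto simp: algebra_simps intro!: matrix_polys_closed\<close>)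
qed

lemma locally_regular_mult:
  assumes "locally_regular T f" "locally_regular T g"
  shows "locally_regular T (\<lambda>A. f A * g A)"
proof -
  obtain N D where N: "N \<in> matrix_polys" "D \<in> matrix_polys" "\<forall>A\<in>T. D A \<noteq> 0" "\<And>A. D A \<noteq> 0 \<Longrightarrow> N A = f A * D A"
    using assms(1) unfolding locally_regular_def by metis
  obtain M C where M: "M \<in> matrix_polys" "C \<in> matrix_polys" "\<forall>A\<in>T. C A \<noteq> 0" "\<And>A. C A \<noteq> 0 \<Longrightarrow> M A = g A * C A"
    using assms(2) unfolding locally_regular_def by metis
  show ?thesis unfolding locally_regular_def
    by (rule bexI[of _ "\<lambda>A. N A * M A"], rule bexI[of _ "\<lambda>A. D A * C A"])
      (use N M in \<open>auto simp: mult_ac intro!: matrix_polys_closed\<close>)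
qed

lemma locally_regular_inverse:
  assumes "locally_regular T f" "\<And>A. A \<in> T \<Longrightarrow> f A \<noteq> 0"
  shows "locally_regular T (\<lambda>A. inverse (f A))"
proof -
  obtain N D where N: "N \<in> matrix_polys" "D \<in> matrix_polys" "\<forall>A\<in>T. D A \<noteq> 0" "\<And>A. D A \<noteq> 0 \<Longrightarrow> N A = f A * D A"
    using assms(1) unfolding locally_regular_def by metis
  have "inverse (f A) * (N A * D A) = D A * D A" if "N A * D A \<noteq> 0" for A
    using N(4)[of A] that by auto
  thus ?thesis unfolding locally_regular_def
    by (intro bexI[of _ "\<lambda>A. D A * D A"] bexI[of _ "\<lambda>A. N A * D A"])
      (use N assms(2) in \<open>auto intro!: matrix_polys_closed\<close>)
qed

lemma GL_regular_locally_regular: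
  assumes "f \<in> GL_regular" "\<And>A. A \<in> T \<Longrightarrow> invertible A"
  shows "locally_regular T f"
  using assms(1)[unfolded GL_regular_def]
proof (induction rule: func_alg.induct)
  case (const c)
  show ?case by (intro locally_regular_poly matrix_polys_closed)
next
  case (gen f)
  then consider "f = (\<lambda>A. inverse (det A))" | "f \<in> entry_funs" by auto
  thus ?case
  proof cases
    case 1
    show ?thesis unfolding 1
      by (intro locally_regular_inverse locally_regular_poly det_matrix_polys)
        (use assms(2) invertible_det_nz in auto)
  next
    case 2
    thus ?thesis by (intro locally_regular_poly) (auto simp: entry_funs_def intro: matrix_polys_closed)
  qed
qed (auto intro: locally_regular_add locally_regular_mult)

text \<open>Functions vanishing on \<open>T\<close> have zero derivative in the directions of its Lie algebra, also
  for quotients: the numerator vanishes on \<open>T\<close>.\<close>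

lemma locally_regular_jet:
  fixes T :: "('k::alg_closed_field^'n^'n) set"
  assumes F: "locally_regular T F" and T: "mat 1 \<in> T"
  shows "\<exists>d. scalar_jet (\<lambda>s. F (mat 1 + mat s ** X)) 1 (F (mat 1)) d"
    "(\<And>A. A \<in> T \<Longrightarrow> F A = 0) \<Longrightarrow> X \<in> lie_algebra T \<Longrightarrow> scalar_jet (\<lambda>s. F (mat 1 + mat s ** X)) 1 0 0"
proof -
  obtain N D where N: "N \<in> matrix_polys" "D \<in> matrix_polys" "\<forall>A\<in>T. D A \<noteq> 0" "\<And>A. D A \<noteq> 0 \<Longrightarrow> N A = F A * D A"
    using F unfolding locally_regular_def by metis
  have D1: "D (mat 1) \<noteq> 0" using N T by blast
  obtain n where n: "has_gradient N n" using has_gradient_exists[OF N(1)] by blast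
  obtain d where d: "has_gradient D d" using has_gradient_exists[OF N(2)] by blast
  obtain p where p: "\<And>s. D (mat 1 + mat s ** X) = poly p s" using matrix_polys_line[OF N(2)] by blast
  have line0: "mat 1 + mat 0 ** X = mat 1" by simp
  have p0: "poly p 0 \<noteq> 0" using p[of 0] D1 unfolding line0 by simp
  have jN: "scalar_jet (\<lambda>s. N (mat 1 + mat s ** X)) 1 (N (mat 1)) (pairing n X)"
    using has_gradientD[OF n _ matrix_jet_line] by simp
  have jD: "scalar_jet (\<lambda>s. inverse (D (mat 1 + mat s ** X))) 1 (inverse (D (mat 1))) (- pairing d X / (D (mat 1))\<^sup>2)"
    using scalar_jet_inverse[OF has_gradientD[OF d _ matrix_jet_line]] D1 by simp
  have eq: "N (mat 1 + mat s ** X) * inverse (D (mat 1 + mat s ** X)) = F (mat 1 + mat s ** X)"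
    if "poly p s \<noteq> 0" for s
    using that N(4)[of "mat 1 + mat s ** X"] by (simp add: p)
  have eq1: "N (mat 1) * inverse (D (mat 1)) = F (mat 1)" using N(4)[OF D1] D1 by simp
  have J: "scalar_jet (\<lambda>s. F (mat 1 + mat s ** X)) 1 (F (mat 1))
      (N (mat 1) * (- pairing d X / (D (mat 1))\<^sup>2) + pairing n X * inverse (D (mat 1)))"
    using scalar_jet_cong[OF scalar_jet_mult[OF _ jN jD] p0 eq] unfolding eq1 by simp
  thus "\<exists>d. scalar_jet (\<lambda>s. F (mat 1 + mat s ** X)) 1 (F (mat 1)) d" by blast
  assume van: "\<And>A. A \<in> T \<Longrightarrow> F A = 0" and X: "X \<in> lie_algebra T"
  have "\<forall>A\<in>T. N A = 0" using N van by auto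
  hence "n \<in> conormal T" using N(1) n by (auto simp: conormal_def)
  hence "pairing n X = 0" using X by (auto simp: lie_algebra_eq)
  thus "scalar_jet (\<lambda>s. F (mat 1 + mat s ** X)) 1 0 0"
    using J \<open>\<forall>A\<in>T. N A = 0\<close> van[OF T] T by simp
qed

section \<open>Laurent curves and characters\<close>

lemma laurent_form:
  assumes "f \<in> func_alg {\<lambda>s::'k::field. s, inverse}"
  shows "\<exists>P K. \<forall>s. s \<noteq> 0 \<longrightarrow> f s * s ^ K = poly P s"
  using assms
proof (induction rule: func_alg.induct)
  case (const c)
  show ?case by (rule exI[of _ "[:c:]"], rule exI[of _ 0]) simp
next
  case (gen f)
  then consider "f = (\<lambda>s. s)" | "f = inverse" by auto
  thus ?case
  proof cases
    case 1
    thus ?thesis by (intro exI[of _ "[:0, 1:]"] exI[of _ 0]) simp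
  next
    case 2
    thus ?thesis by (intro exI[of _ "1"] exI[of _ 1]) simp
  qed
next
  case (add f g)
  then obtain P K Q L where h: "\<forall>s. s \<noteq> 0 \<longrightarrow> f s * s ^ K = poly P s" "\<forall>s. s \<noteq> 0 \<longrightarrow> g s * s ^ L = poly Q s"
    by blast
  show ?case
  proof (rule exI[of _ "P * monom 1 L + Q * monom 1 K"], rule exI[of _ "K + L"], intro allI impI)
    fix s :: 'k assume "s \<noteq> 0"
    hence "poly P s = f s * s ^ K" "poly Q s = g s * s ^ L" using h by auto
    thus "(f s + g s) * s ^ (K + L) = poly (P * monom 1 L + Q * monom 1 K) s"
      by (simp add: poly_monom power_add algebra_simps)
  qed
next
  case (mult f g)
  then obtain P K Q L where h: "\<forall>s. s \<noteq> 0 \<longrightarrow> f s * s ^ K = poly P s" "\<forall>s. s \<noteq> 0 \<longrightarrow> g s * s ^ L = poly Q s"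
    by blast
  show ?case
  proof (rule exI[of _ "P * Q"], rule exI[of _ "K + L"], intro allI impI)
    fix s :: 'k assume "s \<noteq> 0"
    hence "poly P s = f s * s ^ K" "poly Q s = g s * s ^ L" using h by auto
    thus "f s * g s * s ^ (K + L) = poly (P * Q) s"
      by (simp add: power_add algebra_simps)
  qed
qed

text \<open>A polynomial over an algebraically closed field without nonzero roots is a monomial.\<close>

lemma laurent_unit:
  fixes f :: "'k::alg_closed_field \<Rightarrow> 'k"
  assumes f: "g \<in> func_alg {\<lambda>s. s, inverse}" "\<And>s. s \<noteq> 0 \<Longrightarrow> f s = g s" and nz: "\<And>s. s \<noteq> 0 \<Longrightarrow> f s \<noteq> 0"
  shows "\<exists>c m. c \<noteq> 0 \<and> (\<forall>s. s \<noteq> 0 \<longrightarrow> f s = c * s powi m)"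
proof -
  obtain P K where P: "\<And>s. s \<noteq> 0 \<Longrightarrow> g s * s ^ K = poly P s" using laurent_form[OF f(1)] by blast
  have P0: "poly P s \<noteq> 0" if "s \<noteq> 0" for s using P[OF that] f(2)[OF that] nz[OF that] that by auto
  have "P \<noteq> 0" using P0[of 1] by auto
  then obtain Q where Q: "P = [:- 0, 1:] ^ Polynomial.order 0 P * Q" "\<not> [:- 0, 1:] dvd Q"
    using order_decomp by blast
  have "poly Q s \<noteq> 0" for s
  proof (cases "s = 0")
    case True
    thus ?thesis using Q(2) by (simp add: poly_eq_0_iff_dvd)
  next
    case False
    thus ?thesis using P0[OF False] by (subst (asm) Q(1)) auto
  qed
  hence "degree Q = 0" using alg_closed_imp_poly_has_root by blast
  then obtain c where c: "Q = [:c:]" by (auto elim: degree_eq_zeroE)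
  have "c \<noteq> 0" using \<open>\<And>s. poly Q s \<noteq> 0\<close> c by auto
  moreover have "f s = c * s powi (int (Polynomial.order 0 P) - int K)" if s: "s \<noteq> 0" for s
  proof -
    have "f s * s ^ K = s ^ Polynomial.order 0 P * c" using P[OF s] f(2)[OF s] by (subst (asm) Q(1)) (simp add: c)
    thus ?thesis using s by (simp add: power_int_diff field_simps)
  qed
  ultimately show ?thesis by blast
qed

lemma func_alg_inverse_arg:
  assumes "f \<in> func_alg {\<lambda>s::'k::field. s, inverse}"
  shows "(\<lambda>s. f (inverse s)) \<in> func_alg {\<lambda>s. s, inverse}"
  using assms by (induction rule: func_alg.induct) (auto intro: func_alg.intros)

lemma func_alg_closed:
  "(\<And>k. k \<in> I \<Longrightarrow> h k \<in> func_alg S) \<Longrightarrow> (\<lambda>A. \<Sum>k\<in>I. h k A) \<in> func_alg S"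
  "(\<And>k. k \<in> I \<Longrightarrow> h k \<in> func_alg S) \<Longrightarrow> (\<lambda>A. \<Prod>k\<in>I. h k A) \<in> func_alg S"
  by (induction I rule: infinite_finite_induct) (auto intro: func_alg.intros)

lemma func_alg_substitute:
  assumes f: "f \<in> matrix_polys" and e: "\<And>i j. (\<lambda>s. \<gamma> s $ i $ j) \<in> func_alg S"
  shows "(\<lambda>s. f (\<gamma> s)) \<in> func_alg S"
  using f[unfolded matrix_polys_def]
  by (induction rule: func_alg.induct) (auto simp: entry_funs_def intro: func_alg.intros e)

definition laurent_curve :: "('k::field \<Rightarrow> 'k^'n^'n) \<Rightarrow> bool" where
  "laurent_curve \<gamma> \<longleftrightarrow> (\<forall>i j. \<exists>f\<in>func_alg {\<lambda>s. s, inverse}. \<forall>s. s \<noteq> 0 \<longrightarrow> \<gamma> s $ i $ j = f s)"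

lemma laurent_curve_poly:
  assumes "f \<in> matrix_polys" "laurent_curve \<gamma>"
  shows "\<exists>g\<in>func_alg {\<lambda>s. s, inverse}. \<forall>s. s \<noteq> 0 \<longrightarrow> f (\<gamma> s) = g s"
proof -
  obtain e where e: "\<And>i j. e i j \<in> func_alg {\<lambda>s. s, inverse}" "\<And>i j s. s \<noteq> 0 \<Longrightarrow> \<gamma> s $ i $ j = e i j s"
    using assms(2) unfolding laurent_curve_def by metis
  define \<delta> where "\<delta> s = (\<chi> i j. e i j s)" for s
  have "(\<lambda>s. f (\<delta> s)) \<in> func_alg {\<lambda>s. s, inverse}"
    by (rule func_alg_substitute[OF assms(1)]) (simp add: \<delta>_def e(1))
  moreover have "\<gamma> s = \<delta> s" if "s \<noteq> 0" for s using e(2)[OF that] by (simp add: \<delta>_def vec_eq_iff)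
  ultimately show ?thesis by (intro bexI[of _ "\<lambda>s. f (\<delta> s)"]) auto
qed

lemma laurent_curve_mult:
  assumes "laurent_curve \<gamma>" "laurent_curve \<delta>"
  shows "laurent_curve (\<lambda>s. \<gamma> s ** \<delta> s)"
  unfolding laurent_curve_def
proof (intro allI)
  fix i j
  obtain e where e: "\<And>i j. e i j \<in> func_alg {\<lambda>s. s, inverse}" "\<And>i j s. s \<noteq> 0 \<Longrightarrow> \<gamma> s $ i $ j = e i j s"
    using assms(1) unfolding laurent_curve_def by metis
  obtain d where d: "\<And>i j. d i j \<in> func_alg {\<lambda>s. s, inverse}" "\<And>i j s. s \<noteq> 0 \<Longrightarrow> \<delta> s $ i $ j = d i j s"
    using assms(2) unfolding laurent_curve_def by metis
  show "\<exists>f\<in>func_alg {\<lambda>s. s, inverse}. \<forall>s. s \<noteq> 0 \<longrightarrow> (\<gamma> s ** \<delta> s) $ i $ j = f s"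
    by (rule bexI[of _ "\<lambda>s. \<Sum>k\<in>UNIV. e i k s * d k j s"])
      (auto simp: matrix_matrix_mult_def e(2) d(2) intro!: func_alg_closed func_alg.mult e d)
qed

lemma laurent_curve_inverse_arg:
  assumes "laurent_curve \<gamma>"
  shows "laurent_curve (\<lambda>s. \<gamma> (inverse s))"
  unfolding laurent_curve_def
proof (intro allI)
  fix i j
  obtain f where f: "f \<in> func_alg {\<lambda>s. s, inverse}" "\<And>s. s \<noteq> 0 \<Longrightarrow> \<gamma> s $ i $ j = f s"
    using assms unfolding laurent_curve_def by blast
  show "\<exists>f\<in>func_alg {\<lambda>s. s, inverse}. \<forall>s. s \<noteq> 0 \<longrightarrow> \<gamma> (inverse s) $ i $ j = f s"
    using f(2) by (intro bexI[OF _ func_alg_inverse_arg[OF f(1)]]) auto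
qed

lemma laurent_curve_of_poly:
  assumes p: "\<And>i j. \<exists>p. \<forall>\<xi>. u \<xi> $ i $ j = poly p \<xi>" and g: "g \<in> func_alg {\<lambda>s. s, inverse}"
  shows "laurent_curve (\<lambda>s. u (g s))"
  unfolding laurent_curve_def
proof (intro allI)
  fix i j
  obtain p where p: "\<forall>\<xi>. u \<xi> $ i $ j = poly p \<xi>" using p by blast
  have "(\<lambda>s. poly p (g s)) \<in> func_alg {\<lambda>s. s, inverse}"
  proof (induction p)
    case 0
    show ?case using func_alg.const[of 0] by simp
  next
    case (pCons a p)
    thus ?case using func_alg.add[OF func_alg.const[of a] func_alg.mult[OF g pCons.IH]] by simp
  qed
  thus "\<exists>f\<in>func_alg {\<lambda>s. s, inverse}. \<forall>s. s \<noteq> 0 \<longrightarrow> u (g s) $ i $ j = f s" using p by auto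
qed

text \<open>The character is a regular function without zeros, so its restriction is a Laurent
  polynomial without zeros. The inverse curve \<open>\<delta>\<close> serves to express the inverse of the
  determinant by a Laurent polynomial.\<close>

lemma character_along_curve:
  fixes T :: "('k::alg_closed_field^'n^'n) set"
  assumes a: "a \<in> characters T" and \<gamma>: "laurent_curve \<gamma>" "\<And>s. s \<noteq> 0 \<Longrightarrow> \<gamma> s \<in> T"
    and \<delta>: "laurent_curve \<delta>" "\<And>s. s \<noteq> 0 \<Longrightarrow> \<gamma> s ** \<delta> s = mat 1"
  shows "\<exists>c m. c \<noteq> 0 \<and> (\<forall>s. s \<noteq> 0 \<longrightarrow> a (\<gamma> s) = c * s powi m)"
proof -
  obtain h where h: "h \<in> GL_regular" "\<And>A. A \<in> T \<Longrightarrow> a A = h A"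
    using a by (auto simp: characters_def regular_on_def)
  have "\<exists>g\<in>func_alg {\<lambda>s. s, inverse}. \<forall>s. s \<noteq> 0 \<longrightarrow> h (\<gamma> s) = g s"
    using h(1)[unfolded GL_regular_def]
  proof (induction rule: func_alg.induct)
    case (const c)
    show ?case by (rule bexI[OF _ func_alg.const[of c]]) auto
  next
    case (gen f)
    then consider "f = (\<lambda>A. inverse (det A))" | "f \<in> matrix_polys"
      unfolding matrix_polys_def by (auto intro: func_alg.gen)
    thus ?case
    proof cases
      case 1
      obtain g where g: "g \<in> func_alg {\<lambda>s. s, inverse}" "\<forall>s. s \<noteq> 0 \<longrightarrow> det (\<delta> s) = g s"
        using laurent_curve_poly[OF det_matrix_polys \<delta>(1)] by blast
      have "inverse (det (\<gamma> s)) = det (\<delta> s)" if "s \<noteq> 0" for s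
      proof -
        have "det (\<gamma> s) * det (\<delta> s) = 1" using \<delta>(2)[OF that] by (metis det_I det_mul)
        thus ?thesis by (rule inverse_unique)
      qed
      thus ?thesis using g 1 by auto
    next
      case 2
      thus ?thesis by (rule laurent_curve_poly[OF _ \<gamma>(1)])
    qed
  next
    case (add f g)
    then obtain p q where "p \<in> func_alg {\<lambda>s. s, inverse}" "\<forall>s. s \<noteq> 0 \<longrightarrow> f (\<gamma> s) = p s"
      "q \<in> func_alg {\<lambda>s. s, inverse}" "\<forall>s. s \<noteq> 0 \<longrightarrow> g (\<gamma> s) = q s" by blast
    thus ?case by (intro bexI[OF _ func_alg.add[of p _ q]]) auto
  next
    case (mult f g)
    then obtain p q where "p \<in> func_alg {\<lambda>s. s, inverse}" "\<forall>s. s \<noteq> 0 \<longrightarrow> f (\<gamma> s) = p s"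
      "q \<in> func_alg {\<lambda>s. s, inverse}" "\<forall>s. s \<noteq> 0 \<longrightarrow> g (\<gamma> s) = q s" by blast
    thus ?case by (intro bexI[OF _ func_alg.mult[of p _ q]]) auto
  qed
  then obtain g where g: "g \<in> func_alg {\<lambda>s. s, inverse}" "\<forall>s. s \<noteq> 0 \<longrightarrow> h (\<gamma> s) = g s" by blast
  show ?thesis
    by (rule laurent_unit[OF g(1)]) (use g(2) h(2) \<gamma>(2) a in \<open>auto simp: characters_def\<close>)
qed

lemma matrix_add_rdistrib: "(A + B) ** (C :: 'a::semiring_1^'n^'m) = A ** C + B ** C"
  by (simp add: vec_eq_iff matrix_matrix_mult_def distrib_right sum.distrib)

section \<open>Tori\<close>

locale parametrised_torus =
  fixes T :: "('k::alg_closed_field^'n^'n) set" and r :: nat and \<phi> :: "(nat \<Rightarrow> 'k) \<Rightarrow> 'k^'n^'n"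
  assumes T_algebraic: "algebraic_group T"
    and bij: "bij_betw \<phi> (Gm_power r) T"
    and hom: "\<And>s t. s \<in> Gm_power r \<Longrightarrow> t \<in> Gm_power r \<Longrightarrow> \<phi> (\<lambda>i\<in>{..<r}. s i * t i) = \<phi> s ** \<phi> t"
    and regular: "\<And>i j. \<exists>f\<in>Gm_power_regular r. \<forall>s\<in>Gm_power r. \<phi> s $ i $ j = f s"
    and inverse_regular: "\<And>i. i < r \<Longrightarrow> regular_on T (\<lambda>A. the_inv_into (Gm_power r) \<phi> A i)"
begin

lemmas T_group = algebraic_group_matrix_subgroup(1)[OF T_algebraic]

lemma in_T: "s \<in> Gm_power r \<Longrightarrow> \<phi> s \<in> T"
  using bij by (auto simp: bij_betw_def)

lemma T_obtain: assumes "A \<in> T" obtains s where "s \<in> Gm_power r" "A = \<phi> s"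
  using bij assms by (auto simp: bij_betw_def)

definition one_vec :: "nat \<Rightarrow> 'k" where "one_vec = (\<lambda>i\<in>{..<r}. 1)"

text \<open>The one-parameter subgroup in the \<open>j\<close>-th coordinate.\<close>

definition upd :: "nat \<Rightarrow> 'k \<Rightarrow> nat \<Rightarrow> 'k" where
  "upd j s = (\<lambda>i\<in>{..<r}. if i = j then s else 1)"

lemma Gm_one: "one_vec \<in> Gm_power r" and Gm_upd: "s \<noteq> 0 \<Longrightarrow> upd j s \<in> Gm_power r"
  by (auto simp: one_vec_def upd_def Gm_power_def)

lemma phi_one: "\<phi> one_vec = mat 1"
proof -
  have "(\<lambda>i\<in>{..<r}. one_vec i * one_vec i) = one_vec" by (auto simp: one_vec_def fun_eq_iff)
  hence "\<phi> one_vec = \<phi> one_vec ** \<phi> one_vec" using hom[OF Gm_one Gm_one] by simp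
  thus ?thesis using matrix_subgroupD(5)[OF T_group in_T[OF Gm_one]]
    by (metis matrix_mul_assoc matrix_mul_lid)
qed

lemma T_commutative:
  assumes "A \<in> T" "B \<in> T"
  shows "A ** B = B ** A"
proof -
  obtain s t where s: "s \<in> Gm_power r" "A = \<phi> s" and t: "t \<in> Gm_power r" "B = \<phi> t"
    using assms T_obtain by metis
  show ?thesis unfolding s t hom[OF s(1) t(1), symmetric] hom[OF t(1) s(1), symmetric]
    by (simp add: mult.commute)
qed

lemma upd_laurent: "laurent_curve (\<lambda>s. \<phi> (upd j s))"
  unfolding laurent_curve_def
proof (intro allI)
  fix i k
  obtain f where f: "f \<in> Gm_power_regular r" "\<forall>s\<in>Gm_power r. \<phi> s $ i $ k = f s" using regular by blast
  have "(\<lambda>s. f (upd j s)) \<in> func_alg {\<lambda>s. s, inverse}"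
    using f(1)[unfolded Gm_power_regular_def]
  proof (induction rule: func_alg.induct)
    case (gen f)
    then obtain l where l: "l < r" "f = (\<lambda>s. s l) \<or> f = (\<lambda>s. inverse (s l))" by auto
    have 1: "(\<lambda>s. s) \<in> func_alg {\<lambda>s::'k. s, inverse}" "(\<lambda>s. inverse s) \<in> func_alg {\<lambda>s::'k. s, inverse}"
      "(\<lambda>s. 1) \<in> func_alg {\<lambda>s::'k. s, inverse}" by (auto intro: func_alg.intros)
    show ?case using l 1 by (cases "l = j") (auto simp: upd_def)
  qed (auto intro: func_alg.intros)
  thus "\<exists>f\<in>func_alg {\<lambda>s. s, inverse}. \<forall>s. s \<noteq> 0 \<longrightarrow> \<phi> (upd j s) $ i $ k = f s"
    using f(2) Gm_upd by (intro bexI[of _ "\<lambda>s. f (upd j s)"]) auto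
qed

text \<open>The restriction of a character to a coordinate subgroup is a power map. If all exponents
  were zero the character would be trivial on the products of these subgroups, which is all of
  \<open>T\<close>; a nonzero exponent allows roots to be extracted.\<close>

lemma character_surjective:
  assumes a: "a \<in> characters T" and t: "t \<in> T" "a t \<noteq> 1" and y: "y \<noteq> 0"
  shows "\<exists>s\<in>T. a s = y"
proof -
  have mult: "a (A ** B) = a A * a B" if "A \<in> T" "B \<in> T" for A B
    using a that by (auto simp: characters_def)
  have nz: "a A \<noteq> 0" if "A \<in> T" for A using a that by (auto simp: characters_def)
  have a1: "a (mat 1) = 1"
    using mult[of "mat 1" "mat 1"] nz matrix_subgroupD(1)[OF T_group] by simp
  have inv: "\<phi> (upd j s) ** \<phi> (upd j (inverse s)) = mat 1" if "s \<noteq> 0" for s j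
  proof -
    have "(\<lambda>i\<in>{..<r}. upd j s i * upd j (inverse s) i) = one_vec"
      using that by (auto simp: upd_def one_vec_def fun_eq_iff)
    thus ?thesis using hom[OF Gm_upd Gm_upd, of s "inverse s" j j] that phi_one by simp
  qed
  have "\<exists>m. \<forall>s. s \<noteq> 0 \<longrightarrow> a (\<phi> (upd j s)) = s powi m" for j
  proof -
    obtain c m where cm: "\<And>s. s \<noteq> 0 \<Longrightarrow> a (\<phi> (upd j s)) = c * s powi m"
      using character_along_curve[OF a upd_laurent in_T[OF Gm_upd] laurent_curve_inverse_arg[OF upd_laurent] inv]
      by blast
    have "upd j 1 = one_vec" by (auto simp: upd_def one_vec_def fun_eq_iff)
    hence "c = 1" using cm[of 1] phi_one a1 by simp
    thus ?thesis using cm by auto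
  qed
  then obtain m where m: "\<And>j s. s \<noteq> 0 \<Longrightarrow> a (\<phi> (upd j s)) = s powi m j" by metis
  have "\<exists>j. m j \<noteq> 0"
  proof (rule ccontr)
    assume "\<not> (\<exists>j. m j \<noteq> 0)"
    hence triv: "a (\<phi> (upd j s)) = 1" if "s \<noteq> 0" for j s using m[OF that] by simp
    obtain s where s: "s \<in> Gm_power r" "t = \<phi> s" using T_obtain[OF t(1)] by blast
    define part where "part n = (\<lambda>i\<in>{..<r}. if i < n then s i else 1)" for n
    have snz: "s i \<noteq> 0" if "i < r" for i using s(1) that by (auto simp: Gm_power_def)
    have Gp: "part n \<in> Gm_power r" for n using snz by (auto simp: part_def Gm_power_def)
    have "a (\<phi> (part n)) = 1" for n
    proof (induction n)
      case 0
      have "part 0 = one_vec" by (auto simp: part_def one_vec_def fun_eq_iff)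
      thus ?case using phi_one a1 by simp
    next
      case (Suc n)
      show ?case
      proof (cases "n < r")
        case True
        have "part (Suc n) = (\<lambda>i\<in>{..<r}. part n i * upd n (s n) i)"
          by (auto simp: part_def upd_def fun_eq_iff)
        hence "\<phi> (part (Suc n)) = \<phi> (part n) ** \<phi> (upd n (s n))"
          using hom[OF Gp Gm_upd[OF snz[OF True]]] by simp
        thus ?thesis using mult[OF in_T[OF Gp] in_T[OF Gm_upd[OF snz[OF True]]]] Suc triv[OF snz[OF True]]
          by simp
      next
        case False
        hence "part (Suc n) = part n" by (auto simp: part_def fun_eq_iff)
        thus ?thesis using Suc by simp
      qed
    qed
    moreover have "part r = s" using s(1) by (auto simp: part_def fun_eq_iff Gm_power_def PiE_def extensional_def)
    ultimately show False using t(2) s(2) by metis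
  qed
  then obtain j where j: "m j \<noteq> 0" by blast
  obtain w where w: "w ^ nat \<bar>m j\<bar> = (if m j > 0 then y else inverse y)"
    using nth_root_exists[of "nat \<bar>m j\<bar>"] j by fastforce
  have "w \<noteq> 0"
  proof
    assume "w = 0"
    moreover have "nat \<bar>m j\<bar> \<noteq> 0" using j by simp
    ultimately have "(if m j > 0 then y else inverse y) = 0" using w by (metis power_0_left)
    thus False using y by (auto split: if_splits)
  qed
  moreover have "w powi m j = y"
    using w j by (cases "m j > 0") (auto simp: power_int_def power_inverse)
  ultimately have "a (\<phi> (upd j w)) = y" using m by simp
  thus ?thesis using in_T[OF Gm_upd[OF \<open>w \<noteq> 0\<close>]] by blast
qed

text \<open>Commuting with \<open>t\<close> is a linear equation that holds on \<open>T\<close>, so it holds on the Lie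
  algebra.\<close>

lemma lie_T_weight_zero:
  assumes X: "X \<in> lie_algebra T" and t: "t \<in> T"
  shows "t ** X = X ** t"
proof -
  have "(t ** X) $ i $ j = (X ** t) $ i $ j" for i j
  proof -
    define f where "f A = (\<Sum>k\<in>UNIV. t $ i $ k * A $ k $ j) + - 1 * (\<Sum>k\<in>UNIV. A $ i $ k * t $ k $ j)" for A :: "'k^'n^'n"
    have f: "f \<in> matrix_polys" unfolding f_def by (intro matrix_polys_closed)
    have f_eq: "f A = (t ** A) $ i $ j - (A ** t) $ i $ j" for A by (simp add: f_def matrix_matrix_mult_def)
    have "\<forall>A\<in>T. f A = 0" using T_commutative[OF t] by (simp add: f_eq)
    then obtain p where p: "\<And>s. f (mat 1 + mat s ** X) = poly p s" "coeff p 1 = 0"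
      using X f unfolding lie_algebra_def by blast
    have sc: "mat s ** X ** t = mat s ** (X ** t)" "t ** (mat s ** X) = mat s ** (t ** X)" for s
    proof -
      show "mat s ** X ** t = mat s ** (X ** t)" by (simp add: matrix_mul_assoc)
      show "t ** (mat s ** X) = mat s ** (t ** X)"
        by (simp add: vec_eq_iff scale_nth)
          (simp add: matrix_matrix_mult_def[of t] scale_nth sum_distrib_left mult_ac)
    qed
    have "f (mat 1 + mat s ** X) = s * ((t ** X) $ i $ j - (X ** t) $ i $ j)" for s
      unfolding f_eq by (simp add: matrix_add_ldistrib matrix_add_rdistrib sc scale_nth algebra_simps)
    hence "poly p s = poly [:0, (t ** X) $ i $ j - (X ** t) $ i $ j:] s" for s using p(1) by simp
    hence "p = [:0, (t ** X) $ i $ j - (X ** t) $ i $ j:]" by (intro poly_eq_cofinite[of 1]) auto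
    thus ?thesis using p(2) by simp
  qed
  thus ?thesis by (simp add: vec_eq_iff)
qed

text \<open>The chain rule for regular functions on a product of multiplicative groups, along curves
  that start at the neutral element.\<close>

lemma Gm_gradient:
  assumes "g \<in> Gm_power_regular r"
  shows "\<exists>c. \<forall>\<sigma> \<xi>. (\<forall>i<r. scalar_jet (\<lambda>s. \<sigma> s i) 1 1 (\<xi> i)) \<longrightarrow>
    scalar_jet (\<lambda>s. g (\<sigma> s)) 1 (g one_vec) (\<Sum>i<r. c i * \<xi> i)"
  using assms[unfolded Gm_power_regular_def]
proof (induction rule: func_alg.induct)
  case (const a)
  show ?case by (rule exI[of _ "\<lambda>_. 0"]) (auto intro: scalar_jet_const)
next
  case (gen g)
  then consider l where "l < r" "g = (\<lambda>s. s l)" | l where "l < r" "g = (\<lambda>s. inverse (s l))" by auto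
  thus ?case
  proof cases
    case 1
    thus ?thesis by (intro exI[of _ "\<lambda>i. if i = l then 1 else 0"])
        (auto simp: one_vec_def if_distrib[of "\<lambda>x. x * _"] cong: if_cong)
  next
    case 2
    have "scalar_jet (\<lambda>s. inverse (\<sigma> s l)) 1 1 (- \<xi> l)" if "\<forall>i<r. scalar_jet (\<lambda>s. \<sigma> s i) 1 1 (\<xi> i)"
      for \<sigma> :: "'k \<Rightarrow> nat \<Rightarrow> 'k" and \<xi>
      using scalar_jet_inverse[of "\<lambda>s. \<sigma> s l" 1 "\<xi> l"] that 2(1) by simp
    thus ?thesis using 2 by (intro exI[of _ "\<lambda>i. if i = l then - 1 else 0"])
        (auto simp: one_vec_def if_distrib[of "\<lambda>x. x * _"] cong: if_cong)
  qed
next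
  case (add f g)
  then obtain c d where c: "\<forall>\<sigma> \<xi>. (\<forall>i<r. scalar_jet (\<lambda>s. \<sigma> s i) 1 1 (\<xi> i)) \<longrightarrow>
    scalar_jet (\<lambda>s. f (\<sigma> s)) 1 (f one_vec) (\<Sum>i<r. c i * \<xi> i)"
    and d: "\<forall>\<sigma> \<xi>. (\<forall>i<r. scalar_jet (\<lambda>s. \<sigma> s i) 1 1 (\<xi> i)) \<longrightarrow>
    scalar_jet (\<lambda>s. g (\<sigma> s)) 1 (g one_vec) (\<Sum>i<r. d i * \<xi> i)" by blast
  show ?case
  proof (intro exI[of _ "\<lambda>i. c i + d i"] allI impI)
    fix \<sigma> :: "'k \<Rightarrow> nat \<Rightarrow> 'k" and \<xi> assume "\<forall>i<r. scalar_jet (\<lambda>s. \<sigma> s i) 1 1 (\<xi> i)"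
    from scalar_jet_add[OF c[rule_format, of \<sigma> \<xi>] d[rule_format, of \<sigma> \<xi>]] this
    show "scalar_jet (\<lambda>s. f (\<sigma> s) + g (\<sigma> s)) 1 (f one_vec + g one_vec) (\<Sum>i<r. (c i + d i) * \<xi> i)"
      by (simp add: distrib_right sum.distrib)
  qed
next
  case (mult f g)
  then obtain c d where c: "\<forall>\<sigma> \<xi>. (\<forall>i<r. scalar_jet (\<lambda>s. \<sigma> s i) 1 1 (\<xi> i)) \<longrightarrow>
    scalar_jet (\<lambda>s. f (\<sigma> s)) 1 (f one_vec) (\<Sum>i<r. c i * \<xi> i)"
    and d: "\<forall>\<sigma> \<xi>. (\<forall>i<r. scalar_jet (\<lambda>s. \<sigma> s i) 1 1 (\<xi> i)) \<longrightarrow>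
    scalar_jet (\<lambda>s. g (\<sigma> s)) 1 (g one_vec) (\<Sum>i<r. d i * \<xi> i)" by blast
  show ?case
  proof (intro exI[of _ "\<lambda>i. f one_vec * d i + c i * g one_vec"] allI impI)
    fix \<sigma> :: "'k \<Rightarrow> nat \<Rightarrow> 'k" and \<xi> assume J: "\<forall>i<r. scalar_jet (\<lambda>s. \<sigma> s i) 1 1 (\<xi> i)"
    have "scalar_jet (\<lambda>s. f (\<sigma> s) * g (\<sigma> s)) 1 (f one_vec * g one_vec)
        (f one_vec * (\<Sum>i<r. d i * \<xi> i) + (\<Sum>i<r. c i * \<xi> i) * g one_vec)"
      using scalar_jet_mult[OF _ c[rule_format, of \<sigma> \<xi>] d[rule_format, of \<sigma> \<xi>]] J by simp
    moreover have "f one_vec * (\<Sum>i<r. d i * \<xi> i) + (\<Sum>i<r. c i * \<xi> i) * g one_vec =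
        (\<Sum>i<r. (f one_vec * d i + c i * g one_vec) * \<xi> i)"
      by (simp add: sum_distrib_left sum_distrib_right sum.distrib algebra_simps)
    ultimately show "scalar_jet (\<lambda>s. f (\<sigma> s) * g (\<sigma> s)) 1 (f one_vec * g one_vec)
        (\<Sum>i<r. (f one_vec * d i + c i * g one_vec) * \<xi> i)" by simp
  qed
qed

lemma func_alg_upd:
  assumes "f \<in> Gm_power_regular r"
  shows "(\<lambda>s. f (upd j (1 + s))) \<in> func_alg {\<lambda>s. s, \<lambda>s. inverse (1 + s)}"
  using assms[unfolded Gm_power_regular_def]
proof (induction rule: func_alg.induct)
  case (gen f)
  then obtain l where l: "l < r" "f = (\<lambda>s. s l) \<or> f = (\<lambda>s. inverse (s l))" by auto
  have "(\<lambda>s. 1 + s) \<in> func_alg {\<lambda>s::'k. s, \<lambda>s. inverse (1 + s)}" "(\<lambda>s. inverse (1 + s)) \<in> func_alg {\<lambda>s::'k. s, \<lambda>s. inverse (1 + s)}"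
    "(\<lambda>s. 1) \<in> func_alg {\<lambda>s::'k. s, \<lambda>s. inverse (1 + s)}" by (auto intro: func_alg.intros)
  thus ?case using l by (cases "l = j") (auto simp: upd_def)
qed (auto intro: func_alg.intros)

lemma upd_jet: "i < r \<Longrightarrow> scalar_jet (\<lambda>s. upd j (1 + s) i) 1 1 (if i = j then 1 else 0)"
  using scalar_jet_poly[of "[:1, 1:]"] by (auto simp: upd_def intro: scalar_jet_const)

text \<open>The curves \<open>s \<mapsto> \<phi>(1, \<dots>, 1 + s, \<dots>, 1)\<close> span the Lie algebra of \<open>T\<close>. Otherwise some linear
  form \<open>d\<close> vanishes on their tangent vectors but not on \<open>X\<close>. Expressed in the coordinates of
  \<open>T\<close>, which are regular functions of the matrix, this form has zero derivative in every
  direction; along \<open>1 + s X\<close> this contradicts \<open>d(X) = 1\<close>.\<close>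

lemma torus_curves:
  "\<exists>z E. (\<forall>k s. 1 + s \<noteq> 0 \<longrightarrow> z k s \<in> T) \<and>
     (\<forall>k i j. (\<lambda>s. z k s $ i $ j) \<in> func_alg {\<lambda>s. s, \<lambda>s. inverse (1 + s)}) \<and>
     (\<forall>k. matrix_jet (z k) 1 (E k)) \<and>
     (\<forall>X\<in>lie_algebra T. \<exists>a. X = (\<Sum>k<r. mat (a k) ** E k))"
proof -
  obtain f where f: "\<And>i j. f i j \<in> Gm_power_regular r" "\<And>i j s. s \<in> Gm_power r \<Longrightarrow> \<phi> s $ i $ j = f i j s"
    using regular by metis
  define z where "z k s = (\<chi> i j. f i j (upd k (1 + s)))" for k s
  have z_eq: "z k s = \<phi> (upd k (1 + s))" if "1 + s \<noteq> 0" for k s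
    using f(2)[OF Gm_upd[OF that]] by (simp add: z_def vec_eq_iff)
  obtain c where c: "\<And>i j \<sigma> \<xi>. (\<And>l. l < r \<Longrightarrow> scalar_jet (\<lambda>s. \<sigma> s l) 1 1 (\<xi> l)) \<Longrightarrow>
    scalar_jet (\<lambda>s. f i j (\<sigma> s)) 1 (f i j one_vec) (\<Sum>l<r. c i j l * \<xi> l)"
    using Gm_gradient[OF f(1)] by metis
  define E where "E k = (\<chi> i j. \<Sum>l<r. c i j l * (if l = k then 1 else 0))" for k
  have jet: "matrix_jet (z k) 1 (E k)" for k
    unfolding matrix_jet_def
  proof (intro allI)
    fix i j
    have "f i j one_vec = (mat 1 :: 'k^'n^'n) $ i $ j" using f(2)[OF Gm_one] phi_one by metis
    thus "scalar_jet (\<lambda>s. z k s $ i $ j) 1 ((mat 1 :: 'k^'n^'n) $ i $ j) (E k $ i $ j)"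
      using c[of "\<lambda>s. upd k (1 + s)" "\<lambda>l. if l = k then 1 else 0" i j, OF upd_jet] by (simp add: z_def E_def)
  qed
  have span: "\<exists>a. X = (\<Sum>k<r. mat (a k) ** E k)" if X: "X \<in> lie_algebra T" for X
  proof (rule ccontr)
    assume nX: "\<nexists>a. X = (\<Sum>k<r. mat (a k) ** E k)"
    obtain d where dE: "\<And>k. k < r \<Longrightarrow> pairing d (E k) = 0" and dX: "pairing d X = 1"
      using combination_functional[OF _ nX] by auto
    \<comment> \<open>the linear form as a function of the matrix, and as a function of the coordinates\<close>
    define L where "L A = pairing d (A - mat 1)" for A
    define g where "g s = (\<Sum>i\<in>UNIV. \<Sum>j\<in>UNIV. d $ i $ j * (f i j s + - (mat 1 :: 'k^'n^'n) $ i $ j))" for s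
    have g: "g \<in> Gm_power_regular r"
      unfolding g_def Gm_power_regular_def
      by (intro func_alg_closed func_alg.mult func_alg.add func_alg.const f(1)[unfolded Gm_power_regular_def])
    have Lg: "L (\<phi> s) = g s" if "s \<in> Gm_power r" for s
      by (simp add: L_def g_def pairing_def f(2)[OF that])
    obtain e where e: "\<And>\<sigma> \<xi>. (\<And>l. l < r \<Longrightarrow> scalar_jet (\<lambda>s. \<sigma> s l) 1 1 (\<xi> l)) \<Longrightarrow>
        scalar_jet (\<lambda>s. g (\<sigma> s)) 1 (g one_vec) (\<Sum>l<r. e l * \<xi> l)"
      using Gm_gradient[OF g] by metis
    have L_poly: "L \<in> matrix_polys"
      unfolding L_def[abs_def] pairing_def vector_minus_component
      unfolding diff_conv_add_uminus by (intro matrix_polys_closed)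
    obtain dl where dl: "has_gradient L dl" using has_gradient_exists[OF L_poly] by blast
    have L_line: "scalar_jet (\<lambda>s. L (mat 1 + mat s ** Y)) 1 0 (pairing d Y)" for Y
      using scalar_jet_poly[of "[:0, pairing d Y:]"] by (simp add: L_def pairing_scale)
    have dl_eq: "pairing dl Y = pairing d Y" for Y
      by (rule scalar_jet_unique(2)[OF has_gradientD[OF dl _ matrix_jet_line] L_line]) simp
    have e0: "e k = 0" if "k < r" for k
    proof -
      have 1: "scalar_jet (\<lambda>s. g (upd k (1 + s))) 1 (g one_vec) (\<Sum>l<r. e l * (if l = k then 1 else 0))"
        by (rule e) (rule upd_jet)
      have "scalar_jet (\<lambda>s. L (z k s)) 1 (L (mat 1)) (pairing dl (E k))"
        using has_gradientD[OF dl _ jet] by simp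
      hence 2: "scalar_jet (\<lambda>s. g (upd k (1 + s))) 1 (L (mat 1)) (pairing dl (E k))"
      proof (rule scalar_jet_cong)
        show "poly [:1, 1:] (0::'k) \<noteq> 0" by simp
        fix s :: 'k assume "poly [:1, 1:] s \<noteq> 0"
        thus "L (z k s) = g (upd k (1 + s))" using z_eq Lg[OF Gm_upd] by simp
      qed
      have "(\<Sum>l<r. e l * (if l = k then 1 else 0)) = e k"
        using that by (simp add: if_distrib[of "\<lambda>x. _ * x"] cong: if_cong)
      thus ?thesis using scalar_jet_unique(2)[OF 1 2] dE[OF that] dl_eq by simp
    qed
    obtain h where h: "\<And>i. i < r \<Longrightarrow> h i \<in> GL_regular"
      "\<And>i A. i < r \<Longrightarrow> A \<in> T \<Longrightarrow> the_inv_into (Gm_power r) \<phi> A i = h i A"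
      using inverse_regular unfolding regular_on_def by metis
    have inj: "inj_on \<phi> (Gm_power r)" using bij by (simp add: bij_betw_def)
    have h_phi: "h i (\<phi> s) = s i" if "i < r" "s \<in> Gm_power r" for i s
      using h(2)[OF that(1) in_T[OF that(2)]] the_inv_into_f_f[OF inj that(2)] by simp
    have T1: "mat 1 \<in> T" by (rule matrix_subgroupD(1)[OF T_group])
    have h_reg: "locally_regular T (h i)" if "i < r" for i
      by (rule GL_regular_locally_regular[OF h(1)[OF that] matrix_subgroupD(6)[OF T_group]])
    have h_nz: "h i A \<noteq> 0" if i: "i < r" and A: "A \<in> T" for i A
    proof -
      obtain s where "s \<in> Gm_power r" "A = \<phi> s" using T_obtain[OF A] by blast
      thus ?thesis using h_phi[OF i] i by (auto simp: Gm_power_def)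
    qed
    define hv where "hv A = (\<lambda>i\<in>{..<r}. h i A)" for A
    have gh_reg: "locally_regular T (\<lambda>A. g (hv A))"
      using g[unfolded Gm_power_regular_def]
    proof (induction rule: func_alg.induct)
      case (const a)
      show ?case by (intro locally_regular_poly matrix_polys_closed)
    next
      case (gen g)
      then obtain l where l: "l < r" "g = (\<lambda>s. s l) \<or> g = (\<lambda>s. inverse (s l))" by auto
      thus ?case using h_reg[OF l(1)] locally_regular_inverse[OF h_reg[OF l(1)] h_nz[OF l(1)]]
        by (auto simp: hv_def)
    qed (auto intro: locally_regular_add locally_regular_mult)
    have h1: "h i (mat 1) = 1" if "i < r" for i
      using h_phi[OF that Gm_one] phi_one that by (simp add: one_vec_def)
    have "\<exists>\<xi>. scalar_jet (\<lambda>s. h i (mat 1 + mat s ** X)) 1 1 \<xi>" if "i < r" for i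
      using locally_regular_jet(1)[OF h_reg[OF that] T1, of X] h1[OF that] by simp
    then obtain \<xi> where \<xi>: "\<And>i. i < r \<Longrightarrow> scalar_jet (\<lambda>s. h i (mat 1 + mat s ** X)) 1 1 (\<xi> i)" by metis
    have "scalar_jet (\<lambda>s. hv (mat 1 + mat s ** X) l) 1 1 (\<xi> l)" if "l < r" for l
      using \<xi>[OF that] that by (simp add: hv_def)
    hence "scalar_jet (\<lambda>s. g (hv (mat 1 + mat s ** X))) 1 (g one_vec) (\<Sum>l<r. e l * \<xi> l)" by (rule e)
    hence J1: "scalar_jet (\<lambda>s. g (hv (mat 1 + mat s ** X))) 1 (g one_vec) 0" using e0 by simp
    have "locally_regular T (\<lambda>A. L A + (- 1) * g (hv A))"
      by (intro locally_regular_add locally_regular_mult gh_reg locally_regular_poly L_poly matrix_polys_closed)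
    moreover have "L A + (- 1) * g (hv A) = 0" if A: "A \<in> T" for A
    proof -
      obtain s where s: "s \<in> Gm_power r" "A = \<phi> s" using T_obtain[OF A] by blast
      have "hv A = s" using h_phi[OF _ s(1)] s by (auto simp: hv_def fun_eq_iff Gm_power_def PiE_def extensional_def)
      thus ?thesis using Lg[OF s(1)] s(2) by simp
    qed
    ultimately have J2: "scalar_jet (\<lambda>s. L (mat 1 + mat s ** X) + (- 1) * g (hv (mat 1 + mat s ** X))) 1 0 0"
      by (intro locally_regular_jet(2)[OF _ T1 _ X]) auto
    have "scalar_jet (\<lambda>s. L (mat 1 + mat s ** X)) 1 (0 + g one_vec) (0 + 0)"
      using scalar_jet_add[OF J2 J1] by simp
    from scalar_jet_unique(2)[OF this L_line] dX show False by simp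
  qed
  show ?thesis
  proof (intro exI[of _ z] exI[of _ E] conjI allI impI ballI)
    fix k s assume "1 + s \<noteq> (0::'k)"
    thus "z k s \<in> T" using z_eq in_T[OF Gm_upd] by simp
  next
    fix k i j
    show "(\<lambda>s. z k s $ i $ j) \<in> func_alg {\<lambda>s. s, \<lambda>s. inverse (1 + s)}"
      using func_alg_upd[OF f(1)] by (simp add: z_def)
  qed (use jet span in auto)
qed

end

lemma torus_parametrised:
  fixes T :: "('k::alg_closed_field^'n^'n) set"
  assumes "torus T"
  shows "\<exists>r \<phi>. parametrised_torus T r \<phi>"
proof -
  obtain r \<phi> where "algebraic_group T" "bij_betw \<phi> (Gm_power r) T"
    "\<forall>s\<in>Gm_power r. \<forall>t\<in>Gm_power r. \<phi> (\<lambda>i\<in>{..<r}. s i * t i) = \<phi> s ** \<phi> t"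
    "\<forall>i j. \<exists>f\<in>Gm_power_regular r. \<forall>s\<in>Gm_power r. \<phi> s $ i $ j = f s"
    "\<forall>i<r. regular_on T (\<lambda>A. the_inv_into (Gm_power r) \<phi> A i)"
    using assms unfolding torus_def by blast
  hence "parametrised_torus T r \<phi>" by unfold_locales auto
  thus ?thesis by blast
qed

section \<open>The root lattice of D4\<close>

text \<open>The Gram matrix in the basis of simple roots is the Cartan matrix, which makes the form
  invariant under the Weyl group.\<close>

definition d4_form :: "(d4_node \<Rightarrow> int) \<Rightarrow> (d4_node \<Rightarrow> int) \<Rightarrow> int" where
  "d4_form c d = 2 * (c N1 * d N1 + c N2 * d N2 + c N3 * d N3 + c N4 * d N4)
     - c N2 * (d N1 + d N3 + d N4) - d N2 * (c N1 + c N3 + c N4)"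

definition simple_vec :: "d4_node \<Rightarrow> d4_node \<Rightarrow> int" where
  "simple_vec i = (\<lambda>j. if j = i then 1 else 0)"

definition scale_vec :: "int \<Rightarrow> (d4_node \<Rightarrow> int) \<Rightarrow> d4_node \<Rightarrow> int" where
  "scale_vec m c = (\<lambda>i. m * c i)"

definition reflect :: "d4_node \<Rightarrow> (d4_node \<Rightarrow> int) \<Rightarrow> d4_node \<Rightarrow> int" where
  "reflect j c = c - scale_vec (d4_form c (simple_vec j)) (simple_vec j)"

lemma vec_apply [simp]: "scale_vec m c i = m * c i" "simple_vec i j = (if j = i then 1 else 0)"
  by (simp_all add: scale_vec_def simple_vec_def)

lemma d4_form_simps: "d4_form (c + d) e = d4_form c e + d4_form d e"
  "d4_form (c - d) e = d4_form c e - d4_form d e"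
  "d4_form (scale_vec m c) e = m * d4_form c e" "d4_form (- c) e = - d4_form c e"
  "d4_form e (c + d) = d4_form e c + d4_form e d"
  "d4_form e (c - d) = d4_form e c - d4_form e d"
  "d4_form e (scale_vec m c) = m * d4_form e c" "d4_form e (- c) = - d4_form e c"
  "d4_form 0 c = 0" "d4_form c 0 = 0"
  by (simp_all add: d4_form_def algebra_simps)

lemma d4_form_sym: "d4_form c d = d4_form d c"
  by (simp add: d4_form_def algebra_simps)

lemma d4_form_simple: "d4_form (simple_vec i) (simple_vec j) = d4_cartan i j"
  by (cases i; cases j) (auto simp: d4_form_def d4_cartan_def)

lemma d4_roots_simple: "simple_vec i \<in> d4_roots"
  unfolding simple_vec_def by (rule d4_roots.simple)

lemma reflect_eq: "reflect j c = c(j := c j - (\<Sum>i\<in>UNIV. c i * d4_cartan i j))"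
proof -
  have "(\<Sum>i\<in>UNIV. c i * d4_cartan i j) = d4_form c (simple_vec j)"
    unfolding UNIV_d4_node by (cases j) (auto simp: d4_cartan_def d4_form_def)
  thus ?thesis by (auto simp: reflect_def fun_eq_iff)
qed

lemma d4_roots_reflect: "c \<in> d4_roots \<Longrightarrow> reflect j c \<in> d4_roots"
  unfolding reflect_eq by (rule d4_roots.reflection)

lemma d4_roots_induct [consumes 1, case_names simple reflect]:
  assumes "c \<in> d4_roots" "\<And>i. P (simple_vec i)" "\<And>c j. c \<in> d4_roots \<Longrightarrow> P c \<Longrightarrow> P (reflect j c)"
  shows "P c"
  using assms(1)
proof (induction rule: d4_roots.induct)
  case (simple i)
  show ?case using assms(2) unfolding simple_vec_def .
next
  case (reflection c j)
  show ?case using assms(3)[OF reflection] unfolding reflect_eq .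
qed

lemma d4_form_simple_self: "d4_form (simple_vec j) (simple_vec j) = 2"
  by (simp add: d4_form_simple d4_cartan_def)

lemma d4_form_reflect: "d4_form (reflect j c) (reflect j d) = d4_form c d"
  by (simp add: reflect_def d4_form_simps d4_form_simple_self d4_form_sym[of "simple_vec j"] algebra_simps)

lemma d4_roots_norm: "c \<in> d4_roots \<Longrightarrow> d4_form c c = 2"
  by (induction rule: d4_roots_induct) (simp_all only: d4_form_simple_self d4_form_reflect)

text \<open>The completion of squares that shows the form to be positive definite.\<close>

lemma d4_form_squares:
  "2 * d4_form c c = (2 * c N1 - c N2)\<^sup>2 + (2 * c N3 - c N2)\<^sup>2 + (2 * c N4 - c N2)\<^sup>2 + (c N2)\<^sup>2"
  by (simp add: d4_form_def power2_eq_square algebra_simps)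

lemma d4_form_pos: "d4_form c c \<ge> 0" "d4_form c c = 0 \<Longrightarrow> c = 0"
proof -
  show "d4_form c c \<ge> 0" using d4_form_squares[of c] by (smt (verit) zero_le_power2)
  assume "d4_form c c = 0"
  hence 0: "(2 * c N1 - c N2)\<^sup>2 + (2 * c N3 - c N2)\<^sup>2 + (2 * c N4 - c N2)\<^sup>2 + (c N2)\<^sup>2 = 0"
    using d4_form_squares[of c] by simp
  have nn: "0 \<le> (2 * c N1 - c N2)\<^sup>2" "0 \<le> (2 * c N3 - c N2)\<^sup>2" "0 \<le> (2 * c N4 - c N2)\<^sup>2" "0 \<le> (c N2)\<^sup>2" by simp_all
  have "(c N2)\<^sup>2 = 0" "(2 * c N1 - c N2)\<^sup>2 = 0" "(2 * c N3 - c N2)\<^sup>2 = 0" "(2 * c N4 - c N2)\<^sup>2 = 0"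
    using 0 nn by linarith+
  hence "c i = 0" for i by (cases i) auto
  thus "c = 0" by (simp add: fun_eq_iff)
qed

text \<open>The form is positive and even.\<close>

lemma d4_form_ge_2: "c \<noteq> 0 \<Longrightarrow> d4_form c c \<ge> 2"
proof -
  assume "c \<noteq> 0"
  hence "d4_form c c > 0" using d4_form_pos[of c] by (metis order_le_less)
  moreover have "even (d4_form c c)"
  proof -
    have "d4_form c c = 2 * (c N1 * c N1 + c N2 * c N2 + c N3 * c N3 + c N4 * c N4 - c N2 * (c N1 + c N3 + c N4))"
      by (simp add: d4_form_def algebra_simps)
    thus ?thesis by simp
  qed
  ultimately show ?thesis by presburger
qed

text \<open>The vector \<open>a + b\<close> is nonzero, so its square length \<open>4 + 2(a, b)\<close> is at least 2.\<close>

lemma root_pair_form: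
  assumes "a \<in> d4_roots" "b \<in> d4_roots" "b \<noteq> - a"
  shows "d4_form a b \<ge> - 1"
proof -
  have "a + b \<noteq> 0" using assms(3) by (metis add_eq_0_iff)
  hence "d4_form (a + b) (a + b) \<ge> 2" by (rule d4_form_ge_2)
  thus ?thesis using assms d4_roots_norm by (simp add: d4_form_simps d4_form_sym[of b a])
qed

text \<open>The square length of \<open>i a + j b\<close> is at least \<open>2 (i - j)\<^sup>2 + 2 i j\<close>, since the product of
  \<open>a\<close> and \<open>b\<close> is at least \<open>- 1\<close>. This replaces the inspection of root strings.\<close>

lemma root_combination:
  assumes a: "a \<in> d4_roots" and b: "b \<in> d4_roots" "b \<noteq> - a" and ij: "i \<ge> 1" "j \<ge> 1"
  shows "scale_vec i a + scale_vec j b \<noteq> 0"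
    "scale_vec i a + scale_vec j b \<in> d4_roots \<Longrightarrow> i = 1 \<and> j = 1"
proof -
  have "d4_form (scale_vec i a + scale_vec j b) (scale_vec i a + scale_vec j b)
      = 2 * i\<^sup>2 + 2 * j\<^sup>2 + 2 * (i * j * d4_form a b)"
    using d4_roots_norm[OF a] d4_roots_norm[OF b(1)]
    by (simp add: d4_form_simps d4_form_sym[of b a] power2_eq_square algebra_simps)
  moreover have "i * j * d4_form a b \<ge> i * j * (- 1)"
    using root_pair_form[OF a b] ij by (intro mult_left_mono) auto
  ultimately have ge: "d4_form (scale_vec i a + scale_vec j b) (scale_vec i a + scale_vec j b)
      \<ge> 2 * (i - j)\<^sup>2 + 2 * (i * j)" by (simp add: power2_eq_square algebra_simps)
  have p: "i * j \<ge> 1" "i * j \<ge> i" "i * j \<ge> j"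
    using ij mult_mono[of 1 i 1 j] mult_left_mono[of 1 j i] mult_right_mono[of 1 i j] by auto
  show "scale_vec i a + scale_vec j b \<noteq> 0"
  proof
    assume "scale_vec i a + scale_vec j b = 0"
    hence "0 \<ge> 2 * (i - j)\<^sup>2 + 2 * (i * j)" using ge d4_form_simps(9)[of 0] by simp
    thus False using p(1) by (smt (verit) zero_le_power2)
  qed
  assume "scale_vec i a + scale_vec j b \<in> d4_roots"
  hence "2 \<ge> 2 * (i - j)\<^sup>2 + 2 * (i * j)" using ge d4_roots_norm by simp
  hence "i * j \<le> 1" by (smt (verit) zero_le_power2)
  thus "i = 1 \<and> j = 1" using p ij by linarith
qed

lemma root_multiple:
  assumes "c \<in> d4_roots"
  shows "scale_vec m c = 0 \<Longrightarrow> m = 0" "scale_vec m c \<in> d4_roots \<Longrightarrow> m = 1 \<or> m = - 1"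
proof -
  have "d4_form (scale_vec m c) (scale_vec m c) = 2 * m\<^sup>2"
    using d4_roots_norm[OF assms] by (simp add: d4_form_simps power2_eq_square)
  thus "scale_vec m c = 0 \<Longrightarrow> m = 0" "scale_vec m c \<in> d4_roots \<Longrightarrow> m = 1 \<or> m = - 1"
    using d4_roots_norm[of "scale_vec m c"] by (auto simp: d4_form_simps power2_eq_1_iff)
qed

definition positive :: "(d4_node \<Rightarrow> int) \<Rightarrow> bool" where
  "positive c \<longleftrightarrow> c \<in> d4_roots \<and> (\<forall>i. c i \<ge> 0)"

text \<open>Write \<open>c = p - q\<close> with the positive and negative parts. Their product is at most 0,
  because distinct simple roots have nonpositive products, so the square lengths of \<open>p\<close> and \<open>q\<close>
  add up to at most 2; as \<open>p\<close> is nonzero, \<open>q\<close> is zero.\<close>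

lemma root_sign:
  assumes c: "c \<in> d4_roots" and j: "c j > 0"
  shows "positive c"
proof -
  define p n where "p = (\<lambda>i. max (c i) 0)" and "n = (\<lambda>i. max (- c i) 0)"
  have cpn: "c = p - n" by (auto simp: p_def n_def fun_eq_iff)
  have pn: "p i \<ge> 0" "n i \<ge> 0" "p i * n i = 0" for i by (auto simp: p_def n_def max_def)
  have "d4_form p n \<le> 0"
  proof -
    have "d4_form p n = 2 * (p N1 * n N1 + p N2 * n N2 + p N3 * n N3 + p N4 * n N4)
       - p N2 * (n N1 + n N3 + n N4) - n N2 * (p N1 + p N3 + p N4)" by (simp add: d4_form_def)
    moreover have "p N2 * (n N1 + n N3 + n N4) \<ge> 0" "n N2 * (p N1 + p N3 + p N4) \<ge> 0" using pn by auto
    ultimately show ?thesis using pn(3) by simp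
  qed
  moreover have "d4_form c c = d4_form p p + d4_form n n - 2 * d4_form p n"
    unfolding cpn by (simp add: d4_form_simps d4_form_sym[of n p])
  moreover have "p \<noteq> 0" using j by (auto simp: p_def fun_eq_iff intro!: exI[of _ j])
  hence "d4_form p p \<ge> 2" by (rule d4_form_ge_2)
  ultimately have "d4_form n n < 2" using d4_roots_norm[OF c] by linarith
  hence "n = 0" using d4_form_ge_2[of n] by linarith
  hence "c i \<ge> 0" for i using pn(2)[of i] fun_cong[OF \<open>n = 0\<close>, of i] unfolding n_def by simp
  thus ?thesis using c by (simp add: positive_def)
qed

lemma root_neg: "c \<in> d4_roots \<Longrightarrow> - c \<in> d4_roots"
proof (induction rule: d4_roots_induct)
  case (simple i)
  have "reflect i (simple_vec i) = - simple_vec i"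
    by (auto simp: reflect_def d4_form_simple_self fun_eq_iff)
  thus ?case using d4_roots_reflect[OF d4_roots_simple[of i], of i] by (simp only:)
next
  case (reflect c j)
  have "- reflect j c = reflect j (- c)" by (auto simp: reflect_def d4_form_simps fun_eq_iff)
  thus ?case using d4_roots_reflect[OF reflect.IH] by (simp only:)
qed

lemma root_dichotomy: "c \<in> d4_roots \<Longrightarrow> positive c \<or> positive (- c)"
proof -
  assume c: "c \<in> d4_roots"
  hence "c \<noteq> 0" using d4_roots_norm[of c] by (auto simp: d4_form_simps)
  then obtain j where "c j \<noteq> 0" by (auto simp: fun_eq_iff)
  thus ?thesis using root_sign[OF c, of j] root_sign[OF root_neg[OF c], of j] by (cases "c j > 0") auto
qed

text \<open>A reflection changes only one coordinate, and some other coordinate of \<open>c\<close> is positive.\<close>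

lemma reflect_positive:
  assumes "positive c" "c \<noteq> simple_vec j"
  shows "positive (reflect j c)"
proof -
  have c: "c \<in> d4_roots" "\<And>i. c i \<ge> 0" using assms(1) by (auto simp: positive_def)
  have "\<exists>i. i \<noteq> j \<and> c i > 0"
  proof (rule ccontr)
    assume "\<not> (\<exists>i. i \<noteq> j \<and> c i > 0)"
    hence "c i = 0" if "i \<noteq> j" for i using c(2)[of i] that by force
    hence "c = scale_vec (c j) (simple_vec j)" by (intro ext) simp
    moreover from this have "c j = 1 \<or> c j = - 1" using root_multiple(2)[OF d4_roots_simple] c(1) by metis
    hence "c j = 1" using c(2)[of j] by linarith
    ultimately show False using assms(2) by (simp add: fun_eq_iff)
  qed
  then obtain i where "i \<noteq> j" "c i > 0" by blast
  hence "reflect j c i > 0" by (simp add: reflect_def)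
  thus ?thesis by (rule root_sign[OF d4_roots_reflect[OF c(1)]])
qed

lemma reflect_simple: "reflect j (simple_vec j) = - simple_vec j"
  by (auto simp: reflect_def d4_form_simple_self fun_eq_iff)

lemma reflect_reflect: "reflect j (reflect j c) = c"
  by (auto simp: reflect_def d4_form_simps d4_form_simple_self fun_eq_iff)

lemma reflect_add: "reflect j (c + d) = reflect j c + reflect j d"
  and reflect_minus: "reflect j (- c) = - reflect j c"
  by (auto simp: reflect_def d4_form_simps fun_eq_iff algebra_simps)

section \<open>Polynomial curves\<close>

definition poly_curve :: "('k::field \<Rightarrow> 'k^'n^'n) \<Rightarrow> bool" where
  "poly_curve f \<longleftrightarrow> (\<forall>i j. \<exists>p. \<forall>\<xi>. f \<xi> $ i $ j = poly p \<xi>)"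

definition entry_poly :: "('k::field \<Rightarrow> 'k^'n^'n) \<Rightarrow> 'n \<Rightarrow> 'n \<Rightarrow> 'k poly" where
  "entry_poly f i j = (SOME p. \<forall>\<xi>. f \<xi> $ i $ j = poly p \<xi>)"

definition curve_coeff :: "('k::field \<Rightarrow> 'k^'n^'n) \<Rightarrow> nat \<Rightarrow> 'k^'n^'n" where
  "curve_coeff f m = (\<chi> i j. coeff (entry_poly f i j) m)"

lemma entry_poly: "poly_curve f \<Longrightarrow> f \<xi> $ i $ j = poly (entry_poly f i j) \<xi>"
  using someI_ex[of "\<lambda>p. \<forall>\<xi>. f \<xi> $ i $ j = poly p \<xi>"] unfolding poly_curve_def entry_poly_def by blast

lemma entry_poly_unique:
  fixes f :: "'k::alg_closed_field \<Rightarrow> 'k^'n^'n"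
  assumes "\<And>\<xi>. f \<xi> $ i $ j = poly p \<xi>"
  shows "entry_poly f i j = p"
proof -
  have "\<forall>\<xi>. f \<xi> $ i $ j = poly (entry_poly f i j) \<xi>"
    unfolding entry_poly_def by (rule someI_ex) (use assms in blast)
  thus ?thesis using assms by (intro poly_eq_cofinite[of 1]) auto
qed

lemma curve_coeff_eqI:
  fixes f :: "'k::alg_closed_field \<Rightarrow> 'k^'n^'n"
  assumes "\<And>i j \<xi>. f \<xi> $ i $ j = poly (p i j) \<xi>"
  shows "poly_curve f" "curve_coeff f m = (\<chi> i j. coeff (p i j) m)"
proof -
  show "poly_curve f" using assms unfolding poly_curve_def by blast
  have "entry_poly f i j = p i j" for i j using assms by (intro entry_poly_unique)
  thus "curve_coeff f m = (\<chi> i j. coeff (p i j) m)" by (simp add: curve_coeff_def)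
qed

lemma poly_curve_mult:
  fixes f g :: "'k::alg_closed_field \<Rightarrow> 'k^'n^'n"
  assumes "poly_curve f" "poly_curve g"
  shows "poly_curve (\<lambda>\<xi>. f \<xi> ** g \<xi>)"
    "f 0 = mat 1 \<Longrightarrow> g 0 = mat 1 \<Longrightarrow> curve_coeff (\<lambda>\<xi>. f \<xi> ** g \<xi>) 1 = curve_coeff f 1 + curve_coeff g 1"
proof -
  let ?p = "\<lambda>i j. \<Sum>k\<in>UNIV. entry_poly f i k * entry_poly g k j"
  have e: "(f \<xi> ** g \<xi>) $ i $ j = poly (?p i j) \<xi>" for i j \<xi>
    by (simp add: matrix_matrix_mult_def poly_sum entry_poly[OF assms(1)] entry_poly[OF assms(2)])
  show "poly_curve (\<lambda>\<xi>. f \<xi> ** g \<xi>)" by (rule curve_coeff_eqI(1)[OF e])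
  assume 0: "f 0 = mat 1" "g 0 = mat 1"
  have c0: "coeff (entry_poly f i j) 0 = (mat 1 :: 'k^'n^'n) $ i $ j"
    "coeff (entry_poly g i j) 0 = (mat 1 :: 'k^'n^'n) $ i $ j" for i j
    using entry_poly[OF assms(1), of 0 i j] entry_poly[OF assms(2), of 0 i j] 0
    by (simp_all add: poly_0_coeff_0)
  have "curve_coeff (\<lambda>\<xi>. f \<xi> ** g \<xi>) 1 = mat 1 ** curve_coeff g 1 + curve_coeff f 1 ** mat 1"
    unfolding curve_coeff_eqI(2)[OF e]
    by (simp add: vec_eq_iff coeff_sum coeff_mult c0 curve_coeff_def sum.distrib
        matrix_matrix_mult_def[of "mat 1" "vec_lambda _"] matrix_matrix_mult_def[of _ "mat 1"]
        del: matrix_mul_lid matrix_mul_rid)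
  thus "curve_coeff (\<lambda>\<xi>. f \<xi> ** g \<xi>) 1 = curve_coeff f 1 + curve_coeff g 1" by (simp add: add.commute)
qed

lemma curve_coeff_conj:
  fixes f :: "'k::alg_closed_field \<Rightarrow> 'k^'n^'n"
  assumes "poly_curve f"
  shows "poly_curve (\<lambda>\<xi>. A ** f \<xi> ** B)" "curve_coeff (\<lambda>\<xi>. A ** f \<xi> ** B) m = A ** curve_coeff f m ** B"
proof -
  let ?p = "\<lambda>i j. \<Sum>l\<in>UNIV. smult (B $ l $ j) (\<Sum>k\<in>UNIV. smult (A $ i $ k) (entry_poly f k l))"
  have e: "(A ** f \<xi> ** B) $ i $ j = poly (?p i j) \<xi>" for i j \<xi>
    by (simp add: matrix_matrix_mult_def poly_sum entry_poly[OF assms] mult.commute)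
  show "poly_curve (\<lambda>\<xi>. A ** f \<xi> ** B)" by (rule curve_coeff_eqI(1)[OF e])
  show "curve_coeff (\<lambda>\<xi>. A ** f \<xi> ** B) m = A ** curve_coeff f m ** B"
    unfolding curve_coeff_eqI(2)[OF e]
    by (simp add: vec_eq_iff coeff_sum matrix_matrix_mult_def curve_coeff_def mult.commute)
qed

lemma curve_coeff_scale:
  fixes f :: "'k::alg_closed_field \<Rightarrow> 'k^'n^'n"
  assumes "poly_curve f"
  shows "poly_curve (\<lambda>\<xi>. f (a * \<xi>))" "curve_coeff (\<lambda>\<xi>. f (a * \<xi>)) m = mat (a ^ m) ** curve_coeff f m"
proof -
  let ?p = "\<lambda>i j. pcompose (entry_poly f i j) [:0, a:]"
  have e: "f (a * \<xi>) $ i $ j = poly (?p i j) \<xi>" for i j \<xi>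
    by (simp add: poly_pcompose entry_poly[OF assms] mult.commute)
  show "poly_curve (\<lambda>\<xi>. f (a * \<xi>))" by (rule curve_coeff_eqI(1)[OF e])
  show "curve_coeff (\<lambda>\<xi>. f (a * \<xi>)) m = mat (a ^ m) ** curve_coeff f m"
    unfolding curve_coeff_eqI(2)[OF e] by (simp add: vec_eq_iff scale_nth curve_coeff_def coeff_pcompose_linear)
qed

lemma poly_curve_jet:
  fixes f :: "'k::alg_closed_field \<Rightarrow> 'k^'n^'n"
  assumes f: "poly_curve f" "f 0 = mat 1" and low: "\<And>l. 0 < l \<Longrightarrow> l < m \<Longrightarrow> curve_coeff f l = 0"
  shows "matrix_jet f m (curve_coeff f m)"
  unfolding matrix_jet_def scalar_jet_def
proof (intro allI exI conjI impI)
  fix i j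
  show "germ (\<lambda>s. f s $ i $ j) (fps_of_poly (entry_poly f i j))"
    using germ_poly[of "entry_poly f i j"] by (simp add: entry_poly[OF f(1)])
  show "fps_nth (fps_of_poly (entry_poly f i j)) 0 = (mat 1 :: 'k^'n^'n) $ i $ j"
    using entry_poly[OF f(1), of 0 i j] f(2) by (simp add: poly_0_coeff_0)
  show "fps_nth (fps_of_poly (entry_poly f i j)) l = 0" if "0 < l \<and> l < m" for l
    using low[of l] that by (simp add: curve_coeff_def vec_eq_iff)
qed (simp add: curve_coeff_def)

lemma poly_curve_constant:
  fixes f :: "'k::alg_closed_field \<Rightarrow> 'k^'n^'n"
  assumes f: "poly_curve f" "f 0 = mat 1" and c: "\<And>l. l \<ge> 1 \<Longrightarrow> curve_coeff f l = 0"
  shows "f \<xi> = mat 1"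
proof -
  have "f \<xi> $ i $ j = (mat 1 :: 'k^'n^'n) $ i $ j" for i j
  proof -
    have "entry_poly f i j = [:(mat 1 :: 'k^'n^'n) $ i $ j:]"
    proof (rule poly_eqI)
      fix l
      show "coeff (entry_poly f i j) l = coeff [:(mat 1 :: 'k^'n^'n) $ i $ j:] l"
        using c[of l] entry_poly[OF f(1), of 0 i j] f(2)
        by (cases l) (auto simp: curve_coeff_def vec_eq_iff poly_0_coeff_0)
    qed
    thus ?thesis using entry_poly[OF f(1), of \<xi> i j] by simp
  qed
  thus ?thesis by (simp add: vec_eq_iff)
qed

text \<open>In positive characteristic a nontrivial curve may have zero tangent vector, so its lowest
  nonconstant coefficient, of whatever degree, takes the place of the derivative.\<close>

lemma poly_curve_lowest:
  fixes f :: "'k::alg_closed_field \<Rightarrow> 'k^'n^'n"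
  assumes f: "poly_curve f" "f 0 = mat 1" and G: "\<And>\<xi>. f \<xi> \<in> G"
  shows "(\<forall>\<xi>. f \<xi> = mat 1) \<or>
    (\<exists>m\<ge>1. curve_coeff f m \<noteq> 0 \<and> curve_coeff f m \<in> lie_algebra G)" "curve_coeff f 1 \<in> lie_algebra G"
proof -
  have L: "curve_coeff f m \<in> lie_algebra G" if "m \<ge> 1" "\<And>l. 0 < l \<Longrightarrow> l < m \<Longrightarrow> curve_coeff f l = 0" for m
    by (rule curve_in_lie_algebra[OF that(1) poly_curve_jet[OF f that(2)], of 1]) (use G in auto)
  show "curve_coeff f 1 \<in> lie_algebra G" by (rule L) auto
  show "(\<forall>\<xi>. f \<xi> = mat 1) \<or> (\<exists>m\<ge>1. curve_coeff f m \<noteq> 0 \<and> curve_coeff f m \<in> lie_algebra G)"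
  proof (cases "\<exists>m\<ge>1. curve_coeff f m \<noteq> 0")
    case False
    thus ?thesis using poly_curve_constant[OF f] by blast
  next
    case True
    define m where "m = (LEAST m. m \<ge> 1 \<and> curve_coeff f m \<noteq> 0)"
    have m: "m \<ge> 1" "curve_coeff f m \<noteq> 0" using LeastI_ex[OF True] by (auto simp: m_def)
    have "curve_coeff f l = 0" if "0 < l" "l < m" for l
      using not_less_Least[of l "\<lambda>m. m \<ge> 1 \<and> curve_coeff f m \<noteq> 0"] that by (simp add: m_def)
    thus ?thesis using m L by blast
  qed
qed

text \<open>Polynomials in two variables, as polynomials in \<open>\<xi>\<close> whose coefficients are polynomials in
  \<open>\<eta>\<close>.\<close>

definition bipoly :: "('k::field \<Rightarrow> 'k \<Rightarrow> 'k) \<Rightarrow> bool" where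
  "bipoly f \<longleftrightarrow> (\<exists>P. \<forall>\<xi> \<eta>. f \<xi> \<eta> = poly (poly P [:\<eta>:]) \<xi>)"

lemma bipoly_intros:
  "bipoly (\<lambda>\<xi> \<eta>. c)" "bipoly (\<lambda>\<xi> \<eta>. \<xi>)" "bipoly (\<lambda>\<xi> \<eta>. \<eta>)"
  "bipoly f \<Longrightarrow> bipoly g \<Longrightarrow> bipoly (\<lambda>\<xi> \<eta>. f \<xi> \<eta> + g \<xi> \<eta>)"
  "bipoly f \<Longrightarrow> bipoly g \<Longrightarrow> bipoly (\<lambda>\<xi> \<eta>. f \<xi> \<eta> * g \<xi> \<eta>)"
proof -
  show c: "bipoly (\<lambda>\<xi> \<eta>. c)" unfolding bipoly_def by (rule exI[of _ "[:[:c:]:]"]) simp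
  show "bipoly (\<lambda>\<xi> \<eta>. \<xi>)" unfolding bipoly_def by (rule exI[of _ "[:[:0, 1:]:]"]) simp
  show "bipoly (\<lambda>\<xi> \<eta>. \<eta>)" unfolding bipoly_def by (rule exI[of _ "[:0, 1:]"]) simp
  assume "bipoly f" "bipoly g"
  then obtain P Q where "\<forall>\<xi> \<eta>. f \<xi> \<eta> = poly (poly P [:\<eta>:]) \<xi>" "\<forall>\<xi> \<eta>. g \<xi> \<eta> = poly (poly Q [:\<eta>:]) \<xi>"
    unfolding bipoly_def by blast
  thus "bipoly (\<lambda>\<xi> \<eta>. f \<xi> \<eta> + g \<xi> \<eta>)" "bipoly (\<lambda>\<xi> \<eta>. f \<xi> \<eta> * g \<xi> \<eta>)"
    unfolding bipoly_def by (intro exI[of _ "P + Q"], simp, intro exI[of _ "P * Q"], simp)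
qed

lemma bipoly_poly: "bipoly f \<Longrightarrow> bipoly (\<lambda>\<xi> \<eta>. poly p (f \<xi> \<eta>))"
proof (induction p)
  case 0
  show ?case using bipoly_intros(1)[of 0] by simp
next
  case (pCons a p)
  have "bipoly (\<lambda>\<xi> \<eta>. a + f \<xi> \<eta> * poly p (f \<xi> \<eta>))"
    by (intro bipoly_intros pCons)
  thus ?case by simp
qed

lemma bipoly_sum: "(\<And>i. i \<in> I \<Longrightarrow> bipoly (f i)) \<Longrightarrow> bipoly (\<lambda>\<xi> \<eta>. \<Sum>i\<in>I. f i \<xi> \<eta>)"
  by (induction I rule: infinite_finite_induct) (auto intro: bipoly_intros)

definition bipoly_curve :: "('k::field \<Rightarrow> 'k \<Rightarrow> 'k^'n^'n) \<Rightarrow> bool" where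
  "bipoly_curve \<Gamma> \<longleftrightarrow> (\<forall>i j. bipoly (\<lambda>\<xi> \<eta>. \<Gamma> \<xi> \<eta> $ i $ j))"

lemma bipoly_curve_mult: "bipoly_curve \<Gamma> \<Longrightarrow> bipoly_curve \<Delta> \<Longrightarrow> bipoly_curve (\<lambda>\<xi> \<eta>. \<Gamma> \<xi> \<eta> ** \<Delta> \<xi> \<eta>)"
  unfolding bipoly_curve_def
  by (auto simp: matrix_matrix_mult_def intro!: bipoly_sum bipoly_intros)

lemma bipoly_curve_poly: "poly_curve u \<Longrightarrow> bipoly f \<Longrightarrow> bipoly_curve (\<lambda>\<xi> \<eta>. u (f \<xi> \<eta>))"
  unfolding bipoly_curve_def by (simp add: entry_poly bipoly_poly)

section \<open>Eigenvectors of a torus\<close>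

definition eigen :: "('k::field^'n^'n) set \<Rightarrow> ('k^'n^'n \<Rightarrow> 'k) \<Rightarrow> 'k^'n^'n \<Rightarrow> bool" where
  "eigen T w X \<longleftrightarrow> (\<forall>t\<in>T. t ** X ** matrix_inv t = mat (w t) ** X)"

lemma matrix_scale_assoc:
  fixes A B :: "'k::field^'n^'n"
  shows "A ** (mat s ** B) = mat s ** (A ** B)" "(mat s ** A) ** B = mat s ** (A ** B)"
    "mat s ** (mat t ** A) = mat (s * t) ** A" "mat (s + t) ** A = mat s ** A + mat t ** A"
    "mat s ** (A + B) = mat s ** A + mat s ** B" "mat 0 ** A = 0"
proof -
  show "A ** (mat s ** B) = mat s ** (A ** B)"
    by (simp add: vec_eq_iff scale_nth)
      (simp add: matrix_matrix_mult_def[of A] scale_nth sum_distrib_left mult_ac)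
  show "(mat s ** A) ** B = mat s ** (A ** B)" by (simp add: matrix_mul_assoc)
  show "mat s ** (mat t ** A) = mat (s * t) ** A" by (simp add: vec_eq_iff scale_nth)
  show "mat (s + t) ** A = mat s ** A + mat t ** A" by (simp add: vec_eq_iff scale_nth distrib_right)
  show "mat s ** (A + B) = mat s ** A + mat s ** B" by (simp add: vec_eq_iff scale_nth distrib_left)
qed simp

lemma matrix_conj_sum:
  fixes A B :: "'k::field^'n^'n"
  shows "A ** (\<Sum>i\<in>I. X i) ** B = (\<Sum>i\<in>I. A ** X i ** B)"
  by (induction I rule: infinite_finite_induct) (auto simp: matrix_add_ldistrib matrix_add_rdistrib)

text \<open>Eigenvectors for distinct weights are independent; the weights are arbitrary functions on
  \<open>T\<close>.\<close>

lemma eigen_independent: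
  assumes "finite I" "\<And>k. k \<in> I \<Longrightarrow> eigen T (w k) (X k)"
    "\<And>k l. k \<in> I \<Longrightarrow> l \<in> I \<Longrightarrow> k \<noteq> l \<Longrightarrow> \<exists>t\<in>T. w k t \<noteq> w l t" "(\<Sum>k\<in>I. X k) = 0" "k \<in> I"
  shows "X k = 0"
  using assms
proof (induction I arbitrary: X k)
  case (insert a I)
  have z: "X k = 0" if k: "k \<in> I" for k
  proof -
    obtain t where t: "t \<in> T" "w k t \<noteq> w a t" using insert.prems(2)[of k a] k insert.hyps by blast
    define Y where "Y l = mat (w l t - w a t) ** X l" for l
    have "Y k = 0"
    proof (rule insert.IH)
      show "eigen T (w l) (Y l)" if "l \<in> I" for l
        unfolding eigen_def
      proof
        fix t' assume t': "t' \<in> T"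
        let ?a = "w l t - w a t"
        have "t' ** Y l ** matrix_inv t' = mat ?a ** (t' ** X l ** matrix_inv t')"
          unfolding Y_def matrix_scale_assoc(1)[of t'] matrix_scale_assoc(2) ..
        also have "\<dots> = mat ?a ** (mat (w l t') ** X l)"
          using insert.prems(1)[of l] that t' by (simp add: eigen_def)
        also have "\<dots> = mat (w l t') ** Y l" unfolding Y_def matrix_scale_assoc(3) by (simp add: mult.commute)
        finally show "t' ** Y l ** matrix_inv t' = mat (w l t') ** Y l" .
      qed
      show "\<exists>t\<in>T. w i t \<noteq> w j t" if "i \<in> I" "j \<in> I" "i \<noteq> j" for i j using insert.prems(2) that by blast
      have "t ** (\<Sum>l\<in>insert a I. X l) ** matrix_inv t = 0" using insert.prems(3) by simp
      hence "(\<Sum>l\<in>insert a I. mat (w l t) ** X l) = 0"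
        unfolding matrix_conj_sum using insert.prems(1) t(1) by (simp add: eigen_def)
      moreover have "mat (w a t) ** (\<Sum>l\<in>insert a I. X l) = 0" using insert.prems(3) by simp
      hence "(\<Sum>l\<in>insert a I. mat (w a t) ** X l) = 0"
        using matrix_conj_sum[of "mat (w a t)" X "insert a I" "mat 1"] by simp
      ultimately have "(\<Sum>l\<in>insert a I. mat (w l t) ** X l - mat (w a t) ** X l) = 0"
        by (simp only: sum_subtractf diff_0_right)
      moreover have "mat (w l t) ** X l - mat (w a t) ** X l = Y l" for l
        by (simp add: Y_def vec_eq_iff scale_nth left_diff_distrib)
      ultimately show "(\<Sum>l\<in>I. Y l) = 0" using insert.hyps by (simp add: Y_def)
    qed (rule k)
    hence "(w k t - w a t) * X k $ i $ j = 0" for i j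
      using scale_nth[of "w k t - w a t" "X k" i j] by (simp add: Y_def)
    thus ?thesis using t(2) by (simp add: vec_eq_iff)
  qed
  have "X a = 0" using insert.prems(3) insert.hyps z by simp
  thus ?case using insert.prems(4) z by blast
qed simp

section \<open>Root groups\<close>

lemma finite_d4: "finite (UNIV :: d4_node set)"
  by (simp add: UNIV_d4_node)

locale rooted_group = parametrised_torus T r \<phi>
  for T :: "('k::alg_closed_field^'n^'n) set" and r :: nat and \<phi> :: "(nat \<Rightarrow> 'k) \<Rightarrow> 'k^'n^'n" +
  fixes G :: "('k^'n^'n) set" and \<alpha> :: "d4_node \<Rightarrow> 'k^'n^'n \<Rightarrow> 'k"
  assumes G_group: "matrix_subgroup G" and T_sub: "T \<subseteq> G"
    and decomposition: "root_space_decomposition G T"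
    and inj_lattice: "inj (lattice_char T \<alpha>)"
    and roots_eq: "roots G T = lattice_char T \<alpha> ` d4_roots"
    and simple_char: "\<And>i. \<alpha> i \<in> characters T"
begin

lemmas Gr = matrix_subgroupD[OF G_group]
lemmas Tr = matrix_subgroupD[OF T_group]

lemma T_G: "t \<in> T \<Longrightarrow> t \<in> G" using T_sub by blast

definition wt :: "(d4_node \<Rightarrow> int) \<Rightarrow> 'k^'n^'n \<Rightarrow> 'k" where
  "wt c t = (\<Prod>i\<in>UNIV. \<alpha> i t powi c i)"

lemma lattice_char_eq: "lattice_char T \<alpha> c = (\<lambda>t\<in>T. wt c t)"
  by (simp add: lattice_char_def wt_def)

lemma alpha_nz: "t \<in> T \<Longrightarrow> \<alpha> i t \<noteq> 0" and alpha_mult: "s \<in> T \<Longrightarrow> t \<in> T \<Longrightarrow> \<alpha> i (s ** t) = \<alpha> i s * \<alpha> i t"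
  using simple_char by (auto simp: characters_def)

lemma wt_nz: "t \<in> T \<Longrightarrow> wt c t \<noteq> 0"
  by (simp add: wt_def alpha_nz finite_d4)

lemma wt_mult: "s \<in> T \<Longrightarrow> t \<in> T \<Longrightarrow> wt c (s ** t) = wt c s * wt c t"
  by (simp add: wt_def alpha_mult power_int_mult_distrib prod.distrib)

lemma wt_one: "wt c (mat 1) = 1"
proof -
  have "wt c (mat 1) * wt c (mat 1) = wt c (mat 1)" using wt_mult[OF Tr(1) Tr(1), of c] by simp
  thus ?thesis using wt_nz[OF Tr(1)] by simp
qed

lemma wt_zero: "wt 0 t = 1" by (simp add: wt_def)

lemma wt_add: "t \<in> T \<Longrightarrow> wt (c + d) t = wt c t * wt d t"
  by (simp add: wt_def power_int_add alpha_nz prod.distrib)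

lemma wt_neg: "wt (- c) t = inverse (wt c t)"
  by (simp add: wt_def power_int_minus prod_inversef[symmetric])

lemma prod_powi: "(\<Prod>i\<in>S. f i :: 'k) powi m = (\<Prod>i\<in>S. f i powi m)"
  by (induction S rule: infinite_finite_induct) (auto simp: power_int_mult_distrib)

lemma wt_scale: "wt (scale_vec m c) t = wt c t powi m"
  by (simp add: wt_def prod_powi power_int_mult[symmetric] mult.commute)

lemma wt_simple: "wt (simple_vec i) t = \<alpha> i t"
proof -
  have "wt (simple_vec i) t = (\<Prod>j\<in>UNIV. if j = i then \<alpha> j t else 1)"
    unfolding wt_def by (intro prod.cong) auto
  also have "\<dots> = \<alpha> i t" unfolding UNIV_d4_node by (cases i) auto
  finally show ?thesis .
qed

lemma wt_inj:
  assumes "\<And>t. t \<in> T \<Longrightarrow> wt c t = wt d t"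
  shows "c = d"
proof -
  have "lattice_char T \<alpha> c = lattice_char T \<alpha> d"
    unfolding lattice_char_eq using assms by (intro ext) (simp add: restrict_def)
  thus ?thesis using inj_lattice by (simp add: inj_eq)
qed

abbreviation "root_space c \<equiv> weight_space G T (lattice_char T \<alpha> c)"

lemma root_space_iff: "X \<in> root_space c \<longleftrightarrow> X \<in> lie_algebra G \<and> eigen T (wt c) X"
  by (auto simp: weight_space_def eigen_def lattice_char_eq)

lemma root_space_line: "c \<in> d4_roots \<Longrightarrow> \<exists>X. X \<noteq> 0 \<and> root_space c = {mat a ** X | a. True}"
proof -
  assume "c \<in> d4_roots"
  hence c: "lattice_char T \<alpha> c \<in> roots G T" unfolding roots_eq by (rule imageI)
  have "\<forall>a\<in>roots G T. \<exists>X. X \<noteq> 0 \<and> weight_space G T a = {mat c ** X | c. True}"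
    using decomposition unfolding root_space_decomposition_def by (rule conjunct2[OF conjunct2])
  thus ?thesis by (rule bspec[OF _ c])
qed

text \<open>The terms are not assumed to lie in the Lie algebra, only their sum. Decompose the sum
  along the root spaces: these consist of eigenvectors as well, so the independence of
  eigenvectors of distinct weights identifies each term with a component of that decomposition.\<close>

lemma lie_weights:
  assumes I: "finite I" "inj_on w I" "\<And>k. k \<in> I \<Longrightarrow> w k \<in> extensional T"
    and X: "\<And>k. k \<in> I \<Longrightarrow> eigen T (w k) (X k)" "(\<Sum>k\<in>I. X k) \<in> lie_algebra G" and k: "k \<in> I"
  shows "X k = 0 \<or> w k = (\<lambda>_\<in>T. 1) \<or> (w k \<in> roots G T \<and> X k \<in> weight_space G T (w k))"
proof -
  have fin: "finite (roots G T)" and lie: "lie_algebra G = {Y + (\<Sum>a\<in>roots G T. Z a) | Y Z.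
        Y \<in> lie_algebra T \<and> (\<forall>a\<in>roots G T. Z a \<in> weight_space G T a)}"
    using decomposition unfolding root_space_decomposition_def by blast+
  obtain Y Z where YZ: "(\<Sum>k\<in>I. X k) = Y + (\<Sum>a\<in>roots G T. Z a)" "Y \<in> lie_algebra T"
    "\<And>a. a \<in> roots G T \<Longrightarrow> Z a \<in> weight_space G T a"
    using X(2) unfolding lie by blast
  let ?one = "\<lambda>_\<in>T. (1::'k)"
  have one: "?one \<notin> roots G T" by (auto simp: roots_def)
  let ?W = "w ` I \<union> roots G T \<union> {?one}"
  define V1 where "V1 f = (\<Sum>k\<in>{k \<in> I. w k = f}. X k)" for f
  define V2 where "V2 f = (if f \<in> roots G T then mat (- 1) ** Z f else 0)" for f
  define V3 where "V3 f = (if f = ?one then mat (- 1) ** Y else 0)" for f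
  define V where "V f = V1 f + V2 f + V3 f" for f
  have e_add: "eigen T f (A + B)" if "eigen T f A" "eigen T f B" for f A B
    using that by (simp add: eigen_def matrix_add_ldistrib matrix_add_rdistrib)
  have e_0: "eigen T f 0" for f by (simp add: eigen_def)
  have e_neg: "eigen T f (mat (- 1) ** A)" if "eigen T f A" for f A
    unfolding eigen_def
  proof
    fix t assume "t \<in> T"
    have "t ** (mat (- 1) ** A) ** matrix_inv t = mat (- 1) ** (t ** A ** matrix_inv t)"
      unfolding matrix_scale_assoc(1)[of t] matrix_scale_assoc(2) ..
    thus "t ** (mat (- 1) ** A) ** matrix_inv t = mat (f t) ** (mat (- 1) ** A)"
      using that \<open>t \<in> T\<close> by (simp add: eigen_def matrix_scale_assoc(3))
  qed
  have e_sum: "eigen T f (sum g S)" if "\<And>i. i \<in> S \<Longrightarrow> eigen T f (g i)" for f g and S :: "'b set"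
    using that by (induction S rule: infinite_finite_induct) (auto intro: e_0 e_add)
  have eV: "eigen T f (V f)" for f
  proof -
    have "eigen T f (V1 f)" unfolding V1_def using X(1) by (intro e_sum) auto
    moreover have "eigen T f (V2 f)"
      using YZ(3)[of f] by (auto simp: V2_def e_0 weight_space_def eigen_def intro!: e_neg[unfolded eigen_def, rule_format])
    moreover have "eigen T f (V3 f)"
    proof (cases "f = ?one")
      case True
      have "eigen T ?one Y" unfolding eigen_def
      proof
        fix t assume t: "t \<in> T"
        have "t ** Y ** matrix_inv t = Y ** t ** matrix_inv t" using lie_T_weight_zero[OF YZ(2) t] by simp
        also have "\<dots> = Y" using Tr(4)[OF t] by (simp add: matrix_mul_assoc[symmetric])
        finally show "t ** Y ** matrix_inv t = mat (?one t) ** Y" using t by simp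
      qed
      thus ?thesis using True e_neg by (simp add: V3_def)
    qed (simp add: V3_def e_0)
    ultimately show ?thesis unfolding V_def by (intro e_add)
  qed
  have finW: "finite ?W" using I(1) fin by simp
  have "(\<Sum>f\<in>?W. V1 f) = (\<Sum>f\<in>w ` I. V1 f)"
    by (rule sum.mono_neutral_right[OF finW]) (auto simp: V1_def intro!: sum.neutral)
  also have "\<dots> = (\<Sum>k\<in>I. X k)" unfolding V1_def by (rule sum.image_gen[OF I(1), symmetric])
  finally have S1: "(\<Sum>f\<in>?W. V1 f) = (\<Sum>k\<in>I. X k)" .
  have "(\<Sum>f\<in>?W. V2 f) = (\<Sum>f\<in>roots G T. V2 f)"
    by (rule sum.mono_neutral_right[OF finW]) (auto simp: V2_def)
  also have "\<dots> = mat (- 1) ** (\<Sum>a\<in>roots G T. Z a)"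
    using matrix_conj_sum[of "mat (- 1)" Z "roots G T" "mat 1"] by (simp add: V2_def)
  finally have S2: "(\<Sum>f\<in>?W. V2 f) = mat (- 1) ** (\<Sum>a\<in>roots G T. Z a)" .
  have "(\<Sum>f\<in>?W. V3 f) = (\<Sum>f\<in>{?one}. V3 f)"
    by (rule sum.mono_neutral_right[OF finW]) (auto simp: V3_def)
  hence S3: "(\<Sum>f\<in>?W. V3 f) = mat (- 1) ** Y" by (simp add: V3_def)
  have "(\<Sum>f\<in>?W. V f) = 0"
    unfolding V_def sum.distrib S1 S2 S3 YZ(1) by (simp add: vec_eq_iff scale_nth)
  moreover have "\<exists>t\<in>T. f t \<noteq> g t" if "f \<in> ?W" "g \<in> ?W" "f \<noteq> g" for f g
  proof -
    have "f \<in> extensional T" "g \<in> extensional T"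
      using that(1,2) I(3) by (auto simp: roots_def characters_def)
    thus ?thesis using that(3) extensionalityI by metis
  qed
  ultimately have "V (w k) = 0"
    using eV k by (intro eigen_independent[OF finW, of T "\<lambda>f. f" V "w k"]) auto
  moreover have "V1 (w k) = X k"
  proof -
    have "{l \<in> I. w l = w k} = {k}" using I(2) k by (auto simp: inj_on_def)
    thus ?thesis by (simp add: V1_def)
  qed
  ultimately have eq: "X k + V2 (w k) + V3 (w k) = 0" by (simp add: V_def)
  show ?thesis
  proof (cases "w k = ?one")
    case False
    show ?thesis
    proof (cases "w k \<in> roots G T")
      case True
      hence "X k + mat (- 1) ** Z (w k) = 0" using eq False by (simp add: V2_def V3_def)
      hence "X k = Z (w k)" by (simp add: vec_eq_iff scale_nth)
      thus ?thesis using YZ(3)[OF True] True by simp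
    qed (use eq False in \<open>simp add: V2_def V3_def\<close>)
  qed simp
qed

lemma lie_lattice_weights:
  assumes I: "finite I" "inj_on c I"
    and X: "\<And>k. k \<in> I \<Longrightarrow> eigen T (wt (c k)) (X k)" "(\<Sum>k\<in>I. X k) \<in> lie_algebra G" and k: "k \<in> I"
  shows "X k = 0 \<or> c k = 0 \<or> (c k \<in> d4_roots \<and> X k \<in> root_space (c k))"
proof -
  have "X k = 0 \<or> lattice_char T \<alpha> (c k) = (\<lambda>_\<in>T. 1) \<or>
    (lattice_char T \<alpha> (c k) \<in> roots G T \<and> X k \<in> root_space (c k))"
  proof (rule lie_weights[OF I(1) _ _ _ X(2) k])
    show "inj_on (\<lambda>k. lattice_char T \<alpha> (c k)) I"
      using comp_inj_on[OF I(2) inj_on_subset[OF inj_lattice subset_UNIV]] unfolding comp_def .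
    show "lattice_char T \<alpha> (c k) \<in> extensional T" for k by (simp add: lattice_char_eq)
    show "eigen T (lattice_char T \<alpha> (c k)) (X k)" if "k \<in> I" for k
      using X(1)[OF that] by (simp add: eigen_def lattice_char_eq)
  qed
  moreover have "c k = 0" if "lattice_char T \<alpha> (c k) = (\<lambda>_\<in>T. 1)"
  proof (rule wt_inj)
    fix t assume "t \<in> T"
    thus "wt (c k) t = wt 0 t" using fun_cong[OF that, of t] by (simp add: lattice_char_eq wt_zero)
  qed
  moreover have "c k \<in> d4_roots" if "lattice_char T \<alpha> (c k) \<in> roots G T"
    using that inj_lattice unfolding roots_eq by (auto simp: inj_eq)
  ultimately show ?thesis by blast
qed

lemma wt_power: "(wt c t) ^ m = wt (scale_vec (int m) c) t"
  by (simp add: wt_scale)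

text \<open>The coefficient of degree \<open>m\<close> has weight \<open>m c\<close>, and no proper multiple of a root is a root
  or zero.\<close>

lemma equivariant_curve:
  assumes c: "c \<in> d4_roots" and f: "poly_curve f" "f 0 = mat 1" "\<And>\<xi>. f \<xi> \<in> G"
    and eq: "\<And>t \<xi>. t \<in> T \<Longrightarrow> t ** f \<xi> ** matrix_inv t = f (wt c t * \<xi>)"
  shows "curve_coeff f 1 \<in> root_space c" "curve_coeff f 1 = 0 \<Longrightarrow> f \<xi> = mat 1"
proof -
  have e: "eigen T (wt (scale_vec (int m) c)) (curve_coeff f m)" for m
    unfolding eigen_def
  proof
    fix t assume t: "t \<in> T"
    have "(\<lambda>\<xi>. t ** f \<xi> ** matrix_inv t) = (\<lambda>\<xi>. f (wt c t * \<xi>))" using eq[OF t] by blast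
    hence "t ** curve_coeff f m ** matrix_inv t = mat (wt c t ^ m) ** curve_coeff f m"
      using curve_coeff_conj(2)[OF f(1), of t "matrix_inv t" m] curve_coeff_scale(2)[OF f(1), of "wt c t" m]
      by simp
    thus "t ** curve_coeff f m ** matrix_inv t = mat (wt (scale_vec (int m) c) t) ** curve_coeff f m"
      by (simp only: wt_power)
  qed
  have c1: "scale_vec (int 1) c = c" by (simp add: scale_vec_def)
  show "curve_coeff f 1 \<in> root_space c"
    unfolding root_space_iff using poly_curve_lowest(2)[OF f] e[of 1] unfolding c1 by blast
  assume z: "curve_coeff f 1 = 0"
  from poly_curve_lowest(1)[OF f] show "f \<xi> = mat 1"
  proof
    assume "\<exists>m\<ge>1. curve_coeff f m \<noteq> 0 \<and> curve_coeff f m \<in> lie_algebra G"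
    then obtain m where m: "m \<ge> 1" "curve_coeff f m \<noteq> 0" "curve_coeff f m \<in> lie_algebra G" by blast
    have "scale_vec (int m) c = 0 \<or> scale_vec (int m) c \<in> d4_roots"
      using lie_lattice_weights[of "{()}" "\<lambda>_. scale_vec (int m) c" "\<lambda>_. curve_coeff f m" "()"] e[of m] m by auto
    hence "m = 1" using root_multiple[OF c, of "int m"] m(1) by auto
    thus ?thesis using m(2) z by simp
  qed blast
qed

lemma bipoly_curve_coeffs:
  fixes \<Gamma> :: "'k \<Rightarrow> 'k \<Rightarrow> 'k^'n^'n"
  assumes "bipoly_curve \<Gamma>"
  shows "poly_curve (\<Gamma> \<xi>)" "poly_curve (\<lambda>\<xi>. curve_coeff (\<Gamma> \<xi>) m)"
proof -
  obtain P where P: "\<And>i j \<xi> \<eta>. \<Gamma> \<xi> \<eta> $ i $ j = poly (poly (P i j) [:\<eta>:]) \<xi>"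
    using assms unfolding bipoly_curve_def bipoly_def by metis
  have "poly (poly Q [:\<eta>:]) \<xi> = poly (map_poly (\<lambda>q. poly q \<xi>) Q) \<eta>" for Q :: "'k poly poly" and \<xi> \<eta> :: 'k
    by (induction Q) (auto simp: map_poly_pCons mult.commute)
  hence e: "\<Gamma> \<xi> \<eta> $ i $ j = poly (map_poly (\<lambda>q. poly q \<xi>) (P i j)) \<eta>" for i j \<xi> \<eta> using P by simp
  show "poly_curve (\<Gamma> \<xi>)" by (rule curve_coeff_eqI(1)[OF e])
  have "curve_coeff (\<Gamma> \<xi>) m $ i $ j = poly (coeff (P i j) m) \<xi>" for \<xi> i j
    unfolding curve_coeff_eqI(2)[OF e] by (simp add: coeff_map_poly)
  thus "poly_curve (\<lambda>\<xi>. curve_coeff (\<Gamma> \<xi>) m)" by (rule curve_coeff_eqI(1))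
qed

lemma poly_curve_expand:
  fixes f :: "'k \<Rightarrow> 'k^'n^'n"
  assumes "poly_curve f"
  shows "\<exists>N. (\<forall>\<xi>. f \<xi> = (\<Sum>l\<le>N. mat (\<xi> ^ l) ** curve_coeff f l)) \<and> (\<forall>l>N. curve_coeff f l = 0)"
proof -
  define N where "N = Max (range (\<lambda>(i, j). degree (entry_poly f i j)))"
  have N: "degree (entry_poly f i j) \<le> N" for i j
    unfolding N_def by (rule Max_ge) (auto intro!: image_eqI[of _ _ "(i, j)"])
  have "f \<xi> $ i $ j = (\<Sum>l\<le>N. mat (\<xi> ^ l) ** curve_coeff f l) $ i $ j" for \<xi> i j
  proof -
    have "f \<xi> $ i $ j = (\<Sum>l\<le>degree (entry_poly f i j). coeff (entry_poly f i j) l * \<xi> ^ l)"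
      by (simp add: entry_poly[OF assms] poly_altdef)
    also have "\<dots> = (\<Sum>l\<le>N. coeff (entry_poly f i j) l * \<xi> ^ l)"
      using N[of i j] by (intro sum.mono_neutral_left) (auto simp: coeff_eq_0)
    finally show ?thesis by (simp add: scale_nth curve_coeff_def mult.commute)
  qed
  moreover have "curve_coeff f l = 0" if "l > N" for l
    using that le_less_trans[OF N] by (simp add: vec_eq_iff curve_coeff_def coeff_eq_0)
  ultimately show ?thesis by (intro exI[of _ N]) (simp add: vec_eq_iff)
qed

text \<open>Expand \<open>\<Gamma>\<close> in powers of \<open>\<eta>\<close>, with coefficients \<open>D m \<xi>\<close>, and these in powers of \<open>\<xi>\<close>, with
  coefficients \<open>C l m\<close> of weight \<open>l a + m b\<close>. For fixed \<open>\<xi>\<close> the lowest nonzero \<open>D m \<xi>\<close> lies in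
  the Lie algebra, so only those terms of it survive for which \<open>l a + m b\<close> is a root or zero;
  for \<open>l, m \<ge> 1\<close> this leaves \<open>l = m = 1\<close>.\<close>

lemma equivariant_surface:
  assumes a: "a \<in> d4_roots" and b: "b \<in> d4_roots" "b \<noteq> - a"
    and \<Gamma>: "bipoly_curve \<Gamma>" "\<And>\<xi> \<eta>. \<Gamma> \<xi> \<eta> \<in> G" "\<And>\<eta>. \<Gamma> 0 \<eta> = mat 1" "\<And>\<xi>. \<Gamma> \<xi> 0 = mat 1"
    and eq: "\<And>t \<xi> \<eta>. t \<in> T \<Longrightarrow> t ** \<Gamma> \<xi> \<eta> ** matrix_inv t = \<Gamma> (wt a t * \<xi>) (wt b t * \<eta>)"
  shows "curve_coeff (\<Gamma> 1) 1 \<noteq> 0 \<Longrightarrow> a + b \<in> d4_roots \<and> curve_coeff (\<Gamma> 1) 1 \<in> root_space (a + b)"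
    "curve_coeff (\<Gamma> 1) 1 = 0 \<Longrightarrow> \<Gamma> \<xi> \<eta> = mat 1"
proof -
  define D where "D m \<xi> = curve_coeff (\<Gamma> \<xi>) m" for m \<xi>
  define C where "C l m = curve_coeff (D m) l" for l m
  note pc = bipoly_curve_coeffs[OF \<Gamma>(1)]
  have pcD: "poly_curve (D m)" for m using pc(2)[of m] by (simp add: D_def[abs_def])
  have eqD: "t ** D m \<xi> ** matrix_inv t = mat (wt b t ^ m) ** D m (wt a t * \<xi>)" if t: "t \<in> T" for t m \<xi>
  proof -
    have "(\<lambda>\<eta>. t ** \<Gamma> \<xi> \<eta> ** matrix_inv t) = (\<lambda>\<eta>. \<Gamma> (wt a t * \<xi>) (wt b t * \<eta>))" using eq[OF t] by blast
    thus ?thesis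
      using curve_coeff_conj(2)[OF pc(1)[of \<xi>], of t "matrix_inv t" m]
        curve_coeff_scale(2)[OF pc(1)[of "wt a t * \<xi>"], of "wt b t" m]
      by (simp add: D_def)
  qed
  define v where "v l m = scale_vec (int l) a + scale_vec (int m) b" for l m
  have eC: "eigen T (wt (v l m)) (C l m)" for l m
    unfolding eigen_def
  proof
    fix t assume t: "t \<in> T"
    have "(\<lambda>\<xi>. t ** D m \<xi> ** matrix_inv t) = (\<lambda>\<xi>. mat (wt b t ^ m) ** D m (wt a t * \<xi>) ** mat 1)"
      using eqD[OF t] by simp
    hence "t ** C l m ** matrix_inv t = mat (wt b t ^ m) ** (mat (wt a t ^ l) ** C l m)"
      using curve_coeff_conj(2)[OF pcD[of m], of t "matrix_inv t" l]
        curve_coeff_conj(2)[OF curve_coeff_scale(1)[OF pcD[of m], of "wt a t"], of "mat (wt b t ^ m)" "mat 1" l]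
        curve_coeff_scale(2)[OF pcD[of m], of "wt a t" l]
      by (simp add: C_def)
    also have "\<dots> = mat (wt b t ^ m * wt a t ^ l) ** C l m" by (rule matrix_scale_assoc(3))
    also have "wt b t ^ m * wt a t ^ l = wt (v l m) t"
      unfolding v_def wt_add[OF t] wt_power by (rule mult.commute)
    finally show "t ** C l m ** matrix_inv t = mat (wt (v l m) t) ** C l m" .
  qed
  have C0: "C 0 m = 0" if "m \<ge> 1" for m
  proof -
    have "\<Gamma> 0 \<eta> $ i $ j = poly [:(mat 1 :: 'k^'n^'n) $ i $ j:] \<eta>" for \<eta> i j using \<Gamma>(3) by simp
    hence "D m 0 = (\<chi> i j. coeff [:(mat 1 :: 'k^'n^'n) $ i $ j:] m)"
      unfolding D_def by (intro curve_coeff_eqI(2))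
    hence "D m 0 = 0" using that by (simp add: vec_eq_iff coeff_pCons split: nat.split)
    moreover have "D m 0 = C 0 m"
    proof -
      have "coeff (entry_poly (D m) i j) 0 = D m 0 $ i $ j" for i j
        using entry_poly[OF pcD, of m 0 i j] by (simp add: poly_0_coeff_0)
      thus ?thesis by (simp add: C_def curve_coeff_def vec_eq_iff)
    qed
    ultimately show ?thesis by simp
  qed
  have key: "mat (\<xi> ^ l) ** C l m = 0 \<or> (l = 1 \<and> m = 1 \<and> v l m \<in> d4_roots \<and> mat (\<xi> ^ l) ** C l m \<in> root_space (v l m))"
    if D: "D m \<xi> \<in> lie_algebra G" and m: "m \<ge> 1" for l m \<xi>
  proof -
    obtain N where N: "\<And>\<xi>. D m \<xi> = (\<Sum>l\<le>N. mat (\<xi> ^ l) ** C l m)" "\<And>l. l > N \<Longrightarrow> C l m = 0"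
      using poly_curve_expand[OF pcD[of m]] unfolding C_def by blast
    have e: "eigen T (wt (v l m)) (mat (\<xi> ^ l) ** C l m)" for l
      unfolding eigen_def
    proof
      fix t assume "t \<in> T"
      have "t ** (mat (\<xi> ^ l) ** C l m) ** matrix_inv t = mat (\<xi> ^ l) ** (t ** C l m ** matrix_inv t)"
        unfolding matrix_scale_assoc(1)[of t] matrix_scale_assoc(2) ..
      also have "\<dots> = mat (\<xi> ^ l) ** (mat (wt (v l m) t) ** C l m)"
        using eC[of l m] \<open>t \<in> T\<close> by (simp add: eigen_def)
      also have "\<dots> = mat (wt (v l m) t) ** (mat (\<xi> ^ l) ** C l m)"
        unfolding matrix_scale_assoc(3) by (simp add: mult.commute)
      finally show "t ** (mat (\<xi> ^ l) ** C l m) ** matrix_inv t = mat (wt (v l m) t) ** (mat (\<xi> ^ l) ** C l m)" .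
    qed
    let ?I = "{..max N l}"
    have inj: "inj_on (\<lambda>l. v l m) ?I"
    proof (rule inj_onI)
      fix i j assume "v i m = v j m"
      hence "scale_vec (int i - int j) a = 0" by (auto simp: v_def scale_vec_def fun_eq_iff left_diff_distrib)
      from root_multiple(1)[OF a this] show "i = j" by simp
    qed
    define X where "X l = (if l \<le> N then mat (\<xi> ^ l) ** C l m else 0)" for l
    have "(\<Sum>l\<in>?I. X l) = (\<Sum>l\<le>N. mat (\<xi> ^ l) ** C l m)"
    proof -
      have "(\<Sum>l\<in>?I. X l) = (\<Sum>l\<in>{..N}. X l)" by (rule sum.mono_neutral_right) (auto simp: X_def)
      thus ?thesis by (simp add: X_def)
    qed
    hence "(\<Sum>l\<in>?I. X l) \<in> lie_algebra G" using D N(1) by simp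
    moreover have "eigen T (wt (v l m)) (X l)" for l using e by (simp add: X_def) (simp add: eigen_def)
    ultimately have "X l = 0 \<or> v l m = 0 \<or> (v l m \<in> d4_roots \<and> X l \<in> root_space (v l m))"
      by (intro lie_lattice_weights[OF _ inj]) auto
    moreover have "X l = mat (\<xi> ^ l) ** C l m" using N(2)[of l] by (simp add: X_def)
    moreover have "l = 0 \<Longrightarrow> mat (\<xi> ^ l) ** C l m = 0" using C0[OF m] by simp
    moreover have "v l m \<noteq> 0 \<and> (v l m \<in> d4_roots \<longrightarrow> l = 1 \<and> m = 1)" if "l \<noteq> 0"
    proof -
      have "int l \<ge> 1" "int m \<ge> 1" using that m by auto
      from root_combination[OF a b this] show ?thesis unfolding v_def by auto
    qed
    ultimately show ?thesis by metis
  qed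
  have low: "D 1 \<xi> \<in> lie_algebra G" for \<xi>
    unfolding D_def by (rule poly_curve_lowest(2)[OF pc(1) \<Gamma>(4,2)])
  have expand: "D m \<xi> = mat \<xi> ** C 1 m" if D: "D m \<xi> \<in> lie_algebra G" and m: "m \<ge> 1" for m \<xi>
  proof -
    obtain N where N: "\<And>\<xi>. D m \<xi> = (\<Sum>l\<le>N. mat (\<xi> ^ l) ** C l m)" "\<And>l. l > N \<Longrightarrow> C l m = 0"
      using poly_curve_expand[OF pcD[of m]] unfolding C_def by blast
    have z: "mat (\<xi> ^ l) ** C l m = 0" if "l \<noteq> 1" for l using key[OF D m, of l] that by blast
    have z1: "mat (\<xi> ^ 1) ** C 1 m = 0" if "N < 1" using N(2)[OF that] by simp
    have "D m \<xi> = (\<Sum>l\<in>{..N}. if l = 1 then mat (\<xi> ^ 1) ** C 1 m else 0)"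
      unfolding N(1) using z by (intro sum.cong) auto
    also have "\<dots> = mat (\<xi> ^ 1) ** C 1 m" using z1 by (cases "N < 1") auto
    finally show ?thesis by simp
  qed
  have C11: "curve_coeff (\<Gamma> 1) 1 = C 1 1" using expand[OF low, of 1] by (simp add: D_def)
  have v11: "v 1 1 = a + b" by (simp add: v_def scale_vec_def fun_eq_iff)
  show "a + b \<in> d4_roots \<and> curve_coeff (\<Gamma> 1) 1 \<in> root_space (a + b)" if "curve_coeff (\<Gamma> 1) 1 \<noteq> 0"
    using key[OF low[of 1], of 1] that unfolding C11 v11 by simp
  assume z: "curve_coeff (\<Gamma> 1) 1 = 0"
  from poly_curve_lowest(1)[OF pc(1) \<Gamma>(4,2), of \<xi>] show "\<Gamma> \<xi> \<eta> = mat 1"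
  proof
    assume "\<exists>m\<ge>1. curve_coeff (\<Gamma> \<xi>) m \<noteq> 0 \<and> curve_coeff (\<Gamma> \<xi>) m \<in> lie_algebra G"
    then obtain m where m: "m \<ge> 1" "D m \<xi> \<noteq> 0" "D m \<xi> \<in> lie_algebra G" unfolding D_def by blast
    have "mat (\<xi> ^ 1) ** C 1 m \<noteq> 0" using expand[OF m(3,1)] m(2) by simp
    hence "m = 1" "C 1 m \<noteq> 0" using key[OF m(3,1), of 1] by auto
    thus ?thesis using z C11 by simp
  qed blast
qed

text \<open>Weaker than a parametrisation of a root subgroup: neither an inverse nor a closed image is
  required. This makes the notion visibly stable under conjugation by the normalizer of \<open>T\<close>.\<close>

definition root_group :: "(d4_node \<Rightarrow> int) \<Rightarrow> ('k \<Rightarrow> 'k^'n^'n) \<Rightarrow> bool" where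
  "root_group c u \<longleftrightarrow> c \<in> d4_roots \<and> (\<forall>\<xi>. u \<xi> \<in> G) \<and> (\<forall>\<xi> \<eta>. u (\<xi> + \<eta>) = u \<xi> ** u \<eta>) \<and> poly_curve u \<and>
     (\<forall>t\<in>T. \<forall>\<xi>. t ** u \<xi> ** matrix_inv t = u (wt c t * \<xi>)) \<and> u 1 \<noteq> mat 1"

lemma root_groupD:
  assumes "root_group c u"
  shows "c \<in> d4_roots" "u \<xi> \<in> G" "u (\<xi> + \<eta>) = u \<xi> ** u \<eta>" "poly_curve u"
    "t \<in> T \<Longrightarrow> t ** u \<xi> ** matrix_inv t = u (wt c t * \<xi>)" "u 1 \<noteq> mat 1"
    "u 0 = mat 1" "u \<xi> ** u (- \<xi>) = mat 1" "u (- \<xi>) ** u \<xi> = mat 1" "matrix_inv (u \<xi>) = u (- \<xi>)"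
proof -
  show 1: "c \<in> d4_roots" "u \<xi> \<in> G" "u (\<xi> + \<eta>) = u \<xi> ** u \<eta>" "poly_curve u"
    "t \<in> T \<Longrightarrow> t ** u \<xi> ** matrix_inv t = u (wt c t * \<xi>)" "u 1 \<noteq> mat 1" for \<xi> \<eta> t
    using assms unfolding root_group_def by blast+
  have "u 0 = u 0 ** u 0" using 1(3)[of 0 0] by simp
  thus 0: "u 0 = mat 1" using Gr(5)[OF 1(2)[of 0]] by (metis matrix_mul_assoc matrix_mul_lid)
  show 2: "u \<xi> ** u (- \<xi>) = mat 1" "u (- \<xi>) ** u \<xi> = mat 1"
    using 1(3)[of \<xi> "- \<xi>"] 1(3)[of "- \<xi>" \<xi>] 0 by simp_all
  show "matrix_inv (u \<xi>) = u (- \<xi>)" by (rule matrix_inv_unique(1)[OF 2(1)])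
qed

lemma root_group_coeff:
  assumes u: "root_group c u"
  shows "curve_coeff u 1 \<in> root_space c" "curve_coeff u 1 \<noteq> 0"
proof -
  note D = root_groupD[OF u]
  show "curve_coeff u 1 \<in> root_space c"
    by (rule equivariant_curve(1)[OF D(1,4,7,2,5)])
  show "curve_coeff u 1 \<noteq> 0"
    using equivariant_curve(2)[OF D(1,4,7,2,5), of 1] D(6) by blast
qed

lemma root_space_multiple:
  assumes u: "root_group c u" and X: "X \<in> root_space c"
  shows "\<exists>e. X = mat e ** curve_coeff u 1"
proof -
  obtain X0 where X0: "root_space c = {mat a ** X0 | a. True}"
    using root_space_line[OF root_groupD(1)[OF u]] by blast
  obtain p q where p: "curve_coeff u 1 = mat p ** X0" and q: "X = mat q ** X0"
    using root_group_coeff(1)[OF u] X unfolding X0 by blast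
  have "p \<noteq> 0" using p root_group_coeff(2)[OF u] by auto
  hence "X = mat (q / p) ** curve_coeff u 1" unfolding p q matrix_scale_assoc(3) by simp
  thus ?thesis by blast
qed

lemma root_group_scaled:
  assumes u: "root_group c u"
  shows "poly_curve (\<lambda>\<xi>. u (e * \<xi>))" "curve_coeff (\<lambda>\<xi>. u (e * \<xi>)) 1 = mat e ** curve_coeff u 1"
  using curve_coeff_scale[OF root_groupD(4)[OF u], of e] by simp_all

text \<open>If \<open>e\<close> is the ratio of the tangent vectors, the curve \<open>\<xi> \<mapsto> v(\<xi>) u(- e \<xi>)\<close> is equivariant
  with zero tangent vector, hence trivial.\<close>

lemma root_group_unique:
  assumes u: "root_group c u" and v: "root_group c v"
  shows "\<exists>e. e \<noteq> 0 \<and> (\<forall>\<xi>. v \<xi> = u (e * \<xi>))"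
proof -
  note U = root_groupD[OF u] and V = root_groupD[OF v]
  obtain e where e: "curve_coeff v 1 = mat e ** curve_coeff u 1"
    using root_space_multiple[OF u root_group_coeff(1)[OF v]] by blast
  have "e \<noteq> 0" using e root_group_coeff(2)[OF v] by auto
  define f where "f \<xi> = v \<xi> ** u ((- e) * \<xi>)" for \<xi>
  note sc = root_group_scaled[OF u, of "- e"]
  have pf: "poly_curve f" unfolding f_def[abs_def] by (rule poly_curve_mult(1)[OF V(4) sc(1)])
  have f0: "f 0 = mat 1" using U(7) V(7) by (simp add: f_def)
  have fG: "f \<xi> \<in> G" for \<xi> unfolding f_def by (intro Gr(2) U(2) V(2))
  have "curve_coeff f 1 = curve_coeff v 1 + mat (- e) ** curve_coeff u 1"
    unfolding f_def[abs_def] using poly_curve_mult(2)[OF V(4) sc(1)] U(7) V(7) sc(2) by simp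
  hence c0: "curve_coeff f 1 = 0" unfolding e by (simp add: vec_eq_iff scale_nth)
  have eqf: "t ** f \<xi> ** matrix_inv t = f (wt c t * \<xi>)" if t: "t \<in> T" for t \<xi>
  proof -
    have "t ** f \<xi> ** matrix_inv t = (t ** v \<xi> ** matrix_inv t) ** (t ** u ((- e) * \<xi>) ** matrix_inv t)"
      using Tr(5)[OF t] unfolding f_def by (simp add: matrix_mul_assoc) (simp add: matrix_mul_assoc[symmetric])
    also have "\<dots> = v (wt c t * \<xi>) ** u (wt c t * ((- e) * \<xi>))" unfolding U(5)[OF t] V(5)[OF t] ..
    finally show ?thesis unfolding f_def by (simp add: mult_ac)
  qed
  have f1: "f \<xi> = mat 1" for \<xi> by (rule equivariant_curve(2)[OF U(1) pf f0 fG eqf c0])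
  have "v \<xi> = u (e * \<xi>)" for \<xi>
  proof -
    have "v \<xi> = f \<xi> ** u (e * \<xi>)"
      using U(9)[of "e * \<xi>"] by (simp add: f_def matrix_mul_assoc[symmetric])
    thus ?thesis using f1 by simp
  qed
  thus ?thesis using \<open>e \<noteq> 0\<close> by blast
qed

text \<open>The commutator is an equivariant surface. If \<open>a + b\<close> is not a root, it is trivial.
  Otherwise its mixed coefficient is a multiple \<open>e\<close> of the tangent vector of \<open>w\<close>, and the
  product of the commutator with \<open>w(- e \<xi> \<eta>)\<close> is an equivariant surface with zero mixed
  coefficient.\<close>

lemma root_group_commutator:
  assumes u: "root_group a u" and v: "root_group b v" and ab: "b \<noteq> - a"
  shows "a + b \<notin> d4_roots \<Longrightarrow> u \<xi> ** v \<eta> ** u (- \<xi>) = v \<eta>"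
    "root_group (a + b) w \<Longrightarrow> \<exists>\<zeta>. u \<xi> ** v \<eta> ** u (- \<xi>) = w \<zeta> ** v \<eta>"
proof -
  note U = root_groupD[OF u] and V = root_groupD[OF v]
  define \<Gamma> where "\<Gamma> \<xi> \<eta> = u \<xi> ** v \<eta> ** u (- \<xi>) ** v (- \<eta>)" for \<xi> \<eta>
  have bp: "bipoly (\<lambda>\<xi> \<eta>. - \<xi>)" "bipoly (\<lambda>\<xi> \<eta>. - \<eta>)"
    using bipoly_intros(5)[OF bipoly_intros(1)[of "- 1"] bipoly_intros(2)]
      bipoly_intros(5)[OF bipoly_intros(1)[of "- 1"] bipoly_intros(3)] by simp_all
  have b\<Gamma>: "bipoly_curve \<Gamma>" unfolding \<Gamma>_def[abs_def]
    by (intro bipoly_curve_mult bipoly_curve_poly U(4) V(4) bipoly_intros bp)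
  have \<Gamma>G: "\<Gamma> \<xi> \<eta> \<in> G" for \<xi> \<eta> unfolding \<Gamma>_def by (intro Gr(2) U(2) V(2))
  have \<Gamma>0: "\<Gamma> 0 \<eta> = mat 1" "\<Gamma> \<xi> 0 = mat 1" for \<xi> \<eta>
    using U(7,8) V(7,8) by (simp_all add: \<Gamma>_def)
  have conj4: "t ** (A ** B ** C ** D) ** matrix_inv t = (t ** A ** matrix_inv t) ** (t ** B ** matrix_inv t) **
      (t ** C ** matrix_inv t) ** (t ** D ** matrix_inv t)" if t: "t \<in> T" for t A B C D
  proof -
    have c: "X ** matrix_inv t ** t = X" for X
      using Tr(5)[OF t] by (simp add: matrix_mul_assoc[symmetric])
    show ?thesis by (simp add: matrix_mul_assoc c)
  qed
  have eq\<Gamma>: "t ** \<Gamma> \<xi> \<eta> ** matrix_inv t = \<Gamma> (wt a t * \<xi>) (wt b t * \<eta>)" if t: "t \<in> T" for t \<xi> \<eta>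
    unfolding \<Gamma>_def conj4[OF t] U(5)[OF t] V(5)[OF t] by simp
  have recover: "u \<xi> ** v \<eta> ** u (- \<xi>) = \<Gamma> \<xi> \<eta> ** v \<eta>" for \<xi> \<eta>
    using V(9)[of \<eta>] by (simp add: \<Gamma>_def matrix_mul_assoc[symmetric])
  show "u \<xi> ** v \<eta> ** u (- \<xi>) = v \<eta>" if "a + b \<notin> d4_roots"
  proof -
    have "curve_coeff (\<Gamma> 1) 1 = 0"
      using equivariant_surface(1)[OF U(1) V(1) ab b\<Gamma> \<Gamma>G \<Gamma>0 eq\<Gamma>] that by blast
    hence "\<Gamma> \<xi> \<eta> = mat 1"
      using equivariant_surface(2)[OF U(1) V(1) ab b\<Gamma> \<Gamma>G \<Gamma>0 eq\<Gamma>, of \<xi> \<eta>] by blast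
    thus ?thesis unfolding recover by simp
  qed
  assume w: "root_group (a + b) w"
  note W = root_groupD[OF w]
  obtain e where e: "curve_coeff (\<Gamma> 1) 1 = mat e ** curve_coeff w 1"
  proof (cases "curve_coeff (\<Gamma> 1) 1 = 0")
    case True
    thus ?thesis using that[of 0] by simp
  next
    case False
    thus ?thesis
      using equivariant_surface(1)[OF U(1) V(1) ab b\<Gamma> \<Gamma>G \<Gamma>0 eq\<Gamma>] root_space_multiple[OF w] that by blast
  qed
  define \<Delta> where "\<Delta> \<xi> \<eta> = \<Gamma> \<xi> \<eta> ** w ((- e) * (\<xi> * \<eta>))" for \<xi> \<eta>
  have b\<Delta>: "bipoly_curve \<Delta>" unfolding \<Delta>_def[abs_def]
    by (intro bipoly_curve_mult b\<Gamma> bipoly_curve_poly W(4) bipoly_intros)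
  have \<Delta>G: "\<Delta> \<xi> \<eta> \<in> G" for \<xi> \<eta> unfolding \<Delta>_def by (intro Gr(2) \<Gamma>G W(2))
  have \<Delta>0: "\<Delta> 0 \<eta> = mat 1" "\<Delta> \<xi> 0 = mat 1" for \<xi> \<eta> using \<Gamma>0 W(7) by (simp_all add: \<Delta>_def)
  have eq\<Delta>: "t ** \<Delta> \<xi> \<eta> ** matrix_inv t = \<Delta> (wt a t * \<xi>) (wt b t * \<eta>)" if t: "t \<in> T" for t \<xi> \<eta>
  proof -
    have "t ** \<Delta> \<xi> \<eta> ** matrix_inv t =
        (t ** \<Gamma> \<xi> \<eta> ** matrix_inv t) ** (t ** w ((- e) * (\<xi> * \<eta>)) ** matrix_inv t)"
      using conj4[OF t, of "\<Gamma> \<xi> \<eta>" "w ((- e) * (\<xi> * \<eta>))" "mat 1" "mat 1"] Tr(4)[OF t] by (simp add: \<Delta>_def)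
    also have "\<dots> = \<Gamma> (wt a t * \<xi>) (wt b t * \<eta>) ** w (wt (a + b) t * ((- e) * (\<xi> * \<eta>)))"
      unfolding eq\<Gamma>[OF t] W(5)[OF t] ..
    finally show ?thesis unfolding \<Delta>_def wt_add[OF t] by (simp add: mult_ac)
  qed
  have "curve_coeff (\<Delta> 1) 1 = curve_coeff (\<Gamma> 1) 1 + mat (- e) ** curve_coeff w 1"
  proof -
    have "\<Delta> 1 = (\<lambda>\<eta>. \<Gamma> 1 \<eta> ** w ((- e) * \<eta>))" by (simp add: \<Delta>_def fun_eq_iff)
    thus ?thesis
      using poly_curve_mult(2)[OF bipoly_curve_coeffs(1)[OF b\<Gamma>, of 1] root_group_scaled(1)[OF w, of "- e"]]
        \<Gamma>0 W(7) root_group_scaled(2)[OF w, of "- e"] by simp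
  qed
  hence "curve_coeff (\<Delta> 1) 1 = 0" unfolding e by (simp add: vec_eq_iff scale_nth)
  hence "\<Delta> \<xi> \<eta> = mat 1"
    using equivariant_surface(2)[OF U(1) V(1) ab b\<Delta> \<Delta>G \<Delta>0 eq\<Delta>, of \<xi> \<eta>] by blast
  hence "\<Gamma> \<xi> \<eta> = w (e * (\<xi> * \<eta>))"
  proof -
    have "\<Gamma> \<xi> \<eta> = \<Delta> \<xi> \<eta> ** w (e * (\<xi> * \<eta>))"
      using W(9)[of "e * (\<xi> * \<eta>)"] by (simp add: \<Delta>_def matrix_mul_assoc[symmetric])
    thus ?thesis using \<open>\<Delta> \<xi> \<eta> = mat 1\<close> by simp
  qed
  thus "\<exists>\<zeta>. u \<xi> ** v \<eta> ** u (- \<xi>) = w \<zeta> ** v \<eta>" unfolding recover by metis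
qed

end

section \<open>The action of the normalizer on the root lattice\<close>

text \<open>Multiplication by generators on one side suffices, and the sets \<open>S\<close> in use are closed
  under inverses, so that these submonoids are groups.\<close>

inductive_set mgen :: "('k::field^'n^'n) set \<Rightarrow> ('k^'n^'n) set" for S where
  one: "mat 1 \<in> mgen S"
| mult: "s \<in> S \<Longrightarrow> g \<in> mgen S \<Longrightarrow> s ** g \<in> mgen S"

lemma mgen_gen: "s \<in> S \<Longrightarrow> s \<in> mgen S"
  using mgen.mult[OF _ mgen.one, of s S] by simp

lemma mgen_closed: "g \<in> mgen S \<Longrightarrow> h \<in> mgen S \<Longrightarrow> g ** h \<in> mgen S"
  by (induction rule: mgen.induct) (auto simp: matrix_mul_assoc[symmetric] intro: mgen.intros)

lemma mgen_least:
  assumes "mat 1 \<in> H" "\<And>g h. g \<in> H \<Longrightarrow> h \<in> H \<Longrightarrow> g ** h \<in> H" "S \<subseteq> H"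
  shows "mgen S \<subseteq> H"
proof
  fix g assume "g \<in> mgen S"
  thus "g \<in> H" by induction (use assms in auto)
qed

lemma mgen_mono: "S \<subseteq> S' \<Longrightarrow> mgen S \<subseteq> mgen S'"
  by (rule mgen_least) (auto intro: mgen.one mgen_closed mgen_gen)

context rooted_group
begin

lemma cancel:
  assumes "A \<in> G"
  shows "X ** A ** matrix_inv A = X" "X ** matrix_inv A ** A = X" "A ** matrix_inv A = mat 1" "matrix_inv A ** A = mat 1"
  using Gr(4,5)[OF assms] by (simp_all add: matrix_mul_assoc[symmetric])

lemma inv_mult: "A \<in> G \<Longrightarrow> B \<in> G \<Longrightarrow> matrix_inv (A ** B) = matrix_inv B ** matrix_inv A"
  by (rule matrix_inv_unique(1)) (simp add: matrix_mul_assoc cancel)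

lemma inv_inv: "A \<in> G \<Longrightarrow> matrix_inv (matrix_inv A) = A"
  by (rule matrix_inv_unique(2)[OF Gr(4)])

lemma mgen_subgroup:
  assumes S: "S \<subseteq> G" "\<And>s. s \<in> S \<Longrightarrow> matrix_inv s \<in> S"
  shows "matrix_subgroup (mgen S)" "mgen S \<subseteq> G"
proof -
  show sub: "mgen S \<subseteq> G" using S(1) by (intro mgen_least Gr)
  have "matrix_inv g \<in> mgen S" if "g \<in> mgen S" for g
    using that
  proof induction
    case one
    have i1: "matrix_inv (mat 1) = (mat 1 :: 'k^'n^'n)" by (rule matrix_inv_unique(1)) simp
    show ?case unfolding i1 by (rule mgen.one)
  next
    case (mult s g)
    have sg: "s \<in> G" "g \<in> G" using mult.hyps S(1) sub by blast+
    show ?case unfolding inv_mult[OF sg] by (rule mgen_closed[OF mult.IH mgen_gen[OF S(2)[OF mult.hyps(1)]]])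
  qed
  thus "matrix_subgroup (mgen S)" unfolding matrix_subgroup_def
    using sub Gr(6) mgen.one mgen_closed by blast
qed

text \<open>The two conditions on a conjugate say that conjugation maps \<open>T\<close> onto itself and not only
  into itself.\<close>

definition norm_T :: "('k^'n^'n) set" where
  "norm_T = {n \<in> G. \<forall>t\<in>T. n ** t ** matrix_inv n \<in> T \<and> matrix_inv n ** t ** n \<in> T}"

lemma norm_TD: "n \<in> norm_T \<Longrightarrow> n \<in> G" "n \<in> norm_T \<Longrightarrow> t \<in> T \<Longrightarrow> n ** t ** matrix_inv n \<in> T"
  "n \<in> norm_T \<Longrightarrow> t \<in> T \<Longrightarrow> matrix_inv n ** t ** n \<in> T"
  by (auto simp: norm_T_def)

lemma norm_T_mult:
  assumes n: "n \<in> norm_T" and m: "m \<in> norm_T"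
  shows "n ** m \<in> norm_T"
proof -
  note G = norm_TD(1)[OF n] norm_TD(1)[OF m]
  have "n ** m ** t ** matrix_inv (n ** m) \<in> T \<and> matrix_inv (n ** m) ** t ** (n ** m) \<in> T" if "t \<in> T" for t
    using norm_TD(2)[OF n norm_TD(2)[OF m that]] norm_TD(3)[OF m norm_TD(3)[OF n that]]
    by (simp add: inv_mult[OF G] matrix_mul_assoc)
  thus ?thesis using Gr(2)[OF G] by (simp add: norm_T_def)
qed

lemma norm_T_inv: "n \<in> norm_T \<Longrightarrow> matrix_inv n \<in> norm_T"
  by (auto simp: norm_T_def inv_inv Gr(3))

lemma T_norm_T: "t \<in> T \<Longrightarrow> t \<in> norm_T"
  using Tr(2,3) T_G by (auto simp: norm_T_def)

text \<open>The action of the Weyl group on characters, carried over to the root lattice: \<open>w c\<close> is the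
  weight \<open>t \<mapsto> c (n\<^sup>-\<^sup>1 t n)\<close>.\<close>

definition acts :: "'k^'n^'n \<Rightarrow> ((d4_node \<Rightarrow> int) \<Rightarrow> (d4_node \<Rightarrow> int)) \<Rightarrow> bool" where
  "acts n w \<longleftrightarrow> (\<forall>c. \<forall>t\<in>T. wt (w c) t = wt c (matrix_inv n ** t ** n))"

lemma actsD: "acts n w \<Longrightarrow> t \<in> T \<Longrightarrow> wt (w c) t = wt c (matrix_inv n ** t ** n)"
  by (simp add: acts_def)

lemma acts_unique: "acts n w \<Longrightarrow> acts n w' \<Longrightarrow> w = w'"
  by (rule ext, rule wt_inj) (simp add: actsD)

lemma acts_linear:
  assumes n: "n \<in> norm_T" and w: "acts n w"
  shows "w (c + d) = w c + w d" "w (scale_vec m c) = scale_vec m (w c)" "w (- c) = - w c"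
proof -
  show "w (c + d) = w c + w d"
    by (rule wt_inj) (simp only: actsD[OF w] wt_add norm_TD(3)[OF n])
  show "w (scale_vec m c) = scale_vec m (w c)"
    by (rule wt_inj) (simp only: actsD[OF w] wt_scale)
  show "w (- c) = - w c"
    by (rule wt_inj) (simp only: actsD[OF w] wt_neg)
qed

lemma acts_comp:
  assumes n: "n \<in> norm_T" and m: "m \<in> norm_T" and w: "acts n w" "acts m v"
  shows "acts (n ** m) (\<lambda>c. w (v c))"
  unfolding acts_def
proof (intro allI ballI)
  fix c t assume t: "t \<in> T"
  show "wt (w (v c)) t = wt c (matrix_inv (n ** m) ** t ** (n ** m))"
    using actsD[OF w(1) t, of "v c"] actsD[OF w(2) norm_TD(3)[OF n t], of c]
    by (simp add: inv_mult norm_TD(1)[OF n] norm_TD(1)[OF m] matrix_mul_assoc)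
qed

lemma acts_T: "t \<in> T \<Longrightarrow> acts t (\<lambda>c. c)"
  unfolding acts_def
proof (intro allI ballI)
  fix c s assume t: "t \<in> T" and s: "s \<in> T"
  have "matrix_inv t ** s ** t = s"
    using T_commutative[OF Tr(3)[OF t] s] cancel(2)[OF T_G[OF t], of s] by simp
  thus "wt c s = wt c (matrix_inv t ** s ** t)" by simp
qed

lemma lie_conj:
  assumes X: "X \<in> lie_algebra G" and n: "n \<in> G"
  shows "n ** X ** matrix_inv n \<in> lie_algebra G"
  unfolding lie_algebra_def
proof (intro CollectI ballI impI)
  fix f assume f: "f \<in> matrix_polys" "\<forall>A\<in>G. f A = 0"
  let ?g = "\<lambda>A. f (n ** A ** matrix_inv n)"
  have "?g \<in> matrix_polys" by (rule matrix_polys_mult_arg[OF f(1)])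
  moreover have "\<forall>A\<in>G. ?g A = 0" using f(2) Gr(2,3) n by blast
  ultimately obtain p where p: "\<forall>s. ?g (mat 1 + mat s ** X) = poly p s" "coeff p 1 = 0"
    using X[unfolded lie_algebra_def mem_Collect_eq, rule_format, of ?g] by blast
  have "n ** (mat 1 + mat s ** X) ** matrix_inv n = mat 1 + mat s ** (n ** X ** matrix_inv n)" for s
    unfolding matrix_add_ldistrib matrix_add_rdistrib matrix_scale_assoc(1)[of n] matrix_scale_assoc(2)
    using cancel(3)[OF n] by simp
  thus "\<exists>p. (\<forall>s. f (mat 1 + mat s ** (n ** X ** matrix_inv n)) = poly p s) \<and> coeff p 1 = 0"
    using p by metis
qed

text \<open>Conjugation by \<open>n\<close> preserves the Lie algebra and moves a root vector to an eigenvector of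
  nontrivial weight, which is therefore a root vector.\<close>

lemma norm_T_permutes_roots:
  assumes n: "n \<in> norm_T" and c: "c \<in> d4_roots"
  shows "\<exists>d\<in>d4_roots. \<forall>t\<in>T. wt d t = wt c (matrix_inv n ** t ** n)"
proof -
  note nG = norm_TD(1)[OF n]
  obtain X where X: "X \<noteq> 0" "X \<in> root_space c"
  proof -
    obtain X0 where X0: "X0 \<noteq> 0" "root_space c = {mat a ** X0 | a. True}" using root_space_line[OF c] by blast
    have "mat 1 ** X0 \<in> root_space c" unfolding X0(2) by blast
    thus ?thesis using that X0(1) by simp
  qed
  define X' where "X' = n ** X ** matrix_inv n"
  have "X = matrix_inv n ** X' ** n"
    using nG by (simp add: X'_def matrix_mul_assoc cancel)
  hence X'0: "X' \<noteq> 0" using X(1) by auto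
  have L: "X' \<in> lie_algebra G" unfolding X'_def using X(2) nG by (intro lie_conj) (auto simp: root_space_iff)
  define f where "f = (\<lambda>t\<in>T. wt c (matrix_inv n ** t ** n))"
  have "eigen T f X'"
    unfolding eigen_def
  proof
    fix t assume t: "t \<in> T"
    let ?s = "matrix_inv n ** t ** n"
    note tG = T_G[OF t]
    have s: "?s \<in> T" by (rule norm_TD(3)[OF n t])
    have "matrix_inv ?s = matrix_inv n ** matrix_inv t ** n"
      using nG tG Gr(2,3) by (simp add: inv_mult inv_inv matrix_mul_assoc)
    hence "t ** X' ** matrix_inv t = n ** (?s ** X ** matrix_inv ?s) ** matrix_inv n"
      using nG by (simp add: X'_def matrix_mul_assoc cancel)
    also have "\<dots> = n ** (mat (wt c ?s) ** X) ** matrix_inv n"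
      using X(2) s by (simp add: root_space_iff eigen_def)
    also have "\<dots> = mat (wt c ?s) ** X'"
      unfolding X'_def matrix_scale_assoc(1)[of n] matrix_scale_assoc(2) ..
    finally show "t ** X' ** matrix_inv t = mat (f t) ** X'" using t by (simp add: f_def)
  qed
  hence "X' = 0 \<or> f = (\<lambda>_\<in>T. 1) \<or> (f \<in> roots G T \<and> X' \<in> weight_space G T f)"
    using lie_weights[of "{()}" "\<lambda>_. f" "\<lambda>_. X'" "()"] L by (simp add: f_def)
  moreover have "f \<noteq> (\<lambda>_\<in>T. 1)"
  proof
    assume f1: "f = (\<lambda>_\<in>T. 1)"
    have "c = 0"
    proof (rule wt_inj)
      fix s assume s: "s \<in> T"
      let ?t = "n ** s ** matrix_inv n"
      have "matrix_inv n ** ?t ** n = s" using nG by (simp add: matrix_mul_assoc cancel)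
      moreover have "?t \<in> T" by (rule norm_TD(2)[OF n s])
      ultimately show "wt c s = wt 0 s" using fun_cong[OF f1, of ?t] by (simp add: f_def wt_zero)
    qed
    thus False using d4_roots_norm[OF c] by (simp add: d4_form_simps)
  qed
  ultimately have "f \<in> lattice_char T \<alpha> ` d4_roots" using X'0 unfolding roots_eq by blast
  then obtain d where d: "d \<in> d4_roots" "f = lattice_char T \<alpha> d" by blast
  have "wt d t = wt c (matrix_inv n ** t ** n)" if "t \<in> T" for t
    using fun_cong[OF d(2), of t] that by (simp add: f_def lattice_char_eq)
  thus ?thesis using d(1) by blast
qed

text \<open>The images of the simple roots determine \<open>w\<close> as a linear map, since weights are determined
  by their values on \<open>T\<close>.\<close>

lemma acts_exists:
  assumes n: "n \<in> norm_T"
  shows "\<exists>w. acts n w \<and> (\<forall>c\<in>d4_roots. w c \<in> d4_roots)"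
proof -
  obtain w0 where w0: "\<And>c. c \<in> d4_roots \<Longrightarrow> w0 c \<in> d4_roots"
    "\<And>c t. c \<in> d4_roots \<Longrightarrow> t \<in> T \<Longrightarrow> wt (w0 c) t = wt c (matrix_inv n ** t ** n)"
    using norm_T_permutes_roots[OF n] by metis
  define w where "w c = scale_vec (c N1) (w0 (simple_vec N1)) + (scale_vec (c N2) (w0 (simple_vec N2)) +
    (scale_vec (c N3) (w0 (simple_vec N3)) + scale_vec (c N4) (w0 (simple_vec N4))))" for c
  have w: "acts n w"
    unfolding acts_def
  proof (intro allI ballI)
    fix c t assume t: "t \<in> T"
    let ?s = "matrix_inv n ** t ** n"
    have "wt (w0 (simple_vec i)) t = \<alpha> i ?s" for i
      using w0(2)[OF d4_roots_simple t] by (simp add: wt_simple)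
    hence "wt (w c) t = \<alpha> N1 ?s powi c N1 * (\<alpha> N2 ?s powi c N2 * (\<alpha> N3 ?s powi c N3 * \<alpha> N4 ?s powi c N4))"
      unfolding w_def by (simp only: wt_add[OF t] wt_scale)
    thus "wt (w c) t = wt c ?s" by (simp add: wt_def UNIV_d4_node mult_ac)
  qed
  have "w c = w0 c" if "c \<in> d4_roots" for c
    by (rule wt_inj) (simp add: actsD[OF w] w0(2)[OF that])
  thus ?thesis using w w0(1) by auto
qed

lemma acts_roots: "n \<in> norm_T \<Longrightarrow> acts n w \<Longrightarrow> c \<in> d4_roots \<Longrightarrow> w c \<in> d4_roots"
  using acts_exists acts_unique by blast

lemma root_group_conj:
  assumes n: "n \<in> norm_T" and w: "acts n w" and u: "root_group c u"
  shows "root_group (w c) (\<lambda>\<xi>. n ** u \<xi> ** matrix_inv n)"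
proof -
  note U = root_groupD[OF u] and nG = norm_TD(1)[OF n]
  show ?thesis
    unfolding root_group_def
  proof (intro conjI allI ballI)
    show "w c \<in> d4_roots" by (rule acts_roots[OF n w U(1)])
    show "n ** u \<xi> ** matrix_inv n \<in> G" for \<xi> by (intro Gr(2,3) nG U(2))
    show "n ** u (\<xi> + \<eta>) ** matrix_inv n = n ** u \<xi> ** matrix_inv n ** (n ** u \<eta> ** matrix_inv n)" for \<xi> \<eta>
      unfolding U(3) using nG by (simp add: matrix_mul_assoc cancel)
    show "poly_curve (\<lambda>\<xi>. n ** u \<xi> ** matrix_inv n)" by (rule curve_coeff_conj(1)[OF U(4)])
    show "n ** u 1 ** matrix_inv n \<noteq> mat 1"
    proof
      assume e: "n ** u 1 ** matrix_inv n = mat 1"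
      have "u 1 = matrix_inv n ** (n ** u 1 ** matrix_inv n) ** n"
        using nG by (simp add: matrix_mul_assoc cancel)
      thus False using U(6) unfolding e using nG by (simp add: cancel)
    qed
    fix t \<xi> assume t: "t \<in> T"
    let ?s = "matrix_inv n ** t ** n"
    have s: "?s \<in> T" by (rule norm_TD(3)[OF n t])
    have "matrix_inv ?s = matrix_inv n ** matrix_inv t ** n"
      using nG T_G[OF t] Gr(2,3) by (simp add: inv_mult inv_inv matrix_mul_assoc)
    hence "t ** (n ** u \<xi> ** matrix_inv n) ** matrix_inv t = n ** (?s ** u \<xi> ** matrix_inv ?s) ** matrix_inv n"
      using nG by (simp add: matrix_mul_assoc cancel)
    thus "t ** (n ** u \<xi> ** matrix_inv n) ** matrix_inv t = n ** u (wt (w c) t * \<xi>) ** matrix_inv n"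
      unfolding U(5)[OF s] actsD[OF w t] .
  qed
qed

lemma root_group_conj_eq:
  assumes "n \<in> norm_T" "acts n w" "root_group c u" "root_group (w c) v"
  shows "\<exists>e. e \<noteq> 0 \<and> (\<forall>\<xi>. n ** u \<xi> ** matrix_inv n = v (e * \<xi>))"
  using root_group_unique[OF assms(4) root_group_conj[OF assms(1-3)]] .

lemma root_surjective:
  assumes c: "c \<in> d4_roots" and a: "a \<noteq> 0"
  shows "\<exists>t\<in>T. wt c t = a"
proof -
  have "lattice_char T \<alpha> c \<in> roots G T" unfolding roots_eq using c by (rule imageI)
  hence ch: "lattice_char T \<alpha> c \<in> characters T" "\<exists>t\<in>T. lattice_char T \<alpha> c t \<noteq> 1"
    by (auto simp: roots_def)
  then obtain t0 where "t0 \<in> T" "lattice_char T \<alpha> c t0 \<noteq> 1" by blast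
  from character_surjective[OF ch(1) this a] show ?thesis by (auto simp: lattice_char_eq)
qed

lemma simple_surjective: "a \<noteq> 0 \<Longrightarrow> \<exists>t\<in>T. \<alpha> i t = a"
  using root_surjective[OF d4_roots_simple] by (simp add: wt_simple)

text \<open>The torus acts transitively on nonzero parameters, so the root group would be trivial.\<close>

lemma root_group_inj:
  assumes u: "root_group c u" and e: "u \<xi> = mat 1"
  shows "\<xi> = 0"
proof (rule ccontr)
  note U = root_groupD[OF u]
  assume "\<xi> \<noteq> 0"
  then obtain t where t: "t \<in> T" "wt c t * \<xi> = 1"
    using root_surjective[OF U(1), of "inverse \<xi>"] by auto
  have "u 1 = t ** u \<xi> ** matrix_inv t" using U(5)[OF t(1), of \<xi>] t(2) by simp
  thus False using e U(6) cancel(3)[OF T_G[OF t(1)]] by simp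
qed

lemma root_group_poly: "root_group c u \<Longrightarrow> \<exists>p. \<forall>\<xi>. u \<xi> $ i $ j = poly p \<xi>"
  using root_groupD(4) unfolding poly_curve_def by blast

text \<open>Conjugating \<open>y(\<eta>) = x(\<zeta>)\<close> by elements of \<open>T\<close> gives \<open>y(\<eta> s) = x(\<zeta> / s)\<close> for all \<open>s \<noteq> 0\<close>.
  The left-hand side is additive in \<open>s\<close>, so \<open>\<zeta> / (s + 1) = \<zeta> / s + \<zeta>\<close>, which for a suitable \<open>s\<close>
  forces \<open>\<zeta> = 0\<close>.\<close>

lemma opposite_root_groups:
  assumes x: "root_group c x" and y: "root_group (- c) y" and eq: "y \<eta> = x \<zeta>"
  shows "\<eta> = 0"
proof -
  note X = root_groupD[OF x] and Y = root_groupD[OF y]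
  have sc: "y (\<eta> * s) = x (\<zeta> / s)" if s: "s \<noteq> 0" for s
  proof -
    obtain t where t: "t \<in> T" "wt c t = inverse s" using root_surjective[OF X(1), of "inverse s"] s by auto
    have "t ** y \<eta> ** matrix_inv t = t ** x \<zeta> ** matrix_inv t" by (simp add: eq)
    thus ?thesis unfolding X(5)[OF t(1)] Y(5)[OF t(1)] wt_neg t(2) by (simp add: field_simps)
  qed
  obtain s :: 'k where s: "poly [:0, 1:] s \<noteq> 0" "poly [:1, 1:] s \<noteq> 0" "poly [:1, 1, 1:] s \<noteq> 0"
  proof -
    have "[:0, 1:] * [:1, 1:] * [:1, 1, 1:] \<noteq> (0 :: 'k poly)" by simp
    hence "\<exists>s. poly ([:0, 1:] * [:1, 1:] * [:1, 1, 1:]) s \<noteq> (0::'k)"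
      using poly_zero_cofinite[of 1] by (metis poly_1 zero_neq_one)
    thus ?thesis using that unfolding poly_mult mult_eq_0_iff by blast
  qed
  hence s0: "s \<noteq> 0" "s + 1 \<noteq> 0" "s * s + s + 1 \<noteq> 0" by (auto simp: algebra_simps)
  have "x (\<zeta> / (s + 1)) = y (\<eta> * (s + 1))" using sc[OF s0(2)] by simp
  also have "\<dots> = y (\<eta> * s) ** y (\<eta> * 1)" using Y(3)[of "\<eta> * s" "\<eta> * 1"] by (simp add: distrib_left)
  also have "\<dots> = x (\<zeta> / s) ** x (\<zeta> / 1)" using sc[OF s0(1)] sc[of 1] by simp
  also have "\<dots> = x (\<zeta> / s + \<zeta>)" using X(3)[of "\<zeta> / s" \<zeta>] by simp
  finally have "x (\<zeta> / s + \<zeta> + - (\<zeta> / (s + 1))) = mat 1"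
    unfolding X(3)[of "\<zeta> / s + \<zeta>"] using X(8)[of "\<zeta> / (s + 1)"] by simp
  hence "\<zeta> / s + \<zeta> + - (\<zeta> / (s + 1)) = 0" by (rule root_group_inj[OF x])
  hence "\<zeta> * (s * s + s + 1) = 0" using s0(1,2) by (simp add: field_simps)
  hence "\<zeta> = 0" using s0(3) by simp
  hence "y \<eta> = mat 1" using eq X(7) by simp
  thus ?thesis by (rule root_group_inj[OF y])
qed

text \<open>The element \<open>n\<^sup>-\<^sup>1 t n t\<^sup>-\<^sup>1\<close> of \<open>T\<close> is a Laurent curve evaluated at the value of \<open>\<alpha>\<^sub>i\<close> on
  \<open>t\<close>, so every character is a monomial on it; hence \<open>w \<alpha>\<^sub>j = \<alpha>\<^sub>j + m\<^sub>j \<alpha>\<^sub>i\<close>. As \<open>w \<alpha>\<^sub>j\<close> is a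
  root, its square length leaves two possible values of \<open>m\<^sub>j\<close>: zero and the one of the
  reflection. If \<open>w\<close> fixed \<open>\<alpha>\<^sub>i\<close>, then \<open>n\<close> would normalize the root group of \<open>\<alpha>\<^sub>i\<close>, so that all
  nontrivial elements of the opposite root group would lie in \<open>n T x(k)\<close>; their quotients lie in
  \<open>T x(k)\<close>, and commutators of these with \<open>T\<close> would be common to opposite root groups. Finally,
  if \<open>m\<^sub>j = 0\<close> for a neighbour \<open>j\<close> of \<open>i\<close>, the root \<open>\<alpha>\<^sub>j + \<alpha>\<^sub>i\<close> would be mapped to \<open>\<alpha>\<^sub>j - \<alpha>\<^sub>i\<close>,
  which is too long.\<close>

lemma acts_reflection:
  assumes x: "root_group (simple_vec i) x" and y: "root_group (- simple_vec i) y"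
    and n_def: "n = x 1 ** y (- 1) ** x 1" and n: "n \<in> norm_T"
  shows "acts n (reflect i)"
proof -
  note X = root_groupD[OF x] and Y = root_groupD[OF y] and nG = norm_TD(1)[OF n]
  obtain w where w: "acts n w" "\<And>c. c \<in> d4_roots \<Longrightarrow> w c \<in> d4_roots" using acts_exists[OF n] by blast
  have n_inv: "matrix_inv n = x (- 1) ** y 1 ** x (- 1)"
    unfolding n_def using X(2,10) Y(2,10) Gr(2) by (simp add: inv_mult matrix_mul_assoc)
  define \<psi> where "\<psi> a = x (- 1) ** y 1 ** x (- 1) ** x a ** y (- inverse a) ** x a" for a
  define \<psi>' where "\<psi>' a = x (- a) ** y (inverse a) ** x (- a) ** x 1 ** y (- 1) ** x 1" for a
  have \<psi>: "matrix_inv n ** t ** n ** matrix_inv t = \<psi> (\<alpha> i t)" if t: "t \<in> T" for t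
  proof -
    have "t ** n ** matrix_inv t = (t ** x 1 ** matrix_inv t) ** (t ** y (- 1) ** matrix_inv t) ** (t ** x 1 ** matrix_inv t)"
      unfolding n_def using T_G[OF t] by (simp add: matrix_mul_assoc cancel)
    also have "\<dots> = x (\<alpha> i t) ** y (- inverse (\<alpha> i t)) ** x (\<alpha> i t)"
      unfolding X(5)[OF t] Y(5)[OF t] wt_neg wt_simple by simp
    finally have e: "t ** n ** matrix_inv t = x (\<alpha> i t) ** y (- inverse (\<alpha> i t)) ** x (\<alpha> i t)" .
    have "matrix_inv n ** t ** n ** matrix_inv t = matrix_inv n ** (t ** n ** matrix_inv t)"
      by (simp add: matrix_mul_assoc)
    thus ?thesis unfolding e n_inv by (simp add: \<psi>_def matrix_mul_assoc)
  qed
  have fa: "(\<lambda>a. a) \<in> func_alg {\<lambda>s::'k. s, inverse}" "(\<lambda>a. c) \<in> func_alg {\<lambda>s::'k. s, inverse}"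
    "(\<lambda>a. inverse a) \<in> func_alg {\<lambda>s::'k. s, inverse}" "(\<lambda>a. - a) \<in> func_alg {\<lambda>s::'k. s, inverse}"
    "(\<lambda>a. - inverse a) \<in> func_alg {\<lambda>s::'k. s, inverse}" for c
  proof -
    show 1: "(\<lambda>a. a) \<in> func_alg {\<lambda>s::'k. s, inverse}" "(\<lambda>a. c) \<in> func_alg {\<lambda>s::'k. s, inverse}"
      "(\<lambda>a. inverse a) \<in> func_alg {\<lambda>s::'k. s, inverse}" for c by (auto intro: func_alg.intros)
    show "(\<lambda>a. - a) \<in> func_alg {\<lambda>s::'k. s, inverse}" "(\<lambda>a. - inverse a) \<in> func_alg {\<lambda>s::'k. s, inverse}"
      using func_alg.mult[OF 1(2)[of "- 1"] 1(1)] func_alg.mult[OF 1(2)[of "- 1"] 1(3)] by simp_all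
  qed
  note lc = laurent_curve_of_poly[OF root_group_poly[OF x]] laurent_curve_of_poly[OF root_group_poly[OF y]]
  have l\<psi>: "laurent_curve \<psi>" unfolding \<psi>_def[abs_def]
    by (intro laurent_curve_mult lc(1)[OF fa(2)] lc(1)[OF fa(1)] lc(2)[OF fa(2)] lc(2)[OF fa(5)])
  have l\<psi>': "laurent_curve \<psi>'" unfolding \<psi>'_def[abs_def]
    by (intro laurent_curve_mult lc(1)[OF fa(2)] lc(1)[OF fa(4)] lc(2)[OF fa(2)] lc(2)[OF fa(3)])
  have \<psi>T: "\<psi> a \<in> T" if a: "a \<noteq> 0" for a
  proof -
    obtain t where t: "t \<in> T" "\<alpha> i t = a" using simple_surjective[OF a] by blast
    have "matrix_inv n ** t ** n ** matrix_inv t \<in> T" by (rule Tr(2)[OF norm_TD(3)[OF n t(1)] Tr(3)[OF t(1)]])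
    thus ?thesis using \<psi>[OF t(1)] t(2) by simp
  qed
  have \<psi>\<psi>': "\<psi> a ** \<psi>' a = mat 1" if "a \<noteq> 0" for a
  proof -
    have c: "Z ** x \<xi> ** x (- \<xi>) = Z" "Z ** x (- \<xi>) ** x \<xi> = Z" "Z ** y \<xi> ** y (- \<xi>) = Z"
      "Z ** y (- \<xi>) ** y \<xi> = Z" for Z \<xi>
      using X(8,9) Y(8,9) by (simp_all add: matrix_mul_assoc[symmetric])
    show ?thesis unfolding \<psi>_def \<psi>'_def using X(9) by (simp add: matrix_mul_assoc c)
  qed
  have "\<exists>m. w (simple_vec j) = simple_vec j + scale_vec m (simple_vec i)" for j
  proof -
    obtain c m where cm: "\<And>a. a \<noteq> 0 \<Longrightarrow> \<alpha> j (\<psi> a) = c * a powi m"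
      using character_along_curve[OF simple_char[of j] l\<psi> \<psi>T l\<psi>' \<psi>\<psi>'] by blast
    have "\<psi> 1 = mat 1"
    proof -
      have i1: "matrix_inv (mat 1) = (mat 1 :: 'k^'n^'n)" by (rule matrix_inv_unique(1)) simp
      have "\<alpha> i (mat 1) = 1" using wt_one[of "simple_vec i"] by (simp add: wt_simple)
      thus ?thesis using \<psi>[OF Tr(1)] cancel(4)[OF nG] unfolding i1 by simp
    qed
    hence "c = 1" using cm[of 1] wt_one[of "simple_vec j"] by (simp add: wt_simple)
    have "w (simple_vec j) = simple_vec j + scale_vec m (simple_vec i)"
    proof (rule wt_inj)
      fix t assume t: "t \<in> T"
      have "matrix_inv n ** t ** n = \<psi> (\<alpha> i t) ** t"
        using \<psi>[OF t] cancel(2)[OF T_G[OF t]] by metis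
      hence "wt (w (simple_vec j)) t = \<alpha> j (\<psi> (\<alpha> i t)) * \<alpha> j t"
        using actsD[OF w(1) t, of "simple_vec j"] alpha_mult[OF \<psi>T[OF alpha_nz[OF t]] t] by (simp add: wt_simple)
      also have "\<dots> = wt (simple_vec j + scale_vec m (simple_vec i)) t"
        unfolding wt_add[OF t] wt_scale wt_simple cm[OF alpha_nz[OF t]] \<open>c = 1\<close> by simp
      finally show "wt (w (simple_vec j)) t = wt (simple_vec j + scale_vec m (simple_vec i)) t" .
    qed
    thus ?thesis by blast
  qed
  then obtain m where m: "\<And>j. w (simple_vec j) = simple_vec j + scale_vec (m j) (simple_vec i)" by metis
  have quad: "m j = 0 \<or> m j = - d4_cartan j i" for j
  proof -
    have "d4_form (w (simple_vec j)) (w (simple_vec j)) = 2" by (intro d4_roots_norm w(2) d4_roots_simple)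
    moreover have "d4_form (w (simple_vec j)) (w (simple_vec j)) = 2 + 2 * (m j * (d4_cartan j i + m j))"
      unfolding m d4_form_simps d4_form_simple_self
      using d4_form_sym[of "simple_vec i" "simple_vec j"] by (simp add: d4_form_simple algebra_simps)
    ultimately have "m j * (d4_cartan j i + m j) = 0" by simp
    thus ?thesis by auto
  qed
  have "w (simple_vec i) \<noteq> simple_vec i"
  proof
    assume fix_i: "w (simple_vec i) = simple_vec i"
    obtain c where c: "c \<noteq> 0" "\<And>\<xi>. n ** x \<xi> ** matrix_inv n = x (c * \<xi>)"
      using root_group_conj_eq[OF n w(1) x] x fix_i by metis
    have nx: "x \<xi> ** n = n ** x (\<xi> / c)" for \<xi>
    proof -
      have "n ** x (\<xi> / c) = n ** x (\<xi> / c) ** matrix_inv n ** n" using nG by (simp add: cancel)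
      thus ?thesis unfolding c(2) using c(1) by simp
    qed
    define e where "e = - 1 / c - 1"
    have y1: "y (- 1) = n ** x e"
    proof -
      have "x (- 1) ** n ** x (- 1) = y (- 1)"
      proof -
        have "x (- 1) ** n ** x (- 1) = (x (- 1) ** x 1) ** y (- 1) ** (x 1 ** x (- 1))"
          by (simp add: n_def matrix_mul_assoc)
        thus ?thesis using X(8,9) by simp
      qed
      moreover have "x (- 1) ** n ** x (- 1) = n ** x e"
        unfolding nx by (simp add: matrix_mul_assoc[symmetric] X(3)[symmetric] e_def)
      ultimately show ?thesis by simp
    qed
    obtain a :: 'k where a: "a \<noteq> 0" "a \<noteq> 1"
    proof -
      have "[:0, 1:] * [:- 1, 1:] \<noteq> (0 :: 'k poly)" by simp
      hence "\<exists>s. poly ([:0, 1:] * [:- 1, 1:]) s \<noteq> (0::'k)"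
        using poly_zero_cofinite[of 1] by (metis poly_1 zero_neq_one)
      thus ?thesis using that by auto
    qed
    obtain t where t: "t \<in> T" "wt (simple_vec i) t = a" using root_surjective[OF X(1) a(1)] by blast
    note tG = T_G[OF t(1)]
    define s where "s = matrix_inv n ** t ** n ** matrix_inv t"
    have s: "s \<in> T" unfolding s_def by (rule Tr(2)[OF norm_TD(3)[OF n t(1)] Tr(3)[OF t(1)]])
    have ya: "y (- inverse a) = n ** s ** x (a * e)"
    proof -
      have "y (- inverse a) = t ** y (- 1) ** matrix_inv t" unfolding Y(5)[OF t(1)] wt_neg t(2) by simp
      also have "\<dots> = n ** s ** (t ** x e ** matrix_inv t)"
        unfolding y1 s_def using nG tG by (simp add: matrix_mul_assoc cancel)
      finally show ?thesis unfolding X(5)[OF t(1)] t(2) .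
    qed
    define \<eta> where "\<eta> = 1 - inverse a"
    have \<eta>0: "\<eta> \<noteq> 0" using a by (simp add: \<eta>_def)
    define f where "f = - inverse (wt (simple_vec i) s) * e + a * e"
    have y\<eta>: "y \<eta> = s ** x f"
    proof -
      have "y 1 = matrix_inv (y (- 1))" using Y(10)[of "- 1"] by simp
      also have "\<dots> = x (- e) ** matrix_inv n" unfolding y1 using nG X(2,10) by (simp add: inv_mult)
      finally have y_1: "y 1 = x (- e) ** matrix_inv n" .
      have "y \<eta> = y 1 ** y (- inverse a)" using Y(3)[of 1 "- inverse a"] by (simp add: \<eta>_def)
      also have "\<dots> = x (- e) ** s ** x (a * e)" unfolding y_1 ya using nG by (simp add: matrix_mul_assoc cancel)
      also have "x (- e) ** s = s ** x (- inverse (wt (simple_vec i) s) * e)"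
      proof -
        have "s ** x (- inverse (wt (simple_vec i) s) * e) ** matrix_inv s = x (- e)"
        proof -
          have "wt (simple_vec i) s * (- inverse (wt (simple_vec i) s) * e) = - e"
            using wt_nz[OF s, of "simple_vec i"] by (simp add: field_simps)
          thus ?thesis unfolding X(5)[OF s] by (simp only:)
        qed
        thus ?thesis using cancel(2)[OF T_G[OF s]] by metis
      qed
      finally show ?thesis by (simp add: matrix_mul_assoc[symmetric] X(3)[symmetric] f_def)
    qed
    have "y (inverse a * \<eta>) = s ** x (a * f)"
    proof -
      have "y (inverse a * \<eta>) = t ** y \<eta> ** matrix_inv t" unfolding Y(5)[OF t(1)] wt_neg t(2) ..
      also have "\<dots> = t ** s ** matrix_inv t ** (t ** x f ** matrix_inv t)"
        unfolding y\<eta> using tG by (simp add: matrix_mul_assoc cancel)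
      also have "t ** s ** matrix_inv t = s" using T_commutative[OF t(1) s] cancel(1)[OF tG] by simp
      finally show ?thesis unfolding X(5)[OF t(1)] t(2) .
    qed
    hence "y (- \<eta> + inverse a * \<eta>) = matrix_inv (s ** x f) ** (s ** x (a * f))"
      unfolding Y(3) Y(10)[symmetric] y\<eta> by simp
    also have "\<dots> = x (- f) ** x (a * f)"
      using T_G[OF s] X(2,10) by (simp add: inv_mult matrix_mul_assoc cancel)
    also have "\<dots> = x (- f + a * f)" by (rule X(3)[symmetric])
    finally have "- \<eta> + inverse a * \<eta> = 0" by (rule opposite_root_groups[OF x y])
    hence "\<eta> * (inverse a - 1) = 0" by (simp add: algebra_simps)
    thus False using \<eta>0 a by simp
  qed
  hence mi: "m i = - 2" using quad[of i] m[of i] by (auto simp: d4_cartan_def fun_eq_iff)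
  have mj: "m j = - d4_cartan j i" for j
  proof (cases "j = i")
    case True
    thus ?thesis using mi by (simp add: d4_cartan_def)
  next
    case False
    show ?thesis
    proof (rule ccontr)
      assume ne: "m j \<noteq> - d4_cartan j i"
      hence m0: "m j = 0" and c1: "d4_cartan j i = - 1" using quad[of j] False by (auto simp: d4_cartan_def split: if_splits)
      have "reflect i (simple_vec j) = simple_vec j + simple_vec i"
        using c1 by (auto simp: reflect_def d4_form_simple fun_eq_iff)
      hence "simple_vec j + simple_vec i \<in> d4_roots" using d4_roots_reflect[OF d4_roots_simple] by metis
      hence "w (simple_vec j + simple_vec i) \<in> d4_roots" by (rule w(2))
      moreover have "w (simple_vec j + simple_vec i) = simple_vec j - simple_vec i"
        unfolding acts_linear(1)[OF n w(1)] m m0 mi by (auto simp: fun_eq_iff)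
      ultimately have "d4_form (simple_vec j - simple_vec i) (simple_vec j - simple_vec i) = 2"
        using d4_roots_norm by metis
      moreover have "d4_form (simple_vec i) (simple_vec j) = - 1"
        using c1 d4_form_sym[of "simple_vec i" "simple_vec j"] by (simp add: d4_form_simple)
      ultimately show False using c1 unfolding d4_form_simps d4_form_simple_self by (simp add: d4_form_simple)
    qed
  qed
  have simple_eq: "w (simple_vec j) = reflect i (simple_vec j)" for j
    unfolding m mj by (auto simp: reflect_def d4_form_simple fun_eq_iff)
  have "w c = reflect i c" for c
  proof -
    have c: "c = scale_vec (c N1) (simple_vec N1) + (scale_vec (c N2) (simple_vec N2) +
        (scale_vec (c N3) (simple_vec N3) + scale_vec (c N4) (simple_vec N4)))" (is "c = ?c")
    proof
      fix j show "c j = ?c j" by (cases j) auto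
    qed
    have "reflect i (scale_vec k d) = scale_vec k (reflect i d)" for k d
      by (auto simp: reflect_def d4_form_simps fun_eq_iff algebra_simps)
    hence "w ?c = reflect i ?c"
      by (simp only: acts_linear(1,2)[OF n w(1)] reflect_add simple_eq)
    thus ?thesis using c by simp
  qed
  hence "w = reflect i" by blast
  thus ?thesis using w(1) by simp
qed

end

section \<open>The Bruhat decomposition\<close>

locale chevalley_group = rooted_group T r \<phi> G \<alpha>
  for T :: "('k::alg_closed_field^'n^'n) set" and r :: nat and \<phi> :: "(nat \<Rightarrow> 'k) \<Rightarrow> 'k^'n^'n"
    and G :: "('k^'n^'n) set" and \<alpha> :: "d4_node \<Rightarrow> 'k^'n^'n \<Rightarrow> 'k" +
  fixes x y :: "d4_node \<Rightarrow> 'k \<Rightarrow> 'k^'n^'n"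
  assumes G_closed: "zariski_closed G" and G_connected: "zariski_connected G"
    and x_group: "\<And>i. root_group (simple_vec i) (x i)"
    and y_group: "\<And>i. root_group (- simple_vec i) (y i)"
    and n_normalizes: "\<And>i. x i 1 ** y i (- 1) ** x i 1 \<in> norm_T"
begin

definition n :: "d4_node \<Rightarrow> 'k^'n^'n" where
  "n i = x i 1 ** y i (- 1) ** x i 1"

lemma n_norm: "n i \<in> norm_T" using n_normalizes by (simp add: n_def)

lemmas n_G = norm_TD(1)[OF n_norm]

lemma acts_n: "acts (n i) (reflect i)"
  by (rule acts_reflection[OF x_group y_group n_def n_norm])

lemma acts_n_inv: "acts (matrix_inv (n i)) (reflect i)"
  unfolding acts_def
proof (intro allI ballI)
  fix c t assume t: "t \<in> T"
  let ?t = "n i ** t ** matrix_inv (n i)"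
  have "wt (reflect i (reflect i c)) ?t = wt (reflect i c) (matrix_inv (n i) ** ?t ** n i)"
    by (rule actsD[OF acts_n norm_TD(2)[OF n_norm t]])
  moreover have "matrix_inv (n i) ** ?t ** n i = t" using n_G by (simp add: matrix_mul_assoc cancel)
  ultimately show "wt (reflect i c) t = wt c (matrix_inv (matrix_inv (n i)) ** t ** matrix_inv (n i))"
    by (simp add: reflect_reflect inv_inv[OF n_G])
qed

lemma root_group_exists_in:
  assumes H: "matrix_subgroup H" "\<And>i \<xi>. x i \<xi> \<in> H" "\<And>i \<xi>. y i \<xi> \<in> H" and c: "c \<in> d4_roots"
  shows "\<exists>u. root_group c u \<and> range u \<subseteq> H"
  using c
proof (induction rule: d4_roots_induct)
  case (simple i)
  show ?case using x_group H(2) by blast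
next
  case (reflect c j)
  then obtain u where u: "root_group c u" "range u \<subseteq> H" by blast
  have "n j \<in> H" unfolding n_def by (intro matrix_subgroupD(2)[OF H(1)] H)
  hence "n j ** u \<xi> ** matrix_inv (n j) \<in> H" for \<xi>
    using u(2) matrix_subgroupD(2,3)[OF H(1)] by blast
  thus ?case using root_group_conj[OF n_norm acts_n u(1)] by blast
qed

lemma root_group_exists: "c \<in> d4_roots \<Longrightarrow> \<exists>u. root_group c u"
  using root_group_exists_in[OF G_group] root_groupD(2) x_group y_group by blast

text \<open>Independent of the parametrisation, by \<open>root_group_unique\<close>.\<close>

definition root_subgroup :: "(d4_node \<Rightarrow> int) \<Rightarrow> ('k^'n^'n) set" where
  "root_subgroup c = {u \<xi> | u \<xi>. root_group c u}"

lemma root_subgroup_eq: "root_group c u \<Longrightarrow> root_subgroup c = range u"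
proof (intro subset_antisym subsetI)
  assume u: "root_group c u"
  show "g \<in> range u" if g: "g \<in> root_subgroup c" for g
  proof -
    obtain v \<xi> where v: "g = v \<xi>" "root_group c v" using g by (auto simp: root_subgroup_def)
    obtain e where "\<forall>\<xi>. v \<xi> = u (e * \<xi>)" using root_group_unique[OF u v(2)] by blast
    thus ?thesis using v(1) by blast
  qed
  show "g \<in> root_subgroup c" if "g \<in> range u" for g using that u by (auto simp: root_subgroup_def)
qed

lemma root_subgroup_conj:
  assumes n: "n' \<in> norm_T" and w: "acts n' w" and g: "g \<in> root_subgroup c"
  shows "n' ** g ** matrix_inv n' \<in> root_subgroup (w c)"
proof -
  obtain u \<xi> where u: "root_group c u" "g = u \<xi>" using g by (auto simp: root_subgroup_def)
  show ?thesis unfolding root_subgroup_eq[OF root_group_conj[OF n w u(1)]] u(2) by (rule rangeI)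
qed

text \<open>The group in the role of \<open>B\<close> in the BN-pair. By \<open>borel_in\<close> it is contained in every group
  that contains \<open>T\<close> and the simple root groups, such as the Borel subgroup defining the simple
  roots.\<close>

definition borel :: "('k^'n^'n) set" where
  "borel = mgen (T \<union> (\<Union>c\<in>{c. positive c}. root_subgroup c))"

text \<open>Generated by \<open>T\<close> and the unipotent radical of the minimal parabolic subgroup of the simple
  root.\<close>

definition radical :: "d4_node \<Rightarrow> ('k^'n^'n) set" where
  "radical i = mgen (T \<union> (\<Union>c\<in>{c. positive c \<and> c \<noteq> simple_vec i}. root_subgroup c))"

lemma radical_borel: "radical i \<subseteq> borel"
  unfolding radical_def borel_def by (rule mgen_mono) auto

lemma borel_T: "t \<in> T \<Longrightarrow> t \<in> borel" and borel_root: "positive c \<Longrightarrow> g \<in> root_subgroup c \<Longrightarrow> g \<in> borel"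
  unfolding borel_def by (auto intro: mgen_gen)

lemma borel_closed: "a \<in> borel \<Longrightarrow> b \<in> borel \<Longrightarrow> a ** b \<in> borel"
  unfolding borel_def by (rule mgen_closed)

lemma borel_one: "mat 1 \<in> borel" unfolding borel_def by (rule mgen.one)

lemma positive_simple: "positive (simple_vec i)"
  by (auto simp: positive_def d4_roots_simple)

lemma not_positive_neg: "positive c \<Longrightarrow> \<not> positive (- c)"
proof
  assume c: "positive c" "positive (- c)"
  have "c i = 0" for i using c by (auto simp: positive_def antisym)
  hence "c = 0" by (simp add: fun_eq_iff)
  thus False using c(1) d4_roots_norm[of c] by (simp add: positive_def d4_form_simps)
qed

lemma x_borel: "x i \<xi> \<in> borel"
  by (rule borel_root[OF positive_simple]) (auto simp: root_subgroup_eq[OF x_group])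

text \<open>The simple reflection permutes the positive roots other than the simple root.\<close>

lemma radical_conj:
  assumes q: "q \<in> radical i"
  shows "n i ** q ** matrix_inv (n i) \<in> radical i"
  using q unfolding radical_def
proof (induction rule: mgen.induct)
  case one
  show ?case using n_G by (simp add: cancel mgen.one)
next
  case (mult s g)
  have "n i ** s ** matrix_inv (n i) \<in> T \<union> (\<Union>c\<in>{c. positive c \<and> c \<noteq> simple_vec i}. root_subgroup c)"
    using mult.hyps(1)
  proof
    assume "s \<in> T"
    thus ?thesis using norm_TD(2)[OF n_norm] by blast
  next
    assume "s \<in> (\<Union>c\<in>{c. positive c \<and> c \<noteq> simple_vec i}. root_subgroup c)"
    then obtain c where c: "positive c" "c \<noteq> simple_vec i" "s \<in> root_subgroup c" by blast
    have "reflect i c \<noteq> simple_vec i"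
    proof
      assume "reflect i c = simple_vec i"
      hence "c = - simple_vec i" using reflect_reflect[of i c] reflect_simple by metis
      thus False using c(1) not_positive_neg[OF positive_simple] by simp
    qed
    thus ?thesis
      using root_subgroup_conj[OF n_norm acts_n c(3)] reflect_positive[OF c(1,2)] by blast
  qed
  from mgen.mult[OF this mult.IH] show ?case using n_G by (simp add: matrix_mul_assoc cancel)
qed

text \<open>By the commutator formula the simple root group normalizes \<open>radical i\<close>: the sum of a
  positive root and the simple root is positive and not simple.\<close>

lemma borel_factor:
  assumes b: "b \<in> borel"
  shows "\<exists>\<xi>. \<exists>q\<in>radical i. b = x i \<xi> ** q"
  using b unfolding borel_def
proof (induction rule: mgen.induct)
  case one
  show ?case using root_groupD(7)[OF x_group, of i] unfolding radical_def
    by (intro exI[of _ 0] bexI[of _ "mat 1"]) (auto intro: mgen.one)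
next
  case (mult s g)
  note X = root_groupD[OF x_group[of i]]
  obtain \<xi> q where q: "q \<in> radical i" "g = x i \<xi> ** q" using mult.IH by blast
  have comm: ?case if "matrix_inv (x i \<zeta>) ** s ** x i \<xi> \<in> radical i" for \<zeta>
  proof -
    have "s ** g = x i \<zeta> ** ((matrix_inv (x i \<zeta>) ** s ** x i \<xi>) ** q)"
      using X(2) by (simp add: q(2) matrix_mul_assoc cancel)
    moreover have "(matrix_inv (x i \<zeta>) ** s ** x i \<xi>) ** q \<in> radical i"
      using that q(1) unfolding radical_def by (rule mgen_closed)
    ultimately show ?thesis by blast
  qed
  from mult.hyps(1) show ?case
  proof
    assume s: "s \<in> T"
    show ?thesis
    proof (rule comm[of "wt (simple_vec i) s * \<xi>"])
      have "matrix_inv (s ** x i \<xi> ** matrix_inv s) ** s ** x i \<xi> = s"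
        using T_G[OF s] X(2) Gr(2,3) by (simp add: inv_mult inv_inv matrix_mul_assoc cancel)
      thus "matrix_inv (x i (wt (simple_vec i) s * \<xi>)) ** s ** x i \<xi> \<in> radical i"
        unfolding X(5)[OF s, symmetric] using s by (auto simp: radical_def intro: mgen_gen)
    qed
  next
    assume "s \<in> (\<Union>c\<in>{c. positive c}. root_subgroup c)"
    then obtain c where c: "positive c" "s \<in> root_subgroup c" by blast
    show ?thesis
    proof (cases "c = simple_vec i")
      case True
      then obtain \<zeta> where "s = x i \<zeta>" using c(2) root_subgroup_eq[OF x_group] by blast
      hence "s ** g = x i (\<zeta> + \<xi>) ** q" unfolding q(2) X(3) by (simp add: matrix_mul_assoc)
      thus ?thesis using q(1) by blast
    next
      case False
      obtain v \<eta> where v: "root_group c v" "s = v \<eta>" using c(2) by (auto simp: root_subgroup_def)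
      have ne: "c \<noteq> - simple_vec i" using c(1) not_positive_neg[OF positive_simple] by blast
      have sR: "v \<eta> \<in> radical i" unfolding radical_def
        using c False v by (intro mgen_gen) auto
      show ?thesis
      proof (rule comm[of \<xi>])
        have "matrix_inv (x i \<xi>) ** s ** x i \<xi> = x i (- \<xi>) ** v \<eta> ** x i (- (- \<xi>))"
          by (simp add: X(10) v(2))
        also have "\<dots> \<in> radical i"
        proof (cases "simple_vec i + c \<in> d4_roots")
          case False
          show ?thesis unfolding root_group_commutator(1)[OF x_group v(1) ne False] by (rule sR)
        next
          case True
          obtain u where u: "root_group (simple_vec i + c) u" using root_group_exists[OF True] by blast
          obtain \<zeta> where \<zeta>: "x i (- \<xi>) ** v \<eta> ** x i (- (- \<xi>)) = u \<zeta> ** v \<eta>"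
            using root_group_commutator(2)[OF x_group v(1) ne u] by blast
          have "positive (simple_vec i + c)"
            using True c(1) by (auto simp: positive_def)
          moreover have "simple_vec i + c \<noteq> simple_vec i"
            using c(1) d4_roots_norm[of c] by (auto simp: positive_def d4_form_simps)
          ultimately have "u \<zeta> \<in> radical i" unfolding radical_def
            using root_subgroup_eq[OF u] by (intro mgen_gen) blast
          thus ?thesis unfolding \<zeta> using sR unfolding radical_def by (rule mgen_closed)
        qed
        finally show "matrix_inv (x i \<xi>) ** s ** x i \<xi> \<in> radical i" .
      qed
    qed
  qed
qed

text \<open>The two Bruhat relations in the group of rank one. The first one comes from \<open>n = n n
  n\<^sup>-\<^sup>1\<close>, which exchanges the roles of \<open>x\<close> and \<open>y\<close> in the definition of \<open>n\<close>; both are extended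
  from one parameter to all nonzero ones by conjugation with \<open>T\<close>.\<close>

lemma rank_one:
  shows "\<xi> \<noteq> 0 \<Longrightarrow> \<exists>d t e. t \<in> T \<and> x i \<xi> ** matrix_inv (n i) = y i d ** t ** x i e"
    "\<eta> \<noteq> 0 \<Longrightarrow> \<exists>a t. t \<in> T \<and> y i \<eta> = x i a ** matrix_inv (n i) ** t ** x i a"
proof -
  note X = root_groupD[OF x_group[of i]] and Y = root_groupD[OF y_group[of i]]
  have ng: "root_group (reflect i (simple_vec i)) (y i)" "root_group (reflect i (- simple_vec i)) (x i)"
    using x_group y_group by (simp_all only: reflect_simple reflect_minus minus_minus)
  obtain p where p: "p \<noteq> 0" "\<And>\<xi>. n i ** x i \<xi> ** matrix_inv (n i) = y i (p * \<xi>)"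
    using root_group_conj_eq[OF n_norm acts_n x_group ng(1)] by blast
  obtain p' where p': "p' \<noteq> 0" "\<And>\<xi>. n i ** y i \<xi> ** matrix_inv (n i) = x i (p' * \<xi>)"
    using root_group_conj_eq[OF n_norm acts_n y_group ng(2)] by blast
  have "n i = n i ** n i ** matrix_inv (n i)" using n_G by (simp add: cancel)
  also have "\<dots> = (n i ** x i 1 ** matrix_inv (n i)) ** (n i ** y i (- 1) ** matrix_inv (n i)) ** (n i ** x i 1 ** matrix_inv (n i))"
    by (subst (2) n_def) (simp add: matrix_mul_assoc cancel[OF n_G])
  also have "\<dots> = y i p ** x i (- p') ** y i p" unfolding p(2) p'(2) by simp
  finally have n_eq: "n i = y i p ** x i (- p') ** y i p" .
  have xp: "x i (- p') = y i (- p) ** n i ** y i (- p)"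
  proof -
    have "y i (- p) ** n i ** y i (- p) = (y i (- p) ** y i p) ** x i (- p') ** (y i p ** y i (- p))"
      unfolding n_eq by (simp only: matrix_mul_assoc)
    thus ?thesis using Y(8,9) by simp
  qed
  show "\<exists>d t e. t \<in> T \<and> x i \<xi> ** matrix_inv (n i) = y i d ** t ** x i e" if "\<xi> \<noteq> 0"
  proof -
    obtain s where s: "s \<in> T" "\<alpha> i s = \<xi> / (- p')" using simple_surjective[of "\<xi> / (- p')" i] \<open>\<xi> \<noteq> 0\<close> p'(1) by auto
    note sG = T_G[OF s(1)]
    define d where "d = wt (- simple_vec i) s * (- p)"
    have "x i \<xi> = s ** x i (- p') ** matrix_inv s"
      unfolding X(5)[OF s(1)] wt_simple s(2) using p'(1) by simp
    also have "\<dots> = (s ** y i (- p) ** matrix_inv s) ** (s ** n i ** matrix_inv s) ** (s ** y i (- p) ** matrix_inv s)"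
      unfolding xp using sG by (simp add: matrix_mul_assoc cancel)
    also have "\<dots> = y i d ** (s ** n i ** matrix_inv s) ** y i d" unfolding Y(5)[OF s(1)] d_def ..
    finally have "x i \<xi> ** matrix_inv (n i) = y i d ** (s ** (n i ** matrix_inv s ** matrix_inv (n i))) ** (n i ** y i d ** matrix_inv (n i))"
      using n_G by (simp add: matrix_mul_assoc cancel)
    moreover have "s ** (n i ** matrix_inv s ** matrix_inv (n i)) \<in> T"
      by (intro Tr(2) s(1) norm_TD(2)[OF n_norm] Tr(3))
    ultimately show ?thesis unfolding p'(2) by blast
  qed
  show "\<exists>a t. t \<in> T \<and> y i \<eta> = x i a ** matrix_inv (n i) ** t ** x i a" if "\<eta> \<noteq> 0"
  proof -
    have n_inv: "matrix_inv (n i) = x i (- 1) ** y i 1 ** x i (- 1)"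
      unfolding n_def using X(2,10) Y(2,10) Gr(2) by (simp add: inv_mult matrix_mul_assoc)
    have y1: "y i 1 = x i 1 ** matrix_inv (n i) ** x i 1"
    proof -
      have "x i 1 ** matrix_inv (n i) ** x i 1 = (x i 1 ** x i (- 1)) ** y i 1 ** (x i (- 1) ** x i 1)"
        unfolding n_inv by (simp only: matrix_mul_assoc)
      thus ?thesis using X(8,9) by simp
    qed
    obtain s where s: "s \<in> T" "\<alpha> i s = inverse \<eta>" using simple_surjective[of "inverse \<eta>" i] \<open>\<eta> \<noteq> 0\<close> by auto
    note sG = T_G[OF s(1)]
    define a where "a = wt (simple_vec i) s * 1"
    have "y i \<eta> = s ** y i 1 ** matrix_inv s"
      unfolding Y(5)[OF s(1)] wt_neg wt_simple s(2) by simp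
    also have "\<dots> = (s ** x i 1 ** matrix_inv s) ** (s ** matrix_inv (n i) ** matrix_inv s) ** (s ** x i 1 ** matrix_inv s)"
      unfolding y1 using sG by (simp add: matrix_mul_assoc cancel)
    also have "\<dots> = x i a ** (s ** matrix_inv (n i) ** matrix_inv s) ** x i a" unfolding X(5)[OF s(1)] a_def ..
    also have "\<dots> = x i a ** matrix_inv (n i) ** (n i ** s ** matrix_inv (n i) ** matrix_inv s) ** x i a"
      using n_G by (simp add: matrix_mul_assoc cancel)
    finally have "y i \<eta> = x i a ** matrix_inv (n i) ** (n i ** s ** matrix_inv (n i) ** matrix_inv s) ** x i a" .
    moreover have "n i ** s ** matrix_inv (n i) ** matrix_inv s \<in> T"
      by (intro Tr(2) s(1) norm_TD(2)[OF n_norm] Tr(3))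
    ultimately show ?thesis by blast
  qed
qed

text \<open>Write \<open>b = x\<^sub>i(\<xi>) q\<close>, where \<open>q\<close> can be moved past \<open>n\<^sub>i\<^sup>-\<^sup>1\<close>. If \<open>w\<close> keeps \<open>\<alpha>\<^sub>i\<close> positive,
  \<open>x\<^sub>i(\<xi>)\<close> can be moved to the left past \<open>m\<close>. Otherwise \<open>x\<^sub>i(\<xi>) n\<^sub>i\<^sup>-\<^sup>1\<close> is rewritten with \<open>y\<^sub>i\<close>
  on the left, and this factor can be moved to the left past \<open>m\<close>.\<close>

lemma double_coset_step:
  assumes m: "m \<in> norm_T" and b: "b \<in> borel"
  shows "\<exists>m'\<in>{m, m ** matrix_inv (n i)}. \<exists>b1\<in>borel. \<exists>b2\<in>borel. m ** b ** matrix_inv (n i) = b1 ** m' ** b2"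
proof -
  note X = root_groupD[OF x_group[of i]] and mG = norm_TD(1)[OF m]
  obtain w where w: "acts m w" "\<And>c. c \<in> d4_roots \<Longrightarrow> w c \<in> d4_roots" using acts_exists[OF m] by blast
  obtain \<xi> q where q: "q \<in> radical i" "b = x i \<xi> ** q" using borel_factor[OF b] by blast
  define q' where "q' = n i ** q ** matrix_inv (n i)"
  have q': "q' \<in> borel" unfolding q'_def using radical_conj[OF q(1)] radical_borel by blast
  have eq: "m ** b ** matrix_inv (n i) = m ** (x i \<xi> ** matrix_inv (n i)) ** q'"
    unfolding q(2) q'_def using n_G by (simp add: matrix_mul_assoc cancel)
  have xs: "x i \<xi> \<in> root_subgroup (simple_vec i)" by (auto simp: root_subgroup_eq[OF x_group])
  show ?thesis
  proof (cases "positive (w (simple_vec i)) \<or> \<xi> = 0")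
    case True
    have "m ** x i \<xi> ** matrix_inv m \<in> borel"
    proof (cases "\<xi> = 0")
      case True
      thus ?thesis using X(7) mG borel_one by (simp add: cancel)
    next
      case False
      thus ?thesis using True borel_root[OF _ root_subgroup_conj[OF m w(1) xs]] by blast
    qed
    moreover have "m ** b ** matrix_inv (n i) = (m ** x i \<xi> ** matrix_inv m) ** (m ** matrix_inv (n i)) ** q'"
      unfolding eq using mG by (simp add: matrix_mul_assoc cancel)
    ultimately show ?thesis using q' by blast
  next
    case False
    hence neg: "positive (w (- simple_vec i))"
      using root_dichotomy[OF w(2)[OF d4_roots_simple]] acts_linear(3)[OF m w(1)] by metis
    obtain d t e where t: "t \<in> T" "x i \<xi> ** matrix_inv (n i) = y i d ** t ** x i e"
      using rank_one(1)[of \<xi> i] False by blast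
    have "y i d \<in> root_subgroup (- simple_vec i)" by (auto simp: root_subgroup_eq[OF y_group])
    hence "m ** y i d ** matrix_inv m \<in> borel" using borel_root[OF neg root_subgroup_conj[OF m w(1)]] by blast
    moreover have "t ** x i e ** q' \<in> borel" by (intro borel_closed borel_T t x_borel q')
    moreover have "m ** b ** matrix_inv (n i) = (m ** y i d ** matrix_inv m) ** m ** (t ** x i e ** q')"
      unfolding eq t(2) using mG by (simp add: matrix_mul_assoc cancel)
    ultimately show ?thesis by blast
  qed
qed

definition bruhat_union :: "('k^'n^'n) set" where
  "bruhat_union = {b1 ** m ** b2 | b1 m b2. b1 \<in> borel \<and> m \<in> norm_T \<and> b2 \<in> borel}"

lemma bruhat_union_borel: "g \<in> bruhat_union \<Longrightarrow> b \<in> borel \<Longrightarrow> g ** b \<in> bruhat_union"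
proof -
  assume "g \<in> bruhat_union" and b: "b \<in> borel"
  then obtain b1 m b2 where h: "b1 \<in> borel" "m \<in> norm_T" "b2 \<in> borel" "g = b1 ** m ** b2"
    by (auto simp: bruhat_union_def)
  have "g ** b = b1 ** m ** (b2 ** b)" by (simp add: h(4) matrix_mul_assoc)
  thus ?thesis using h borel_closed[OF h(3) b] by (auto simp: bruhat_union_def)
qed

lemma bruhat_union_n: "g \<in> bruhat_union \<Longrightarrow> g ** matrix_inv (n i) \<in> bruhat_union"
proof -
  assume "g \<in> bruhat_union"
  then obtain b1 m b2 where h: "b1 \<in> borel" "m \<in> norm_T" "b2 \<in> borel" "g = b1 ** m ** b2"
    by (auto simp: bruhat_union_def)
  obtain m' c1 c2 where s: "m' \<in> {m, m ** matrix_inv (n i)}" "c1 \<in> borel" "c2 \<in> borel"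
    "m ** b2 ** matrix_inv (n i) = c1 ** m' ** c2" using double_coset_step[OF h(2,3)] by blast
  have "g ** matrix_inv (n i) = b1 ** (m ** b2 ** matrix_inv (n i))" by (simp add: h(4) matrix_mul_assoc)
  also have "\<dots> = (b1 ** c1) ** m' ** c2" unfolding s(4) by (simp add: matrix_mul_assoc)
  finally have "g ** matrix_inv (n i) = (b1 ** c1) ** m' ** c2" .
  moreover have "m' \<in> norm_T" using s(1) h(2) norm_T_mult[OF h(2) norm_T_inv[OF n_norm]] by auto
  ultimately show ?thesis using borel_closed[OF h(1) s(2)] s(3) by (auto simp: bruhat_union_def)
qed

definition gen_set :: "('k^'n^'n) set" where
  "gen_set = T \<union> (\<Union>i. range (x i)) \<union> (\<Union>i. range (y i))"

lemma bruhat_union_gen: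
  assumes g: "g \<in> bruhat_union" and s: "s \<in> gen_set"
  shows "g ** s \<in> bruhat_union"
proof -
  from s consider "s \<in> T" | i \<xi> where "s = x i \<xi>" | i \<eta> where "s = y i \<eta>" by (auto simp: gen_set_def)
  thus ?thesis
  proof cases
    case 3
    show ?thesis
    proof (cases "\<eta> = 0")
      case True
      thus ?thesis using 3 g root_groupD(7)[OF y_group] by simp
    next
      case False
      obtain a t where t: "t \<in> T" "y i \<eta> = x i a ** matrix_inv (n i) ** t ** x i a"
        using rank_one(2)[OF False] by blast
      have "g ** x i a ** matrix_inv (n i) ** t ** x i a \<in> bruhat_union"
        by (intro bruhat_union_borel bruhat_union_n g x_borel borel_T t)
      thus ?thesis by (simp add: 3 t(2) matrix_mul_assoc)
    qed
  qed (use g bruhat_union_borel borel_T x_borel in auto)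
qed

lemma gen_setI: "t \<in> T \<Longrightarrow> t \<in> gen_set" "x i \<xi> \<in> gen_set" "y i \<xi> \<in> gen_set"
  unfolding gen_set_def by blast+

lemma gen_set_cases:
  assumes "s \<in> gen_set"
  obtains "s \<in> T" | i \<xi> where "s = x i \<xi>" | i \<xi> where "s = y i \<xi>"
  using assms by (auto simp: gen_set_def)

lemma gen_group: "matrix_subgroup (mgen gen_set)" "mgen gen_set \<subseteq> G"
proof -
  have SG: "gen_set \<subseteq> G"
    using T_sub root_groupD(2)[OF x_group] root_groupD(2)[OF y_group] by (auto simp: gen_set_def)
  have Sinv: "matrix_inv s \<in> gen_set" if "s \<in> gen_set" for s
    using that
    by (cases s rule: gen_set_cases)
      (simp_all add: gen_setI Tr(3) root_groupD(10)[OF x_group] root_groupD(10)[OF y_group])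
  show "matrix_subgroup (mgen gen_set)" by (rule mgen_subgroup(1)[OF SG Sinv])
  show "mgen gen_set \<subseteq> G" by (rule mgen_subgroup(2)[OF SG Sinv])
qed

text \<open>The root groups of all roots are conjugate to the simple ones under the elements \<open>n i\<close>;
  together with the coordinate subgroups of \<open>T\<close> their tangent vectors span the Lie algebra.\<close>

lemma gen_all: "mgen gen_set = G"
proof -
  let ?H = "mgen gen_set"
  have xyH: "x i \<xi> \<in> ?H" "y i \<xi> \<in> ?H" for i \<xi> by (rule mgen_gen, rule gen_setI)+
  have "\<forall>c. \<exists>u. c \<in> d4_roots \<longrightarrow> root_group c u \<and> range u \<subseteq> ?H"
  proof
    fix c show "\<exists>u. c \<in> d4_roots \<longrightarrow> root_group c u \<and> range u \<subseteq> ?H"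
      using root_group_exists_in[OF gen_group(1) xyH, of c] by meson
  qed
  then obtain u where u: "\<And>c. c \<in> d4_roots \<Longrightarrow> root_group c (u c)" "\<And>c. c \<in> d4_roots \<Longrightarrow> range (u c) \<subseteq> ?H"
    by metis
  have fin_roots: "finite (roots G T)" and lie: "lie_algebra G = {Y + (\<Sum>a\<in>roots G T. Z a) | Y Z.
        Y \<in> lie_algebra T \<and> (\<forall>a\<in>roots G T. Z a \<in> weight_space G T a)}"
    using decomposition[unfolded root_space_decomposition_def]
    by (rule conjunct1, rule conjunct1[OF conjunct2])
  have inj: "inj_on (lattice_char T \<alpha>) d4_roots" by (rule inj_on_subset[OF inj_lattice subset_UNIV])
  have fin: "finite d4_roots" using fin_roots inj unfolding roots_eq by (rule finite_imageD)
  then obtain cs where cs: "set cs = d4_roots" "distinct cs" using finite_distinct_list by blast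
  obtain zT ET where zT: "(\<forall>k s. 1 + s \<noteq> 0 \<longrightarrow> zT k s \<in> T) \<and>
     (\<forall>k i j. (\<lambda>s. zT k s $ i $ j) \<in> func_alg {\<lambda>s. s, \<lambda>s. inverse (1 + s)}) \<and>
     (\<forall>k. matrix_jet (zT k) 1 (ET k)) \<and>
     (\<forall>X\<in>lie_algebra T. \<exists>a. X = (\<Sum>k<r. mat (a k) ** ET k))"
    using torus_curves by (elim exE) (rule that)
  have z: "1 + s \<noteq> 0 \<Longrightarrow> zT k s \<in> T" "(\<lambda>s. zT k s $ i $ j) \<in> func_alg {\<lambda>s. s, \<lambda>s. inverse (1 + s)}"
    "matrix_jet (zT k) 1 (ET k)" "X \<in> lie_algebra T \<Longrightarrow> \<exists>a. X = (\<Sum>k<r. mat (a k) ** ET k)" for k s i j X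
    using zT by (simp_all only: simp_thms)
  let ?L = "length cs"
  define z where "z k = (if k < r then zT k else u (cs ! (k - r)))" for k
  define E where "E k = (if k < r then ET k else curve_coeff (u (cs ! (k - r))) 1)" for k
  have cs_root: "cs ! (k - r) \<in> d4_roots" if "k < r + ?L" "\<not> k < r" for k
    using cs(1) nth_mem[of "k - r" cs] that by auto
  show ?thesis
  proof (rule generated_by_curves[OF G_closed G_connected G_group gen_group])
    fix k s assume k: "k < r + ?L" and s: "1 + s \<noteq> (0::'k)"
    show "z k s \<in> ?H"
    proof (cases "k < r")
      case True
      thus ?thesis using z(1)[OF s, of k] by (auto simp: z_def gen_set_def intro!: mgen_gen)
    next
      case False
      thus ?thesis using u(2)[OF cs_root[OF k False]] by (auto simp: z_def)
    qed
  next
    fix k i j assume k: "k < r + ?L"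
    show "(\<lambda>s. z k s $ i $ j) \<in> func_alg {\<lambda>s. s, \<lambda>s. inverse (1 + s)}"
    proof (cases "k < r")
      case True
      thus ?thesis using z(2) by (simp add: z_def)
    next
      case False
      have "(\<lambda>s. poly p s) \<in> func_alg {\<lambda>s. s, \<lambda>s. inverse (1 + s)}" for p :: "'k poly"
      proof (induction p)
        case 0
        show ?case using func_alg.const[of 0] by simp
      next
        case (pCons a p)
        have "(\<lambda>s. s) \<in> func_alg {\<lambda>s::'k. s, \<lambda>s. inverse (1 + s)}" by (rule func_alg.gen) simp
        thus ?case using func_alg.add[OF func_alg.const[of a] func_alg.mult[OF _ pCons.IH]] by simp
      qed
      thus ?thesis using entry_poly[OF root_groupD(4)[OF u(1)[OF cs_root[OF k False]]]] False
        by (simp add: z_def)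
    qed
  next
    fix k assume k: "k < r + ?L"
    show "matrix_jet (z k) 1 (E k)"
    proof (cases "k < r")
      case True
      thus ?thesis using z(3) by (simp add: z_def E_def)
    next
      case False
      note U = root_groupD[OF u(1)[OF cs_root[OF k False]]]
      show ?thesis using poly_curve_jet[OF U(4,7), of 1] False by (simp add: z_def E_def)
    qed
  next
    fix X assume "X \<in> lie_algebra G"
    then obtain Y Z where Y: "X = Y + (\<Sum>a\<in>roots G T. Z a)" "Y \<in> lie_algebra T"
      "\<And>a. a \<in> roots G T \<Longrightarrow> Z a \<in> weight_space G T a" unfolding lie by blast
    obtain a where a: "Y = (\<Sum>k<r. mat (a k) ** ET k)" using z(4)[OF Y(2)] by blast
    have "\<exists>e. Z (lattice_char T \<alpha> c) = mat e ** curve_coeff (u c) 1" if "c \<in> d4_roots" for c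
      using root_space_multiple[OF u(1)[OF that]] Y(3)[of "lattice_char T \<alpha> c"] that unfolding roots_eq by blast
    then obtain e where e: "\<And>c. c \<in> d4_roots \<Longrightarrow> Z (lattice_char T \<alpha> c) = mat (e c) ** curve_coeff (u c) 1"
      by metis
    define b where "b k = (if k < r then a k else e (cs ! (k - r)))" for k
    have split: "(\<Sum>k<r + l. f k) = (\<Sum>k<r. f k) + (\<Sum>k<l. f (r + k))" for f :: "nat \<Rightarrow> 'k^'n^'n" and l
      by (induction l) (auto simp: add.assoc)
    have "(\<Sum>a\<in>roots G T. Z a) = (\<Sum>c\<in>d4_roots. mat (e c) ** curve_coeff (u c) 1)"
      unfolding roots_eq by (subst sum.reindex[OF inj]) (auto simp: e)
    also have "\<dots> = (\<Sum>k<?L. mat (e (cs ! k)) ** curve_coeff (u (cs ! k)) 1)"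
      using sum.reindex_bij_betw[OF bij_betw_nth[OF cs(2) refl cs(1)[symmetric]], of "\<lambda>c. mat (e c) ** curve_coeff (u c) 1"]
      by simp
    finally have "X = (\<Sum>k<r + ?L. mat (b k) ** E k)"
      unfolding split Y(1) a by (simp add: b_def E_def)
    thus "\<exists>a. X = (\<Sum>k<r + ?L. mat (a k) ** E k)" by blast
  qed
qed

theorem bruhat:
  assumes "g \<in> G"
  shows "\<exists>b1\<in>borel. \<exists>m\<in>norm_T. \<exists>b2\<in>borel. g = b1 ** m ** b2"
proof -
  have 1: "h ** g \<in> bruhat_union" if "g \<in> mgen gen_set" "h \<in> bruhat_union" for h g
    using that
  proof (induction arbitrary: h rule: mgen.induct)
    case (mult s g)
    thus ?case using bruhat_union_gen[of h s] by (simp add: matrix_mul_assoc)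
  qed simp
  have "mat 1 \<in> norm_T" by (rule T_norm_T[OF Tr(1)])
  hence "mat 1 ** mat 1 ** mat 1 \<in> bruhat_union" unfolding bruhat_union_def using borel_one by blast
  hence "mat 1 ** g \<in> bruhat_union" using assms gen_all by (intro 1) auto
  thus ?thesis by (auto simp: bruhat_union_def)
qed

end

section \<open>Parametrised root subgroups and Borel subgroups\<close>

context rooted_group
begin

lemma alpha_lattice: "\<alpha> i = lattice_char T \<alpha> (simple_vec i)"
proof
  fix t
  have "\<alpha> i \<in> extensional T" using simple_char by (auto simp: characters_def)
  thus "\<alpha> i t = lattice_char T \<alpha> (simple_vec i) t"
    by (cases "t \<in> T") (auto simp: lattice_char_eq wt_simple extensional_def)
qed

lemma char_inverse_lattice: "char_inverse T (\<alpha> i) = lattice_char T \<alpha> (- simple_vec i)"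
  by (auto simp: char_inverse_def lattice_char_eq wt_neg wt_simple restrict_def)

text \<open>The regular inverse of the parametrisation shows that \<open>u\<close> is not trivial.\<close>

lemma root_parametrisation_group:
  assumes "root_parametrisation G T (lattice_char T \<alpha> c) u"
  shows "root_group c u"
proof -
  have "lattice_char T \<alpha> c \<in> roots G T" using assms by (simp add: root_parametrisation_def)
  hence c: "c \<in> d4_roots" using inj_lattice unfolding roots_eq by (auto simp: inj_eq)
  obtain h where h: "\<And>\<xi>. h (u \<xi>) = \<xi>" using assms unfolding root_parametrisation_def by blast
  have "u 0 \<noteq> u 1" using h[of 0] h[of 1] by (metis zero_neq_one)
  moreover have add: "u (\<xi> + \<eta>) = u \<xi> ** u \<eta>" for \<xi> \<eta> using assms by (simp add: root_parametrisation_def)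
  have uG: "u \<xi> \<in> G" for \<xi> using assms by (auto simp: root_parametrisation_def)
  have "u 0 = u 0 ** u 0" using add[of 0 0] by simp
  hence "u 0 = mat 1" using cancel(4)[OF uG[of 0]] by (metis matrix_mul_assoc matrix_mul_lid)
  ultimately have "u 1 \<noteq> mat 1" by metis
  thus ?thesis unfolding root_group_def poly_curve_def
    using c add uG assms by (simp add: root_parametrisation_def lattice_char_eq)
qed

text \<open>The normalizer in the library is the stabilizer of \<open>T\<close> under conjugation.\<close>

lemma normalizer_eq: "normalizer (matrix_group G) T = norm_T"
proof -
  have inv: "inv\<^bsub>matrix_group G\<^esub> A = matrix_inv A" if "A \<in> G" for A
    by (rule m_inv_matrix_group[OF that Gr(3,6)[OF that]])
  have coset: "A <#\<^bsub>matrix_group G\<^esub> T #>\<^bsub>matrix_group G\<^esub> (inv\<^bsub>matrix_group G\<^esub> A) = (\<lambda>t. A ** t ** matrix_inv A) ` T"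
    if "A \<in> G" for A
    unfolding inv[OF that] by (auto simp: l_coset_def r_coset_def matrix_group_def)
  have "A \<in> normalizer (matrix_group G) T \<longleftrightarrow> A \<in> G \<and> (\<lambda>t. A ** t ** matrix_inv A) ` T = T" for A
    unfolding normalizer_def stabilizer_def using T_sub coset[of A] by (auto simp: matrix_group_def)
  moreover have "(\<lambda>t. A ** t ** matrix_inv A) ` T = T \<longleftrightarrow> (\<forall>t\<in>T. A ** t ** matrix_inv A \<in> T \<and> matrix_inv A ** t ** A \<in> T)"
    if A: "A \<in> G" for A
  proof
    assume e: "(\<lambda>t. A ** t ** matrix_inv A) ` T = T"
    show "\<forall>t\<in>T. A ** t ** matrix_inv A \<in> T \<and> matrix_inv A ** t ** A \<in> T"
    proof (intro ballI conjI)
      fix t assume t: "t \<in> T"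
      show "A ** t ** matrix_inv A \<in> T" using e t by blast
      obtain s where "s \<in> T" "t = A ** s ** matrix_inv A" using e t by blast
      thus "matrix_inv A ** t ** A \<in> T" using A by (simp add: matrix_mul_assoc cancel)
    qed
  next
    assume h: "\<forall>t\<in>T. A ** t ** matrix_inv A \<in> T \<and> matrix_inv A ** t ** A \<in> T"
    have "t \<in> (\<lambda>t. A ** t ** matrix_inv A) ` T" if "t \<in> T" for t
      using h that A by (intro image_eqI[of _ _ "matrix_inv A ** t ** A"]) (auto simp: matrix_mul_assoc cancel)
    thus "(\<lambda>t. A ** t ** matrix_inv A) ` T = T" using h by blast
  qed
  ultimately show ?thesis unfolding norm_T_def by blast
qed

end

context chevalley_group
begin

text \<open>Some simple root has a positive product with \<open>c\<close>, because \<open>c\<close> is a nonnegative combination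
  of simple roots with positive square length. The product is then 1, and the reflection
  subtracts that simple root.\<close>

lemma positive_descent:
  assumes c: "positive c" and nc: "\<And>i. c \<noteq> simple_vec i"
  shows "\<exists>i. positive (c - simple_vec i) \<and> reflect i (c - simple_vec i) = c"
proof -
  have cr: "c \<in> d4_roots" and c0: "\<And>i. c i \<ge> 0" using c by (auto simp: positive_def)
  have "\<exists>i. d4_form c (simple_vec i) > 0"
  proof (rule ccontr)
    assume "\<not> (\<exists>i. d4_form c (simple_vec i) > 0)"
    hence le: "d4_form c (simple_vec i) \<le> 0" for i by (simp add: not_less)
    have "d4_form c c = c N1 * d4_form c (simple_vec N1) + c N2 * d4_form c (simple_vec N2)
        + c N3 * d4_form c (simple_vec N3) + c N4 * d4_form c (simple_vec N4)"
      by (simp add: d4_form_def algebra_simps)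
    also have "\<dots> \<le> 0" using mult_nonneg_nonpos[OF c0 le] by (smt (verit))
    finally show False using d4_roots_norm[OF cr] by simp
  qed
  then obtain i where i: "d4_form c (simple_vec i) > 0" by blast
  have "simple_vec i \<noteq> - (- c)" using nc[of i] by simp
  hence "d4_form (- c) (simple_vec i) \<ge> - 1" by (intro root_pair_form root_neg cr d4_roots_simple) auto
  hence f1: "d4_form c (simple_vec i) = 1" using i by (simp add: d4_form_simps)
  have r: "reflect i c = c - simple_vec i"
    unfolding reflect_def f1 by (auto simp: fun_eq_iff)
  have "positive (c - simple_vec i)" using reflect_positive[OF c nc[of i]] unfolding r .
  moreover have "reflect i (c - simple_vec i) = c" unfolding r[symmetric] by (rule reflect_reflect)
  ultimately show ?thesis by blast
qed

text \<open>By induction on the height. If \<open>c = b + \<alpha>\<^sub>i\<close>, the commutators of the root groups of \<open>\<alpha>\<^sub>i\<close>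
  and \<open>b\<close> lie in that of \<open>c\<close>. They are not all trivial, as otherwise \<open>n\<^sub>i\<close>, whose factor \<open>y\<^sub>i\<close>
  commutes with the root group of \<open>b\<close> because \<open>b - \<alpha>\<^sub>i\<close> is not a root, would centralize that
  group; and one nontrivial element of the root group gives all others by conjugation with \<open>T\<close>.\<close>

lemma positive_root_group_in:
  assumes H: "matrix_subgroup H" "T \<subseteq> H" "\<And>i \<xi>. x i \<xi> \<in> H" and c: "positive c"
  shows "root_subgroup c \<subseteq> H"
  using c
proof (induction "nat (\<Sum>i\<in>UNIV. c i)" arbitrary: c rule: less_induct)
  case less
  show ?case
  proof (cases "\<exists>i. c = simple_vec i")
    case True
    then obtain i where ci: "c = simple_vec i" by blast
    show ?thesis unfolding ci root_subgroup_eq[OF x_group] using H(3) by blast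
  next
    case False
    then obtain i where i: "positive (c - simple_vec i)" "reflect i (c - simple_vec i) = c"
      using positive_descent[OF less.prems] by blast
    define b where "b = c - simple_vec i"
    have bc: "simple_vec i + b = c" "b + simple_vec i = c" by (simp_all add: b_def)
    have b: "positive b" "reflect i b = c" using i by (simp_all add: b_def)
    have br: "b \<in> d4_roots" and cr: "c \<in> d4_roots" using b(1) less.prems by (auto simp: positive_def)
    have "(\<Sum>j\<in>UNIV. c j) = (\<Sum>j\<in>UNIV. b j) + 1"
      unfolding bc(2)[symmetric] UNIV_d4_node by (cases i) simp_all
    moreover have "(\<Sum>j\<in>UNIV. b j) \<ge> 0" using b(1) by (intro sum_nonneg) (auto simp: positive_def)
    ultimately have "nat (\<Sum>j\<in>UNIV. b j) < nat (\<Sum>j\<in>UNIV. c j)" by simp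
    from less.hyps[OF this b(1)] have bH: "root_subgroup b \<subseteq> H" .
    obtain v where v: "root_group b v" using root_group_exists[OF br] by blast
    obtain w where w: "root_group c w" using root_group_exists[OF cr] by blast
    note X = root_groupD[OF x_group[of i]] and Y = root_groupD[OF y_group[of i]] and V = root_groupD[OF v] and W = root_groupD[OF w]
    have vH: "v \<xi> \<in> H" for \<xi> using bH root_subgroup_eq[OF v] by auto
    have ne: "b \<noteq> - simple_vec i" using b(1) not_positive_neg[OF positive_simple] by blast
    have ne': "b \<noteq> - (- simple_vec i)"
    proof
      assume "b = - (- simple_vec i)"
      hence "c = - simple_vec i" using b(2) by (simp only: minus_minus reflect_simple)
      thus False using less.prems not_positive_neg[OF positive_simple] by blast
    qed
    have form_b: "d4_form (simple_vec i) b = - 1"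
    proof -
      have "d4_form (simple_vec i + b) (simple_vec i + b) = 2" unfolding bc(1) by (rule d4_roots_norm[OF cr])
      thus ?thesis using d4_roots_norm[OF br] d4_form_sym[of b "simple_vec i"]
        by (simp add: d4_form_simps d4_form_simple_self)
    qed
    have w': "root_group (simple_vec i + b) w" using w unfolding bc(1) .
    \<comment> \<open>otherwise \<open>n i\<close> would fix every element of the root group of \<open>b\<close>, although it moves \<open>b\<close>\<close>
    have "\<exists>\<xi> \<eta>. x i \<xi> ** v \<eta> ** x i (- \<xi>) \<noteq> v \<eta>"
    proof (rule ccontr)
      assume "\<not> (\<exists>\<xi> \<eta>. x i \<xi> ** v \<eta> ** x i (- \<xi>) \<noteq> v \<eta>)"
      hence xc: "x i \<xi> ** v \<eta> ** x i (- \<xi>) = v \<eta>" for \<xi> \<eta> by blast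
      have "- simple_vec i + b \<notin> d4_roots"
      proof
        assume "- simple_vec i + b \<in> d4_roots"
        hence "d4_form (- simple_vec i + b) (- simple_vec i + b) = 2" by (rule d4_roots_norm)
        thus False using form_b d4_roots_norm[OF br] d4_form_sym[of b "simple_vec i"]
          unfolding d4_form_simps by (simp add: d4_form_simple_self)
      qed
      hence yc: "y i \<xi> ** v \<eta> ** y i (- \<xi>) = v \<eta>" for \<xi> \<eta>
        by (rule root_group_commutator(1)[OF y_group v ne'])
      have n_inv: "matrix_inv (n i) = x i (- 1) ** y i (- (- 1)) ** x i (- 1)"
        unfolding n_def using X(2,10) Y(2,10) Gr(2) by (simp add: inv_mult matrix_mul_assoc)
      have "n i ** v \<eta> ** matrix_inv (n i) = v \<eta>" for \<eta>
      proof -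
        have "n i ** v \<eta> ** matrix_inv (n i) =
            x i 1 ** (y i (- 1) ** (x i 1 ** v \<eta> ** x i (- 1)) ** y i (- (- 1))) ** x i (- 1)"
          unfolding n_inv unfolding n_def by (simp only: matrix_mul_assoc)
        thus ?thesis unfolding xc yc .
      qed
      hence v': "root_group c v" using root_group_conj[OF n_norm[of i] acts_n[of i] v] unfolding b(2) by simp
      have "b = c"
      proof (rule wt_inj)
        fix t assume t: "t \<in> T"
        have "v (wt b t * 1) = v (wt c t * 1)"
          using V(5)[OF t, of 1] root_groupD(5)[OF v' t, of 1] by simp
        hence "v (wt b t + - wt c t) = mat 1" unfolding V(3) using V(8) by simp
        hence "wt b t + - wt c t = 0" by (rule root_group_inj[OF v])
        thus "wt b t = wt c t" by simp
      qed
      hence "simple_vec i = 0" using bc(2) by simp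
      from fun_cong[OF this, of i] show False by simp
    qed
    then obtain \<xi> \<eta> where ne1: "x i \<xi> ** v \<eta> ** x i (- \<xi>) \<noteq> v \<eta>" by blast
    obtain \<zeta> where \<zeta>: "x i \<xi> ** v \<eta> ** x i (- \<xi>) = w \<zeta> ** v \<eta>"
      using root_group_commutator(2)[OF x_group v ne w'] by blast
    have "w \<zeta> = x i \<xi> ** v \<eta> ** x i (- \<xi>) ** v (- \<eta>)"
      unfolding \<zeta> using V(8)[of \<eta>] by (simp add: matrix_mul_assoc[symmetric])
    hence wH: "w \<zeta> \<in> H" using matrix_subgroupD(2)[OF H(1)] H(3) vH by simp
    have "\<zeta> \<noteq> 0" using ne1 \<zeta> W(7) by auto
    have "w \<rho> \<in> H" for \<rho>
    proof (cases "\<rho> = 0")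
      case True
      thus ?thesis using W(7) matrix_subgroupD(1)[OF H(1)] by simp
    next
      case False
      obtain t where t: "t \<in> T" "wt c t = \<rho> / \<zeta>"
        using root_surjective[OF cr, of "\<rho> / \<zeta>"] \<open>\<zeta> \<noteq> 0\<close> False by auto
      hence "wt c t * \<zeta> = \<rho>" using \<open>\<zeta> \<noteq> 0\<close> by simp
      hence "w \<rho> = t ** w \<zeta> ** matrix_inv t" using W(5)[OF t(1), of \<zeta>] by simp
      thus ?thesis using matrix_subgroupD(2,3)[OF H(1)] wH t(1) H(2) by auto
    qed
    thus ?thesis unfolding root_subgroup_eq[OF w] by blast
  qed
qed

lemma borel_in:
  assumes H: "matrix_subgroup H" "T \<subseteq> H" "\<And>i \<xi>. x i \<xi> \<in> H"
  shows "borel \<subseteq> H"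
  unfolding borel_def
proof (rule mgen_least)
  show "mat 1 \<in> H" by (rule matrix_subgroupD(1)[OF H(1)])
qed (use matrix_subgroupD(2)[OF H(1)] H(2) positive_root_group_in[OF H] in blast)+

lemma borel_generated: "borel \<subseteq> mgen (T \<union> (\<Union>i. range (x i)))"
proof (rule borel_in)
  let ?S = "T \<union> (\<Union>i. range (x i))"
  have SG: "?S \<subseteq> G" using T_sub root_groupD(2)[OF x_group] by auto
  have Sinv: "matrix_inv s \<in> ?S" if "s \<in> ?S" for s
    using that
  proof
    assume "s \<in> (\<Union>i. range (x i))"
    then obtain i \<xi> where "s = x i \<xi>" by blast
    hence "matrix_inv s = x i (- \<xi>)" using root_groupD(10)[OF x_group] by simp
    thus ?thesis by blast
  qed (use Tr(3) in blast)
  show "matrix_subgroup (mgen ?S)" by (rule mgen_subgroup(1)[OF SG Sinv])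
  show "T \<subseteq> mgen ?S" using mgen_gen by blast
  show "x i \<xi> \<in> mgen ?S" for i \<xi> by (rule mgen_gen) blast
qed

end

section \<open>Triality\<close>

text \<open>The action of \<open>\<theta>\<close> on the root lattice: the coordinate of \<open>triality c\<close> at \<open>\<theta> i\<close> is the
  coordinate of \<open>c\<close> at \<open>i\<close>.\<close>

definition triality :: "(d4_node \<Rightarrow> int) \<Rightarrow> d4_node \<Rightarrow> int" where
  "triality c = (\<lambda>j. case j of N1 \<Rightarrow> c N4 | N2 \<Rightarrow> c N2 | N3 \<Rightarrow> c N1 | N4 \<Rightarrow> c N3)"

definition triality_inv :: "(d4_node \<Rightarrow> int) \<Rightarrow> d4_node \<Rightarrow> int" where
  "triality_inv c = (\<lambda>j. case j of N1 \<Rightarrow> c N3 | N2 \<Rightarrow> c N2 | N3 \<Rightarrow> c N4 | N4 \<Rightarrow> c N1)"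

lemma triality_apply [simp]: "triality c N1 = c N4" "triality c N2 = c N2" "triality c N3 = c N1" "triality c N4 = c N3"
  "triality_inv c N1 = c N3" "triality_inv c N2 = c N2" "triality_inv c N3 = c N4" "triality_inv c N4 = c N1"
  by (simp_all add: triality_def triality_inv_def)

lemma d4_ext: "c N1 = d N1 \<Longrightarrow> c N2 = d N2 \<Longrightarrow> c N3 = d N3 \<Longrightarrow> c N4 = d N4 \<Longrightarrow> c = (d :: d4_node \<Rightarrow> int)"
  by (rule ext) (metis d4_node.exhaust)

lemma triality_inverse: "triality (triality_inv c) = c" "triality_inv (triality c) = c"
  "triality (triality c) = triality_inv c"
  by (rule d4_ext; simp)+

text \<open>If \<open>f \<theta>(f) = 1\<close>, then \<open>\<theta>(f) = f\<^sup>-\<^sup>1\<close> and \<open>\<theta>\<^sup>2(f) = f\<close>; as \<open>\<theta>\<^sup>3 = 1\<close>, \<open>\<theta>(f) = f\<close>.\<close>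

lemma twisted_commutes:
  fixes f :: "(d4_node \<Rightarrow> int) \<Rightarrow> d4_node \<Rightarrow> int"
  assumes tw: "\<And>c. f (triality (f (triality_inv c))) = c"
  shows "f (f c) = c" "f (triality c) = triality (f c)"
proof -
  define g where "g c = triality (f (triality_inv c))" for c
  have fg: "f (g c) = c" for c using tw by (simp add: g_def)
  have g_surj: "\<exists>b. a = g b" for a
  proof -
    have "g (triality (g (triality_inv a))) = triality (f (g (triality_inv a)))"
      by (simp only: g_def triality_inverse(2))
    also have "\<dots> = a" by (simp only: fg triality_inverse(1))
    finally show ?thesis by metis
  qed
  have gf: "g (f a) = a" for a
  proof -
    obtain b where "a = g b" using g_surj by blast
    thus ?thesis using fg by simp
  qed
  have A: "f (triality (f c)) = triality c" for c using tw[of "triality c"] by (simp add: triality_inverse)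
  have B: "f (triality_inv (f c)) = triality_inv c" for c
    using gf[of c] by (metis g_def triality_inverse(2))
  have ff: "f (f d) = d" for d
  proof -
    have "\<exists>c. d = triality (f c)"
      using fg[of "triality_inv d"] by (metis triality_inverse(1))
    then obtain c where c: "d = triality (f c)" by blast
    have "f (triality_inv (f c)) = triality (triality c)" using B by (simp only: triality_inverse)
    also have "\<dots> = f (triality (f (f (triality (f c)))))" by (simp only: A)
    finally have "triality_inv (f c) = triality (f (f (triality (f c))))" using gf by metis
    hence "triality (triality (f c)) = triality (f (f (triality (f c))))" by (simp only: triality_inverse)
    thus ?thesis unfolding c by (metis triality_inverse(2))
  qed
  show "f (f c) = c" by (rule ff)
  show "f (triality c) = triality (f c)" using ff[of "triality (f c)"] A[of c] by simp
qed

text \<open>If \<open>s\<^sub>1 w\<close> commutes with \<open>\<theta>\<close> as \<open>w\<close> does, then so does \<open>s\<^sub>1\<close>, which is false. Suppose that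
  \<open>s\<^sub>1 w s\<^sub>3\<close> commutes with \<open>\<theta>\<close>, that is, \<open>s\<^sub>1 w s\<^sub>3 = s\<^sub>3 w s\<^sub>4\<close>, and let \<open>v = w \<alpha>\<^sub>3\<close>.
  Evaluation at \<open>\<alpha>\<^sub>3\<close> and at \<open>\<alpha>\<^sub>4\<close> shows that \<open>v\<close> and \<open>\<theta> v = w \<alpha>\<^sub>4\<close> are combinations of \<open>\<alpha>\<^sub>1\<close>
  and \<open>\<alpha>\<^sub>3\<close>, so \<open>v = k \<alpha>\<^sub>1\<close>. Then \<open>w v = k w \<alpha>\<^sub>1 = k \<theta>\<^sup>-\<^sup>1 v\<close> is a multiple of \<open>\<alpha>\<^sub>4\<close>, while
  \<open>w v = \<alpha>\<^sub>3\<close>.\<close>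

lemma no_involutive_element:
  fixes w :: "(d4_node \<Rightarrow> int) \<Rightarrow> d4_node \<Rightarrow> int"
  assumes lin: "\<And>c. w (- c) = - w c" "\<And>m c. w (scale_vec m c) = scale_vec m (w c)"
    and w: "\<And>c. w (triality (w (triality_inv c))) = c"
  shows "\<exists>c. reflect N1 (w (triality (reflect N1 (w (triality_inv c))))) \<noteq> c"
    "\<exists>c. reflect N1 (w (reflect N3 (triality (reflect N1 (w (reflect N3 (triality_inv c))))))) \<noteq> c"
proof -
  note W = twisted_commutes[OF w]
  show "\<exists>c. reflect N1 (w (triality (reflect N1 (w (triality_inv c))))) \<noteq> c"
  proof (rule ccontr)
    assume "\<nexists>c. reflect N1 (w (triality (reflect N1 (w (triality_inv c))))) \<noteq> c"
    hence "reflect N1 (w (triality c)) = triality (reflect N1 (w c))" for c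
      using twisted_commutes(2)[of "\<lambda>c. reflect N1 (w c)" c] by blast
    from this[of "w (simple_vec N4)"]
    have e: "reflect N1 (triality (simple_vec N4)) = triality (reflect N1 (simple_vec N4))" by (simp only: W)
    have "triality (simple_vec N4) = simple_vec N1" by (rule d4_ext) simp_all
    hence "- simple_vec N1 = triality (reflect N1 (simple_vec N4))" using e by (simp only: reflect_simple)
    from fun_cong[OF this, of N1] show False by (simp add: reflect_def)
  qed
  show "\<exists>c. reflect N1 (w (reflect N3 (triality (reflect N1 (w (reflect N3 (triality_inv c))))))) \<noteq> c"
  proof (rule ccontr)
    assume "\<nexists>c. reflect N1 (w (reflect N3 (triality (reflect N1 (w (reflect N3 (triality_inv c))))))) \<noteq> c"
    hence comm: "reflect N1 (w (reflect N3 (triality c))) = triality (reflect N1 (w (reflect N3 c)))" for c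
      using twisted_commutes(2)[of "\<lambda>c. reflect N1 (w (reflect N3 c))" c] by blast
    have tr: "triality (reflect N1 c) = reflect N3 (triality c)" "triality (reflect N3 c) = reflect N4 (triality c)" for c
      by (rule d4_ext; simp add: reflect_def d4_form_def)+
    have key: "reflect N1 (w (reflect N3 d)) = reflect N3 (w (reflect N4 d))" for d
      using comm[of "triality_inv d"] by (simp only: triality_inverse tr W(2)[symmetric])
    define v where "v = w (simple_vec N3)"
    have r43: "reflect N4 (simple_vec N3) = simple_vec N3" "reflect N3 (simple_vec N4) = simple_vec N4"
      by (rule d4_ext; simp add: reflect_def d4_form_def)+
    have 1: "- reflect N1 v = reflect N3 v"
      using key[of "simple_vec N3"] by (simp only: reflect_simple r43 lin reflect_minus v_def)
    have t34: "triality (simple_vec N3) = simple_vec N4" "triality (simple_vec N1) = simple_vec N3"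
      "triality (simple_vec N4) = simple_vec N1"
      by (rule d4_ext; simp)+
    have 2: "reflect N1 (triality v) = - reflect N3 (triality v)"
      using key[of "simple_vec N4"] by (simp only: reflect_simple r43 lin reflect_minus v_def W(2)[symmetric] t34)
    have v: "v N2 = 0" "v N4 = 0" using fun_cong[OF 1, of N2] fun_cong[OF 1, of N4]
      by (simp_all add: reflect_def)
    have v3: "v N3 = 0" using fun_cong[OF 2, of N4] by (simp add: reflect_def)
    have vk: "v = scale_vec (v N1) (simple_vec N1)" by (rule d4_ext) (simp_all add: v v3)
    have "triality (w (simple_vec N1)) = v" unfolding v_def W(2)[symmetric] t34 ..
    hence "w (simple_vec N1) = triality_inv v" by (metis triality_inverse(2))
    hence "w v = scale_vec (v N1) (triality_inv v)" by (subst vk) (simp only: lin)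
    moreover have "w v = simple_vec N3" unfolding v_def by (rule W(1))
    ultimately have "simple_vec N3 N3 = v N1 * triality_inv v N3" by simp
    thus False using v by simp
  qed
qed

theorem mainTheorem3:
  fixes G T B :: "('k::alg_closed_field ^ 'n ^ 'n) set"
    and \<alpha> :: "d4_node \<Rightarrow> 'k ^ 'n ^ 'n \<Rightarrow> 'k"
    and x y :: "d4_node \<Rightarrow> 'k \<Rightarrow> 'k ^ 'n ^ 'n"
    and \<theta> :: "d4_node \<Rightarrow> d4_node"
    and \<tau> :: "'k ^ 'n ^ 'n \<Rightarrow> 'k ^ 'n ^ 'n"
  assumes char: "CHAR('k) = 0 \<or> (odd CHAR('k) \<and> d4_good_characteristic CHAR('k))"
    and simple: "simple_algebraic_group G"
    and torus: "maximal_torus G T"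
    and borel: "borel_subgroup G B" "T \<subseteq> B"
    and type_D4: "root_system_D4 G T B \<alpha>"
    and sc: "simply_connected G T"
    and root_params:
      "\<And>i. root_parametrisation G T (\<alpha> i) (x i)"
      "\<And>i. root_parametrisation G T (char_inverse T (\<alpha> i)) (y i)"
      "\<And>i. x i 1 ** y i (- 1) ** x i 1 \<in> normalizer (matrix_group G) T"
    and diagram_aut: "d4_diagram_automorphism \<theta>" "\<theta> ^^ 3 = id" "\<theta> \<noteq> id" "\<theta> N1 = N3"
    and group_aut: "algebraic_automorphism G \<tau>" "\<tau> ` T = T" "\<tau> ` B = B"
      "\<And>i \<xi>. \<tau> (x i \<xi>) = x (\<theta> i) \<xi>"
      "\<And>i \<xi>. \<tau> (y i \<xi>) = y (\<theta> i) \<xi>"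
  shows "\<not> (\<exists>C \<in> twisted_conjugacy_classes G \<tau>. involutive G T B \<tau> C)"
proof
  assume "\<exists>C \<in> twisted_conjugacy_classes G \<tau>. involutive G T B \<tau> C"
  then obtain x0 where x0: "x0 \<in> G" and inv: "involutive G T B \<tau> {g ** x0 ** matrix_inv (\<tau> g) | g. g \<in> G}"
    unfolding twisted_conjugacy_classes_def by blast
  define C where "C = {g ** x0 ** matrix_inv (\<tau> g) | g. g \<in> G}"
  have G_alg: "algebraic_group G" "zariski_connected G" using simple by (auto simp: simple_algebraic_group_def)
  note G_mat = algebraic_group_matrix_subgroup[OF G_alg(1)]
  have T: "Defs.torus T" "T \<subseteq> G" using torus by (auto simp: maximal_torus_def)
  obtain r \<phi> where pt: "parametrised_torus T r \<phi>" using torus_parametrised[OF T(1)] by blast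
  have simple_pos: "\<exists>u. root_parametrisation G T (\<alpha> i) u \<and> range u \<subseteq> B" for i
  proof -
    have "\<alpha> i \<in> simple_roots G T B" using type_D4 unfolding root_system_D4_def by blast
    thus ?thesis by (auto simp: simple_roots_def positive_roots_def)
  qed
  have alpha_char: "\<alpha> i \<in> characters T" for i
    using root_params(1)[of i] by (auto simp: root_parametrisation_def roots_def)
  interpret rooted_group T r \<phi> G \<alpha>
    using pt G_mat(1) T(2) type_D4 alpha_char
    unfolding rooted_group_def rooted_group_axioms_def root_system_D4_def by blast
  have x_rg: "root_group (simple_vec i) (x i)" for i
    by (rule root_parametrisation_group) (use root_params(1)[of i] alpha_lattice[of i] in simp)
  have y_rg: "root_group (- simple_vec i) (y i)" for i
    by (rule root_parametrisation_group) (use root_params(2)[of i] char_inverse_lattice[of i] in simp)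
  interpret chevalley_group T r \<phi> G \<alpha> x y
    by unfold_locales (use G_mat(2) G_alg(2) x_rg y_rg root_params(3) normalizer_eq in auto)
  have B_group: "matrix_subgroup B"
    using borel(1) algebraic_group_matrix_subgroup(1)
    by (auto simp: borel_subgroup_def connected_solvable_subgroup_def)
  have B_sub: "B \<subseteq> G" using borel(1) by (auto simp: borel_subgroup_def connected_solvable_subgroup_def)
  have x_B: "x i \<xi> \<in> B" for i \<xi>
  proof -
    obtain u where u: "root_parametrisation G T (\<alpha> i) u" "range u \<subseteq> B" using simple_pos by blast
    have "root_group (simple_vec i) u"
      by (rule root_parametrisation_group) (use u(1) alpha_lattice[of i] in simp)
    hence "range (x i) = range u" using root_subgroup_eq x_rg by metis
    thus ?thesis using u(2) by blast
  qed
  have borel_B: "borel \<subseteq> B" by (rule borel_in[OF B_group borel(2) x_B])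
  have iso: "\<tau> \<in> iso (matrix_group G) (matrix_group G)" using group_aut(1) by (simp add: algebraic_automorphism_def)
  have \<tau>G: "\<tau> A \<in> G" if "A \<in> G" for A
    using iso that by (auto simp: iso_def hom_def matrix_group_def Pi_def)
  have \<tau>_mult: "\<tau> (A ** D) = \<tau> A ** \<tau> D" if "A \<in> G" "D \<in> G" for A D
    using iso that by (auto simp: iso_def hom_def matrix_group_def)
  have \<tau>_one: "\<tau> (mat 1) = mat 1"
  proof -
    have "\<tau> (mat 1) = \<tau> (mat 1) ** \<tau> (mat 1)" using \<tau>_mult[OF Gr(1) Gr(1)] by simp
    thus ?thesis using cancel(4)[OF \<tau>G[OF Gr(1)]] by (metis matrix_mul_assoc matrix_mul_lid)
  qed
  have \<tau>_inv: "matrix_inv (\<tau> A) = \<tau> (matrix_inv A)" if "A \<in> G" for A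
    by (rule matrix_inv_unique(1)) (use \<tau>_mult[OF that Gr(3)[OF that]] cancel(3)[OF that] \<tau>_one in simp)
  have \<tau>T: "\<tau> t \<in> T" if "t \<in> T" for t using group_aut(2) that by blast
  have \<theta>: "\<theta> N1 = N3" "\<theta> N2 = N2" "\<theta> N3 = N4" "\<theta> N4 = N1"
  proof -
    have bij: "bij \<theta>" and cart: "\<And>i j. d4_cartan (\<theta> i) (\<theta> j) = d4_cartan i j"
      using diagram_aut(1) by (auto simp: d4_diagram_automorphism_def)
    have inj: "\<theta> i = \<theta> j \<longleftrightarrow> i = j" for i j using bij by (simp add: bij_def inj_eq)
    have c3: "\<theta> (\<theta> (\<theta> i)) = i" for i using fun_cong[OF diagram_aut(2), of i] by (simp add: numeral_3_eq_3)
    show 1: "\<theta> N1 = N3" by (rule diagram_aut(4))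
    show 2: "\<theta> N2 = N2"
    proof -
      have "d4_cartan (\<theta> N2) N3 = - 1" using cart[of N2 N1] 1 by (simp add: d4_cartan_def)
      thus ?thesis by (cases "\<theta> N2") (auto simp: d4_cartan_def)
    qed
    have "\<theta> (\<theta> N3) = N1" using c3[of N1] 1 by simp
    thus 3: "\<theta> N3 = N4"
      using inj[of N3 N1] inj[of N3 N2] 1 2 by (cases "\<theta> N3") auto
    show "\<theta> N4 = N1" using c3[of N1] 1 3 by simp
  qed
  have alpha_\<tau>: "\<alpha> (\<theta> i) (\<tau> t) = \<alpha> i t" if t: "t \<in> T" for i t
  proof -
    note Xi = root_groupD[OF x_rg[of i]] and Xj = root_groupD[OF x_rg[of "\<theta> i"]]
    have "x (\<theta> i) (\<alpha> i t) = \<tau> (t ** x i 1 ** matrix_inv t)"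
      unfolding Xi(5)[OF t] wt_simple group_aut(4) by simp
    also have "\<dots> = \<tau> t ** x (\<theta> i) 1 ** matrix_inv (\<tau> t)"
      using T_G[OF t] Xi(2) Gr(2,3) by (simp add: \<tau>_mult \<tau>_inv group_aut(4))
    also have "\<dots> = x (\<theta> i) (\<alpha> (\<theta> i) (\<tau> t))" unfolding Xj(5)[OF \<tau>T[OF t]] wt_simple by simp
    finally have "x (\<theta> i) (\<alpha> (\<theta> i) (\<tau> t) + - \<alpha> i t) = mat 1"
      unfolding Xj(3) using Xj(8)[of "\<alpha> i t"] by simp
    hence "\<alpha> (\<theta> i) (\<tau> t) + - \<alpha> i t = 0" by (rule root_group_inj[OF x_rg])
    thus ?thesis by simp
  qed
  have wt_\<tau>: "wt (triality c) (\<tau> t) = wt c t" if t: "t \<in> T" for c t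
    using alpha_\<tau>[OF t, of N1] alpha_\<tau>[OF t, of N2] alpha_\<tau>[OF t, of N3] alpha_\<tau>[OF t, of N4]
    by (simp add: wt_def UNIV_d4_node \<theta> mult_ac)
  have \<tau>_norm: "\<tau> m \<in> norm_T" if m: "m \<in> norm_T" for m
    unfolding norm_T_def
  proof (intro CollectI conjI ballI)
    note mG = norm_TD(1)[OF m]
    show "\<tau> m \<in> G" by (rule \<tau>G[OF mG])
    fix t assume "t \<in> T"
    then obtain s where s: "s \<in> T" "t = \<tau> s" using group_aut(2) by blast
    have "\<tau> m ** t ** matrix_inv (\<tau> m) = \<tau> (m ** s ** matrix_inv m)"
      unfolding s(2) using mG T_G[OF s(1)] Gr(2,3) by (simp add: \<tau>_mult \<tau>_inv)
    thus "\<tau> m ** t ** matrix_inv (\<tau> m) \<in> T" using \<tau>T norm_TD(2)[OF m s(1)] by simp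
    have "matrix_inv (\<tau> m) ** t ** \<tau> m = \<tau> (matrix_inv m ** s ** m)"
      unfolding s(2) using mG T_G[OF s(1)] Gr(2,3) by (simp add: \<tau>_mult \<tau>_inv)
    thus "matrix_inv (\<tau> m) ** t ** \<tau> m \<in> T" using \<tau>T norm_TD(3)[OF m s(1)] by simp
  qed
  have \<tau>_acts: "acts (\<tau> m) (\<lambda>c. triality (w (triality_inv c)))" if m: "m \<in> norm_T" and w: "acts m w" for m w
    unfolding acts_def
  proof (intro allI ballI)
    note mG = norm_TD(1)[OF m]
    fix c t assume "t \<in> T"
    then obtain s where s: "s \<in> T" "t = \<tau> s" using group_aut(2) by blast
    have "wt (triality (w (triality_inv c))) t = wt (triality_inv c) (matrix_inv m ** s ** m)"
      unfolding s(2) wt_\<tau>[OF s(1)] actsD[OF w s(1)] ..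
    also have "\<dots> = wt (triality (triality_inv c)) (\<tau> (matrix_inv m ** s ** m))"
      by (rule wt_\<tau>[OF norm_TD(3)[OF m s(1)], symmetric])
    also have "\<tau> (matrix_inv m ** s ** m) = matrix_inv (\<tau> m) ** t ** \<tau> m"
      unfolding s(2) using mG T_G[OF s(1)] Gr(2,3) by (simp add: \<tau>_mult \<tau>_inv)
    finally show "wt (triality (w (triality_inv c))) t = wt c (matrix_inv (\<tau> m) ** t ** \<tau> m)"
      by (simp only: triality_inverse)
  qed
  have twisted: "w (triality (w (triality_inv c))) = c"
    if g: "g \<in> C" "g = b1 ** m ** b2" "b1 \<in> B" "b2 \<in> B" and m: "m \<in> norm_T" and w: "acts m w"
    for g b1 m b2 w c
  proof -
    let ?W = "weyl_group G T"
    define v where "v = (\<lambda>t. t ** m) ` T"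
    have v: "v \<in> carrier ?W"
      unfolding weyl_group_def carrier_FactGroup
    proof (rule image_eqI)
      show "v = T #>\<^bsub>(matrix_group G)\<lparr>carrier := normalizer (matrix_group G) T\<rparr>\<^esub> m"
        by (auto simp: v_def r_coset_def matrix_group_def)
      show "m \<in> carrier ((matrix_group G)\<lparr>carrier := normalizer (matrix_group G) T\<rparr>)"
        using m by (simp add: normalizer_eq)
    qed
    have mv: "m \<in> v" unfolding v_def by (rule image_eqI[of _ _ "mat 1"]) (auto simp: Tr(1))
    have "g \<in> bruhat_cell G B v"
      unfolding bruhat_cell_def set_mult_def matrix_group_def using g(2-4) mv by auto
    hence "twisted_involution G T \<tau> v"
      using inv v g(1) unfolding involutive_def C_def by blast
    hence "v <#>\<^bsub>(matrix_group G)\<lparr>carrier := normalizer (matrix_group G) T\<rparr>\<^esub> (\<tau> ` v) = T"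
      unfolding twisted_involution_def weyl_group_def by simp
    moreover have "m ** \<tau> m \<in> v <#>\<^bsub>(matrix_group G)\<lparr>carrier := normalizer (matrix_group G) T\<rparr>\<^esub> (\<tau> ` v)"
      unfolding set_mult_def matrix_group_def using mv by auto
    ultimately have mT: "m ** \<tau> m \<in> T" by simp
    have "acts (m ** \<tau> m) (\<lambda>c. w (triality (w (triality_inv c))))"
      by (rule acts_comp[OF m \<tau>_norm[OF m] w \<tau>_acts[OF m w]])
    from acts_unique[OF this acts_T[OF mT]] show ?thesis by (rule fun_cong)
  qed
  have conj_C: "g ** a ** matrix_inv (\<tau> g) \<in> C" if "g \<in> G" "a \<in> C" for g a
  proof -
    obtain h where h: "h \<in> G" "a = h ** x0 ** matrix_inv (\<tau> h)" using \<open>a \<in> C\<close> by (auto simp: C_def)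
    have "g ** a ** matrix_inv (\<tau> g) = (g ** h) ** x0 ** matrix_inv (\<tau> (g ** h))"
      using \<open>g \<in> G\<close> h \<tau>G by (simp add: \<tau>_mult inv_mult matrix_mul_assoc)
    thus ?thesis using Gr(2)[OF \<open>g \<in> G\<close> h(1)] unfolding C_def by blast
  qed
  have "x0 \<in> C" unfolding C_def
    using Gr(1) \<tau>_one \<tau>_inv[OF Gr(1)] cancel(3)[OF Gr(1)] by (auto intro!: exI[of _ "mat 1"])
  have \<tau>_borel: "\<tau> b \<in> borel" if "b \<in> borel" for b
  proof -
    let ?S = "T \<union> (\<Union>i. range (x i))"
    have "\<tau> b \<in> borel \<and> b \<in> G" if "b \<in> mgen ?S" for b
      using that
    proof induction
      case one
      show ?case using \<tau>_one borel_one Gr(1) by simp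
    next
      case (mult s g)
      have "\<tau> s \<in> borel \<and> s \<in> G"
        using mult.hyps(1)
      proof
        assume "s \<in> T"
        thus ?thesis using borel_T \<tau>T T_G by blast
      next
        assume "s \<in> (\<Union>i. range (x i))"
        then obtain i \<xi> where "s = x i \<xi>" by blast
        thus ?thesis using group_aut(4) x_borel root_groupD(2)[OF x_rg] by simp
      qed
      thus ?case using mult.IH \<tau>_mult borel_closed Gr(2) by simp
    qed
    thus ?thesis using borel_generated that by blast
  qed
  obtain b1 m b2 where bmb: "b1 \<in> borel" "m \<in> norm_T" "b2 \<in> borel" "x0 = b1 ** m ** b2"
    using bruhat[OF x0] by blast
  have b1G: "b1 \<in> G" using bmb(1) borel_B B_sub by blast
  define b where "b = b2 ** \<tau> b1"
  have b: "b \<in> borel" unfolding b_def by (rule borel_closed[OF bmb(3) \<tau>_borel[OF bmb(1)]])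
  have mb: "m ** b \<in> C"
  proof -
    have "matrix_inv b1 ** x0 ** matrix_inv (\<tau> (matrix_inv b1)) = m ** b"
      unfolding bmb(4) b_def \<tau>_inv[OF b1G, symmetric] inv_inv[OF \<tau>G[OF b1G]]
      using b1G by (simp add: matrix_mul_assoc cancel)
    thus ?thesis using conj_C[OF Gr(3)[OF b1G] \<open>x0 \<in> C\<close>] by simp
  qed
  obtain w where w: "acts m w" using acts_exists[OF bmb(2)] by blast
  have tw: "w (triality (w (triality_inv c))) = c" for c
    by (rule twisted[OF mb _ _ _ bmb(2) w, of "mat 1" b])
      (use b borel_B matrix_subgroupD(1)[OF B_group] in auto)
  have \<tau>_n: "\<tau> (n N1) = n N3"
    unfolding n_def using root_groupD(2)[OF x_rg] root_groupD(2)[OF y_rg] Gr(2)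
    by (simp add: \<tau>_mult group_aut(4,5) \<theta>)
  have conj_n: "n N1 ** (m ** b) ** matrix_inv (n N3) \<in> C"
    using conj_C[OF n_G mb, of N1] unfolding \<tau>_n .
  have nm: "n N1 ** m \<in> norm_T" by (rule norm_T_mult[OF n_norm bmb(2)])
  obtain m' c1 c2 where m': "m' \<in> {n N1 ** m, n N1 ** m ** matrix_inv (n N3)}" "c1 \<in> borel" "c2 \<in> borel"
    "n N1 ** m ** b ** matrix_inv (n N3) = c1 ** m' ** c2"
    using double_coset_step[OF nm b] by blast
  have cell: "n N1 ** (m ** b) ** matrix_inv (n N3) = c1 ** m' ** c2" "c1 \<in> B" "c2 \<in> B"
    using m' borel_B by (auto simp: matrix_mul_assoc)
  have a1: "acts (n N1 ** m) (\<lambda>c. reflect N1 (w c))" by (rule acts_comp[OF n_norm bmb(2) acts_n w])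
  have a2: "acts (n N1 ** m ** matrix_inv (n N3)) (\<lambda>c. reflect N1 (w (reflect N3 c)))"
    by (rule acts_comp[OF nm norm_T_inv[OF n_norm] a1 acts_n_inv])
  note no = no_involutive_element[of w, OF acts_linear(3)[OF bmb(2) w] acts_linear(2)[OF bmb(2) w] tw]
  from m'(1) show False
  proof (elim insertE emptyE)
    assume e: "m' = n N1 ** m"
    show False using twisted[OF conj_n cell(1-3) _ a1[folded e]] nm e no(1) by blast
  next
    assume e: "m' = n N1 ** m ** matrix_inv (n N3)"
    show False
      using twisted[OF conj_n cell(1-3) _ a2[folded e]] norm_T_mult[OF nm norm_T_inv[OF n_norm]] e no(2) by blast
  qed
qed

end
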